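(* Let $H$ be a Hopf algebra over $k$ with invertible antipode. Then the data $(H_{par},A,\tilde A,s,t,\tilde s,\tilde t,\underline\Delta_l,\underline\Delta_r,\underline\epsilon_l,\underline\epsilon_r,\mathcal S)$ described in the context define a Hopf algebroid structure on $H_{par}$.
   Context: $k$ is a commutative ring; all algebras are associative unital $k$-algebras. $H$ is a Hopf algebra over $k$ with Sweedler notation $\Delta(h)=h_{(1)}\otimes h_{(2)}$ and antipode $S$. **The algebra $H_{par}$.** $H_{par}$ is the quotient of the tensor algebra $T(H)$ by the ideal generated by the elements, for all $h,l\in H$: $1_H-1_{T(H)}$; $h\otimes l_{(1)}\otimes S(l_{(2)})-hl_{(1)}\otimes S(l_{(2)})$; $h_{(1)}\otimes S(h_{(2)})\otimes l-h_{(1)}\otimes S(h_{(2)})l$; $h\otimes S(l_{(1)})\otimes l_{(2)}-hS(l_{(1)})\otimes l_{(2)}$; $S(h_{(1)})\otimes h_{(2)}\otimes l-S(h_{(1)})\otimes h_{(2)}l$. The class of $h$ is $[h]$. Put $\varepsilon_h=[h_{(1)}][S(h_{(2)})]$, $\tilde\varepsilon_h=[S(h_{(1)})][h_{(2)}]$; $A$ (resp. $\tilde A$) is the subalgebra of $H_{par}$ generated by all $\varepsilon_h$ (resp. all $\tilde\varepsilon_h$), $h\in H$. **Structure maps.** The anti-algebra maps $\mathcal S,\mathcal S':H_{par}\to H_{par}$ are $\mathcal S([h^1]\cdots[h^n])=[S(h^n)]\cdots[S(h^1)]$ and $\mathcal S'([h^1]\cdots[h^n])=[S^{-1}(h^n)]\cdots[S^{-1}(h^1)]$.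 The maps $s,t:A\to H_{par}$ are $s(a)=a$, $t(a)=\mathcal S'(a)$; the maps $\tilde s,\tilde t:\tilde A\to H_{par}$ are $\tilde s(a')=a'$, $\tilde t(a')=\mathcal S'(a')$. The $A$-bimodule structure is $a\triangleright x\triangleleft b=s(a)t(b)x$, and the $\tilde A$-bimodule structure is $a\triangleright x\triangleleft b=x\tilde s(b)\tilde t(a)$. Further $$\underline\Delta_l([h^1]\cdots[h^n])=[h^1_{(1)}]\cdots[h^n_{(1)}]\otimes_A[h^1_{(2)}]\cdots[h^n_{(2)}],\qquad \underline\epsilon_l([h^1]\cdots[h^n])=\varepsilon_{h^1_{(1)}}\varepsilon_{h^1_{(2)}h^2_{(1)}}\cdots\varepsilon_{h^1_{(n)}h^2_{(n-1)}\cdots h^n},$$ $$\underline\Delta_r([h^1]\cdots[h^n])=[h^1_{(1)}]\cdots[h^n_{(1)}]\otimes_{\tilde A}[h^1_{(2)}]\cdots[h^n_{(2)}],\qquad \underline\epsilon_r([h^1]\cdots[h^n])=\tilde\varepsilon_{h^1h^2_{(1)}\cdots h^n_{(1)}}\tilde\varepsilon_{h^2_{(2)}\cdots h^n_{(2)}}\cdots\tilde\varepsilon_{h^n_{(n)}}.$$ **Bialgebroids.** A left (resp. right) bialgebroid over a $k$-algebra $A$ is given by data $(\mathcal H,A,s,t,\underline\Delta_l,\underline\epsilon_l)$ (resp. $(\mathcal H,A,\tilde s,\tilde t,\underline\Delta_r,\underline\epsilon_r)$) such that: (1) $\mathcal H$ is a $k$-algebra. (2) $s$ (resp. $\tilde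 s$) is an algebra morphism $A\to\mathcal H$, $t$ (resp. $\tilde t$) is an algebra anti-morphism $A\to\mathcal H$, and their images commute elementwise; $\mathcal H$ is an $A$-bimodule by $a\triangleright h\triangleleft b=s(a)t(b)h$ (resp. $a\triangleright h\triangleleft b=h\tilde s(b)\tilde t(a)$). (3) $(\mathcal H,\underline\Delta_l,\underline\epsilon_l)$ (resp. $(\mathcal H,\underline\Delta_r,\underline\epsilon_r)$) is an $A$-coring for this bimodule structure. (4) The image of $\underline\Delta_l$ (resp. $\underline\Delta_r$) lies in the Takeuchi algebra $\mathcal H\times_A\mathcal H=\{\sum_i h_i\otimes k_i\in\mathcal H\otimes_A\mathcal H: \sum_i h_it(a)\otimes k_i=\sum_i h_i\otimes k_is(a)\ \forall a\in A\}$ (resp. $\mathcal H\,{}_A\!\times\mathcal H=\{\sum_i h_i\otimes k_i\in\mathcal H\otimes_A\mathcal H:\sum_i\tilde s(a)h_i\otimes k_i=\sum_i h_i\otimes\tilde t(a)k_i\ \forall a\in A\}$), and it is an algebra morphism into it. (5) For all $h,l\in\mathcal H$: $\underline\epsilon_l(hl)=\underline\epsilon_l(hs(\underline\epsilon_l(l)))=\underline\epsilon_l(ht(\underline\epsilon_l(l)))$ (resp. $\underline\epsilon_r(hl)=\underline\epsilon_r(\tilde s(\underline\epsilon_r(h))l)=\underline\epsilon_r(\tilde t(\underline\epsilon_r(h))l)$). **Hopf algebroids.** Given algebras $A,\tilde A$ with $A\cong\tilde A^{op}$, a left $A$-bialgebroid $(\mathcal H,A,s,t,\underline\Delta_l,\underline\epsilon_l)$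 and a right $\tilde A$-bialgebroid $(\mathcal H,\tilde A,\tilde s,\tilde t,\underline\Delta_r,\underline\epsilon_r)$ on the same algebra $\mathcal H$, a Hopf algebroid structure is given by an anti-algebra morphism $\mathcal S:\mathcal H\to\mathcal H$ (antipode) such that: (i) $s\circ\underline\epsilon_l\circ\tilde t=\tilde t$, $t\circ\underline\epsilon_l\circ\tilde s=\tilde s$, $\tilde s\circ\underline\epsilon_r\circ t=t$, $\tilde t\circ\underline\epsilon_r\circ s=s$; (ii) $(\underline\Delta_l\otimes_{\tilde A}I)\circ\underline\Delta_r=(I\otimes_A\underline\Delta_r)\circ\underline\Delta_l$ and $(I\otimes_{\tilde A}\underline\Delta_l)\circ\underline\Delta_r=(\underline\Delta_r\otimes_AI)\circ\underline\Delta_l$; (iii) $\mathcal S(t(a)h\tilde t(b'))=\tilde s(b')\mathcal S(h)s(a)$ for $a\in A$, $b'\in\tilde A$, $h\in\mathcal H$; (iv) $\mu_{\mathcal H}\circ(\mathcal S\otimes I)\circ\underline\Delta_l=\tilde s\circ\underline\epsilon_r$ and $\mu_{\mathcal H}\circ(I\otimes\mathcal S)\circ\underline\Delta_r=s\circ\underline\epsilon_l$, where $\mu_{\mathcal H}$ is multiplication. *)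

theory Defs
  imports "HOL-Algebra.Module" "HOL-Algebra.QuotRing" "HOL-Algebra.Free_Abelian_Groups"
begin

section \<open>Algebras and bimodules\<close>

text \<open>The locale \<^locale>\<open>algebra\<close> of the library requires a commutative algebra,
  which is too narrow here.\<close>

locale assoc_algebra = module R M + M?: ring M
  for R :: "'k ring" (structure) and M :: "('k, 'm, 'z) module_scheme" (structure) +
  assumes smult_mult_left:
      "\<lbrakk>c \<in> carrier R; x \<in> carrier M; y \<in> carrier M\<rbrakk>
        \<Longrightarrow> (c \<odot>\<^bsub>M\<^esub> x) \<otimes>\<^bsub>M\<^esub> y = c \<odot>\<^bsub>M\<^esub> (x \<otimes>\<^bsub>M\<^esub> y)"
    and smult_mult_right:
      "\<lbrakk>c \<in> carrier R; x \<in> carrier M; y \<in> carrier M\<rbrakk>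
        \<Longrightarrow> x \<otimes>\<^bsub>M\<^esub> (c \<odot>\<^bsub>M\<^esub> y) = c \<odot>\<^bsub>M\<^esub> (x \<otimes>\<^bsub>M\<^esub> y)"

definition base_algebra :: "'k ring \<Rightarrow> ('k, 'k) module" where
  "base_algebra R = \<lparr>carrier = carrier R, monoid.mult = monoid.mult R, one = one R,
     ring.zero = ring.zero R, ring.add = ring.add R, smult = monoid.mult R\<rparr>"

definition op_algebra :: "('k, 'm, 'z) module_scheme \<Rightarrow> ('k, 'm, 'z) module_scheme" where
  "op_algebra B = B\<lparr>mult := \<lambda>x y. y \<otimes>\<^bsub>B\<^esub> x\<rparr>"

definition lin_map ::
    "'k ring \<Rightarrow> ('k, 'm, 'y) module_scheme \<Rightarrow> ('k, 'n, 'z) module_scheme \<Rightarrow> ('m \<Rightarrow> 'n) \<Rightarrow> bool" where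
  "lin_map R M N f \<longleftrightarrow>
     f \<in> carrier M \<rightarrow> carrier N \<and>
     (\<forall>x\<in>carrier M. \<forall>y\<in>carrier M. f (x \<oplus>\<^bsub>M\<^esub> y) = f x \<oplus>\<^bsub>N\<^esub> f y) \<and>
     (\<forall>c\<in>carrier R. \<forall>x\<in>carrier M. f (c \<odot>\<^bsub>M\<^esub> x) = c \<odot>\<^bsub>N\<^esub> f x)"

definition alg_hom ::
    "'k ring \<Rightarrow> ('k, 'm, 'y) module_scheme \<Rightarrow> ('k, 'n, 'z) module_scheme \<Rightarrow> ('m \<Rightarrow> 'n) \<Rightarrow> bool" where
  "alg_hom R A B f \<longleftrightarrow> f \<in> ring_hom A B \<and> lin_map R A B f"

definition alg_antihom ::
    "'k ring \<Rightarrow> ('k, 'm, 'y) module_scheme \<Rightarrow> ('k, 'n, 'z) module_scheme \<Rightarrow> ('m \<Rightarrow> 'n) \<Rightarrow> bool" where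
  "alg_antihom R A B f \<longleftrightarrow> alg_hom R A (op_algebra B) f"

definition is_subalgebra :: "'k ring \<Rightarrow> ('k, 'm, 'z) module_scheme \<Rightarrow> 'm set \<Rightarrow> bool" where
  "is_subalgebra R B C \<longleftrightarrow>
     C \<subseteq> carrier B \<and> \<one>\<^bsub>B\<^esub> \<in> C \<and>
     (\<forall>x\<in>C. \<forall>y\<in>C. x \<oplus>\<^bsub>B\<^esub> y \<in> C \<and> x \<otimes>\<^bsub>B\<^esub> y \<in> C) \<and>
     (\<forall>c\<in>carrier R. \<forall>x\<in>C. c \<odot>\<^bsub>B\<^esub> x \<in> C)"

definition gen_subalgebra ::
    "'k ring \<Rightarrow> ('k, 'm, 'z) module_scheme \<Rightarrow> 'm set \<Rightarrow> ('k, 'm, 'z) module_scheme" where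
  "gen_subalgebra R B X = B\<lparr>carrier := \<Inter>{C. is_subalgebra R B C \<and> X \<subseteq> C}\<rparr>"

definition quot_algebra :: "('k, 'm, 'z) module_scheme \<Rightarrow> 'm set \<Rightarrow> ('k, 'm set) module" where
  "quot_algebra B I = \<lparr>carrier = carrier (B Quot I), monoid.mult = monoid.mult (B Quot I), one = one (B Quot I),
     ring.zero = ring.zero (B Quot I), ring.add = ring.add (B Quot I),
     smult = \<lambda>c X. \<Union>x\<in>X. I +>\<^bsub>B\<^esub> (c \<odot>\<^bsub>B\<^esub> x)\<rparr>"

definition sum_of :: "('m, 'z) ring_scheme \<Rightarrow> 'm list \<Rightarrow> 'm" where
  "sum_of G xs = foldr (ring.add G) xs \<zero>\<^bsub>G\<^esub>"

definition prod_of :: "('m, 'z) monoid_scheme \<Rightarrow> 'm list \<Rightarrow> 'm" where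
  "prod_of G xs = foldr (mult G) xs \<one>\<^bsub>G\<^esub>"

text \<open>The underlying record of a bimodule extends that of an algebra; the fields
  \<^const>\<open>mult\<close> and \<^const>\<open>one\<close> play no role in the notion of bimodule and serve only those
  bimodules that come from algebras.\<close>

record ('k, 'a, 'b, 'm) bimod = "('k, 'm) module" +
  lact :: "'a \<Rightarrow> 'm \<Rightarrow> 'm"
  ract :: "'m \<Rightarrow> 'b \<Rightarrow> 'm"

definition as_bimod ::
    "('k, 'm, 'z) module_scheme \<Rightarrow> ('a \<Rightarrow> 'm \<Rightarrow> 'm) \<Rightarrow> ('m \<Rightarrow> 'b \<Rightarrow> 'm) \<Rightarrow> ('k, 'a, 'b, 'm) bimod" where
  "as_bimod M la ra = \<lparr>carrier = carrier M, monoid.mult = monoid.mult M, one = one M,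
     ring.zero = ring.zero M, ring.add = ring.add M, smult = smult M, lact = la, ract = ra\<rparr>"

definition reg_bimod :: "('k, 'a, 'z) module_scheme \<Rightarrow> ('k, 'a, 'a, 'a) bimod" where
  "reg_bimod A = as_bimod A (mult A) (mult A)"

definition base_bimod :: "('k, 'm, 'z) module_scheme \<Rightarrow> ('k, 'k, 'k, 'm) bimod" where
  "base_bimod M = as_bimod M (smult M) (\<lambda>x c. c \<odot>\<^bsub>M\<^esub> x)"

locale bimodule =
  fixes R :: "'k ring" and A :: "('k, 'a) module" and B :: "('k, 'b) module"
    and M :: "('k, 'a, 'b, 'm) bimod"
  assumes alg_A: "assoc_algebra R A" and alg_B: "assoc_algebra R B" and mod_M: "module R M"
    and lact_closed: "\<lbrakk>a \<in> carrier A; x \<in> carrier M\<rbrakk> \<Longrightarrow> lact M a x \<in> carrier M"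
    and lact_add_left: "\<lbrakk>a \<in> carrier A; a' \<in> carrier A; x \<in> carrier M\<rbrakk>
      \<Longrightarrow> lact M (a \<oplus>\<^bsub>A\<^esub> a') x = lact M a x \<oplus>\<^bsub>M\<^esub> lact M a' x"
    and lact_add_right: "\<lbrakk>a \<in> carrier A; x \<in> carrier M; y \<in> carrier M\<rbrakk>
      \<Longrightarrow> lact M a (x \<oplus>\<^bsub>M\<^esub> y) = lact M a x \<oplus>\<^bsub>M\<^esub> lact M a y"
    and lact_mult: "\<lbrakk>a \<in> carrier A; a' \<in> carrier A; x \<in> carrier M\<rbrakk>
      \<Longrightarrow> lact M (a \<otimes>\<^bsub>A\<^esub> a') x = lact M a (lact M a' x)"
    and lact_smult_one: "\<lbrakk>c \<in> carrier R; x \<in> carrier M\<rbrakk>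
      \<Longrightarrow> lact M (c \<odot>\<^bsub>A\<^esub> \<one>\<^bsub>A\<^esub>) x = c \<odot>\<^bsub>M\<^esub> x"
    and ract_closed: "\<lbrakk>b \<in> carrier B; x \<in> carrier M\<rbrakk> \<Longrightarrow> ract M x b \<in> carrier M"
    and ract_add_left: "\<lbrakk>b \<in> carrier B; x \<in> carrier M; y \<in> carrier M\<rbrakk>
      \<Longrightarrow> ract M (x \<oplus>\<^bsub>M\<^esub> y) b = ract M x b \<oplus>\<^bsub>M\<^esub> ract M y b"
    and ract_add_right: "\<lbrakk>b \<in> carrier B; b' \<in> carrier B; x \<in> carrier M\<rbrakk>
      \<Longrightarrow> ract M x (b \<oplus>\<^bsub>B\<^esub> b') = ract M x b \<oplus>\<^bsub>M\<^esub> ract M x b'"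
    and ract_mult: "\<lbrakk>b \<in> carrier B; b' \<in> carrier B; x \<in> carrier M\<rbrakk>
      \<Longrightarrow> ract M x (b \<otimes>\<^bsub>B\<^esub> b') = ract M (ract M x b) b'"
    and ract_smult_one: "\<lbrakk>c \<in> carrier R; x \<in> carrier M\<rbrakk>
      \<Longrightarrow> ract M x (c \<odot>\<^bsub>B\<^esub> \<one>\<^bsub>B\<^esub>) = c \<odot>\<^bsub>M\<^esub> x"
    and act_commute: "\<lbrakk>a \<in> carrier A; b \<in> carrier B; x \<in> carrier M\<rbrakk>
      \<Longrightarrow> ract M (lact M a x) b = lact M a (ract M x b)"

definition bimod_hom ::
    "('k, 'a) module \<Rightarrow> ('k, 'b) module \<Rightarrow> ('k, 'a, 'b, 'm) bimod \<Rightarrow> ('k, 'a, 'b, 'n) bimod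
      \<Rightarrow> ('m \<Rightarrow> 'n) \<Rightarrow> bool" where
  "bimod_hom A B M N f \<longleftrightarrow>
     f \<in> carrier M \<rightarrow> carrier N \<and>
     (\<forall>x\<in>carrier M. \<forall>y\<in>carrier M. f (x \<oplus>\<^bsub>M\<^esub> y) = f x \<oplus>\<^bsub>N\<^esub> f y) \<and>
     (\<forall>a\<in>carrier A. \<forall>x\<in>carrier M. f (lact M a x) = lact N a (f x)) \<and>
     (\<forall>b\<in>carrier B. \<forall>x\<in>carrier M. f (ract M x b) = ract N (f x) b)"


section \<open>Tensor products\<close>

text \<open>\<open>M \<otimes>\<^sub>B N\<close> is the free abelian group on pairs modulo biadditivity and \<open>B\<close>-balancing.\<close>

definition tensor_rels ::
    "('k, 'a, 'b, 'm) bimod \<Rightarrow> ('k, 'b) module \<Rightarrow> ('k, 'b, 'c, 'n) bimod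
      \<Rightarrow> ('m \<times> 'n \<Rightarrow>\<^sub>0 int) set" where
  "tensor_rels M B N =
     {frag_of (x \<oplus>\<^bsub>M\<^esub> x', y) - frag_of (x, y) - frag_of (x', y) | x x' y.
        x \<in> carrier M \<and> x' \<in> carrier M \<and> y \<in> carrier N} \<union>
     {frag_of (x, y \<oplus>\<^bsub>N\<^esub> y') - frag_of (x, y) - frag_of (x, y') | x y y'.
        x \<in> carrier M \<and> y \<in> carrier N \<and> y' \<in> carrier N} \<union>
     {frag_of (ract M x b, y) - frag_of (x, lact N b y) | x b y.
        x \<in> carrier M \<and> b \<in> carrier B \<and> y \<in> carrier N}"

definition tensor_free ::
    "('k, 'a, 'b, 'm) bimod \<Rightarrow> ('k, 'b, 'c, 'n) bimod \<Rightarrow> ('m \<times> 'n \<Rightarrow>\<^sub>0 int) monoid" where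
  "tensor_free M N = free_Abelian_group (carrier M \<times> carrier N)"

definition tensor_ker ::
    "('k, 'a, 'b, 'm) bimod \<Rightarrow> ('k, 'b) module \<Rightarrow> ('k, 'b, 'c, 'n) bimod
      \<Rightarrow> ('m \<times> 'n \<Rightarrow>\<^sub>0 int) set" where
  "tensor_ker M B N = generate (tensor_free M N) (tensor_rels M B N)"

definition tensor_group ::
    "('k, 'a, 'b, 'm) bimod \<Rightarrow> ('k, 'b) module \<Rightarrow> ('k, 'b, 'c, 'n) bimod
      \<Rightarrow> ('m \<times> 'n \<Rightarrow>\<^sub>0 int) set monoid" where
  "tensor_group M B N = tensor_free M N Mod tensor_ker M B N"

definition pure ::
    "('k, 'a, 'b, 'm) bimod \<Rightarrow> ('k, 'b) module \<Rightarrow> ('k, 'b, 'c, 'n) bimod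
      \<Rightarrow> 'm \<Rightarrow> 'n \<Rightarrow> ('m \<times> 'n \<Rightarrow>\<^sub>0 int) set" where
  "pure M B N x y = tensor_ker M B N #>\<^bsub>tensor_free M N\<^esub> frag_of (x, y)"

text \<open>A chosen expression \<open>\<Sum>\<^sub>i x\<^sub>i \<otimes> y\<^sub>i\<close> of a tensor as a sum of pure tensors.\<close>

definition tensor_rep ::
    "('k, 'a, 'b, 'm) bimod \<Rightarrow> ('k, 'b) module \<Rightarrow> ('k, 'b, 'c, 'n) bimod
      \<Rightarrow> ('m \<times> 'n \<Rightarrow>\<^sub>0 int) set \<Rightarrow> ('m \<times> 'n) list" where
  "tensor_rep M B N X = (SOME xs. set xs \<subseteq> carrier M \<times> carrier N \<and>
     X = prod_of (tensor_group M B N) (map (\<lambda>(x, y). pure M B N x y) xs))"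

text \<open>The map \<open>\<Sum>\<^sub>i x\<^sub>i \<otimes> y\<^sub>i \<mapsto> \<Sum>\<^sub>i f x\<^sub>i y\<^sub>i\<close>. For balanced \<open>f\<close> the value does not depend
  on the chosen expression; it is applied to balanced maps only. The one exception is the
  componentwise product in \<open>tensor\<close> below, which is meaningful if \<open>B\<close> is the base ring,
  or on a Takeuchi product.\<close>

definition tensor_lift ::
    "('k, 'a, 'b, 'm) bimod \<Rightarrow> ('k, 'b) module \<Rightarrow> ('k, 'b, 'c, 'n) bimod
      \<Rightarrow> ('g, 'z) ring_scheme \<Rightarrow> ('m \<Rightarrow> 'n \<Rightarrow> 'g) \<Rightarrow> ('m \<times> 'n \<Rightarrow>\<^sub>0 int) set \<Rightarrow> 'g" where
  "tensor_lift M B N G f X = sum_of G (map (\<lambda>(x, y). f x y) (tensor_rep M B N X))"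

text \<open>The abelian group \<open>M \<otimes>\<^sub>B N\<close> in additive form. Its product is not used.\<close>

definition tensor_ab ::
    "('k, 'a, 'b, 'm) bimod \<Rightarrow> ('k, 'b) module \<Rightarrow> ('k, 'b, 'c, 'n) bimod
      \<Rightarrow> ('m \<times> 'n \<Rightarrow>\<^sub>0 int) set ring" where
  "tensor_ab M B N = \<lparr>carrier = carrier (tensor_group M B N), monoid.mult = undefined,
     one = pure M B N \<one>\<^bsub>M\<^esub> \<one>\<^bsub>N\<^esub>, ring.zero = one (tensor_group M B N),
     ring.add = monoid.mult (tensor_group M B N)\<rparr>"

definition tensor ::
    "('k, 'a, 'b, 'm) bimod \<Rightarrow> ('k, 'b) module \<Rightarrow> ('k, 'b, 'c, 'n) bimod
      \<Rightarrow> ('k, 'a, 'c, ('m \<times> 'n \<Rightarrow>\<^sub>0 int) set) bimod" where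
  "tensor M B N = (let G = tensor_ab M B N; p = pure M B N; lift = tensor_lift M B N G in
     \<lparr>carrier = carrier G,
      monoid.mult = \<lambda>X Y. lift (\<lambda>x y. lift (\<lambda>x' y'. p (x \<otimes>\<^bsub>M\<^esub> x') (y \<otimes>\<^bsub>N\<^esub> y')) Y) X,
      one = p \<one>\<^bsub>M\<^esub> \<one>\<^bsub>N\<^esub>, ring.zero = ring.zero G, ring.add = ring.add G,
      smult = \<lambda>c. lift (\<lambda>x y. p (c \<odot>\<^bsub>M\<^esub> x) y),
      lact = \<lambda>a. lift (\<lambda>x y. p (lact M a x) y),
      ract = \<lambda>X c. lift (\<lambda>x y. p x (ract N y c)) X\<rparr>)"

text \<open>\<open>f \<otimes> g : M \<otimes>\<^sub>B N \<rightarrow> M' \<otimes>\<^sub>B N'\<close>\<close>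

definition tensor_map ::
    "('k, 'a, 'b, 'm) bimod \<Rightarrow> ('k, 'b) module \<Rightarrow> ('k, 'b, 'c, 'n) bimod
      \<Rightarrow> ('k, 'd, 'b, 'p) bimod \<Rightarrow> ('k, 'b, 'e, 'q) bimod \<Rightarrow> ('m \<Rightarrow> 'p) \<Rightarrow> ('n \<Rightarrow> 'q)
      \<Rightarrow> ('m \<times> 'n \<Rightarrow>\<^sub>0 int) set \<Rightarrow> ('p \<times> 'q \<Rightarrow>\<^sub>0 int) set" where
  "tensor_map M B N M' N' f g =
     tensor_lift M B N (tensor M' B N') (\<lambda>x y. pure M' B N' (f x) (g y))"

text \<open>\<open>(M \<otimes>\<^sub>B N) \<otimes>\<^sub>C P \<rightarrow> M \<otimes>\<^sub>B (N \<otimes>\<^sub>C P)\<close>\<close>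

definition tensor_assoc ::
    "('k, 'a, 'b, 'm) bimod \<Rightarrow> ('k, 'b) module \<Rightarrow> ('k, 'b, 'c, 'n) bimod
      \<Rightarrow> ('k, 'c) module \<Rightarrow> ('k, 'c, 'd, 'p) bimod
      \<Rightarrow> ((('m \<times> 'n \<Rightarrow>\<^sub>0 int) set) \<times> 'p \<Rightarrow>\<^sub>0 int) set
      \<Rightarrow> ('m \<times> (('n \<times> 'p \<Rightarrow>\<^sub>0 int) set) \<Rightarrow>\<^sub>0 int) set" where
  "tensor_assoc M B N C P =
     (let NP = tensor N C P; T = tensor M B NP in
      tensor_lift (tensor M B N) C P T
        (\<lambda>u z. tensor_lift M B N T (\<lambda>x y. pure M B NP x (pure N C P y z)) u))"


section \<open>Corings, bialgebroids and Hopf algebroids\<close>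

locale coring =
  fixes R :: "'k ring" and A :: "('k, 'a) module" and C :: "('k, 'a, 'a, 'c) bimod"
    and D :: "'c \<Rightarrow> ('c \<times> 'c \<Rightarrow>\<^sub>0 int) set" and E :: "'c \<Rightarrow> 'a"
  assumes bimod: "bimodule R A A C"
    and comult_hom: "bimod_hom A A C (tensor C A C) D"
    and counit_hom: "bimod_hom A A C (reg_bimod A) E"
    and coassoc: "x \<in> carrier C \<Longrightarrow>
      tensor_assoc C A C A C (tensor_map C A C (tensor C A C) C D (\<lambda>y. y) (D x)) =
      tensor_map C A C C (tensor C A C) (\<lambda>y. y) D (D x)"
    and counit_left: "x \<in> carrier C \<Longrightarrow>
      tensor_lift C A C C (\<lambda>y z. lact C (E y) z) (D x) = x"
    and counit_right: "x \<in> carrier C \<Longrightarrow>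
      tensor_lift C A C C (\<lambda>y z. ract C y (E z)) (D x) = x"

definition left_bimod ::
    "('k, 'h) module \<Rightarrow> ('a \<Rightarrow> 'h) \<Rightarrow> ('a \<Rightarrow> 'h) \<Rightarrow> ('k, 'a, 'a, 'h) bimod" where
  "left_bimod H s t = as_bimod H (\<lambda>a x. s a \<otimes>\<^bsub>H\<^esub> x) (\<lambda>x b. t b \<otimes>\<^bsub>H\<^esub> x)"

definition right_bimod ::
    "('k, 'h) module \<Rightarrow> ('a \<Rightarrow> 'h) \<Rightarrow> ('a \<Rightarrow> 'h) \<Rightarrow> ('k, 'a, 'a, 'h) bimod" where
  "right_bimod H s t = as_bimod H (\<lambda>a x. x \<otimes>\<^bsub>H\<^esub> t a) (\<lambda>x b. x \<otimes>\<^bsub>H\<^esub> s b)"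

definition left_takeuchi ::
    "('k, 'h) module \<Rightarrow> ('k, 'a) module \<Rightarrow> ('a \<Rightarrow> 'h) \<Rightarrow> ('a \<Rightarrow> 'h)
      \<Rightarrow> ('k, 'a, 'a, ('h \<times> 'h \<Rightarrow>\<^sub>0 int) set) bimod" where
  "left_takeuchi H A s t = (let M = left_bimod H s t; T = tensor M A M in
     T\<lparr>carrier := {X \<in> carrier T. \<forall>a\<in>carrier A.
       tensor_lift M A M T (\<lambda>x y. pure M A M (x \<otimes>\<^bsub>H\<^esub> t a) y) X =
       tensor_lift M A M T (\<lambda>x y. pure M A M x (y \<otimes>\<^bsub>H\<^esub> s a)) X}\<rparr>)"

definition right_takeuchi ::
    "('k, 'h) module \<Rightarrow> ('k, 'a) module \<Rightarrow> ('a \<Rightarrow> 'h) \<Rightarrow> ('a \<Rightarrow> 'h)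
      \<Rightarrow> ('k, 'a, 'a, ('h \<times> 'h \<Rightarrow>\<^sub>0 int) set) bimod" where
  "right_takeuchi H A s t = (let M = right_bimod H s t; T = tensor M A M in
     T\<lparr>carrier := {X \<in> carrier T. \<forall>a\<in>carrier A.
       tensor_lift M A M T (\<lambda>x y. pure M A M (s a \<otimes>\<^bsub>H\<^esub> x) y) X =
       tensor_lift M A M T (\<lambda>x y. pure M A M x (t a \<otimes>\<^bsub>H\<^esub> y)) X}\<rparr>)"

locale left_bialgebroid =
  fixes R :: "'k ring" and H :: "('k, 'h) module" and A :: "('k, 'a) module"
    and s :: "'a \<Rightarrow> 'h" and t :: "'a \<Rightarrow> 'h"
    and D :: "'h \<Rightarrow> ('h \<times> 'h \<Rightarrow>\<^sub>0 int) set" and E :: "'h \<Rightarrow> 'a"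
  assumes alg_H: "assoc_algebra R H" and alg_base: "assoc_algebra R A"
    and source: "alg_hom R A H s" and target: "alg_antihom R A H t"
    and commute: "\<lbrakk>a \<in> carrier A; b \<in> carrier A\<rbrakk> \<Longrightarrow> s a \<otimes>\<^bsub>H\<^esub> t b = t b \<otimes>\<^bsub>H\<^esub> s a"
    and is_coring: "coring R A (left_bimod H s t) D E"
    and comult_alg_hom: "alg_hom R H (left_takeuchi H A s t) D"
    and counit_source: "\<lbrakk>x \<in> carrier H; y \<in> carrier H\<rbrakk>
      \<Longrightarrow> E (x \<otimes>\<^bsub>H\<^esub> y) = E (x \<otimes>\<^bsub>H\<^esub> s (E y))"
    and counit_target: "\<lbrakk>x \<in> carrier H; y \<in> carrier H\<rbrakk>
      \<Longrightarrow> E (x \<otimes>\<^bsub>H\<^esub> y) = E (x \<otimes>\<^bsub>H\<^esub> t (E y))"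

locale right_bialgebroid =
  fixes R :: "'k ring" and H :: "('k, 'h) module" and A :: "('k, 'a) module"
    and s :: "'a \<Rightarrow> 'h" and t :: "'a \<Rightarrow> 'h"
    and D :: "'h \<Rightarrow> ('h \<times> 'h \<Rightarrow>\<^sub>0 int) set" and E :: "'h \<Rightarrow> 'a"
  assumes alg_H: "assoc_algebra R H" and alg_base: "assoc_algebra R A"
    and source: "alg_hom R A H s" and target: "alg_antihom R A H t"
    and commute: "\<lbrakk>a \<in> carrier A; b \<in> carrier A\<rbrakk> \<Longrightarrow> s a \<otimes>\<^bsub>H\<^esub> t b = t b \<otimes>\<^bsub>H\<^esub> s a"
    and is_coring: "coring R A (right_bimod H s t) D E"
    and comult_alg_hom: "alg_hom R H (right_takeuchi H A s t) D"
    and counit_source: "\<lbrakk>x \<in> carrier H; y \<in> carrier H\<rbrakk>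
      \<Longrightarrow> E (x \<otimes>\<^bsub>H\<^esub> y) = E (s (E x) \<otimes>\<^bsub>H\<^esub> y)"
    and counit_target: "\<lbrakk>x \<in> carrier H; y \<in> carrier H\<rbrakk>
      \<Longrightarrow> E (x \<otimes>\<^bsub>H\<^esub> y) = E (t (E x) \<otimes>\<^bsub>H\<^esub> y)"

text \<open>\<open>L\<close> and \<open>Q\<close> below are the \<open>A\<close>-bimodule and the \<open>A'\<close>-bimodule \<open>H\<close>. The middle factor of
  \<open>H \<otimes>\<^sub>A H \<otimes>\<^sub>A\<^sub>' H\<close> carries the left \<open>A\<close>-action of \<open>L\<close> and the right \<open>A'\<close>-action of \<open>Q\<close>; this is
  the bimodule \<open>LQ\<close>. Symmetrically, \<open>QL\<close> is the middle factor of \<open>H \<otimes>\<^sub>A\<^sub>' H \<otimes>\<^sub>A H\<close>.\<close>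

locale hopf_algebroid =
  fixes R :: "'k ring" and H :: "('k, 'h) module"
    and A :: "('k, 'a) module" and A' :: "('k, 'b) module"
    and s :: "'a \<Rightarrow> 'h" and t :: "'a \<Rightarrow> 'h" and s' :: "'b \<Rightarrow> 'h" and t' :: "'b \<Rightarrow> 'h"
    and Dl :: "'h \<Rightarrow> ('h \<times> 'h \<Rightarrow>\<^sub>0 int) set" and Dr :: "'h \<Rightarrow> ('h \<times> 'h \<Rightarrow>\<^sub>0 int) set"
    and El :: "'h \<Rightarrow> 'a" and Er :: "'h \<Rightarrow> 'b" and S :: "'h \<Rightarrow> 'h"
    and L :: "('k, 'a, 'a, 'h) bimod" and Q :: "('k, 'b, 'b, 'h) bimod"
    and LQ :: "('k, 'a, 'b, 'h) bimod" and QL :: "('k, 'b, 'a, 'h) bimod"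
  defines "L \<equiv> left_bimod H s t" and "Q \<equiv> right_bimod H s' t'"
    and "LQ \<equiv> as_bimod H (lact L) (ract Q)" and "QL \<equiv> as_bimod H (lact Q) (ract L)"
  assumes left: "left_bialgebroid R H A s t Dl El"
    and right: "right_bialgebroid R H A' s' t' Dr Er"
    and bases_anti_iso: "\<exists>\<phi>. alg_hom R A (op_algebra A') \<phi> \<and> bij_betw \<phi> (carrier A) (carrier A')"
    and antipode: "alg_antihom R H H S"
    and s_El_t': "b \<in> carrier A' \<Longrightarrow> s (El (t' b)) = t' b"
    and t_El_s': "b \<in> carrier A' \<Longrightarrow> t (El (s' b)) = s' b"
    and s'_Er_t: "a \<in> carrier A \<Longrightarrow> s' (Er (t a)) = t a"
    and t'_Er_s: "a \<in> carrier A \<Longrightarrow> t' (Er (s a)) = s a"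
    and mixed_coassoc_left: "x \<in> carrier H \<Longrightarrow>
      tensor_assoc L A LQ A' Q (tensor_map Q A' Q (tensor L A LQ) Q Dl (\<lambda>y. y) (Dr x)) =
      tensor_map L A L L (tensor LQ A' Q) (\<lambda>y. y) Dr (Dl x)"
    and mixed_coassoc_right: "x \<in> carrier H \<Longrightarrow>
      tensor_map Q A' Q Q (tensor QL A L) (\<lambda>y. y) Dl (Dr x) =
      tensor_assoc Q A' QL A L (tensor_map L A L (tensor Q A' QL) L Dr (\<lambda>y. y) (Dl x))"
    and antipode_twist: "\<lbrakk>a \<in> carrier A; b \<in> carrier A'; x \<in> carrier H\<rbrakk> \<Longrightarrow>
      S (t a \<otimes>\<^bsub>H\<^esub> x \<otimes>\<^bsub>H\<^esub> t' b) = s' b \<otimes>\<^bsub>H\<^esub> S x \<otimes>\<^bsub>H\<^esub> s a"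
    and antipode_left: "x \<in> carrier H \<Longrightarrow>
      tensor_lift L A L H (\<lambda>y z. S y \<otimes>\<^bsub>H\<^esub> z) (Dl x) = s' (Er x)"
    and antipode_right: "x \<in> carrier H \<Longrightarrow>
      tensor_lift Q A' Q H (\<lambda>y z. y \<otimes>\<^bsub>H\<^esub> S z) (Dr x) = s (El x)"


section \<open>Hopf algebras and Sweedler notation\<close>

record ('k, 'h) hopf = "('k, 'h) module" +
  comult :: "'h \<Rightarrow> ('h \<times> 'h \<Rightarrow>\<^sub>0 int) set"
  counit :: "'h \<Rightarrow> 'k"
  antipode :: "'h \<Rightarrow> 'h"

definition tensor_self :: "'k ring \<Rightarrow> ('k, 'h, 'z) module_scheme
    \<Rightarrow> ('k, 'k, 'k, ('h \<times> 'h \<Rightarrow>\<^sub>0 int) set) bimod" where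
  "tensor_self R H = tensor (base_bimod H) (base_algebra R) (base_bimod H)"

text \<open>The list of pairs \<open>(h\<^sub>1, h\<^sub>2)\<close> in \<open>\<Delta>(h) = \<Sum> h\<^sub>1 \<otimes> h\<^sub>2\<close>.\<close>

definition sweedler :: "'k ring \<Rightarrow> ('k, 'h) hopf \<Rightarrow> 'h \<Rightarrow> ('h \<times> 'h) list" where
  "sweedler R H h = tensor_rep (base_bimod H) (base_algebra R) (base_bimod H) (comult H h)"

text \<open>\<open>iter_sweedler R H n h\<close> is the list of tuples \<open>[h\<^sub>1, \<dots>, h\<^sub>n\<^sub>+\<^sub>1]\<close> of length \<open>n + 1\<close>.\<close>

primrec iter_sweedler :: "'k ring \<Rightarrow> ('k, 'h) hopf \<Rightarrow> nat \<Rightarrow> 'h \<Rightarrow> 'h list list" where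
  "iter_sweedler R H 0 h = [[h]]"
| "iter_sweedler R H (Suc n) h =
     concat (map (\<lambda>(x, y). map ((#) x) (iter_sweedler R H n y)) (sweedler R H h))"

definition sweedler_sum ::
    "'k ring \<Rightarrow> ('k, 'h) hopf \<Rightarrow> ('g, 'z) ring_scheme \<Rightarrow> ('h \<Rightarrow> 'h \<Rightarrow> 'g) \<Rightarrow> 'h \<Rightarrow> 'g" where
  "sweedler_sum R H G f h = sum_of G (map (\<lambda>(x, y). f x y) (sweedler R H h))"

locale hopf_algebra =
  fixes R :: "'k ring" and H :: "('k, 'h) hopf"
  assumes alg: "assoc_algebra R H"
    and is_coalgebra: "coring R (base_algebra R) (base_bimod H) (comult H) (counit H)"
    and comult_alg_hom: "alg_hom R H (tensor_self R H) (comult H)"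
    and counit_alg_hom: "alg_hom R H (base_algebra R) (counit H)"
    and antipode_lin: "lin_map R H H (antipode H)"
    and antipode_left: "h \<in> carrier H \<Longrightarrow>
      sweedler_sum R H H (\<lambda>x y. antipode H x \<otimes>\<^bsub>H\<^esub> y) h = counit H h \<odot>\<^bsub>H\<^esub> \<one>\<^bsub>H\<^esub>"
    and antipode_right: "h \<in> carrier H \<Longrightarrow>
      sweedler_sum R H H (\<lambda>x y. x \<otimes>\<^bsub>H\<^esub> antipode H y) h = counit H h \<odot>\<^bsub>H\<^esub> \<one>\<^bsub>H\<^esub>"

definition antipode_inv :: "('k, 'h) hopf \<Rightarrow> 'h \<Rightarrow> 'h" where
  "antipode_inv H = inv_into (carrier H) (antipode H)"


section \<open>The tensor algebra and the algebra \<open>H\<^sub>p\<^sub>a\<^sub>r\<close>\<close>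

text \<open>The free \<open>R\<close>-algebra on the set \<open>X\<close>: finitely supported functions on the words over \<open>X\<close>,
  multiplied by convolution along concatenation.\<close>

definition free_algebra :: "'k ring \<Rightarrow> 'h set \<Rightarrow> ('k, 'h list \<Rightarrow> 'k) module" where
  "free_algebra R X =
     \<lparr>carrier = {f. (\<forall>w. f w \<in> carrier R) \<and> finite {w. f w \<noteq> \<zero>\<^bsub>R\<^esub>} \<and>
        {w. f w \<noteq> \<zero>\<^bsub>R\<^esub>} \<subseteq> lists X},
      monoid.mult = \<lambda>f g w. \<Oplus>\<^bsub>R\<^esub>i\<in>{..length w}. f (take i w) \<otimes>\<^bsub>R\<^esub> g (drop i w),
      one = \<lambda>w. if w = [] then \<one>\<^bsub>R\<^esub> else \<zero>\<^bsub>R\<^esub>,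
      ring.zero = \<lambda>w. \<zero>\<^bsub>R\<^esub>,
      ring.add = \<lambda>f g w. f w \<oplus>\<^bsub>R\<^esub> g w,
      smult = \<lambda>c f w. c \<otimes>\<^bsub>R\<^esub> f w\<rparr>"

definition free_gen :: "'k ring \<Rightarrow> 'h \<Rightarrow> 'h list \<Rightarrow> 'k" where
  "free_gen R h = (\<lambda>w. if w = [h] then \<one>\<^bsub>R\<^esub> else \<zero>\<^bsub>R\<^esub>)"

text \<open>The ideal generated by the linearity relations is spanned, in degree \<open>n\<close>, by the
  multilinearity relations between words of length \<open>n\<close>. So the quotient in degree \<open>n\<close> is
  \<open>H \<otimes> \<dots> \<otimes> H\<close> (\<open>n\<close> factors), and the quotient is the tensor algebra \<open>T(H)\<close>.\<close>

definition lin_rels :: "'k ring \<Rightarrow> ('k, 'h, 'z) module_scheme \<Rightarrow> ('h list \<Rightarrow> 'k) set" where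
  "lin_rels R H = (let F = free_algebra R (carrier H); g = free_gen R in
     {g (x \<oplus>\<^bsub>H\<^esub> y) \<ominus>\<^bsub>F\<^esub> (g x \<oplus>\<^bsub>F\<^esub> g y) | x y. x \<in> carrier H \<and> y \<in> carrier H} \<union>
     {g (c \<odot>\<^bsub>H\<^esub> x) \<ominus>\<^bsub>F\<^esub> c \<odot>\<^bsub>F\<^esub> g x | c x. c \<in> carrier R \<and> x \<in> carrier H})"

definition lin_ideal :: "'k ring \<Rightarrow> ('k, 'h, 'z) module_scheme \<Rightarrow> ('h list \<Rightarrow> 'k) set" where
  "lin_ideal R H = Idl\<^bsub>free_algebra R (carrier H)\<^esub> (lin_rels R H)"

definition tensor_algebra ::
    "'k ring \<Rightarrow> ('k, 'h, 'z) module_scheme \<Rightarrow> ('k, ('h list \<Rightarrow> 'k) set) module" where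
  "tensor_algebra R H = quot_algebra (free_algebra R (carrier H)) (lin_ideal R H)"

definition tensor_gen ::
    "'k ring \<Rightarrow> ('k, 'h, 'z) module_scheme \<Rightarrow> 'h \<Rightarrow> ('h list \<Rightarrow> 'k) set" where
  "tensor_gen R H h = lin_ideal R H +>\<^bsub>free_algebra R (carrier H)\<^esub> free_gen R h"

definition par_rels :: "'k ring \<Rightarrow> ('k, 'h) hopf \<Rightarrow> ('h list \<Rightarrow> 'k) set set" where
  "par_rels R H = (let T = tensor_algebra R H; i = tensor_gen R H; S = antipode H;
       \<Sigma> = sweedler_sum R H T in
     {i \<one>\<^bsub>H\<^esub> \<ominus>\<^bsub>T\<^esub> \<one>\<^bsub>T\<^esub>} \<union>
     (\<Union>h\<in>carrier H. \<Union>l\<in>carrier H.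
       {\<Sigma> (\<lambda>x y. i h \<otimes>\<^bsub>T\<^esub> i x \<otimes>\<^bsub>T\<^esub> i (S y)) l \<ominus>\<^bsub>T\<^esub> \<Sigma> (\<lambda>x y. i (h \<otimes>\<^bsub>H\<^esub> x) \<otimes>\<^bsub>T\<^esub> i (S y)) l,
        \<Sigma> (\<lambda>x y. i x \<otimes>\<^bsub>T\<^esub> i (S y) \<otimes>\<^bsub>T\<^esub> i l) h \<ominus>\<^bsub>T\<^esub> \<Sigma> (\<lambda>x y. i x \<otimes>\<^bsub>T\<^esub> i (S y \<otimes>\<^bsub>H\<^esub> l)) h,
        \<Sigma> (\<lambda>x y. i h \<otimes>\<^bsub>T\<^esub> i (S x) \<otimes>\<^bsub>T\<^esub> i y) l \<ominus>\<^bsub>T\<^esub> \<Sigma> (\<lambda>x y. i (h \<otimes>\<^bsub>H\<^esub> S x) \<otimes>\<^bsub>T\<^esub> i y) l,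
        \<Sigma> (\<lambda>x y. i (S x) \<otimes>\<^bsub>T\<^esub> i y \<otimes>\<^bsub>T\<^esub> i l) h \<ominus>\<^bsub>T\<^esub> \<Sigma> (\<lambda>x y. i (S x) \<otimes>\<^bsub>T\<^esub> i (y \<otimes>\<^bsub>H\<^esub> l)) h}))"

definition par_ideal :: "'k ring \<Rightarrow> ('k, 'h) hopf \<Rightarrow> ('h list \<Rightarrow> 'k) set set" where
  "par_ideal R H = Idl\<^bsub>tensor_algebra R H\<^esub> (par_rels R H)"

type_synonym ('k, 'h) hpar = "('h list \<Rightarrow> 'k) set set"

definition Hpar :: "'k ring \<Rightarrow> ('k, 'h) hopf \<Rightarrow> ('k, ('k, 'h) hpar) module" where
  "Hpar R H = quot_algebra (tensor_algebra R H) (par_ideal R H)"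

definition cls :: "'k ring \<Rightarrow> ('k, 'h) hopf \<Rightarrow> 'h \<Rightarrow> ('k, 'h) hpar" where
  "cls R H h = par_ideal R H +>\<^bsub>tensor_algebra R H\<^esub> tensor_gen R H h"

definition eps :: "'k ring \<Rightarrow> ('k, 'h) hopf \<Rightarrow> 'h \<Rightarrow> ('k, 'h) hpar" where
  "eps R H = sweedler_sum R H (Hpar R H)
     (\<lambda>x y. cls R H x \<otimes>\<^bsub>Hpar R H\<^esub> cls R H (antipode H y))"

definition eps' :: "'k ring \<Rightarrow> ('k, 'h) hopf \<Rightarrow> 'h \<Rightarrow> ('k, 'h) hpar" where
  "eps' R H = sweedler_sum R H (Hpar R H)
     (\<lambda>x y. cls R H (antipode H x) \<otimes>\<^bsub>Hpar R H\<^esub> cls R H y)"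

definition par_base :: "'k ring \<Rightarrow> ('k, 'h) hopf \<Rightarrow> ('k, ('k, 'h) hpar) module" where
  "par_base R H = gen_subalgebra R (Hpar R H) (eps R H ` carrier H)"

definition par_base' :: "'k ring \<Rightarrow> ('k, 'h) hopf \<Rightarrow> ('k, ('k, 'h) hpar) module" where
  "par_base' R H = gen_subalgebra R (Hpar R H) (eps' R H ` carrier H)"


section \<open>The structure maps of \<open>H\<^sub>p\<^sub>a\<^sub>r\<close>\<close>

definition par_comult_word :: "'k ring \<Rightarrow> ('k, 'h) hopf
    \<Rightarrow> ('k, 'a, 'a, ('k, 'h) hpar) bimod \<Rightarrow> ('k, 'a) module
    \<Rightarrow> 'h list \<Rightarrow> (('k, 'h) hpar \<times> ('k, 'h) hpar \<Rightarrow>\<^sub>0 int) set" where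
  "par_comult_word R H M B hs = sum_of (tensor M B M)
     (map (\<lambda>ps. pure M B M
         (prod_of (Hpar R H) (map (\<lambda>p. cls R H (fst p)) ps))
         (prod_of (Hpar R H) (map (\<lambda>p. cls R H (snd p)) ps)))
       (product_lists (map (sweedler R H) hs)))"

text \<open>With indices starting from 0, \<open>us ! i\<close> lists the Sweedler components of \<open>hs ! i\<close>, of which
  there are \<open>n - i\<close> in the left counit and \<open>i + 1\<close> in the right counit.\<close>

definition par_left_counit_word :: "'k ring \<Rightarrow> ('k, 'h) hopf \<Rightarrow> 'h list \<Rightarrow> ('k, 'h) hpar" where
  "par_left_counit_word R H hs = (let n = length hs in sum_of (Hpar R H)
     (map (\<lambda>us. prod_of (Hpar R H)
         (map (\<lambda>j. eps R H (prod_of H (map (\<lambda>i. us ! i ! (j - i)) [0..<Suc j]))) [0..<n]))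
       (product_lists (map (\<lambda>i. iter_sweedler R H (n - 1 - i) (hs ! i)) [0..<n]))))"

definition par_right_counit_word :: "'k ring \<Rightarrow> ('k, 'h) hopf \<Rightarrow> 'h list \<Rightarrow> ('k, 'h) hpar" where
  "par_right_counit_word R H hs = (let n = length hs in sum_of (Hpar R H)
     (map (\<lambda>us. prod_of (Hpar R H)
         (map (\<lambda>j. eps' R H (prod_of H (map (\<lambda>i. us ! i ! j) [j..<n]))) [0..<n]))
       (product_lists (map (\<lambda>i. iter_sweedler R H i (hs ! i)) [0..<n]))))"

text \<open>Each map is linear (or an algebra antimorphism) and is given on the products
  \<open>[h\<^sup>1]\<dots>[h\<^sup>n]\<close>, which span \<open>H\<^sub>p\<^sub>a\<^sub>r\<close>; so these conditions determine the maps on \<open>H\<^sub>p\<^sub>a\<^sub>r\<close>. That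
  maps with these properties exist is not taken for granted. The source maps are inclusions
  and the target maps are restrictions of \<open>S'\<close>.\<close>

locale par_structure_maps =
  fixes R :: "'k ring" and H :: "('k, 'h) hopf"
    and S :: "('k, 'h) hpar \<Rightarrow> ('k, 'h) hpar" and S' :: "('k, 'h) hpar \<Rightarrow> ('k, 'h) hpar"
    and Dl :: "('k, 'h) hpar \<Rightarrow> (('k, 'h) hpar \<times> ('k, 'h) hpar \<Rightarrow>\<^sub>0 int) set"
    and Dr :: "('k, 'h) hpar \<Rightarrow> (('k, 'h) hpar \<times> ('k, 'h) hpar \<Rightarrow>\<^sub>0 int) set"
    and El :: "('k, 'h) hpar \<Rightarrow> ('k, 'h) hpar" and Er :: "('k, 'h) hpar \<Rightarrow> ('k, 'h) hpar"
    and P :: "('k, ('k, 'h) hpar) module"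
    and A :: "('k, ('k, 'h) hpar) module" and A' :: "('k, ('k, 'h) hpar) module"
    and L :: "('k, ('k, 'h) hpar, ('k, 'h) hpar, ('k, 'h) hpar) bimod"
    and Q :: "('k, ('k, 'h) hpar, ('k, 'h) hpar, ('k, 'h) hpar) bimod"
    and word :: "'h list \<Rightarrow> ('k, 'h) hpar"
  defines "P \<equiv> Hpar R H" and "A \<equiv> par_base R H" and "A' \<equiv> par_base' R H"
    and "L \<equiv> left_bimod P (\<lambda>a. a) S'" and "Q \<equiv> right_bimod P (\<lambda>a. a) S'"
    and "word \<equiv> \<lambda>hs. prod_of P (map (cls R H) hs)"
  assumes S_anti: "alg_antihom R P P S"
    and S_word: "hs \<in> lists (carrier H) \<Longrightarrow> S (word hs) = word (map (antipode H) (rev hs))"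
    and S'_anti: "alg_antihom R P P S'"
    and S'_word: "hs \<in> lists (carrier H) \<Longrightarrow> S' (word hs) = word (map (antipode_inv H) (rev hs))"
    and Dl_lin: "lin_map R P (tensor L A L) Dl"
    and Dl_word: "hs \<in> lists (carrier H) \<Longrightarrow> Dl (word hs) = par_comult_word R H L A hs"
    and El_lin: "lin_map R P A El"
    and El_word: "hs \<in> lists (carrier H) \<Longrightarrow> El (word hs) = par_left_counit_word R H hs"
    and Dr_lin: "lin_map R P (tensor Q A' Q) Dr"
    and Dr_word: "hs \<in> lists (carrier H) \<Longrightarrow> Dr (word hs) = par_comult_word R H Q A' hs"
    and Er_lin: "lin_map R P A' Er"
    and Er_word: "hs \<in> lists (carrier H) \<Longrightarrow> Er (word hs) = par_right_counit_word R H hs"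

end

theory Submission
  imports Defs
begin

text \<open>Let \<open>act h b = [h\<^sub>1] b [S(h\<^sub>2)]\<close>. The relations of \<open>H\<^sub>p\<^sub>a\<^sub>r\<close> show that \<open>act h\<close> turns a product of
  elements \<open>eps q\<^sub>i\<close>, for \<open>i = 1, \<dots>, n\<close>, into the sum of the products of the \<open>eps (h\<^sub>i q\<^sub>i)\<close> and
  \<open>eps h\<^sub>n\<^sub>+\<^sub>1\<close>. So the closed formula for the left counit amounts to the recursion
  \<open>\<epsilon>\<^sub>l([h] x) = act h (\<epsilon>\<^sub>l x)\<close>, from which the counit axioms follow by induction on words.

  The operators \<open>x \<otimes> y \<mapsto> [h\<^sub>1] x \<otimes> [h\<^sub>2] y\<close> satisfy the relations of \<open>H\<^sub>p\<^sub>a\<^sub>r\<close> and make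
  \<open>H\<^sub>p\<^sub>a\<^sub>r \<otimes>\<^sub>A H\<^sub>p\<^sub>a\<^sub>r\<close> an \<open>H\<^sub>p\<^sub>a\<^sub>r\<close>-module; the left comultiplication is the orbit map of \<open>1 \<otimes> 1\<close>.
  Since right multiplications commute with the module structure, the Takeuchi condition and
  multiplicativity need to be checked at \<open>1 \<otimes> 1\<close> only.

  The antipode \<open>\<theta>\<close> is bijective with inverse \<open>\<theta>'\<close>, and \<open>flip (x \<otimes> y) = \<theta> y \<otimes> \<theta> x\<close> carries the left
  structure to the right one: \<open>\<Delta>\<^sub>r x = flip (\<Delta>\<^sub>l (\<theta>' x))\<close> and \<open>\<epsilon>\<^sub>r x = \<theta> (\<epsilon>\<^sub>l (\<theta>' x))\<close>.\<close>

section \<open>Finite sums and products\<close>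

text \<open>The obstacle is well-definedness. \<open>Hpar R H\<close> is reached only through its
  universal property, which yields algebra maps, while the comultiplications take values in a tensor
  product over a possibly noncommutative base, where a componentwise product makes no sense in
  general. Endomorphisms of that tensor product do form an algebra; this is why h is sent to an
  operator. The operators satisfy the relations because of one exchange rule,
  \<open>diag_shift2\<close>: the sums of [h1][l]x \<otimes> [h2 m]y and of [h1 l]x \<otimes>
  [h2][m]y agree. It allows each relation to be applied in a single slot. The inverse antipode
  enters here, as the target of \<open>eps R H h\<close> is \<open>eps'\<close> at S^-1(h).

  The left counit needs no second universal argument: the antipode axiom prescribes it as the right
  comultiplication followed by y \<otimes> z \<mapsto> y \<theta>(z), a linear map whose values on
  words obey the recursion. So the counits presuppose the antipodes and the comultiplications.

  A coproduct is a chosen list of pairs. Every manipulation that changes the list is an equality of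
  lifts of multilinear maps, which accounts for the many linearity conditions.\<close>

lemma sum_of_Nil [simp]: "sum_of G [] = \<zero>\<^bsub>G\<^esub>"
  by (simp add: sum_of_def)

lemma sum_of_Cons [simp]: "sum_of G (x # xs) = x \<oplus>\<^bsub>G\<^esub> sum_of G xs"
  by (simp add: sum_of_def)

lemma prod_of_Nil [simp]: "prod_of G [] = \<one>\<^bsub>G\<^esub>"
  by (simp add: prod_of_def)

lemma prod_of_Cons [simp]: "prod_of G (x # xs) = x \<otimes>\<^bsub>G\<^esub> prod_of G xs"
  by (simp add: prod_of_def)

context abelian_group
begin

lemma sum_of_closed [simp, intro]: "set xs \<subseteq> carrier G \<Longrightarrow> sum_of G xs \<in> carrier G"
  by (induction xs) auto

lemma sum_of_append:
  "set xs \<subseteq> carrier G \<Longrightarrow> set ys \<subseteq> carrier G \<Longrightarrow>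
    sum_of G (xs @ ys) = sum_of G xs \<oplus> sum_of G ys"
  by (induction xs) (auto simp: a_assoc)

lemma sum_of_concat:
  "(\<And>xs. xs \<in> set xss \<Longrightarrow> set xs \<subseteq> carrier G) \<Longrightarrow>
    sum_of G (concat xss) = sum_of G (map (sum_of G) xss)"
  by (induction xss) (auto simp: sum_of_append UN_subset_iff)

lemma sum_of_zero: "sum_of G (map (\<lambda>x. \<zero>) xs) = \<zero>"
  by (induction xs) auto

lemma sum_of_add:
  assumes "\<And>x. x \<in> set xs \<Longrightarrow> f x \<in> carrier G" "\<And>x. x \<in> set xs \<Longrightarrow> g x \<in> carrier G"
  shows "sum_of G (map (\<lambda>x. f x \<oplus> g x) xs) = sum_of G (map f xs) \<oplus> sum_of G (map g xs)"
  using assms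
proof (induction xs)
  case (Cons x xs)
  have "sum_of G (map f xs) \<in> carrier G" "sum_of G (map g xs) \<in> carrier G"
    using Cons.prems by (auto intro!: sum_of_closed)
  with Cons show ?case by (simp add: a_ac)
qed simp

lemma sum_of_swap:
  assumes "\<And>x y. x \<in> set xs \<Longrightarrow> y \<in> set ys \<Longrightarrow> f x y \<in> carrier G"
  shows "sum_of G (map (\<lambda>x. sum_of G (map (f x) ys)) xs) =
    sum_of G (map (\<lambda>y. sum_of G (map (\<lambda>x. f x y) xs)) ys)"
  using assms
proof (induction xs)
  case (Cons x xs)
  then show ?case
    by (simp, subst sum_of_add) (auto intro!: sum_of_closed)
qed (simp add: sum_of_zero)

end

lemma (in monoid) prod_of_closed [simp, intro]: "set xs \<subseteq> carrier G \<Longrightarrow> prod_of G xs \<in> carrier G"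
  by (induction xs) auto

lemma (in monoid) prod_of_append:
  "set xs \<subseteq> carrier G \<Longrightarrow> set ys \<subseteq> carrier G \<Longrightarrow>
    prod_of G (xs @ ys) = prod_of G xs \<otimes> prod_of G ys"
  by (induction xs) (auto simp: m_assoc)

section \<open>Additive and linear maps\<close>

definition additive_map :: "('a, 'y) ring_scheme \<Rightarrow> ('b, 'z) ring_scheme \<Rightarrow> ('a \<Rightarrow> 'b) \<Rightarrow> bool" where
  "additive_map G K f \<longleftrightarrow> f \<in> carrier G \<rightarrow> carrier K \<and>
     (\<forall>x\<in>carrier G. \<forall>y\<in>carrier G. f (x \<oplus>\<^bsub>G\<^esub> y) = f x \<oplus>\<^bsub>K\<^esub> f y)"

lemma additive_mapI:
  "(\<And>x. x \<in> carrier G \<Longrightarrow> f x \<in> carrier K) \<Longrightarrow>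
   (\<And>x y. x \<in> carrier G \<Longrightarrow> y \<in> carrier G \<Longrightarrow> f (x \<oplus>\<^bsub>G\<^esub> y) = f x \<oplus>\<^bsub>K\<^esub> f y) \<Longrightarrow>
   additive_map G K f"
  by (auto simp: additive_map_def)

lemma additive_map_closed: "additive_map G K f \<Longrightarrow> x \<in> carrier G \<Longrightarrow> f x \<in> carrier K"
  by (auto simp: additive_map_def)

lemma additive_map_add:
  "additive_map G K f \<Longrightarrow> x \<in> carrier G \<Longrightarrow> y \<in> carrier G \<Longrightarrow> f (x \<oplus>\<^bsub>G\<^esub> y) = f x \<oplus>\<^bsub>K\<^esub> f y"
  by (auto simp: additive_map_def)

lemma additive_map_zero:
  assumes "additive_map G K f" "abelian_group G" "abelian_group K"
  shows "f \<zero>\<^bsub>G\<^esub> = \<zero>\<^bsub>K\<^esub>"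
proof -
  interpret G: abelian_group G by fact
  interpret K: abelian_group K by fact
  have "f \<zero>\<^bsub>G\<^esub> \<oplus>\<^bsub>K\<^esub> f \<zero>\<^bsub>G\<^esub> = f \<zero>\<^bsub>G\<^esub> \<oplus>\<^bsub>K\<^esub> \<zero>\<^bsub>K\<^esub>"
    using additive_map_add[OF assms(1), of "\<zero>\<^bsub>G\<^esub>" "\<zero>\<^bsub>G\<^esub>"] additive_map_closed[OF assms(1)] by simp
  then show ?thesis
    using additive_map_closed[OF assms(1) G.zero_closed] by simp
qed

lemma additive_map_sum_of:
  assumes "additive_map G K f" "abelian_group G" "abelian_group K" "set xs \<subseteq> carrier G"
  shows "f (sum_of G xs) = sum_of K (map f xs)"
  using assms(4)
proof (induction xs)
  case Nil
  then show ?case by (simp add: additive_map_zero[OF assms(1-3)])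
next
  case (Cons x xs)
  then show ?case
    using abelian_group.sum_of_closed[OF assms(2), of xs] by (simp add: additive_map_add[OF assms(1)])
qed

lemma lin_map_additive: "lin_map R M N f \<Longrightarrow> additive_map M N f"
  by (auto simp: lin_map_def additive_map_def)

lemma lin_mapI:
  "(\<And>x. x \<in> carrier M \<Longrightarrow> f x \<in> carrier N) \<Longrightarrow>
   (\<And>x y. x \<in> carrier M \<Longrightarrow> y \<in> carrier M \<Longrightarrow> f (x \<oplus>\<^bsub>M\<^esub> y) = f x \<oplus>\<^bsub>N\<^esub> f y) \<Longrightarrow>
   (\<And>c x. c \<in> carrier R \<Longrightarrow> x \<in> carrier M \<Longrightarrow> f (c \<odot>\<^bsub>M\<^esub> x) = c \<odot>\<^bsub>N\<^esub> f x) \<Longrightarrow>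
   lin_map R M N f"
  by (auto simp: lin_map_def)

lemma lin_map_closed: "lin_map R M N f \<Longrightarrow> x \<in> carrier M \<Longrightarrow> f x \<in> carrier N"
  and lin_map_add: "lin_map R M N f \<Longrightarrow> x \<in> carrier M \<Longrightarrow> y \<in> carrier M \<Longrightarrow>
    f (x \<oplus>\<^bsub>M\<^esub> y) = f x \<oplus>\<^bsub>N\<^esub> f y"
  and lin_map_smult: "lin_map R M N f \<Longrightarrow> c \<in> carrier R \<Longrightarrow> x \<in> carrier M \<Longrightarrow>
    f (c \<odot>\<^bsub>M\<^esub> x) = c \<odot>\<^bsub>N\<^esub> f x"
  by (auto simp: lin_map_def)

lemma lin_map_comp:
  "lin_map R N K g \<Longrightarrow> lin_map R M N f \<Longrightarrow> lin_map R M K (\<lambda>x. g (f x))"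
  by (auto simp: lin_map_def Pi_iff)

section \<open>Tensor products\<close>

text \<open>Only additivity and balancing are recorded, as tensors are built as abelian groups;
  linearity over the base ring is recovered by \<open>tensor_lift_lin\<close>.\<close>

definition balanced ::
    "('k, 'a, 'b, 'm) bimod \<Rightarrow> ('k, 'b) module \<Rightarrow> ('k, 'b, 'c, 'n) bimod
      \<Rightarrow> ('g, 'z) ring_scheme \<Rightarrow> ('m \<Rightarrow> 'n \<Rightarrow> 'g) \<Rightarrow> bool" where
  "balanced M B N G f \<longleftrightarrow>
     (\<forall>y\<in>carrier N. additive_map M G (\<lambda>x. f x y)) \<and>
     (\<forall>x\<in>carrier M. additive_map N G (f x)) \<and>
     (\<forall>x\<in>carrier M. \<forall>b\<in>carrier B. \<forall>y\<in>carrier N. f (ract M x b) y = f x (lact N b y))"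

lemma balancedI:
  assumes "\<And>y. y \<in> carrier N \<Longrightarrow> additive_map M G (\<lambda>x. f x y)"
    and "\<And>x. x \<in> carrier M \<Longrightarrow> additive_map N G (f x)"
    and "\<And>x b y. x \<in> carrier M \<Longrightarrow> b \<in> carrier B \<Longrightarrow> y \<in> carrier N \<Longrightarrow>
      f (ract M x b) y = f x (lact N b y)"
  shows "balanced M B N G f"
  using assms by (auto simp: balanced_def)

locale tensor_pair = M: bimodule R A B M + N: bimodule R B C N
  for R :: "'k ring" and A :: "('k, 'a) module" and B :: "('k, 'b) module"
    and C :: "('k, 'c) module" and M :: "('k, 'a, 'b, 'm) bimod" and N :: "('k, 'b, 'c, 'n) bimod"
begin

sublocale R: cring R
  using M.mod_M by (rule module.axioms(1))
sublocale MM: module R M by (rule M.mod_M)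
sublocale NN: module R N by (rule N.mod_M)
sublocale AA: assoc_algebra R A by (rule M.alg_A)
sublocale BB: assoc_algebra R B by (rule M.alg_B)
sublocale CC: assoc_algebra R C by (rule N.alg_B)

abbreviation "T \<equiv> tensor M B N"
abbreviation "p \<equiv> pure M B N"
abbreviation "F \<equiv> tensor_free M N"
abbreviation "K \<equiv> tensor_ker M B N"

lemma comm_group_F: "comm_group F"
  by (simp add: tensor_free_def abelian_free_Abelian_group)

sublocale F: comm_group F by (rule comm_group_F)

lemma carrier_F: "u \<in> carrier F \<longleftrightarrow> Poly_Mapping.keys u \<subseteq> carrier M \<times> carrier N"
  by (simp add: tensor_free_def)

lemma diff_carrier_F: "u \<in> carrier F \<Longrightarrow> v \<in> carrier F \<Longrightarrow> u - v \<in> carrier F"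
  using keys_diff[of u v] unfolding carrier_F by blast

lemma add_carrier_F: "u \<in> carrier F \<Longrightarrow> v \<in> carrier F \<Longrightarrow> u + v \<in> carrier F"
  using F.m_closed[of u v] by (simp add: tensor_free_def)

lemma frag_carrier_F: "x \<in> carrier M \<Longrightarrow> y \<in> carrier N \<Longrightarrow> frag_of (x, y) \<in> carrier F"
  by (simp add: carrier_F)

lemma rels_carrier: "tensor_rels M B N \<subseteq> carrier F"
  unfolding tensor_rels_def
  by (auto intro!: diff_carrier_F frag_carrier_F M.ract_closed N.lact_closed)

lemma subgroup_K: "subgroup K F"
  unfolding tensor_ker_def by (rule F.generate_is_subgroup[OF rels_carrier])

lemma normal_K: "K \<lhd> F"
  using subgroup_K F.normal_iff_subgroup by blast

lemma comm_group_TG: "comm_group (tensor_group M B N)"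
  unfolding tensor_group_def by (rule F.abelian_FactGroup[OF subgroup_K])

lemma coset_eqI:
  assumes "u \<in> carrier F" "v \<in> carrier F" "u - v \<in> K"
  shows "K #>\<^bsub>F\<^esub> u = K #>\<^bsub>F\<^esub> v"
proof -
  have "u = (u - v) \<otimes>\<^bsub>F\<^esub> v"
    by (simp add: tensor_free_def)
  then have "K #>\<^bsub>F\<^esub> u = (K #>\<^bsub>F\<^esub> (u - v)) #>\<^bsub>F\<^esub> v"
    using F.coset_mult_assoc[of K "u - v" v] subgroup.subset[OF subgroup_K] diff_carrier_F assms
    by simp
  then show ?thesis
    using F.coset_join2[of "u - v" K] subgroup_K diff_carrier_F assms by simp
qed

lemma mult_cosets:
  "u \<in> carrier F \<Longrightarrow> v \<in> carrier F \<Longrightarrow>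
    (K #>\<^bsub>F\<^esub> u) \<otimes>\<^bsub>tensor_group M B N\<^esub> (K #>\<^bsub>F\<^esub> v) = K #>\<^bsub>F\<^esub> (u + v)"
  using normal.rcos_sum[OF normal_K, of u v] by (simp add: tensor_group_def tensor_free_def)

lemma sum_of_T: "sum_of T xs = prod_of (tensor_group M B N) xs"
  by (simp add: sum_of_def prod_of_def tensor_def tensor_ab_def Let_def)

lemma sum_of_tensor_ab: "sum_of (tensor_ab M B N) = sum_of T"
  by (simp add: fun_eq_iff sum_of_def tensor_def tensor_ab_def Let_def)

text \<open>\<open>tensor\<close> has to define its actions by lifts into the bare group
  \<open>tensor_ab\<close>, as the record itself is not yet available there. A lift reads only
  addition and zero of its target, which both records share, so these lifts may be taken in
  \<open>T\<close>.\<close>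

lemma lift_tensor_ab: "tensor_lift P Q S (tensor_ab M B N) = tensor_lift P Q S T"
  by (simp add: fun_eq_iff tensor_lift_def sum_of_tensor_ab)

lemma carrier_T: "carrier T = carrier (tensor_group M B N)"
  and add_T: "ring.add T = monoid.mult (tensor_group M B N)"
  and zero_T: "ring.zero T = one (tensor_group M B N)"
  and one_T: "one T = p \<one>\<^bsub>M\<^esub> \<one>\<^bsub>N\<^esub>"
  by (simp_all add: tensor_def tensor_ab_def Let_def)

lemma smult_T: "c \<odot>\<^bsub>T\<^esub> X = tensor_lift M B N T (\<lambda>x y. p (c \<odot>\<^bsub>M\<^esub> x) y) X"
  and lact_T: "lact T a X = tensor_lift M B N T (\<lambda>x y. p (lact M a x) y) X"
  and ract_T: "ract T X b = tensor_lift M B N T (\<lambda>x y. p x (ract N y b)) X"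
  and mult_T: "X \<otimes>\<^bsub>T\<^esub> Y = tensor_lift M B N T
    (\<lambda>x y. tensor_lift M B N T (\<lambda>x' y'. p (x \<otimes>\<^bsub>M\<^esub> x') (y \<otimes>\<^bsub>N\<^esub> y')) Y) X"
  unfolding lift_tensor_ab[symmetric] by (simp_all add: tensor_def Let_def)

lemma abelian_group_T: "abelian_group T"
proof -
  interpret G: comm_group "tensor_group M B N" by (rule comm_group_TG)
  show ?thesis
  proof (rule abelian_groupI)
    fix X Y Z assume "X \<in> carrier T" "Y \<in> carrier T" "Z \<in> carrier T"
    then show "X \<oplus>\<^bsub>T\<^esub> Y \<oplus>\<^bsub>T\<^esub> Z = X \<oplus>\<^bsub>T\<^esub> (Y \<oplus>\<^bsub>T\<^esub> Z)"
      by (simp add: carrier_T add_T G.m_assoc)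
  next
    fix X Y assume "X \<in> carrier T" "Y \<in> carrier T"
    then show "X \<oplus>\<^bsub>T\<^esub> Y = Y \<oplus>\<^bsub>T\<^esub> X"
      by (simp add: carrier_T add_T G.m_comm)
  next
    fix X assume "X \<in> carrier T"
    then show "\<exists>Y\<in>carrier T. Y \<oplus>\<^bsub>T\<^esub> X = \<zero>\<^bsub>T\<^esub>"
      by (intro bexI[of _ "inv\<^bsub>tensor_group M B N\<^esub> X"]) (simp_all add: carrier_T add_T zero_T)
  qed (simp_all add: carrier_T add_T zero_T)
qed

sublocale T: abelian_group T by (rule abelian_group_T)

lemma pure_closed [simp]: "x \<in> carrier M \<Longrightarrow> y \<in> carrier N \<Longrightarrow> p x y \<in> carrier T"
  unfolding carrier_T tensor_group_def FactGroup_def RCOSETS_def pure_def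
  using frag_carrier_F by auto

lemma relation_K: "r \<in> tensor_rels M B N \<Longrightarrow> r \<in> K"
  unfolding tensor_ker_def by (rule generate.incl)

lemma pure_balanced: "balanced M B N T p"
proof (intro balancedI additive_mapI pure_closed; assumption?)
  fix x x' y assume 1: "x \<in> carrier M" "x' \<in> carrier M" "y \<in> carrier N"
  have "frag_of (x \<oplus>\<^bsub>M\<^esub> x', y) - frag_of (x, y) - frag_of (x', y) \<in> K"
    using 1 by (intro relation_K) (auto simp: tensor_rels_def)
  then have "K #>\<^bsub>F\<^esub> frag_of (x \<oplus>\<^bsub>M\<^esub> x', y) = K #>\<^bsub>F\<^esub> (frag_of (x, y) + frag_of (x', y))"
    using 1 by (intro coset_eqI frag_carrier_F add_carrier_F) (simp_all add: diff_diff_add)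
  then show "p (x \<oplus>\<^bsub>M\<^esub> x') y = p x y \<oplus>\<^bsub>T\<^esub> p x' y"
    using 1 unfolding add_T pure_def by (simp add: mult_cosets frag_carrier_F)
next
  fix x y y' assume 1: "x \<in> carrier M" "y \<in> carrier N" "y' \<in> carrier N"
  have "frag_of (x, y \<oplus>\<^bsub>N\<^esub> y') - frag_of (x, y) - frag_of (x, y') \<in> K"
    using 1 by (intro relation_K) (auto simp: tensor_rels_def)
  then have "K #>\<^bsub>F\<^esub> frag_of (x, y \<oplus>\<^bsub>N\<^esub> y') = K #>\<^bsub>F\<^esub> (frag_of (x, y) + frag_of (x, y'))"
    using 1 by (intro coset_eqI frag_carrier_F add_carrier_F) (simp_all add: diff_diff_add)
  then show "p x (y \<oplus>\<^bsub>N\<^esub> y') = p x y \<oplus>\<^bsub>T\<^esub> p x y'"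
    using 1 unfolding add_T pure_def by (simp add: mult_cosets frag_carrier_F)
next
  fix x b y assume 1: "x \<in> carrier M" "b \<in> carrier B" "y \<in> carrier N"
  have "frag_of (ract M x b, y) - frag_of (x, lact N b y) \<in> K"
    using 1 by (intro relation_K) (auto simp: tensor_rels_def)
  then show "p (ract M x b) y = p x (lact N b y)"
    unfolding pure_def
    using 1 by (intro coset_eqI frag_carrier_F M.ract_closed N.lact_closed)
qed

text \<open>This makes the choice in \<open>tensor_rep\<close> legitimate. The free abelian group
  supplies differences, so signs have to be absorbed: the negative of a pure tensor x \<otimes> y is
  the pure tensor of -x and y.\<close>

lemma tensor_span:
  assumes "X \<in> carrier T"
  shows "\<exists>xs. set xs \<subseteq> carrier M \<times> carrier N \<and> X = sum_of T (map (\<lambda>(x, y). p x y) xs)"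
proof -
  obtain u where u: "u \<in> carrier F" "X = K #>\<^bsub>F\<^esub> u"
    using assms unfolding carrier_T tensor_group_def FactGroup_def RCOSETS_def by auto
  have "\<exists>xs. set xs \<subseteq> carrier M \<times> carrier N \<and> K #>\<^bsub>F\<^esub> u = sum_of T (map (\<lambda>(x, y). p x y) xs)"
    using u(1)[unfolded carrier_F]
  proof (induction u rule: free_Abelian_group_induct[consumes 1])
    case 1
    have "K #>\<^bsub>F\<^esub> 0 = \<zero>\<^bsub>T\<^esub>"
      using F.coset_join2[OF F.one_closed subgroup_K subgroup.one_closed[OF subgroup_K]]
      by (simp add: zero_T tensor_group_def FactGroup_def) (simp add: tensor_free_def)
    then show ?case by (intro exI[of _ "[]"]) simp
  next
    case (2 u v)
    then obtain xs ys where
      xs: "set xs \<subseteq> carrier M \<times> carrier N" "K #>\<^bsub>F\<^esub> u = sum_of T (map (\<lambda>(x, y). p x y) xs)" and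
      ys: "set ys \<subseteq> carrier M \<times> carrier N" "K #>\<^bsub>F\<^esub> v = sum_of T (map (\<lambda>(x, y). p x y) ys)"
      by blast
    let ?zs = "map (\<lambda>(x, y). (\<ominus>\<^bsub>M\<^esub> x, y)) ys"
    have neg: "p (\<ominus>\<^bsub>M\<^esub> x) y = \<ominus>\<^bsub>T\<^esub> (p x y)" if "x \<in> carrier M" "y \<in> carrier N" for x y
    proof -
      have *: "additive_map M T (\<lambda>x. p x y)" using pure_balanced that by (simp add: balanced_def)
      have "p (\<ominus>\<^bsub>M\<^esub> x) y \<oplus>\<^bsub>T\<^esub> p x y = \<zero>\<^bsub>T\<^esub>"
        using that additive_map_add[OF *, of "\<ominus>\<^bsub>M\<^esub> x" x]
          additive_map_zero[OF * MM.abelian_group_axioms T.abelian_group_axioms]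
        by (simp add: MM.l_neg)
      then show ?thesis using that T.minus_equality by simp
    qed
    have **: "set zs \<subseteq> carrier M \<times> carrier N \<Longrightarrow>
      sum_of T (map (\<lambda>(x, y). p x y) (map (\<lambda>(x, y). (\<ominus>\<^bsub>M\<^esub> x, y)) zs)) =
      \<ominus>\<^bsub>T\<^esub> sum_of T (map (\<lambda>(x, y). p x y) zs)" for zs
    proof (induction zs)
      case (Cons z zs)
      have "sum_of T (map (\<lambda>(x, y). p x y) zs) \<in> carrier T"
        using Cons.prems by (intro T.sum_of_closed) auto
      with Cons show ?case by (cases z) (simp add: neg T.minus_add)
    qed (simp add: T.minus_equality[OF T.l_zero[OF T.zero_closed]])
    have vd: "(K #>\<^bsub>F\<^esub> (u - v)) \<oplus>\<^bsub>T\<^esub> (K #>\<^bsub>F\<^esub> v) = K #>\<^bsub>F\<^esub> u"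
      using mult_cosets[OF diff_carrier_F[of u v], of v] 2(1,2) by (simp add: add_T carrier_F)
    have cl: "K #>\<^bsub>F\<^esub> w \<in> carrier T" if "w \<in> carrier F" for w
      using that unfolding carrier_T tensor_group_def FactGroup_def RCOSETS_def by auto
    have "K #>\<^bsub>F\<^esub> (u - v) = (K #>\<^bsub>F\<^esub> u) \<oplus>\<^bsub>T\<^esub> \<ominus>\<^bsub>T\<^esub> (K #>\<^bsub>F\<^esub> v)"
      using 2(1,2) vd cl[OF diff_carrier_F[of u v]] cl[of v]
      by (metis T.add.inv_solve_right carrier_F cl)
    also have "\<dots> = sum_of T (map (\<lambda>(x, y). p x y) (xs @ ?zs))"
      unfolding xs ys **[OF ys(1), symmetric] map_append
      using xs(1) ys(1) by (intro T.sum_of_append[symmetric]) auto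
    finally show ?case
      using xs(1) ys(1) by (intro exI[of _ "xs @ ?zs"]) auto
  next
    case (3 a)
    then show ?case by (intro exI[of _ "[a]"]) (auto simp: pure_def[symmetric])
  qed
  then show ?thesis using u(2) by simp
qed

text \<open>The free abelian group extends \<open>f\<close>; the three kinds of relations lie in the
  kernel of the extension, which therefore factors through the quotient.\<close>

lemma tensor_universal:
  assumes G: "abelian_group G" and f: "balanced M B N G f"
  obtains \<phi> where "additive_map T G \<phi>"
    and "\<And>x y. x \<in> carrier M \<Longrightarrow> y \<in> carrier N \<Longrightarrow> \<phi> (p x y) = f x y"
proof -
  interpret G: abelian_group G by fact
  have cl: "f x y \<in> carrier G" if "x \<in> carrier M" "y \<in> carrier N" for x y
    using f that by (auto simp: balanced_def additive_map_def)
  have "(\<lambda>(x, y). f x y) ` (carrier M \<times> carrier N) \<subseteq> carrier (add_monoid G)"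
    using cl by auto
  from comm_group.free_Abelian_group_universal[OF G.a_comm_group this] obtain h where
    h: "h \<in> hom F (add_monoid G)" and
    "\<And>z. z \<in> carrier M \<times> carrier N \<Longrightarrow> h (frag_of z) = (case z of (x, y) \<Rightarrow> f x y)"
    unfolding tensor_free_def by metis
  then have h_frag: "\<And>x y. x \<in> carrier M \<Longrightarrow> y \<in> carrier N \<Longrightarrow> h (frag_of (x, y)) = f x y"
    by auto
  have gh: "group_hom F (add_monoid G) h"
    using h by (simp add: group_hom_def group_hom_axioms_def F.is_group G.add.is_group)
  have h_diff: "h (u - v) = h u \<ominus>\<^bsub>G\<^esub> h v" if "u \<in> carrier F" "v \<in> carrier F" for u v
  proof -
    have eq: "h u = h (u - v) \<oplus>\<^bsub>G\<^esub> h v"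
      using hom_mult[OF h diff_carrier_F[OF that] that(2)] by (simp add: tensor_free_def)
    have "h (u - v) \<in> carrier G" "h v \<in> carrier G"
      using group_hom.hom_closed[OF gh that(2)] group_hom.hom_closed[OF gh diff_carrier_F[OF that]] by simp_all
    then show ?thesis
      unfolding eq by (simp add: G.minus_eq G.a_assoc G.r_neg)
  qed
  have cancel: "a \<oplus>\<^bsub>G\<^esub> b \<ominus>\<^bsub>G\<^esub> a \<ominus>\<^bsub>G\<^esub> b = \<zero>\<^bsub>G\<^esub>" if "a \<in> carrier G" "b \<in> carrier G" for a b
    using that by (simp add: G.minus_eq G.a_comm[of a b] G.a_assoc G.r_neg)
  have r1: "h (frag_of (x \<oplus>\<^bsub>M\<^esub> x', y) - frag_of (x, y) - frag_of (x', y)) = \<zero>\<^bsub>G\<^esub>"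
    if "x \<in> carrier M" "x' \<in> carrier M" "y \<in> carrier N" for x x' y
  proof -
    have "f (x \<oplus>\<^bsub>M\<^esub> x') y = f x y \<oplus>\<^bsub>G\<^esub> f x' y"
      using f that by (auto simp: balanced_def additive_map_def)
    then show ?thesis
      using that by (simp add: h_diff h_frag frag_carrier_F diff_carrier_F cl cancel)
  qed
  have r2: "h (frag_of (x, y \<oplus>\<^bsub>N\<^esub> y') - frag_of (x, y) - frag_of (x, y')) = \<zero>\<^bsub>G\<^esub>"
    if "x \<in> carrier M" "y \<in> carrier N" "y' \<in> carrier N" for x y y'
  proof -
    have "f x (y \<oplus>\<^bsub>N\<^esub> y') = f x y \<oplus>\<^bsub>G\<^esub> f x y'"
      using f that by (auto simp: balanced_def additive_map_def)
    then show ?thesis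
      using that by (simp add: h_diff h_frag frag_carrier_F diff_carrier_F cl cancel)
  qed
  have r3: "h (frag_of (ract M x b, y) - frag_of (x, lact N b y)) = \<zero>\<^bsub>G\<^esub>"
    if "x \<in> carrier M" "b \<in> carrier B" "y \<in> carrier N" for x b y
  proof -
    have "f (ract M x b) y = f x (lact N b y)"
      using f that by (auto simp: balanced_def)
    then show ?thesis
      using that by (simp add: h_diff h_frag frag_carrier_F cl M.ract_closed N.lact_closed
          G.minus_eq G.r_neg)
  qed
  have "tensor_rels M B N \<subseteq> {r. h r = \<zero>\<^bsub>G\<^esub>}"
    unfolding tensor_rels_def
    by (intro Un_least subsetI; elim CollectE exE conjE; simp only: r1 r2 r3 mem_Collect_eq)
  then have "tensor_rels M B N \<subseteq> kernel F (add_monoid G) h"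
    using rels_carrier by (auto simp: kernel_def)
  then have "K \<subseteq> kernel F (add_monoid G) h"
    unfolding tensor_ker_def by (intro F.generate_subgroup_incl group_hom.subgroup_kernel[OF gh])
  then obtain \<phi> where \<phi>: "\<phi> \<in> hom (F Mod K) (add_monoid G)"
    "\<And>u. u \<in> carrier F \<Longrightarrow> \<phi> (K #>\<^bsub>F\<^esub> u) = h u"
    using group_hom.FactGroup_universal_kernel[OF gh normal_K] by metis
  show thesis
  proof
    show "additive_map T G \<phi>"
      using \<phi>(1) by (auto simp: additive_map_def hom_def carrier_T add_T tensor_group_def)
    show "\<phi> (p x y) = f x y" if "x \<in> carrier M" "y \<in> carrier N" for x y
      using that by (simp add: pure_def \<phi>(2) frag_carrier_F h_frag)
  qed
qed

lemma tensor_rep: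
  assumes "X \<in> carrier T"
  shows "set (tensor_rep M B N X) \<subseteq> carrier M \<times> carrier N"
    and "X = sum_of T (map (\<lambda>(x, y). p x y) (tensor_rep M B N X))"
  using someI_ex[OF tensor_span[OF assms]] unfolding tensor_rep_def sum_of_T by blast+

text \<open>An additive map with the right values on pure tensors can be evaluated along whichever
  expression \<open>tensor_rep\<close> has chosen, so the lift coincides with the map of
  \<open>tensor_universal\<close>.\<close>

lemma tensor_lift:
  assumes G: "abelian_group G" and f: "balanced M B N G f"
  shows tensor_lift_additive: "additive_map T G (tensor_lift M B N G f)"
    and tensor_lift_pure: "x \<in> carrier M \<Longrightarrow> y \<in> carrier N \<Longrightarrow> tensor_lift M B N G f (p x y) = f x y"
proof -
  obtain \<phi> where \<phi>: "additive_map T G \<phi>"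
    "\<And>x y. x \<in> carrier M \<Longrightarrow> y \<in> carrier N \<Longrightarrow> \<phi> (p x y) = f x y"
    using tensor_universal[OF assms] by metis
  have eq: "tensor_lift M B N G f X = \<phi> X" if X: "X \<in> carrier T" for X
  proof -
    have "\<phi> X = \<phi> (sum_of T (map (\<lambda>(x, y). p x y) (tensor_rep M B N X)))"
      by (rule arg_cong[OF tensor_rep(2)[OF X]])
    also have "\<dots> = sum_of G (map \<phi> (map (\<lambda>(x, y). p x y) (tensor_rep M B N X)))"
      using tensor_rep(1)[OF X] by (intro additive_map_sum_of[OF \<phi>(1) abelian_group_T G]) auto
    also have "map \<phi> (map (\<lambda>(x, y). p x y) (tensor_rep M B N X)) =
      map (\<lambda>(x, y). f x y) (tensor_rep M B N X)"
      using tensor_rep(1)[OF X] \<phi>(2) by auto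
    finally show ?thesis by (simp add: tensor_lift_def)
  qed
  show "additive_map T G (tensor_lift M B N G f)"
    using \<phi>(1) by (simp add: additive_map_def eq Pi_iff)
  show "x \<in> carrier M \<Longrightarrow> y \<in> carrier N \<Longrightarrow> tensor_lift M B N G f (p x y) = f x y"
    using \<phi>(2) by (simp add: eq)
qed

lemmas tensor_lift_closed = additive_map_closed[OF tensor_lift_additive]
lemmas tensor_lift_add = additive_map_add[OF tensor_lift_additive]

text \<open>Zero and negatives have no cases of their own: zero is the pure tensor of two zeros, and
  \<open>tensor_rep\<close> gives sums without signs.\<close>

lemma tensor_induct [consumes 1, case_names pure add]:
  assumes X: "X \<in> carrier T"
    and pure: "\<And>x y. x \<in> carrier M \<Longrightarrow> y \<in> carrier N \<Longrightarrow> Q (p x y)"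
    and add: "\<And>X Y. X \<in> carrier T \<Longrightarrow> Y \<in> carrier T \<Longrightarrow> Q X \<Longrightarrow> Q Y \<Longrightarrow> Q (X \<oplus>\<^bsub>T\<^esub> Y)"
  shows "Q X"
proof -
  have "additive_map M T (\<lambda>x. p x \<zero>\<^bsub>N\<^esub>)"
    using pure_balanced by (auto simp: balanced_def)
  from additive_map_zero[OF this MM.abelian_group_axioms abelian_group_T]
  have zero: "Q \<zero>\<^bsub>T\<^esub>" using pure[of "\<zero>\<^bsub>M\<^esub>" "\<zero>\<^bsub>N\<^esub>"] by simp
  have "set xs \<subseteq> carrier M \<times> carrier N \<Longrightarrow> Q (sum_of T (map (\<lambda>(x, y). p x y) xs))" for xs
  proof (induction xs)
    case (Cons z xs)
    obtain x y where z: "z = (x, y)" by force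
    have "sum_of T (map (\<lambda>(x, y). p x y) xs) \<in> carrier T"
      using Cons.prems by (intro T.sum_of_closed) auto
    then show ?case
      using Cons unfolding z by (simp add: add pure)
  qed (simp add: zero)
  from this[OF tensor_rep(1)[OF X]] show ?thesis
    by (simp only: tensor_rep(2)[OF X, symmetric])
qed

section \<open>Scalars and outer actions on a tensor product\<close>

lemma pure_add_left: "x \<in> carrier M \<Longrightarrow> x' \<in> carrier M \<Longrightarrow> y \<in> carrier N \<Longrightarrow>
    p (x \<oplus>\<^bsub>M\<^esub> x') y = p x y \<oplus>\<^bsub>T\<^esub> p x' y"
  and pure_add_right: "x \<in> carrier M \<Longrightarrow> y \<in> carrier N \<Longrightarrow> y' \<in> carrier N \<Longrightarrow>
    p x (y \<oplus>\<^bsub>N\<^esub> y') = p x y \<oplus>\<^bsub>T\<^esub> p x y'"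
  and pure_ract: "x \<in> carrier M \<Longrightarrow> b \<in> carrier B \<Longrightarrow> y \<in> carrier N \<Longrightarrow>
    p (ract M x b) y = p x (lact N b y)"
  using pure_balanced by (auto simp: balanced_def additive_map_def)

text \<open>A scalar c crosses the tensor sign because on both sides it acts as the element c1 of
  the middle algebra.\<close>

lemma pure_smult: 
  assumes "c \<in> carrier R" "x \<in> carrier M" "y \<in> carrier N"
  shows "p (c \<odot>\<^bsub>M\<^esub> x) y = p x (c \<odot>\<^bsub>N\<^esub> y)"
  using assms pure_ract[of x "c \<odot>\<^bsub>B\<^esub> \<one>\<^bsub>B\<^esub>" y] by (simp add: M.ract_smult_one N.lact_smult_one)

lemma smult_ract: 
  assumes "c \<in> carrier R" "x \<in> carrier M" "b \<in> carrier B"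
  shows "c \<odot>\<^bsub>M\<^esub> ract M x b = ract M (c \<odot>\<^bsub>M\<^esub> x) b"
  using assms M.act_commute[of "c \<odot>\<^bsub>A\<^esub> \<one>\<^bsub>A\<^esub>" b x] by (simp add: M.lact_smult_one M.ract_closed)

lemma balanced_smult: "c \<in> carrier R \<Longrightarrow> balanced M B N T (\<lambda>x y. p (c \<odot>\<^bsub>M\<^esub> x) y)"
  by (intro balancedI additive_mapI)
    (simp_all add: MM.smult_r_distr pure_add_left pure_add_right smult_ract pure_ract)

lemma balanced_lact: "a \<in> carrier A \<Longrightarrow> balanced M B N T (\<lambda>x y. p (lact M a x) y)"
  by (intro balancedI additive_mapI)
    (simp_all add: M.lact_closed M.lact_add_right pure_add_left pure_add_right
      M.act_commute[symmetric] pure_ract)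

lemma balanced_ract: "d \<in> carrier C \<Longrightarrow> balanced M B N T (\<lambda>x y. p x (ract N y d))"
  by (intro balancedI additive_mapI)
    (simp_all add: N.ract_closed N.lact_closed N.ract_add_left pure_add_left pure_add_right
      N.act_commute pure_ract)

lemma smult_pure: "c \<in> carrier R \<Longrightarrow> x \<in> carrier M \<Longrightarrow> y \<in> carrier N \<Longrightarrow>
    c \<odot>\<^bsub>T\<^esub> p x y = p (c \<odot>\<^bsub>M\<^esub> x) y"
  and lact_pure: "a \<in> carrier A \<Longrightarrow> x \<in> carrier M \<Longrightarrow> y \<in> carrier N \<Longrightarrow>
    lact T a (p x y) = p (lact M a x) y"
  and ract_pure: "d \<in> carrier C \<Longrightarrow> x \<in> carrier M \<Longrightarrow> y \<in> carrier N \<Longrightarrow>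
    ract T (p x y) d = p x (ract N y d)"
  by (simp_all add: smult_T lact_T ract_T tensor_lift_pure abelian_group_T balanced_smult
      balanced_lact balanced_ract)

lemma smult_closed_T: "c \<in> carrier R \<Longrightarrow> X \<in> carrier T \<Longrightarrow> c \<odot>\<^bsub>T\<^esub> X \<in> carrier T"
  and lact_closed_T: "a \<in> carrier A \<Longrightarrow> X \<in> carrier T \<Longrightarrow> lact T a X \<in> carrier T"
  and ract_closed_T: "d \<in> carrier C \<Longrightarrow> X \<in> carrier T \<Longrightarrow> ract T X d \<in> carrier T"
  by (simp_all add: smult_T lact_T ract_T tensor_lift_closed abelian_group_T balanced_smult
      balanced_lact balanced_ract)

lemma smult_add_T: "c \<in> carrier R \<Longrightarrow> X \<in> carrier T \<Longrightarrow> Y \<in> carrier T \<Longrightarrow>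
    c \<odot>\<^bsub>T\<^esub> (X \<oplus>\<^bsub>T\<^esub> Y) = c \<odot>\<^bsub>T\<^esub> X \<oplus>\<^bsub>T\<^esub> c \<odot>\<^bsub>T\<^esub> Y"
  and lact_add_T: "a \<in> carrier A \<Longrightarrow> X \<in> carrier T \<Longrightarrow> Y \<in> carrier T \<Longrightarrow>
    lact T a (X \<oplus>\<^bsub>T\<^esub> Y) = lact T a X \<oplus>\<^bsub>T\<^esub> lact T a Y"
  and ract_add_T: "d \<in> carrier C \<Longrightarrow> X \<in> carrier T \<Longrightarrow> Y \<in> carrier T \<Longrightarrow>
    ract T (X \<oplus>\<^bsub>T\<^esub> Y) d = ract T X d \<oplus>\<^bsub>T\<^esub> ract T Y d"
  by (simp_all add: smult_T lact_T ract_T tensor_lift_add abelian_group_T balanced_smult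
      balanced_lact balanced_ract)

lemmas T_closed = smult_closed_T lact_closed_T ract_closed_T
lemmas T_add = smult_add_T lact_add_T ract_add_T
lemmas T_pure = smult_pure lact_pure ract_pure

lemma module_T: "module R T"
proof (rule moduleI)
  fix c d X assume "c \<in> carrier R" "d \<in> carrier R" and X: "X \<in> carrier T"
  from X this(1,2) show "(c \<oplus>\<^bsub>R\<^esub> d) \<odot>\<^bsub>T\<^esub> X = c \<odot>\<^bsub>T\<^esub> X \<oplus>\<^bsub>T\<^esub> d \<odot>\<^bsub>T\<^esub> X"
    by (induction rule: tensor_induct)
      (simp_all add: T_pure T_add T_closed MM.smult_l_distr pure_add_left T.a_ac)
next
  fix c d X assume "c \<in> carrier R" "d \<in> carrier R" and X: "X \<in> carrier T"
  from X this(1,2) show "(c \<otimes>\<^bsub>R\<^esub> d) \<odot>\<^bsub>T\<^esub> X = c \<odot>\<^bsub>T\<^esub> (d \<odot>\<^bsub>T\<^esub> X)"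
    by (induction rule: tensor_induct)
      (simp_all add: T_pure T_add T_closed MM.smult_assoc1)
next
  fix X assume "X \<in> carrier T"
  then show "\<one>\<^bsub>R\<^esub> \<odot>\<^bsub>T\<^esub> X = X"
    by (induction rule: tensor_induct) (simp_all add: T_pure T_add T_closed)
qed (simp_all add: R.is_cring abelian_group_T T_closed T_add)

lemma bimodule_T: "bimodule R A C T"
proof (rule bimodule.intro)
  fix a a' X assume "a \<in> carrier A" "a' \<in> carrier A" and X: "X \<in> carrier T"
  from X this(1,2) show "lact T (a \<oplus>\<^bsub>A\<^esub> a') X = lact T a X \<oplus>\<^bsub>T\<^esub> lact T a' X"
    by (induction rule: tensor_induct)
      (simp_all add: T_pure T_add T_closed M.lact_add_left M.lact_closed pure_add_left T.a_ac)
next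
  fix a a' X assume "a \<in> carrier A" "a' \<in> carrier A" and X: "X \<in> carrier T"
  from X this(1,2) show "lact T (a \<otimes>\<^bsub>A\<^esub> a') X = lact T a (lact T a' X)"
    by (induction rule: tensor_induct)
      (simp_all add: T_pure T_add T_closed M.lact_mult M.lact_closed)
next
  fix c X assume "c \<in> carrier R" and X: "X \<in> carrier T"
  from X this(1) show "lact T (c \<odot>\<^bsub>A\<^esub> \<one>\<^bsub>A\<^esub>) X = c \<odot>\<^bsub>T\<^esub> X"
    by (induction rule: tensor_induct)
      (simp_all add: T_pure T_add T_closed M.lact_smult_one)
next
  fix d d' X assume "d \<in> carrier C" "d' \<in> carrier C" and X: "X \<in> carrier T"
  from X this(1,2) show "ract T X (d \<oplus>\<^bsub>C\<^esub> d') = ract T X d \<oplus>\<^bsub>T\<^esub> ract T X d'"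
    by (induction rule: tensor_induct)
      (simp_all add: T_pure T_add T_closed N.ract_add_right N.ract_closed pure_add_right T.a_ac)
next
  fix d d' X assume "d \<in> carrier C" "d' \<in> carrier C" and X: "X \<in> carrier T"
  from X this(1,2) show "ract T X (d \<otimes>\<^bsub>C\<^esub> d') = ract T (ract T X d) d'"
    by (induction rule: tensor_induct)
      (simp_all add: T_pure T_add T_closed N.ract_mult N.ract_closed)
next
  fix c X assume "c \<in> carrier R" and X: "X \<in> carrier T"
  from X this(1) show "ract T X (c \<odot>\<^bsub>C\<^esub> \<one>\<^bsub>C\<^esub>) = c \<odot>\<^bsub>T\<^esub> X"
    by (induction rule: tensor_induct)
      (simp_all add: T_pure T_add T_closed N.ract_smult_one pure_smult)
next
  fix a d X assume "a \<in> carrier A" "d \<in> carrier C" and X: "X \<in> carrier T"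
  from X this(1,2) show "ract T (lact T a X) d = lact T a (ract T X d)"
    by (induction rule: tensor_induct)
      (simp_all add: T_pure T_add T_closed N.ract_closed M.lact_closed)
qed (simp_all add: AA.assoc_algebra_axioms CC.assoc_algebra_axioms module_T T_closed T_add)

lemma tensor_lift_lin:
  assumes G: "module R G" and f: "balanced M B N G f"
    and sm: "\<And>c x y. c \<in> carrier R \<Longrightarrow> x \<in> carrier M \<Longrightarrow> y \<in> carrier N \<Longrightarrow>
      f (c \<odot>\<^bsub>M\<^esub> x) y = c \<odot>\<^bsub>G\<^esub> f x y"
  shows "lin_map R T G (tensor_lift M B N G f)"
proof -
  interpret G: module R G by fact
  note l = tensor_lift_pure[OF G.abelian_group_axioms f] tensor_lift_closed[OF G.abelian_group_axioms f]
    tensor_lift_add[OF G.abelian_group_axioms f]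
  show ?thesis
  proof (rule lin_mapI)
    fix c X assume c: "c \<in> carrier R" and "X \<in> carrier T"
    from this(2) show "tensor_lift M B N G f (c \<odot>\<^bsub>T\<^esub> X) = c \<odot>\<^bsub>G\<^esub> tensor_lift M B N G f X"
      using c by (induction rule: tensor_induct) (simp_all add: T_pure T_add T_closed l sm G.smult_r_distr)
  qed (simp_all add: l)
qed

end

section \<open>Triple tensor products\<close>

locale tensor_triple = MN: tensor_pair R A B C M N + NP: tensor_pair R B C D N P
  for R :: "'k ring" and A :: "('k, 'a) module" and B :: "('k, 'b) module"
    and C :: "('k, 'c) module" and D :: "('k, 'd) module" and M :: "('k, 'a, 'b, 'm) bimod"
    and N :: "('k, 'b, 'c, 'n) bimod" and P :: "('k, 'c, 'd, 'p) bimod"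
begin

sublocale LP: tensor_pair R A C D "tensor M B N" P
  by (intro tensor_pair.intro MN.bimodule_T NP.N.bimodule_axioms)

sublocale RP: tensor_pair R A B D M "tensor N C P"
  by (intro tensor_pair.intro NP.bimodule_T MN.M.bimodule_axioms)

text \<open>Lets lifts be iterated: a map balanced at both tensor signs is lifted in its last two
  variables, and the result is still balanced against the first one.\<close>

lemma balanced_lift_right:
  assumes G: "abelian_group G"
    and f1: "\<And>x. x \<in> carrier M \<Longrightarrow> balanced N C P G (f x)"
    and f2: "\<And>y z. y \<in> carrier N \<Longrightarrow> z \<in> carrier P \<Longrightarrow> additive_map M G (\<lambda>x. f x y z)"
    and f3: "\<And>x b y z. x \<in> carrier M \<Longrightarrow> b \<in> carrier B \<Longrightarrow> y \<in> carrier N \<Longrightarrow> z \<in> carrier P \<Longrightarrow>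
      f (ract M x b) y z = f x (lact N b y) z"
  shows "balanced M B (tensor N C P) G (\<lambda>x. tensor_lift N C P G (f x))"
proof (rule balancedI)
  interpret G: abelian_group G by fact
  note l = NP.tensor_lift_pure[OF G f1] NP.tensor_lift_add[OF G f1] NP.tensor_lift_closed[OF G f1]
  show "additive_map M G (\<lambda>x. tensor_lift N C P G (f x) Y)" if Y: "Y \<in> carrier (tensor N C P)" for Y
  proof (rule additive_mapI)
    show "tensor_lift N C P G (f x) Y \<in> carrier G" if "x \<in> carrier M" for x
      using that Y by (rule l)
    show "tensor_lift N C P G (f (x \<oplus>\<^bsub>M\<^esub> x')) Y =
      tensor_lift N C P G (f x) Y \<oplus>\<^bsub>G\<^esub> tensor_lift N C P G (f x') Y"
      if "x \<in> carrier M" "x' \<in> carrier M" for x x'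
      using Y that
      by (induction rule: NP.tensor_induct) (simp_all add: l additive_map_add[OF f2] G.a_ac)
  qed
  show "additive_map (tensor N C P) G (tensor_lift N C P G (f x))" if "x \<in> carrier M" for x
    using NP.tensor_lift_additive[OF G f1[OF that]] .
  show "tensor_lift N C P G (f (ract M x b)) Y = tensor_lift N C P G (f x) (lact (tensor N C P) b Y)"
    if x: "x \<in> carrier M" and b: "b \<in> carrier B" and Y: "Y \<in> carrier (tensor N C P)" for x b Y
    using Y x b
    by (induction rule: NP.tensor_induct)
      (simp_all add: l f3 MN.M.ract_closed MN.N.lact_closed NP.lact_pure NP.lact_add_T
        NP.lact_closed_T)
qed

lemma balanced_lift_left:
  assumes G: "abelian_group G"
    and f1: "\<And>z. z \<in> carrier P \<Longrightarrow> balanced M B N G (\<lambda>x y. f x y z)"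
    and f2: "\<And>x y. x \<in> carrier M \<Longrightarrow> y \<in> carrier N \<Longrightarrow> additive_map P G (f x y)"
    and f3: "\<And>x y c z. x \<in> carrier M \<Longrightarrow> y \<in> carrier N \<Longrightarrow> c \<in> carrier C \<Longrightarrow> z \<in> carrier P \<Longrightarrow>
      f x (ract N y c) z = f x y (lact P c z)"
  shows "balanced (tensor M B N) C P G (\<lambda>u z. tensor_lift M B N G (\<lambda>x y. f x y z) u)"
proof (rule balancedI)
  interpret G: abelian_group G by fact
  note l = MN.tensor_lift_pure[OF G f1] MN.tensor_lift_add[OF G f1] MN.tensor_lift_closed[OF G f1]
  show "additive_map (tensor M B N) G (\<lambda>u. tensor_lift M B N G (\<lambda>x y. f x y z) u)"
    if "z \<in> carrier P" for z
    using MN.tensor_lift_additive[OF G f1[OF that]] .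
  show "additive_map P G (\<lambda>z. tensor_lift M B N G (\<lambda>x y. f x y z) u)"
    if u: "u \<in> carrier (tensor M B N)" for u
  proof (rule additive_mapI)
    show "tensor_lift M B N G (\<lambda>x y. f x y z) u \<in> carrier G" if "z \<in> carrier P" for z
      using that u by (rule l)
    show "tensor_lift M B N G (\<lambda>x y. f x y (z \<oplus>\<^bsub>P\<^esub> z')) u =
      tensor_lift M B N G (\<lambda>x y. f x y z) u \<oplus>\<^bsub>G\<^esub> tensor_lift M B N G (\<lambda>x y. f x y z') u"
      if "z \<in> carrier P" "z' \<in> carrier P" for z z'
      using u that
      by (induction rule: MN.tensor_induct) (simp_all add: l additive_map_add[OF f2] G.a_ac)
  qed
  show "tensor_lift M B N G (\<lambda>x y. f x y z) (ract (tensor M B N) u c) =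
      tensor_lift M B N G (\<lambda>x y. f x y (lact P c z)) u"
    if u: "u \<in> carrier (tensor M B N)" and "c \<in> carrier C" "z \<in> carrier P" for u c z
    using u that(2,3)
    by (induction rule: MN.tensor_induct)
      (simp_all add: l f3 MN.N.ract_closed NP.N.lact_closed MN.ract_pure MN.ract_add_T
        MN.ract_closed_T)
qed

text \<open>Justifies both nested lifts in \<open>tensor_assoc\<close>, so that it takes the
  expected value in \<open>tensor_assoc_pure\<close>.\<close>

lemma balanced_assoc:
  shows balanced_assoc_inner: "z \<in> carrier P \<Longrightarrow>
      balanced M B N (tensor M B (tensor N C P)) (\<lambda>x y. pure M B (tensor N C P) x (pure N C P y z))"
    and balanced_assoc_outer: "balanced (tensor M B N) C P (tensor M B (tensor N C P))
      (\<lambda>u z. tensor_lift M B N (tensor M B (tensor N C P))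
        (\<lambda>x y. pure M B (tensor N C P) x (pure N C P y z)) u)"
proof -
  show inner: "balanced M B N (tensor M B (tensor N C P))
      (\<lambda>x y. pure M B (tensor N C P) x (pure N C P y z))" if "z \<in> carrier P" for z
    using that by (intro balancedI additive_mapI)
      (simp_all add: RP.pure_add_left RP.pure_add_right NP.pure_add_left RP.pure_ract
        NP.lact_pure MN.N.lact_closed)
  show "balanced (tensor M B N) C P (tensor M B (tensor N C P))
      (\<lambda>u z. tensor_lift M B N (tensor M B (tensor N C P))
        (\<lambda>x y. pure M B (tensor N C P) x (pure N C P y z)) u)"
    by (rule balanced_lift_left[OF RP.abelian_group_T inner])
      (auto intro!: additive_mapI simp: RP.pure_add_right NP.pure_add_right NP.pure_ract)
qed

lemma tensor_assoc_additive:
  "additive_map (tensor (tensor M B N) C P) (tensor M B (tensor N C P)) (tensor_assoc M B N C P)"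
  unfolding tensor_assoc_def Let_def
  by (rule LP.tensor_lift_additive[OF RP.abelian_group_T balanced_assoc_outer])

lemma tensor_assoc_pure:
  assumes "u \<in> carrier (tensor M B N)" "z \<in> carrier P"
  shows "tensor_assoc M B N C P (pure (tensor M B N) C P u z) =
    tensor_lift M B N (tensor M B (tensor N C P))
      (\<lambda>x y. pure M B (tensor N C P) x (pure N C P y z)) u"
  unfolding tensor_assoc_def Let_def
  by (rule LP.tensor_lift_pure[OF RP.abelian_group_T balanced_assoc_outer assms])

end

section \<open>Sweedler calculus in a Hopf algebra\<close>

text \<open>The rules in \<open>lin_intros\<close> decompose an expression along the unique occurrence of the
  argument, so that resolution with them decides linearity in each variable of a multilinear expression.\<close>

named_theorems lin_intros

lemma lin_map_id [lin_intros]: "lin_map R M M (\<lambda>x. x)"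
  by (simp add: lin_map_def)

lemma lin_map_mult_left [lin_intros]:
  assumes "assoc_algebra R B" "c \<in> carrier B" "lin_map R M B g"
  shows "lin_map R M B (\<lambda>x. c \<otimes>\<^bsub>B\<^esub> g x)"
proof -
  interpret assoc_algebra R B by fact
  show ?thesis
    using assms(2) by (intro lin_mapI)
      (simp_all add: lin_map_closed[OF assms(3)] lin_map_add[OF assms(3)] lin_map_smult[OF assms(3)]
        M.r_distr smult_mult_right)
qed

lemma lin_map_mult_right [lin_intros]:
  assumes "assoc_algebra R B" "c \<in> carrier B" "lin_map R M B g"
  shows "lin_map R M B (\<lambda>x. g x \<otimes>\<^bsub>B\<^esub> c)"
proof -
  interpret assoc_algebra R B by fact
  show ?thesis
    using assms(2) by (intro lin_mapI)
      (simp_all add: lin_map_closed[OF assms(3)] lin_map_add[OF assms(3)] lin_map_smult[OF assms(3)]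
        M.l_distr smult_mult_left)
qed

lemma lin_map_smult_left [lin_intros]:
  assumes "module R G" "c \<in> carrier R" "lin_map R M G g"
  shows "lin_map R M G (\<lambda>x. c \<odot>\<^bsub>G\<^esub> g x)"
proof -
  interpret module R G by fact
  show ?thesis
    using assms(2) by (intro lin_mapI)
      (simp_all add: lin_map_closed[OF assms(3)] lin_map_add[OF assms(3)] lin_map_smult[OF assms(3)]
        smult_r_distr smult_assoc1[symmetric] m_comm)
qed

definition bilin :: "'k ring \<Rightarrow> ('k, 'm, 'x) module_scheme \<Rightarrow> ('k, 'n, 'y) module_scheme
    \<Rightarrow> ('k, 'g, 'z) module_scheme \<Rightarrow> ('m \<Rightarrow> 'n \<Rightarrow> 'g) \<Rightarrow> bool" where
  "bilin R M N G f \<longleftrightarrow> (\<forall>y\<in>carrier N. lin_map R M G (\<lambda>x. f x y)) \<and> (\<forall>x\<in>carrier M. lin_map R N G (f x))"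

lemma bilinI:
  "(\<And>y. y \<in> carrier N \<Longrightarrow> lin_map R M G (\<lambda>x. f x y)) \<Longrightarrow>
   (\<And>x. x \<in> carrier M \<Longrightarrow> lin_map R N G (f x)) \<Longrightarrow> bilin R M N G f"
  by (simp add: bilin_def)

lemma bilin_left: "bilin R M N G f \<Longrightarrow> y \<in> carrier N \<Longrightarrow> lin_map R K M g \<Longrightarrow>
    lin_map R K G (\<lambda>x. f (g x) y)"
  and bilin_right: "bilin R M N G f \<Longrightarrow> x \<in> carrier M \<Longrightarrow> lin_map R K N g \<Longrightarrow>
    lin_map R K G (\<lambda>y. f x (g y))"
  by (auto simp: bilin_def intro: lin_map_comp)

lemma bilin_closed: "bilin R M N G f \<Longrightarrow> x \<in> carrier M \<Longrightarrow> y \<in> carrier N \<Longrightarrow> f x y \<in> carrier G"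
  by (auto simp: bilin_def lin_map_def)

lemma assoc_algebra_module: "assoc_algebra R B \<Longrightarrow> module R B"
  by (rule assoc_algebra.axioms(1))

locale bij_hopf_algebra = hopf_algebra R H for R :: "'k ring" and H :: "('k, 'h) hopf" +
  assumes bij_antipode: "bij_betw (antipode H) (carrier H) (carrier H)"
begin

sublocale HA: assoc_algebra R H by (rule alg)

abbreviation mult_H (infixl "\<cdot>" 70) where "x \<cdot> y \<equiv> x \<otimes>\<^bsub>H\<^esub> y"
abbreviation one_H ("\<one>\<^sub>H") where "one_H \<equiv> \<one>\<^bsub>H\<^esub>"
abbreviation "S \<equiv> antipode H"
abbreviation "S\<^sub>i \<equiv> antipode_inv H"
abbreviation "\<epsilon> \<equiv> counit H"
abbreviation "SW G f h \<equiv> sweedler_sum R H G f h"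
abbreviation "lin G f \<equiv> lin_map R H G f"

abbreviation "K \<equiv> base_algebra R"
abbreviation "B \<equiv> base_bimod H"

lemma base_bimod_simps [simp]:
  "carrier B = carrier H" "ring.add B = ring.add H" "ring.zero B = ring.zero H"
  "one B = one H" "monoid.mult B = monoid.mult H" "smult B = smult H"
  "lact B = smult H" "ract B = (\<lambda>x c. c \<odot>\<^bsub>H\<^esub> x)"
  by (simp_all add: base_bimod_def as_bimod_def)

lemma base_algebra_simps [simp]:
  "carrier K = carrier R" "ring.add K = ring.add R" "ring.zero K = ring.zero R"
  "one K = one R" "monoid.mult K = monoid.mult R" "smult K = monoid.mult R"
  by (simp_all add: base_algebra_def)

lemma bimodule_B: "bimodule R K K B"
  using coring.bimod[OF is_coalgebra] .

sublocale HT: tensor_triple R K K K K B B B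
  by (intro tensor_triple.intro tensor_pair.intro bimodule_B)

lemma modH [simp]: "module R H" by (rule HA.module_axioms)
lemma algH [simp]: "assoc_algebra R H" by (rule alg)
lemma abH [simp]: "abelian_group H" by (rule HA.abelian_group_axioms)

lemma bilin_balanced: "bilin R H H G f \<Longrightarrow> balanced B K B G f"
  by (auto simp: bilin_def balanced_def lin_map_def additive_map_def)

text \<open>A Sweedler sum is a lift evaluated at the coproduct. Rules that change the list of pairs
  (coassociativity, coproducts of products or of antipodes) therefore ask for multilinear summands;
  rules that keep the list, such as \<open>SW_swap\<close>, ask only that the summands lie in the
  carrier.\<close>

lemma SW_lift: "SW G f h = tensor_lift B K B G f (comult H h)"
  by (simp add: sweedler_sum_def sweedler_def tensor_lift_def)

lemma comult_lin: "lin_map R H (tensor B K B) (comult H)"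
  using comult_alg_hom by (simp add: alg_hom_def tensor_self_def)

lemma comult_closed [simp]: "h \<in> carrier H \<Longrightarrow> comult H h \<in> carrier (tensor B K B)"
  by (rule lin_map_closed[OF comult_lin])

lemma sweedler_carrier:
  "h \<in> carrier H \<Longrightarrow> set (sweedler R H h) \<subseteq> carrier H \<times> carrier H"
  unfolding sweedler_def using HT.MN.tensor_rep(1)[OF comult_closed] by simp

text \<open>Makes it known that the components lie in the carrier while the simplifier rewrites
  under the sum.\<close>

lemma SW_cong [cong]:
  "h = h' \<Longrightarrow> h' \<in> carrier H \<Longrightarrow>
    (\<And>x y. x \<in> carrier H \<Longrightarrow> y \<in> carrier H \<Longrightarrow> f x y = g x y) \<Longrightarrow> SW G f h = SW G g h'"
  unfolding sweedler_sum_def using sweedler_carrier[of h']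
  by (auto intro!: arg_cong[where f = "sum_of G"] map_cong)

lemma counit_lin: "lin_map R H K \<epsilon>"
  using counit_alg_hom by (simp add: alg_hom_def)

lemma counit_closed [simp]: "h \<in> carrier H \<Longrightarrow> \<epsilon> h \<in> carrier R"
  using lin_map_closed[OF counit_lin] by simp

lemma counit_mult [simp]: "h \<in> carrier H \<Longrightarrow> k \<in> carrier H \<Longrightarrow> \<epsilon> (h \<cdot> k) = \<epsilon> h \<otimes>\<^bsub>R\<^esub> \<epsilon> k"
  and counit_one [simp]: "\<epsilon> \<one>\<^sub>H = \<one>\<^bsub>R\<^esub>"
  using counit_alg_hom ring_hom_mult[of \<epsilon> H K] ring_hom_one[of \<epsilon> H K] by (simp_all add: alg_hom_def)

lemma antipode_closed [simp]: "h \<in> carrier H \<Longrightarrow> S h \<in> carrier H"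
  by (rule lin_map_closed[OF antipode_lin])

lemmas lin_map_antipode [lin_intros] = lin_map_comp[OF antipode_lin]

lemma SW_closed [simp]:
  assumes "abelian_group G" "h \<in> carrier H"
    "\<And>x y. x \<in> carrier H \<Longrightarrow> y \<in> carrier H \<Longrightarrow> f x y \<in> carrier G"
  shows "SW G f h \<in> carrier G"
  unfolding sweedler_sum_def using sweedler_carrier[OF assms(2)] assms(3)
  by (intro abelian_group.sum_of_closed[OF assms(1)]) auto

lemma SW_additive_map:
  assumes "additive_map G G' \<phi>" "abelian_group G" "abelian_group G'" "h \<in> carrier H"
    "\<And>x y. x \<in> carrier H \<Longrightarrow> y \<in> carrier H \<Longrightarrow> f x y \<in> carrier G"
  shows "\<phi> (SW G f h) = SW G' (\<lambda>x y. \<phi> (f x y)) h"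
proof -
  have "\<phi> (SW G f h) = sum_of G' (map \<phi> (map (\<lambda>(x, y). f x y) (sweedler R H h)))"
    unfolding sweedler_sum_def using sweedler_carrier[OF assms(4)] assms(5)
    by (intro additive_map_sum_of[OF assms(1-3)]) auto
  also have "map \<phi> (map (\<lambda>(x, y). f x y) (sweedler R H h)) =
      map (\<lambda>(x, y). \<phi> (f x y)) (sweedler R H h)"
    by auto
  finally show ?thesis by (simp add: sweedler_sum_def)
qed

lemma SW_lin_map:
  assumes "lin_map R G G' \<phi>" "module R G" "module R G'" "h \<in> carrier H"
    "\<And>x y. x \<in> carrier H \<Longrightarrow> y \<in> carrier H \<Longrightarrow> f x y \<in> carrier G"
  shows "\<phi> (SW G f h) = SW G' (\<lambda>x y. \<phi> (f x y)) h"
  using assms by (intro SW_additive_map lin_map_additive) (auto intro: module.axioms(2))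

lemma SW_swap:
  assumes "abelian_group G" "h \<in> carrier H" "k \<in> carrier H"
    "\<And>x y u v. x \<in> carrier H \<Longrightarrow> y \<in> carrier H \<Longrightarrow> u \<in> carrier H \<Longrightarrow> v \<in> carrier H \<Longrightarrow>
      f x y u v \<in> carrier G"
  shows "SW G (\<lambda>x y. SW G (\<lambda>u v. f x y u v) k) h = SW G (\<lambda>u v. SW G (\<lambda>x y. f x y u v) h) k"
  unfolding sweedler_sum_def case_prod_beta
  using sweedler_carrier[OF assms(2)] sweedler_carrier[OF assms(3)]
  by (intro abelian_group.sum_of_swap[OF assms(1)] assms(4)) auto

lemma SW_mult_left:
  assumes "assoc_algebra R G" "h \<in> carrier H" "c \<in> carrier G"
    "\<And>x y. x \<in> carrier H \<Longrightarrow> y \<in> carrier H \<Longrightarrow> f x y \<in> carrier G"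
  shows "c \<otimes>\<^bsub>G\<^esub> SW G f h = SW G (\<lambda>x y. c \<otimes>\<^bsub>G\<^esub> f x y) h"
  using assms by (intro SW_lin_map[of G G "\<lambda>z. c \<otimes>\<^bsub>G\<^esub> z"] lin_intros) (auto intro: assoc_algebra_module)

lemma SW_mult_right:
  assumes "assoc_algebra R G" "h \<in> carrier H" "c \<in> carrier G"
    "\<And>x y. x \<in> carrier H \<Longrightarrow> y \<in> carrier H \<Longrightarrow> f x y \<in> carrier G"
  shows "SW G f h \<otimes>\<^bsub>G\<^esub> c = SW G (\<lambda>x y. f x y \<otimes>\<^bsub>G\<^esub> c) h"
  using assms by (intro SW_lin_map[of G G "\<lambda>z. z \<otimes>\<^bsub>G\<^esub> c"] lin_intros) (auto intro: assoc_algebra_module)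

lemma SW_smult:
  assumes "module R G" "h \<in> carrier H" "c \<in> carrier R"
    "\<And>x y. x \<in> carrier H \<Longrightarrow> y \<in> carrier H \<Longrightarrow> f x y \<in> carrier G"
  shows "c \<odot>\<^bsub>G\<^esub> SW G f h = SW G (\<lambda>x y. c \<odot>\<^bsub>G\<^esub> f x y) h"
  using assms by (intro SW_lin_map[of G G "\<lambda>z. c \<odot>\<^bsub>G\<^esub> z"] lin_intros) auto

lemma SW_add:
  assumes "abelian_group G" "h \<in> carrier H"
    "\<And>x y. x \<in> carrier H \<Longrightarrow> y \<in> carrier H \<Longrightarrow> f x y \<in> carrier G"
    "\<And>x y. x \<in> carrier H \<Longrightarrow> y \<in> carrier H \<Longrightarrow> g x y \<in> carrier G"
  shows "SW G (\<lambda>x y. f x y \<oplus>\<^bsub>G\<^esub> g x y) h = SW G f h \<oplus>\<^bsub>G\<^esub> SW G g h"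
  unfolding sweedler_sum_def case_prod_beta
  using sweedler_carrier[OF assms(2)]
  by (intro abelian_group.sum_of_add[OF assms(1)] assms(3,4)) auto

text \<open>A variable can enter a Sweedler sum in two places: in the comultiplied element, treated
  here, or in the summand, treated by \<open>lin_map_SW_body\<close>.\<close>

lemma lin_map_SW_arg [lin_intros]:
  assumes G: "module R G"
    and f: "\<And>y. y \<in> carrier H \<Longrightarrow> lin G (\<lambda>x. f x y)" "\<And>x. x \<in> carrier H \<Longrightarrow> lin G (\<lambda>y. f x y)"
    and g: "lin_map R M H g"
  shows "lin_map R M G (\<lambda>x. SW G f (g x))"
proof -
  interpret G: module R G by fact
  have b: "bilin R H H G f" using f by (simp add: bilin_def)
  have "lin_map R (tensor B K B) G (tensor_lift B K B G f)"
    by (rule HT.MN.tensor_lift_lin[OF G bilin_balanced[OF b]])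
      (use f in \<open>simp_all add: lin_map_def\<close>)
  then show ?thesis
    unfolding SW_lift by (rule lin_map_comp[OF lin_map_comp[OF _ comult_lin] g])
qed

lemma lin_map_SW_body [lin_intros]:
  assumes G: "module R G" and h: "h \<in> carrier H"
    and f: "\<And>u v. u \<in> carrier H \<Longrightarrow> v \<in> carrier H \<Longrightarrow> lin_map R M G (\<lambda>x. f x u v)"
  shows "lin_map R M G (\<lambda>x. SW G (\<lambda>u v. f x u v) h)"
proof -
  interpret G: module R G by fact
  show ?thesis
    using f h by (intro lin_mapI)
      (simp_all add: SW_add[symmetric] SW_smult[OF G] lin_map_closed[OF f] lin_map_add[OF f]
        lin_map_smult[OF f] G.abelian_group_axioms)
qed

text \<open>The trilinear map lifts to the triple tensor product; applying the lift
  \<open>?g\<close> to both sides of coassociativity gives the two nested sums.\<close>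

lemma SW_coassoc:
  assumes G: "module R G" and h: "h \<in> carrier H"
    and f: "\<And>y z. y \<in> carrier H \<Longrightarrow> z \<in> carrier H \<Longrightarrow> lin G (\<lambda>x. f x y z)"
      "\<And>x z. x \<in> carrier H \<Longrightarrow> z \<in> carrier H \<Longrightarrow> lin G (\<lambda>y. f x y z)"
      "\<And>x y. x \<in> carrier H \<Longrightarrow> y \<in> carrier H \<Longrightarrow> lin G (\<lambda>z. f x y z)"
  shows "SW G (\<lambda>w z. SW G (\<lambda>x y. f x y z) w) h = SW G (\<lambda>x w. SW G (\<lambda>y z. f x y z) w) h"
proof -
  interpret G: module R G by fact
  note aG = G.abelian_group_axioms
  let ?BB = "tensor B K B" and ?p = "pure B K B"
  let ?TR = "tensor B K ?BB" and ?TL = "tensor ?BB K B"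
  let ?g = "tensor_lift B K ?BB G (\<lambda>x. tensor_lift B K B G (f x))"
  have bal: "balanced B K B G (f x)" if "x \<in> carrier H" for x
    using f that by (intro bilin_balanced) (simp add: bilin_def)
  have balR: "balanced B K ?BB G (\<lambda>x. tensor_lift B K B G (f x))"
    using f by (intro HT.balanced_lift_right[OF aG])
      (auto simp: bal lin_map_additive lin_map_def additive_map_def)
  note ga = HT.RP.tensor_lift_additive[OF aG balR]
  note abTR = HT.RP.abelian_group_T
  have "?g (tensor_map B K B B ?BB (\<lambda>y. y) (comult H) (comult H h)) =
      SW G (\<lambda>x w. SW G (\<lambda>y z. f x y z) w) h"
  proof -
    have "tensor_map B K B B ?BB (\<lambda>y. y) (comult H) (comult H h) =
      SW ?TR (\<lambda>x y. pure B K ?BB x (comult H y)) h"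
      by (simp add: tensor_map_def SW_lift)
    then show ?thesis
      using h by (simp add: SW_additive_map[OF ga abTR aG] HT.RP.pure_closed
          HT.RP.tensor_lift_pure[OF aG balR] flip: SW_lift)
  qed
  moreover have "?g (tensor_assoc B K B K B (tensor_map B K B ?BB B (comult H) (\<lambda>y. y) (comult H h))) =
      SW G (\<lambda>w z. SW G (\<lambda>x y. f x y z) w) h"
  proof -
    have "tensor_map B K B ?BB B (comult H) (\<lambda>y. y) (comult H h) =
      SW ?TL (\<lambda>x y. pure ?BB K B (comult H x) y) h"
      by (simp add: tensor_map_def SW_lift)
    then have "tensor_assoc B K B K B (tensor_map B K B ?BB B (comult H) (\<lambda>y. y) (comult H h)) =
      SW ?TR (\<lambda>w z. tensor_lift B K B ?TR (\<lambda>x y. pure B K ?BB x (?p y z)) (comult H w)) h"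
      using h by (simp add: SW_additive_map[OF HT.tensor_assoc_additive HT.LP.abelian_group_T abTR]
          HT.LP.pure_closed HT.tensor_assoc_pure)
    then show ?thesis
      using h by (simp add: SW_additive_map[OF ga abTR aG] HT.RP.pure_closed HT.MN.pure_closed abTR
          HT.RP.tensor_lift_pure[OF aG balR] HT.MN.tensor_lift_pure[OF aG bal] flip: SW_lift)
  qed
  ultimately show ?thesis
    using coring.coassoc[OF is_coalgebra, of h] h by simp
qed

lemma SW_counit_left:
  assumes "module R G" "lin G g" "h \<in> carrier H"
  shows "SW G (\<lambda>x y. \<epsilon> x \<odot>\<^bsub>G\<^esub> g y) h = g h"
proof -
  have "tensor_lift B K B B (\<lambda>y z. lact B (\<epsilon> y) z) (comult H h) = h"
    using coring.counit_left[OF is_coalgebra, of h] assms(3) by simp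
  then have "SW H (\<lambda>y z. \<epsilon> y \<odot>\<^bsub>H\<^esub> z) h = h"
    by (simp add: SW_lift tensor_lift_def sum_of_def)
  then have "g h = g (SW H (\<lambda>y z. \<epsilon> y \<odot>\<^bsub>H\<^esub> z) h)" by simp
  also have "\<dots> = SW G (\<lambda>x y. g (\<epsilon> x \<odot>\<^bsub>H\<^esub> y)) h"
    using assms by (intro SW_lin_map) auto
  also have "\<dots> = SW G (\<lambda>x y. \<epsilon> x \<odot>\<^bsub>G\<^esub> g y) h"
    using assms(3) by (intro SW_cong) (simp_all add: lin_map_smult[OF assms(2)])
  finally show ?thesis by simp
qed

lemma SW_counit_right:
  assumes "module R G" "lin G g" "h \<in> carrier H"
  shows "SW G (\<lambda>x y. \<epsilon> y \<odot>\<^bsub>G\<^esub> g x) h = g h"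
proof -
  have "tensor_lift B K B B (\<lambda>y z. ract B y (\<epsilon> z)) (comult H h) = h"
    using coring.counit_right[OF is_coalgebra, of h] assms(3) by simp
  then have "SW H (\<lambda>y z. \<epsilon> z \<odot>\<^bsub>H\<^esub> y) h = h"
    by (simp add: SW_lift tensor_lift_def sum_of_def)
  then have "g h = g (SW H (\<lambda>y z. \<epsilon> z \<odot>\<^bsub>H\<^esub> y) h)" by simp
  also have "\<dots> = SW G (\<lambda>x y. g (\<epsilon> y \<odot>\<^bsub>H\<^esub> x)) h"
    using assms by (intro SW_lin_map) auto
  also have "\<dots> = SW G (\<lambda>x y. \<epsilon> y \<odot>\<^bsub>G\<^esub> g x) h"
    using assms(3) by (intro SW_cong) (simp_all add: lin_map_smult[OF assms(2)])
  finally show ?thesis by simp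
qed

text \<open>Multiplicativity of the coproduct, read through the lift of \<open>f\<close>; the
  product in the tensor square is itself a double Sweedler sum of pure tensors.\<close>

lemma SW_mult:
  assumes G: "module R G" and h: "h \<in> carrier H" and k: "k \<in> carrier H"
    and f: "\<And>y. y \<in> carrier H \<Longrightarrow> lin G (\<lambda>x. f x y)" "\<And>x. x \<in> carrier H \<Longrightarrow> lin G (\<lambda>y. f x y)"
  shows "SW G f (h \<cdot> k) = SW G (\<lambda>x y. SW G (\<lambda>x' y'. f (x \<cdot> x') (y \<cdot> y')) k) h"
proof -
  interpret G: module R G by fact
  note aG = G.abelian_group_axioms
  let ?T = "tensor B K B" and ?p = "pure B K B"
  have b: "balanced B K B G f" using f by (intro bilin_balanced) (simp add: bilin_def)
  note ga = HT.MN.tensor_lift_additive[OF aG b]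
  have "comult H (h \<cdot> k) = comult H h \<otimes>\<^bsub>?T\<^esub> comult H k"
    using comult_alg_hom ring_hom_mult[of "comult H" H ?T] h k
    by (simp add: alg_hom_def tensor_self_def)
  also have "\<dots> = SW ?T (\<lambda>x y. SW ?T (\<lambda>x' y'. ?p (x \<cdot> x') (y \<cdot> y')) k) h"
    by (simp add: HT.MN.mult_T SW_lift)
  finally have "SW G f (h \<cdot> k) =
      tensor_lift B K B G f (SW ?T (\<lambda>x y. SW ?T (\<lambda>x' y'. ?p (x \<cdot> x') (y \<cdot> y')) k) h)"
    by (simp add: SW_lift)
  then show ?thesis
    using h k by (simp add: SW_additive_map[OF ga HT.MN.abelian_group_T aG] HT.MN.pure_closed
        HT.MN.abelian_group_T HT.MN.tensor_lift_pure[OF aG b])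
qed

lemma SW_one:
  assumes G: "module R G"
    and f: "\<And>y. y \<in> carrier H \<Longrightarrow> lin G (\<lambda>x. f x y)" "\<And>x. x \<in> carrier H \<Longrightarrow> lin G (\<lambda>y. f x y)"
  shows "SW G f \<one>\<^sub>H = f \<one>\<^sub>H \<one>\<^sub>H"
proof -
  interpret G: module R G by fact
  note aG = G.abelian_group_axioms
  have b: "balanced B K B G f" using f by (intro bilin_balanced) (simp add: bilin_def)
  have "comult H \<one>\<^sub>H = pure B K B \<one>\<^sub>H \<one>\<^sub>H"
    using comult_alg_hom ring_hom_one[of "comult H" H "tensor B K B"]
    by (simp add: alg_hom_def tensor_self_def HT.MN.one_T)
  then show ?thesis
    by (simp add: SW_lift HT.MN.tensor_lift_pure[OF aG b])
qed

text \<open>The common form of the four antipode cancellations: S(h1) h2 and h1 S(h2), and for the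
  inverse antipode S^-1(h2) h1 and h2 S^-1(h1).\<close>

definition cancels :: "('h \<Rightarrow> 'h \<Rightarrow> 'h) \<Rightarrow> bool" where
  "cancels m \<longleftrightarrow> bilin R H H H m \<and> (\<forall>h\<in>carrier H. SW H m h = \<epsilon> h \<odot>\<^bsub>H\<^esub> \<one>\<^sub>H)"

lemma cancel:
  assumes "cancels m" "module R G" "lin G g" "h \<in> carrier H"
  shows "SW G (\<lambda>x y. g (m x y)) h = \<epsilon> h \<odot>\<^bsub>G\<^esub> g \<one>\<^sub>H"
proof -
  have "SW G (\<lambda>x y. g (m x y)) h = g (SW H m h)"
    using assms by (intro SW_lin_map[symmetric]) (auto simp: cancels_def dest: bilin_closed)
  then show ?thesis
    using assms by (simp add: cancels_def lin_map_smult[OF assms(3)])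
qed

text \<open>Nested sums are kept associated to the right, so a pair in front has to be reassociated
  before it can cancel; a pair at the end, as in \<open>cancel_right\<close>, is already in
  place.\<close>

lemma cancel_left:
  assumes m: "cancels m" and G: "module R G" and h: "h \<in> carrier H"
    and g: "\<And>y. y \<in> carrier H \<Longrightarrow> lin G (\<lambda>x. g x y)" "\<And>x. x \<in> carrier H \<Longrightarrow> lin G (\<lambda>y. g x y)"
  shows "SW G (\<lambda>x w. SW G (\<lambda>y z. g (m x y) z) w) h = g \<one>\<^sub>H h"
proof -
  have b: "bilin R H H H m" using m by (simp add: cancels_def)
  have bg: "bilin R H H G g" using g by (simp add: bilin_def)
  have "SW G (\<lambda>x w. SW G (\<lambda>y z. g (m x y) z) w) h = SW G (\<lambda>w z. SW G (\<lambda>x y. g (m x y) z) w) h"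
    by (rule SW_coassoc[OF G h, symmetric])
      (intro bilin_left[OF bg] bilin_right[OF bg] bilin_left[OF b] bilin_right[OF b]
        bilin_closed[OF b] lin_map_id; assumption)+
  also have "\<dots> = SW G (\<lambda>w z. \<epsilon> w \<odot>\<^bsub>G\<^esub> g \<one>\<^sub>H z) h"
    using h cancel[OF m G g(1)] by (intro SW_cong) auto
  also have "\<dots> = g \<one>\<^sub>H h"
    using SW_counit_left[OF G g(2) h] by simp
  finally show ?thesis .
qed

lemma cancel_right:
  assumes m: "cancels m" and G: "module R G" and h: "h \<in> carrier H"
    and g: "\<And>y. y \<in> carrier H \<Longrightarrow> lin G (\<lambda>x. g x y)" "\<And>x. x \<in> carrier H \<Longrightarrow> lin G (\<lambda>y. g x y)"
  shows "SW G (\<lambda>x w. SW G (\<lambda>y z. g x (m y z)) w) h = g h \<one>\<^sub>H"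
proof -
  have "SW G (\<lambda>x w. SW G (\<lambda>y z. g x (m y z)) w) h = SW G (\<lambda>x w. \<epsilon> w \<odot>\<^bsub>G\<^esub> g x \<one>\<^sub>H) h"
    using h cancel[OF m G g(2)] by (intro SW_cong) auto
  also have "\<dots> = g h \<one>\<^sub>H"
    using SW_counit_right[OF G g(1) h] by simp
  finally show ?thesis .
qed

section \<open>The antipode reverses products and coproducts\<close>

lemma cancels_antipode_left: "cancels (\<lambda>x y. S x \<cdot> y)"
  and cancels_antipode_right: "cancels (\<lambda>x y. x \<cdot> S y)"
  unfolding cancels_def using antipode_left antipode_right
  by (auto intro!: bilinI lin_intros)

text \<open>Uniqueness of convolution inverses: S(h1 k1) h2 k2 S(k3) S(h3) collapses to S(hk) when
  the right part is cancelled, and to S(k) S(h) when S(h1 k1) h2 k2 is.\<close>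

lemma antipode_mult:
  assumes [simp]: "h \<in> carrier H" "k \<in> carrier H"
  shows "S (h \<cdot> k) = S k \<cdot> S h"
proof -
  let ?F = "\<lambda>h1 h2 h3 k1 k2 k3. S (h1 \<cdot> k1) \<cdot> (h2 \<cdot> k2) \<cdot> (S k3 \<cdot> S h3)"
  let ?G = "\<lambda>h1 h2 h3. SW H (\<lambda>k1 w. SW H (\<lambda>k2 k3. ?F h1 h2 h3 k1 k2 k3) w) k"
  have 1: "?G h1 h2 h3 = S (h1 \<cdot> k) \<cdot> (h2 \<cdot> S h3)"
    if [simp]: "h1 \<in> carrier H" "h2 \<in> carrier H" "h3 \<in> carrier H" for h1 h2 h3
  proof -
    have "SW H (\<lambda>k1 w. SW H (\<lambda>k2 k3. S (h1 \<cdot> k1) \<cdot> h2 \<cdot> (k2 \<cdot> S k3) \<cdot> S h3) w) k =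
      S (h1 \<cdot> k) \<cdot> h2 \<cdot> \<one>\<^sub>H \<cdot> S h3"
      by (intro cancel_right[OF cancels_antipode_right, where g="\<lambda>k1 m. S (h1 \<cdot> k1) \<cdot> h2 \<cdot> m \<cdot> S h3"]
          lin_intros; simp)
    then show ?thesis by (simp add: HA.m_assoc)
  qed
  have "SW H (\<lambda>h1 v. SW H (\<lambda>h2 h3. ?G h1 h2 h3) v) h =
      SW H (\<lambda>h1 v. SW H (\<lambda>h2 h3. S (h1 \<cdot> k) \<cdot> (h2 \<cdot> S h3)) v) h"
    by (intro SW_cong refl 1; simp)
  also have "\<dots> = S (h \<cdot> k) \<cdot> \<one>\<^sub>H"
    by (intro cancel_right[OF cancels_antipode_right, where g="\<lambda>h1 m. S (h1 \<cdot> k) \<cdot> m"]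
          lin_intros; simp)
  finally have eq1: "SW H (\<lambda>h1 v. SW H (\<lambda>h2 h3. ?G h1 h2 h3) v) h = S (h \<cdot> k)"
    by simp
  \<comment> \<open>The same sum with the first two components grouped: S(h1 k1) h2 k2 becomes the
    antipode axiom at the product v w.\<close>
  have 2: "SW H (\<lambda>h1 h2. ?G h1 h2 h3) v = \<epsilon> v \<odot>\<^bsub>H\<^esub> (S k \<cdot> S h3)"
    if [simp]: "v \<in> carrier H" "h3 \<in> carrier H" for v h3
  proof -
    have "SW H (\<lambda>h1 h2. ?G h1 h2 h3) v =
        SW H (\<lambda>h1 h2. SW H (\<lambda>w k3. SW H (\<lambda>k1 k2. ?F h1 h2 h3 k1 k2 k3) w) k) v"
      by (intro SW_cong refl SW_coassoc[symmetric] lin_intros; simp)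
    also have "\<dots> = SW H (\<lambda>w k3. SW H (\<lambda>h1 h2. SW H (\<lambda>k1 k2. ?F h1 h2 h3 k1 k2 k3) w) v) k"
      by (intro SW_swap; simp)
    also have "\<dots> = SW H (\<lambda>w k3. \<epsilon> v \<odot>\<^bsub>H\<^esub> (\<epsilon> w \<odot>\<^bsub>H\<^esub> (S k3 \<cdot> S h3))) k"
    proof (intro SW_cong refl)
      fix w k3 assume [simp]: "w \<in> carrier H" "k3 \<in> carrier H"
      have "SW H (\<lambda>h1 h2. SW H (\<lambda>k1 k2. ?F h1 h2 h3 k1 k2 k3) w) v =
          SW H (\<lambda>h1 h2. SW H (\<lambda>k1 k2. S (h1 \<cdot> k1) \<cdot> (h2 \<cdot> k2)) w) v \<cdot> (S k3 \<cdot> S h3)"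
        by (simp add: SW_mult_right)
      also have "SW H (\<lambda>h1 h2. SW H (\<lambda>k1 k2. S (h1 \<cdot> k1) \<cdot> (h2 \<cdot> k2)) w) v =
          SW H (\<lambda>x y. S x \<cdot> y) (v \<cdot> w)"
        by (rule SW_mult[symmetric]; (intro lin_intros)?; simp)
      also have "\<dots> = \<epsilon> (v \<cdot> w) \<odot>\<^bsub>H\<^esub> \<one>\<^sub>H"
        by (rule antipode_left) simp
      finally show "SW H (\<lambda>h1 h2. SW H (\<lambda>k1 k2. ?F h1 h2 h3 k1 k2 k3) w) v =
          \<epsilon> v \<odot>\<^bsub>H\<^esub> (\<epsilon> w \<odot>\<^bsub>H\<^esub> (S k3 \<cdot> S h3))"
        by (simp add: HA.smult_mult_left HA.smult_assoc1)
    qed simp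
    also have "\<dots> = \<epsilon> v \<odot>\<^bsub>H\<^esub> SW H (\<lambda>w k3. \<epsilon> w \<odot>\<^bsub>H\<^esub> (S k3 \<cdot> S h3)) k"
      by (rule SW_smult[symmetric]; simp)
    also have "SW H (\<lambda>w k3. \<epsilon> w \<odot>\<^bsub>H\<^esub> (S k3 \<cdot> S h3)) k = S k \<cdot> S h3"
      by (intro SW_counit_left lin_intros; simp)
    finally show ?thesis .
  qed
  have "SW H (\<lambda>h1 v. SW H (\<lambda>h2 h3. ?G h1 h2 h3) v) h =
      SW H (\<lambda>v h3. SW H (\<lambda>h1 h2. ?G h1 h2 h3) v) h"
    by (rule SW_coassoc[symmetric]; (intro lin_intros)?; simp)
  also have "\<dots> = SW H (\<lambda>v h3. \<epsilon> v \<odot>\<^bsub>H\<^esub> (S k \<cdot> S h3)) h"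
    by (intro SW_cong refl 2; simp)
  also have "\<dots> = S k \<cdot> S h"
    by (intro SW_counit_left lin_intros; simp)
  finally show ?thesis using eq1 by simp
qed

lemma antipode_one [simp]: "S \<one>\<^sub>H = \<one>\<^sub>H"
proof -
  have "SW H (\<lambda>x y. S x \<cdot> y) \<one>\<^sub>H = S \<one>\<^sub>H \<cdot> \<one>\<^sub>H"
    by (rule SW_one; (intro lin_intros)?; simp)
  then show ?thesis
    using antipode_left[of "\<one>\<^sub>H"] by simp
qed

text \<open>The uniqueness argument again, now for the coproduct. With h split into a, b, c, d, e,
  the expression \<open>?F\<close> multiplies the coproduct of S(a) by b S(e) in one slot and by c
  S(d) in the other, and is evaluated in two ways.\<close>

lemma SW_antipode:
  assumes G: "module R G" and h [simp]: "h \<in> carrier H"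
    and f: "\<And>y. y \<in> carrier H \<Longrightarrow> lin G (\<lambda>x. f x y)" "\<And>x. x \<in> carrier H \<Longrightarrow> lin G (\<lambda>y. f x y)"
  shows "SW G f (S h) = SW G (\<lambda>x y. f (S y) (S x)) h"
proof -
  interpret G: module R G by fact
  note [simp] = G G.abelian_group_axioms
  have b: "bilin R H H G f" using f by (simp add: bilin_def)
  note [lin_intros] = bilin_left[OF b] bilin_right[OF b]
  note [simp] = bilin_closed[OF b]
  let ?F = "\<lambda>a b c d e. SW G (\<lambda>p q. f (p \<cdot> b \<cdot> S e) (q \<cdot> c \<cdot> S d)) (S a)"
  \<comment> \<open>First evaluation: c S(d) cancels here and b S(e) afterwards, so that
    \<open>f\<close> remains at the coproduct of S(h).\<close>
  have 1: "SW G (\<lambda>c w. SW G (\<lambda>d e. ?F a b c d e) w) u = SW G (\<lambda>p q. f (p \<cdot> (b \<cdot> S u)) q) (S a)"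
    if [simp]: "a \<in> carrier H" "b \<in> carrier H" "u \<in> carrier H" for a b u
  proof -
    have "SW G (\<lambda>c w. SW G (\<lambda>d e. SW G (\<lambda>p q. f (p \<cdot> (b \<cdot> S e)) (q \<cdot> (c \<cdot> S d))) (S a)) w) u =
        SW G (\<lambda>p q. f (p \<cdot> (b \<cdot> S u)) (q \<cdot> \<one>\<^sub>H)) (S a)"
      by (intro cancel_left[OF cancels_antipode_right, where
            g="\<lambda>m e. SW G (\<lambda>p q. f (p \<cdot> (b \<cdot> S e)) (q \<cdot> m)) (S a)"] lin_intros; simp)
    then show ?thesis by (simp add: HA.m_assoc)
  qed
  have "SW G (\<lambda>a v. SW G (\<lambda>b u. SW G (\<lambda>c w. SW G (\<lambda>d e. ?F a b c d e) w) u) v) h =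
      SW G (\<lambda>a v. SW G (\<lambda>b u. SW G (\<lambda>p q. f (p \<cdot> (b \<cdot> S u)) q) (S a)) v) h"
    by (intro SW_cong refl 1; simp)
  also have "\<dots> = SW G (\<lambda>p q. f (p \<cdot> \<one>\<^sub>H) q) (S h)"
    by (intro cancel_right[OF cancels_antipode_right, where
          g="\<lambda>a m. SW G (\<lambda>p q. f (p \<cdot> m) q) (S a)"] lin_intros; simp)
  also have "\<dots> = SW G f (S h)" by simp
  finally have eq1: "SW G (\<lambda>a v. SW G (\<lambda>b u. SW G (\<lambda>c w. SW G (\<lambda>d e. ?F a b c d e) w) u) v) h = SW G f (S h)" .
  \<comment> \<open>Second evaluation: b and c are regrouped as the coproduct of one element, which
    is absorbed into S(a); then S(a) b cancels and d, e survive in reversed order.\<close>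
  have "SW G (\<lambda>a v. SW G (\<lambda>b u. SW G (\<lambda>c w. SW G (\<lambda>d e. ?F a b c d e) w) u) v) h =
     SW G (\<lambda>a v. SW G (\<lambda>b w. SW G (\<lambda>b c. SW G (\<lambda>d e. ?F a b c d e) w) b) v) h"
    by (intro SW_cong refl SW_coassoc[symmetric] lin_intros; simp)
  also have "\<dots> = SW G (\<lambda>a v. SW G (\<lambda>b w. SW G (\<lambda>d e. SW G (\<lambda>p q. f (p \<cdot> S e) (q \<cdot> S d)) (S a \<cdot> b)) w) v) h"
  proof (rule SW_cong[OF refl h], rule SW_cong[OF refl])
    fix a v b w assume [simp]: "a \<in> carrier H" "b \<in> carrier H" "w \<in> carrier H"
    have "SW G (\<lambda>b c. SW G (\<lambda>d e. ?F a b c d e) w) b = SW G (\<lambda>d e. SW G (\<lambda>b c. ?F a b c d e) b) w"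
      by (intro SW_swap; simp)
    also have "\<dots> = SW G (\<lambda>d e. SW G (\<lambda>p q. SW G (\<lambda>b c. f (p \<cdot> b \<cdot> S e) (q \<cdot> c \<cdot> S d)) b) (S a)) w"
      by (intro SW_cong refl SW_swap; simp)
    also have "\<dots> = SW G (\<lambda>d e. SW G (\<lambda>p q. f (p \<cdot> S e) (q \<cdot> S d)) (S a \<cdot> b)) w"
      by (intro SW_cong refl SW_mult[symmetric, where f="\<lambda>p q. f (p \<cdot> S _) (q \<cdot> S _)"] lin_intros; simp)
    finally show "SW G (\<lambda>b c. SW G (\<lambda>d e. ?F a b c d e) w) b =
        SW G (\<lambda>d e. SW G (\<lambda>p q. f (p \<cdot> S e) (q \<cdot> S d)) (S a \<cdot> b)) w" .
  qed simp_all
  also have "\<dots> = SW G (\<lambda>d e. SW G (\<lambda>p q. f (p \<cdot> S e) (q \<cdot> S d)) \<one>\<^sub>H) h"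
    by (intro cancel_left[OF cancels_antipode_left, where
          g="\<lambda>m w. SW G (\<lambda>d e. SW G (\<lambda>p q. f (p \<cdot> S e) (q \<cdot> S d)) m) w"] lin_intros; simp)
  also have "\<dots> = SW G (\<lambda>d e. f (\<one>\<^sub>H \<cdot> S e) (\<one>\<^sub>H \<cdot> S d)) h"
    by (intro SW_cong refl SW_one[where f="\<lambda>p q. f (p \<cdot> S _) (q \<cdot> S _)"] lin_intros; simp)
  finally show ?thesis using eq1 by simp
qed

section \<open>The inverse antipode\<close>

lemma inv_antipode_closed [simp]: "h \<in> carrier H \<Longrightarrow> S\<^sub>i h \<in> carrier H"
  and antipode_inv_antipode [simp]: "h \<in> carrier H \<Longrightarrow> S (S\<^sub>i h) = h"
  and inv_antipode_antipode [simp]: "h \<in> carrier H \<Longrightarrow> S\<^sub>i (S h) = h"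
  using bij_antipode unfolding antipode_inv_def
  by (auto simp: bij_betw_def inv_into_f_f f_inv_into_f intro: inv_into_into)

lemma antipode_eqD: "S x = S y \<Longrightarrow> x \<in> carrier H \<Longrightarrow> y \<in> carrier H \<Longrightarrow> x = y"
  using bij_antipode by (auto simp: bij_betw_def inj_on_def)

lemma inv_antipode_lin: "lin H S\<^sub>i"
  by (intro lin_mapI; (rule antipode_eqD)?)
    (simp_all add: lin_map_add[OF antipode_lin] lin_map_smult[OF antipode_lin])

lemmas lin_map_inv_antipode [lin_intros] = lin_map_comp[OF inv_antipode_lin]

lemma inv_antipode_mult:
  "h \<in> carrier H \<Longrightarrow> k \<in> carrier H \<Longrightarrow> S\<^sub>i (h \<cdot> k) = S\<^sub>i k \<cdot> S\<^sub>i h"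
  by (rule antipode_eqD) (simp_all add: antipode_mult)

lemma inv_antipode_one [simp]: "S\<^sub>i \<one>\<^sub>H = \<one>\<^sub>H"
  using inv_antipode_antipode[of "\<one>\<^sub>H"] by simp

lemma SW_inv_antipode:
  assumes G: "module R G" and h [simp]: "h \<in> carrier H"
    and f: "\<And>y. y \<in> carrier H \<Longrightarrow> lin G (\<lambda>x. f x y)" "\<And>x. x \<in> carrier H \<Longrightarrow> lin G (\<lambda>y. f x y)"
  shows "SW G f (S\<^sub>i h) = SW G (\<lambda>x y. f (S\<^sub>i y) (S\<^sub>i x)) h"
proof -
  have b: "bilin R H H G f" using f by (simp add: bilin_def)
  note [lin_intros] = bilin_left[OF b] bilin_right[OF b]
  have "SW G (\<lambda>x y. f (S\<^sub>i y) (S\<^sub>i x)) (S (S\<^sub>i h)) = SW G (\<lambda>x y. f (S\<^sub>i (S x)) (S\<^sub>i (S y))) (S\<^sub>i h)"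
    by (intro SW_antipode[OF G] lin_intros; simp)
  then show ?thesis by simp
qed

text \<open>Apply \<open>S\<^sub>i\<close> to the antipode axioms; as it reverses products, the two
  components change places.\<close>

lemma cancels_inv_antipode_left: "cancels (\<lambda>x y. S\<^sub>i y \<cdot> x)"
  and cancels_inv_antipode_right: "cancels (\<lambda>x y. y \<cdot> S\<^sub>i x)"
proof -
  have *: "SW H (\<lambda>x y. S\<^sub>i y \<cdot> x) h = \<epsilon> h \<odot>\<^bsub>H\<^esub> \<one>\<^sub>H \<and> SW H (\<lambda>x y. y \<cdot> S\<^sub>i x) h = \<epsilon> h \<odot>\<^bsub>H\<^esub> \<one>\<^sub>H"
    if [simp]: "h \<in> carrier H" for h
  proof -
    have "SW H (\<lambda>x y. S\<^sub>i y \<cdot> x) h = S\<^sub>i (SW H (\<lambda>x y. S x \<cdot> y) h)"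
      by (simp add: SW_lin_map[OF inv_antipode_lin] inv_antipode_mult)
    moreover have "SW H (\<lambda>x y. y \<cdot> S\<^sub>i x) h = S\<^sub>i (SW H (\<lambda>x y. x \<cdot> S y) h)"
      by (simp add: SW_lin_map[OF inv_antipode_lin] inv_antipode_mult)
    ultimately show ?thesis
      by (simp add: antipode_left antipode_right lin_map_smult[OF inv_antipode_lin])
  qed
  then show "cancels (\<lambda>x y. S\<^sub>i y \<cdot> x)" "cancels (\<lambda>x y. y \<cdot> S\<^sub>i x)"
    unfolding cancels_def by (auto intro!: bilinI lin_intros)
qed

end

section \<open>Constructions of algebras\<close>

lemma assoc_algebraI:
  assumes "module R B" "Group.monoid B"
    and "\<And>x y z. x \<in> carrier B \<Longrightarrow> y \<in> carrier B \<Longrightarrow> z \<in> carrier B \<Longrightarrow>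
      (x \<oplus>\<^bsub>B\<^esub> y) \<otimes>\<^bsub>B\<^esub> z = x \<otimes>\<^bsub>B\<^esub> z \<oplus>\<^bsub>B\<^esub> y \<otimes>\<^bsub>B\<^esub> z"
    and "\<And>x y z. x \<in> carrier B \<Longrightarrow> y \<in> carrier B \<Longrightarrow> z \<in> carrier B \<Longrightarrow>
      z \<otimes>\<^bsub>B\<^esub> (x \<oplus>\<^bsub>B\<^esub> y) = z \<otimes>\<^bsub>B\<^esub> x \<oplus>\<^bsub>B\<^esub> z \<otimes>\<^bsub>B\<^esub> y"
    and "\<And>c x y. c \<in> carrier R \<Longrightarrow> x \<in> carrier B \<Longrightarrow> y \<in> carrier B \<Longrightarrow>
      (c \<odot>\<^bsub>B\<^esub> x) \<otimes>\<^bsub>B\<^esub> y = c \<odot>\<^bsub>B\<^esub> (x \<otimes>\<^bsub>B\<^esub> y)"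
    and "\<And>c x y. c \<in> carrier R \<Longrightarrow> x \<in> carrier B \<Longrightarrow> y \<in> carrier B \<Longrightarrow>
      x \<otimes>\<^bsub>B\<^esub> (c \<odot>\<^bsub>B\<^esub> y) = c \<odot>\<^bsub>B\<^esub> (x \<otimes>\<^bsub>B\<^esub> y)"
  shows "assoc_algebra R B"
  using assms module.axioms(2)[OF assms(1)]
  by (intro assoc_algebra.intro ringI assoc_algebra_axioms.intro) auto

lemma op_algebra_simps [simp]:
  "carrier (op_algebra B) = carrier B" "ring.add (op_algebra B) = ring.add B"
  "ring.zero (op_algebra B) = ring.zero B" "one (op_algebra B) = one B"
  "x \<otimes>\<^bsub>op_algebra B\<^esub> y = y \<otimes>\<^bsub>B\<^esub> x" "smult (op_algebra B) = smult B"
  by (simp_all add: op_algebra_def)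

lemma assoc_algebra_op:
  assumes "assoc_algebra R B"
  shows "assoc_algebra R (op_algebra B)"
proof -
  interpret assoc_algebra R B by fact
  show ?thesis
  proof (intro assoc_algebraI moduleI abelian_groupI monoidI)
    fix x assume "x \<in> carrier (op_algebra B)"
    then show "\<exists>y\<in>carrier (op_algebra B). y \<oplus>\<^bsub>op_algebra B\<^esub> x = \<zero>\<^bsub>op_algebra B\<^esub>"
      using M.l_neg by auto
  qed (simp_all add: M.a_ac M.l_distr M.r_distr smult_mult_left smult_mult_right smult_l_distr
      smult_r_distr smult_assoc1 M.m_assoc is_cring)
qed

lemma alg_hom_lin: "alg_hom R B C f \<Longrightarrow> lin_map R B C f"
  and alg_hom_mult: "alg_hom R B C f \<Longrightarrow> x \<in> carrier B \<Longrightarrow> y \<in> carrier B \<Longrightarrow>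
    f (x \<otimes>\<^bsub>B\<^esub> y) = f x \<otimes>\<^bsub>C\<^esub> f y"
  and alg_hom_one: "alg_hom R B C f \<Longrightarrow> f \<one>\<^bsub>B\<^esub> = \<one>\<^bsub>C\<^esub>"
  by (auto simp: alg_hom_def ring_hom_def)

lemma alg_homI:
  assumes "lin_map R B C f"
    and "\<And>x y. x \<in> carrier B \<Longrightarrow> y \<in> carrier B \<Longrightarrow> f (x \<otimes>\<^bsub>B\<^esub> y) = f x \<otimes>\<^bsub>C\<^esub> f y"
    and "f \<one>\<^bsub>B\<^esub> = \<one>\<^bsub>C\<^esub>"
  shows "alg_hom R B C f"
  using assms by (auto simp: alg_hom_def ring_hom_def lin_map_def)

text \<open>The axioms pass along a surjection that respects all operations. The instance in mind is
  the projection onto a quotient.\<close>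

lemma assoc_algebra_image:
  assumes B: "assoc_algebra R B" and car: "carrier Q = f ` carrier B"
    and add: "\<And>x y. x \<in> carrier B \<Longrightarrow> y \<in> carrier B \<Longrightarrow> f x \<oplus>\<^bsub>Q\<^esub> f y = f (x \<oplus>\<^bsub>B\<^esub> y)"
    and mult: "\<And>x y. x \<in> carrier B \<Longrightarrow> y \<in> carrier B \<Longrightarrow> f x \<otimes>\<^bsub>Q\<^esub> f y = f (x \<otimes>\<^bsub>B\<^esub> y)"
    and smult: "\<And>c x. c \<in> carrier R \<Longrightarrow> x \<in> carrier B \<Longrightarrow> c \<odot>\<^bsub>Q\<^esub> f x = f (c \<odot>\<^bsub>B\<^esub> x)"
    and zero: "\<zero>\<^bsub>Q\<^esub> = f \<zero>\<^bsub>B\<^esub>" and one: "\<one>\<^bsub>Q\<^esub> = f \<one>\<^bsub>B\<^esub>"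
  shows "assoc_algebra R Q" "alg_hom R B Q f"
proof -
  interpret assoc_algebra R B by fact
  note s = car add mult smult zero one
  show "assoc_algebra R Q"
  proof (intro assoc_algebraI moduleI abelian_groupI monoidI)
    fix X assume "X \<in> carrier Q"
    then obtain x where "x \<in> carrier B" "X = f x" by (auto simp: car)
    then show "\<exists>Y\<in>carrier Q. Y \<oplus>\<^bsub>Q\<^esub> X = \<zero>\<^bsub>Q\<^esub>"
      by (intro bexI[of _ "f (\<ominus>\<^bsub>B\<^esub> x)"]) (auto simp: s M.l_neg)
  qed (auto simp: s M.a_ac M.l_distr M.r_distr smult_mult_left smult_mult_right smult_l_distr
      smult_r_distr smult_assoc1 M.m_assoc is_cring)
  show "alg_hom R B Q f"
    by (intro alg_homI lin_mapI) (auto simp: s)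
qed

section \<open>Subalgebras and quotients\<close>

lemma is_subalgebra_assoc_algebra:
  assumes B: "assoc_algebra R B" and C: "is_subalgebra R B C"
  shows "assoc_algebra R (B\<lparr>carrier := C\<rparr>)"
proof -
  interpret assoc_algebra R B by fact
  have sub: "x \<in> carrier B" if "x \<in> C" for x
    using C that by (auto simp: is_subalgebra_def)
  have cl: "\<one>\<^bsub>B\<^esub> \<in> C" "\<And>x y. x \<in> C \<Longrightarrow> y \<in> C \<Longrightarrow> x \<oplus>\<^bsub>B\<^esub> y \<in> C"
    "\<And>x y. x \<in> C \<Longrightarrow> y \<in> C \<Longrightarrow> x \<otimes>\<^bsub>B\<^esub> y \<in> C" "\<And>c x. c \<in> carrier R \<Longrightarrow> x \<in> C \<Longrightarrow> c \<odot>\<^bsub>B\<^esub> x \<in> C"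
    using C by (auto simp: is_subalgebra_def)
  \<comment> \<open>\<open>is_subalgebra\<close> lists neither negatives nor zero: closure under
    negation is closure under the scalar -1, and then zero is 1 - 1.\<close>
  have neg: "\<ominus>\<^bsub>B\<^esub> x \<in> C" if "x \<in> C" for x
    using cl(4)[OF R.a_inv_closed[OF R.one_closed] that] sub[OF that] by (simp add: smult_l_minus)
  have zero: "\<zero>\<^bsub>B\<^esub> \<in> C"
    using cl(2)[OF cl(1) neg[OF cl(1)]] by (simp add: M.r_neg)
  show ?thesis
  proof (intro assoc_algebraI moduleI abelian_groupI monoidI)
    fix x assume "x \<in> carrier (B\<lparr>carrier := C\<rparr>)"
    then show "\<exists>y\<in>carrier (B\<lparr>carrier := C\<rparr>). y \<oplus>\<^bsub>B\<lparr>carrier := C\<rparr>\<^esub> x = \<zero>\<^bsub>B\<lparr>carrier := C\<rparr>\<^esub>"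
      by (intro bexI[of _ "\<ominus>\<^bsub>B\<^esub> x"]) (auto simp: sub M.l_neg neg)
  qed (auto simp: sub cl zero M.a_ac M.l_distr M.r_distr smult_mult_left smult_mult_right
      smult_l_distr smult_r_distr smult_assoc1 M.m_assoc is_cring)
qed

lemma is_subalgebra_gen:
  assumes "assoc_algebra R B" "X \<subseteq> carrier B"
  shows "is_subalgebra R B (carrier (gen_subalgebra R B X))"
proof -
  interpret assoc_algebra R B by fact
  have "is_subalgebra R B (carrier B)" by (simp add: is_subalgebra_def)
  with assms(2) show ?thesis
    by (auto simp: gen_subalgebra_def is_subalgebra_def)
qed

lemma gen_subalgebra_eq: "gen_subalgebra R B X = B\<lparr>carrier := carrier (gen_subalgebra R B X)\<rparr>"
  by (simp add: gen_subalgebra_def)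

lemma gen_subalgebra_assoc_algebra:
  assumes "assoc_algebra R B" "X \<subseteq> carrier B"
  shows "assoc_algebra R (gen_subalgebra R B X)"
  using is_subalgebra_assoc_algebra[OF assms(1) is_subalgebra_gen[OF assms]]
  by (simp flip: gen_subalgebra_eq)

lemma gen_subalgebra_incl: "x \<in> X \<Longrightarrow> x \<in> carrier (gen_subalgebra R B X)"
  by (auto simp: gen_subalgebra_def)

lemma gen_subalgebra_induct [consumes 2, case_names gen one add mult smult]:
  assumes B: "assoc_algebra R B" and x: "x \<in> carrier (gen_subalgebra R B X)" and X: "X \<subseteq> carrier B"
    and "\<And>x. x \<in> X \<Longrightarrow> Q x" "Q \<one>\<^bsub>B\<^esub>"
    and "\<And>x y. x \<in> carrier (gen_subalgebra R B X) \<Longrightarrow> y \<in> carrier (gen_subalgebra R B X) \<Longrightarrow>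
      Q x \<Longrightarrow> Q y \<Longrightarrow> Q (x \<oplus>\<^bsub>B\<^esub> y)"
    and "\<And>x y. x \<in> carrier (gen_subalgebra R B X) \<Longrightarrow> y \<in> carrier (gen_subalgebra R B X) \<Longrightarrow>
      Q x \<Longrightarrow> Q y \<Longrightarrow> Q (x \<otimes>\<^bsub>B\<^esub> y)"
    and "\<And>c x. c \<in> carrier R \<Longrightarrow> x \<in> carrier (gen_subalgebra R B X) \<Longrightarrow> Q x \<Longrightarrow> Q (c \<odot>\<^bsub>B\<^esub> x)"
  shows "Q x"
proof -
  let ?C = "{x \<in> carrier (gen_subalgebra R B X). Q x}"
  have "is_subalgebra R B ?C"
    using is_subalgebra_gen[OF B X] assms(5-) unfolding is_subalgebra_def by auto
  moreover have "X \<subseteq> ?C"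
    using assms(4) gen_subalgebra_incl[of _ X R B] by auto
  ultimately have "carrier (gen_subalgebra R B X) \<subseteq> ?C"
    by (auto simp: gen_subalgebra_def)
  with x show ?thesis by auto
qed

locale algebra_ideal = assoc_algebra R M + I?: ideal I M
  for R :: "'k ring" and M :: "('k, 'm, 'z) module_scheme" (structure) and I
begin

lemma quot_carrier: "carrier (quot_algebra M I) = (\<lambda>x. I +> x) ` carrier M"
  by (auto simp: quot_algebra_def FactRing_def A_RCOSETS_def')

lemma quot_ops:
  "x \<in> carrier M \<Longrightarrow> y \<in> carrier M \<Longrightarrow> (I +> x) \<oplus>\<^bsub>quot_algebra M I\<^esub> (I +> y) = I +> (x \<oplus> y)"
  "x \<in> carrier M \<Longrightarrow> y \<in> carrier M \<Longrightarrow> (I +> x) \<otimes>\<^bsub>quot_algebra M I\<^esub> (I +> y) = I +> (x \<otimes> y)"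
  "\<zero>\<^bsub>quot_algebra M I\<^esub> = I +> \<zero>" "\<one>\<^bsub>quot_algebra M I\<^esub> = I +> \<one>"
  by (simp_all add: quot_algebra_def FactRing_def rcoset_mult_add a_rcos_sum M.a_rcosI
      I.a_rcos_const)

lemma coset_eq_iff: "x \<in> carrier M \<Longrightarrow> y \<in> carrier M \<Longrightarrow> I +> x = I +> y \<longleftrightarrow> x \<ominus> y \<in> I"
  using M.quotient_eq_iff_same_a_r_cos[OF I.is_ideal] by simp

lemma quot_smult:
  assumes "c \<in> carrier R" "x \<in> carrier M"
  shows "c \<odot>\<^bsub>quot_algebra M I\<^esub> (I +> x) = I +> (c \<odot>\<^bsub>M\<^esub> x)"
proof -
  have eq: "I +> (c \<odot>\<^bsub>M\<^esub> y) = I +> (c \<odot>\<^bsub>M\<^esub> x)" if y: "y \<in> I +> x" for y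
  proof -
    obtain i where i: "i \<in> I" "y = i \<oplus> x"
      using y by (auto simp: a_r_coset_def r_coset_def)
    have ic: "i \<in> carrier M" using i(1) by (rule I.a_Hcarr)
    \<comment> \<open>A ring ideal is closed under scalars because c acts as multiplication by
      c1.\<close>
    have "c \<odot>\<^bsub>M\<^esub> i = (c \<odot>\<^bsub>M\<^esub> \<one>) \<otimes> i"
      using assms(1) ic by (simp add: smult_mult_left)
    then have "c \<odot>\<^bsub>M\<^esub> i \<in> I"
      using I.I_l_closed[OF i(1), of "c \<odot>\<^bsub>M\<^esub> \<one>"] assms(1) by simp
    moreover have "c \<odot>\<^bsub>M\<^esub> y \<ominus> c \<odot>\<^bsub>M\<^esub> x = c \<odot>\<^bsub>M\<^esub> i"
      using assms ic i(2) by (simp add: smult_r_distr M.minus_eq M.a_assoc M.r_neg)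
    ultimately show ?thesis
      using assms ic i(2) by (simp add: coset_eq_iff)
  qed
  \<comment> \<open>The union that defines scalar multiplication runs over a nonempty family of
    equal cosets.\<close>
  have "I +> x \<noteq> {}" using I.a_rcos_self[OF assms(2)] by blast
  then have "(\<Union>y\<in>I +> x. I +> (c \<odot>\<^bsub>M\<^esub> y)) = I +> (c \<odot>\<^bsub>M\<^esub> x)"
    by (rule SUP_eq_const) (rule eq)
  then show ?thesis
    by (simp add: quot_algebra_def)
qed

lemma quot_assoc_algebra: "assoc_algebra R (quot_algebra M I)"
  and quot_proj: "alg_hom R M (quot_algebra M I) (\<lambda>x. I +> x)"
  by (rule assoc_algebra_image[OF assoc_algebra_axioms quot_carrier]; simp add: quot_ops quot_smult)+

end

lemma (in assoc_algebra) quot_universal: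
  assumes X: "X \<subseteq> carrier M" and I: "I = Idl\<^bsub>M\<^esub> X" and C: "assoc_algebra R C"
    and \<phi>: "alg_hom R M C \<phi>" and kill: "\<And>x. x \<in> X \<Longrightarrow> \<phi> x = \<zero>\<^bsub>C\<^esub>"
  obtains \<psi> where "alg_hom R (quot_algebra M I) C \<psi>" "\<And>x. x \<in> carrier M \<Longrightarrow> \<psi> (I +>\<^bsub>M\<^esub> x) = \<phi> x"
proof -
  interpret C: assoc_algebra R C by fact
  interpret h: ring_hom_ring M C \<phi>
    using \<phi> by (intro ring_hom_ringI2 M.ring_axioms C.M.ring_axioms) (simp add: alg_hom_def)
  have ideal: "ideal I M" unfolding I by (rule M.genideal_ideal[OF X])
  have ai: "algebra_ideal R M I" using algebra_ideal.intro[OF assoc_algebra_axioms ideal] .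
  have "X \<subseteq> a_kernel M C \<phi>"
    unfolding a_kernel_def' by (intro subsetI CollectI conjI subsetD[OF X] kill)
  then have "I \<subseteq> a_kernel M C \<phi>"
    unfolding I by (rule M.genideal_minimal[OF h.kernel_is_ideal])
  then have zero: "\<phi> x = \<zero>\<^bsub>C\<^esub>" if "x \<in> I" for x
    using that unfolding a_kernel_def' by blast
  have eq: "\<phi> x = \<phi> y" if "x \<in> carrier M" "y \<in> carrier M" "I +>\<^bsub>M\<^esub> x = I +>\<^bsub>M\<^esub> y" for x y
  proof -
    have "\<phi> x \<ominus>\<^bsub>C\<^esub> \<phi> y = \<zero>\<^bsub>C\<^esub>"
      using zero[of "x \<ominus>\<^bsub>M\<^esub> y"] algebra_ideal.coset_eq_iff[OF ai, of x y] that by (simp add: M.minus_eq C.M.minus_eq)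
    then show ?thesis
      using that h.hom_closed[of x] h.hom_closed[of y]
      by (metis C.M.add.inv_closed C.M.add.inv_solve_right C.M.l_zero C.M.minus_eq C.M.zero_closed)
  qed
  define \<psi> where "\<psi> X = \<phi> (SOME x. x \<in> carrier M \<and> X = I +>\<^bsub>M\<^esub> x)" for X
  have \<psi>: "\<psi> (I +>\<^bsub>M\<^esub> x) = \<phi> x" if "x \<in> carrier M" for x
  proof -
    have "(SOME y. y \<in> carrier M \<and> I +>\<^bsub>M\<^esub> x = I +>\<^bsub>M\<^esub> y) \<in> carrier M \<and>
        I +>\<^bsub>M\<^esub> x = I +>\<^bsub>M\<^esub> (SOME y. y \<in> carrier M \<and> I +>\<^bsub>M\<^esub> x = I +>\<^bsub>M\<^esub> y)"
      using that by (intro someI[of "\<lambda>y. y \<in> carrier M \<and> I +>\<^bsub>M\<^esub> x = I +>\<^bsub>M\<^esub> y" x]) simp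
    then show ?thesis
      unfolding \<psi>_def using that eq by metis
  qed
  have "alg_hom R (quot_algebra M I) C \<psi>"
    using lin_map_smult[OF alg_hom_lin[OF \<phi>]]
    by (intro alg_homI lin_mapI) (auto simp: algebra_ideal.quot_carrier[OF ai] algebra_ideal.quot_ops[OF ai]
        algebra_ideal.quot_smult[OF ai] \<psi>)
  with \<psi> that show thesis by blast
qed

text \<open>Maps are cut off outside the carrier so that two endomorphisms are equal when they agree
  on it. Partial representations in this algebra lead to \<open>Hpar\<close>-module
  structures.\<close>

definition end_algebra :: "'k ring \<Rightarrow> ('k, 'm, 'z) module_scheme \<Rightarrow> ('k, 'm \<Rightarrow> 'm) module" where
  "end_algebra R M = \<lparr>carrier = {f. lin_map R M M f \<and> f \<in> extensional (carrier M)},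
     monoid.mult = \<lambda>f g. restrict (\<lambda>x. f (g x)) (carrier M), one = restrict (\<lambda>x. x) (carrier M),
     ring.zero = restrict (\<lambda>x. \<zero>\<^bsub>M\<^esub>) (carrier M),
     ring.add = \<lambda>f g. restrict (\<lambda>x. f x \<oplus>\<^bsub>M\<^esub> g x) (carrier M),
     smult = \<lambda>c f. restrict (\<lambda>x. c \<odot>\<^bsub>M\<^esub> f x) (carrier M)\<rparr>"

lemma end_algebra_simps:
  "f \<in> carrier (end_algebra R M) \<longleftrightarrow> lin_map R M M f \<and> f \<in> extensional (carrier M)"
  "f \<otimes>\<^bsub>end_algebra R M\<^esub> g = restrict (\<lambda>x. f (g x)) (carrier M)"
  "\<one>\<^bsub>end_algebra R M\<^esub> = restrict (\<lambda>x. x) (carrier M)"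
  "\<zero>\<^bsub>end_algebra R M\<^esub> = restrict (\<lambda>x. \<zero>\<^bsub>M\<^esub>) (carrier M)"
  "f \<oplus>\<^bsub>end_algebra R M\<^esub> g = restrict (\<lambda>x. f x \<oplus>\<^bsub>M\<^esub> g x) (carrier M)"
  "c \<odot>\<^bsub>end_algebra R M\<^esub> f = restrict (\<lambda>x. c \<odot>\<^bsub>M\<^esub> f x) (carrier M)"
  by (simp_all add: end_algebra_def)

lemma end_algebra:
  fixes R :: "'k ring"
  assumes "module R M"
  shows "assoc_algebra R (end_algebra R M)"
proof -
  interpret module R M by fact
  let ?E = "end_algebra R M"
  have cl: "f x \<in> carrier M" if "f \<in> carrier ?E" "x \<in> carrier M" for f x
    using that by (auto simp: end_algebra_simps lin_map_def)
  have add: "f (x \<oplus>\<^bsub>M\<^esub> y) = f x \<oplus>\<^bsub>M\<^esub> f y" if "f \<in> carrier ?E" "x \<in> carrier M" "y \<in> carrier M" for f x y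
    using that by (auto simp: end_algebra_simps lin_map_def)
  have sm: "f (c \<odot>\<^bsub>M\<^esub> x) = c \<odot>\<^bsub>M\<^esub> f x" if "f \<in> carrier ?E" "x \<in> carrier M" "c \<in> carrier R" for f x c
    using that by (auto simp: end_algebra_simps lin_map_def)
  have E: "f \<in> carrier ?E" if "f \<in> extensional (carrier M)" "\<And>x. x \<in> carrier M \<Longrightarrow> f x \<in> carrier M"
    "\<And>x y. x \<in> carrier M \<Longrightarrow> y \<in> carrier M \<Longrightarrow> f (x \<oplus>\<^bsub>M\<^esub> y) = f x \<oplus>\<^bsub>M\<^esub> f y"
    "\<And>c x. c \<in> carrier R \<Longrightarrow> x \<in> carrier M \<Longrightarrow> f (c \<odot>\<^bsub>M\<^esub> x) = c \<odot>\<^bsub>M\<^esub> f x" for f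
    using that by (simp add: end_algebra_simps lin_map_def)
  have ext: "f = g" if "f \<in> carrier ?E" "g \<in> carrier ?E" "\<And>x. x \<in> carrier M \<Longrightarrow> f x = g x" for f g
    using that by (auto simp: end_algebra_simps intro: extensionalityI)
  have sw: "c \<odot>\<^bsub>M\<^esub> (d \<odot>\<^bsub>M\<^esub> x) = d \<odot>\<^bsub>M\<^esub> (c \<odot>\<^bsub>M\<^esub> x)"
    if "c \<in> carrier R" "d \<in> carrier R" "x \<in> carrier M" for c d x
    using that by (simp add: smult_assoc1[symmetric] R.m_comm)
  note ops = end_algebra_simps(2-)
  have closed: "f \<otimes>\<^bsub>?E\<^esub> g \<in> carrier ?E" "f \<oplus>\<^bsub>?E\<^esub> g \<in> carrier ?E"
    if "f \<in> carrier ?E" "g \<in> carrier ?E" for f g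
    using that by (auto intro!: E simp: ops cl add sm smult_r_distr M.a_ac)
  have closed': "\<one>\<^bsub>?E\<^esub> \<in> carrier ?E" "\<zero>\<^bsub>?E\<^esub> \<in> carrier ?E"
    by (auto intro!: E simp: ops)
  have closed'': "c \<odot>\<^bsub>?E\<^esub> f \<in> carrier ?E" if "c \<in> carrier R" "f \<in> carrier ?E" for c f
    using that by (auto intro!: E simp: ops cl add sm sw smult_r_distr)
  note cls = closed closed' closed''
  show ?thesis
  proof (intro assoc_algebraI moduleI abelian_groupI monoidI)
    fix f assume f: "f \<in> carrier ?E"
    have "(\<ominus>\<^bsub>R\<^esub> \<one>\<^bsub>R\<^esub>) \<odot>\<^bsub>?E\<^esub> f \<oplus>\<^bsub>?E\<^esub> f = \<zero>\<^bsub>?E\<^esub>"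
    proof (rule ext)
      show "(\<ominus>\<^bsub>R\<^esub> \<one>\<^bsub>R\<^esub>) \<odot>\<^bsub>?E\<^esub> f \<oplus>\<^bsub>?E\<^esub> f \<in> carrier ?E" using f by (intro cls) simp_all
      show "\<zero>\<^bsub>?E\<^esub> \<in> carrier ?E" by (rule closed')
    qed (use f in \<open>simp add: ops cl smult_l_minus M.l_neg\<close>)
    then show "\<exists>g\<in>carrier ?E. g \<oplus>\<^bsub>?E\<^esub> f = \<zero>\<^bsub>?E\<^esub>"
      using closed''[OF R.a_inv_closed[OF R.one_closed] f] by blast
  qed (auto intro!: ext cls simp: R.is_cring; auto simp: ops cl add sm sw smult_r_distr smult_l_distr smult_assoc1 M.a_ac)+
qed

section \<open>The free algebra\<close>

text \<open>Singled out from \<open>free_algebra\<close> because \<open>conv_Cons\<close> turns the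
  sum over all cuts of a word into a recursion on its first letter.\<close>

definition conv :: "'k ring \<Rightarrow> ('h list \<Rightarrow> 'k) \<Rightarrow> ('h list \<Rightarrow> 'k) \<Rightarrow> 'h list \<Rightarrow> 'k" where
  "conv R f g w = (\<Oplus>\<^bsub>R\<^esub>i\<in>{..length w}. f (take i w) \<otimes>\<^bsub>R\<^esub> g (drop i w))"

definition free_mon :: "'k ring \<Rightarrow> 'h list \<Rightarrow> 'h list \<Rightarrow> 'k" where
  "free_mon R u = (\<lambda>w. if w = u then \<one>\<^bsub>R\<^esub> else \<zero>\<^bsub>R\<^esub>)"

lemma free_gen_eq: "free_gen R h = free_mon R [h]"
  by (simp add: free_gen_def free_mon_def)

lemma free_algebra_simps:
  "f \<in> carrier (free_algebra R X) \<longleftrightarrow>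
     (\<forall>w. f w \<in> carrier R) \<and> finite {w. f w \<noteq> \<zero>\<^bsub>R\<^esub>} \<and> {w. f w \<noteq> \<zero>\<^bsub>R\<^esub>} \<subseteq> lists X"
  "f \<otimes>\<^bsub>free_algebra R X\<^esub> g = conv R f g"
  "\<one>\<^bsub>free_algebra R X\<^esub> = free_mon R []"
  "\<zero>\<^bsub>free_algebra R X\<^esub> = (\<lambda>w. \<zero>\<^bsub>R\<^esub>)"
  "f \<oplus>\<^bsub>free_algebra R X\<^esub> g = (\<lambda>w. f w \<oplus>\<^bsub>R\<^esub> g w)"
  "c \<odot>\<^bsub>free_algebra R X\<^esub> f = (\<lambda>w. c \<otimes>\<^bsub>R\<^esub> f w)"
  by (simp_all add: free_algebra_def conv_def fun_eq_iff free_mon_def)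

locale free_alg = cring R for R :: "'k ring" (structure) and X :: "'h set"
begin

abbreviation "F \<equiv> free_algebra R X"

lemma conv_closed [simp]:
  "(\<And>w. f w \<in> carrier R) \<Longrightarrow> (\<And>w. g w \<in> carrier R) \<Longrightarrow> conv R f g w \<in> carrier R"
  unfolding conv_def by (intro finsum_closed) auto

lemma conv_Nil [simp]:
  "(\<And>w. f w \<in> carrier R) \<Longrightarrow> (\<And>w. g w \<in> carrier R) \<Longrightarrow> conv R f g [] = f [] \<otimes> g []"
  by (simp add: conv_def)

lemma conv_Cons [simp]:
  assumes "\<And>w. f w \<in> carrier R" "\<And>w. g w \<in> carrier R"
  shows "conv R f g (x # w) = f [] \<otimes> g (x # w) \<oplus> conv R (\<lambda>u. f (x # u)) g w"
proof -
  let ?t = "\<lambda>i. f (take i (x # w)) \<otimes> g (drop i (x # w))"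
  have "conv R f g (x # w) = (\<Oplus>i\<in>{..Suc (length w)}. ?t i)"
    by (simp add: conv_def)
  also have "\<dots> = (\<Oplus>i\<in>{..length w}. ?t (Suc i)) \<oplus> ?t 0"
    by (rule finsum_Suc2) (use assms in auto)
  also have "(\<Oplus>i\<in>{..length w}. ?t (Suc i)) = conv R (\<lambda>u. f (x # u)) g w"
    by (simp add: conv_def)
  finally show ?thesis
    using assms by (simp add: a_comm)
qed

lemma conv_zero_left: "(\<And>w. g w \<in> carrier R) \<Longrightarrow> conv R (\<lambda>w. \<zero>) g w = \<zero>"
  by (induction w) simp_all

lemma conv_add_left:
  "(\<And>w. f w \<in> carrier R) \<Longrightarrow> (\<And>w. f' w \<in> carrier R) \<Longrightarrow> (\<And>w. g w \<in> carrier R) \<Longrightarrow>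
    conv R (\<lambda>w. f w \<oplus> f' w) g w = conv R f g w \<oplus> conv R f' g w"
  by (induction w arbitrary: f f') (simp_all add: l_distr a_ac)

lemma conv_add_right:
  "(\<And>w. f w \<in> carrier R) \<Longrightarrow> (\<And>w. g' w \<in> carrier R) \<Longrightarrow> (\<And>w. g w \<in> carrier R) \<Longrightarrow>
    conv R f (\<lambda>w. g w \<oplus> g' w) w = conv R f g w \<oplus> conv R f g' w"
  by (induction w arbitrary: f) (simp_all add: r_distr a_ac)

lemma conv_smult_left:
  "(\<And>w. f w \<in> carrier R) \<Longrightarrow> (\<And>w. g w \<in> carrier R) \<Longrightarrow> c \<in> carrier R \<Longrightarrow>
    conv R (\<lambda>w. c \<otimes> f w) g w = c \<otimes> conv R f g w"
  by (induction w arbitrary: f) (simp_all add: r_distr m_assoc)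

lemma conv_smult_right:
  "(\<And>w. f w \<in> carrier R) \<Longrightarrow> (\<And>w. g w \<in> carrier R) \<Longrightarrow> c \<in> carrier R \<Longrightarrow>
    conv R f (\<lambda>w. c \<otimes> g w) w = c \<otimes> conv R f g w"
  by (induction w arbitrary: f) (simp_all add: r_distr m_lcomm)

text \<open>Peeling off a letter replaces \<open>f\<close> by a shifted function, so the induction
  on the word has to range over all \<open>f\<close>.\<close>

lemma conv_assoc:
  "(\<And>w. f w \<in> carrier R) \<Longrightarrow> (\<And>w. g w \<in> carrier R) \<Longrightarrow> (\<And>w. h w \<in> carrier R) \<Longrightarrow>
    conv R (conv R f g) h w = conv R f (conv R g h) w"
proof (induction w arbitrary: f)
  case (Cons x w)
  then have "conv R (\<lambda>u. conv R f g (x # u)) h w =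
      f [] \<otimes> conv R (\<lambda>u. g (x # u)) h w \<oplus> conv R (conv R (\<lambda>u. f (x # u)) g) h w"
    by (simp add: conv_add_left conv_smult_left)
  with Cons show ?case
    by (simp add: r_distr m_assoc a_assoc)
qed (simp add: m_assoc)

lemma free_mon_closed [simp]: "free_mon R u w \<in> carrier R"
  by (simp add: free_mon_def)

lemma conv_one_left:
  assumes "\<And>w. g w \<in> carrier R"
  shows "conv R (free_mon R []) g w = g w"
proof (cases w)
  case (Cons x u)
  have "(\<lambda>z. free_mon R [] (x # z)) = (\<lambda>z. \<zero>)" by (simp add: free_mon_def)
  with Cons assms show ?thesis by (simp add: conv_zero_left) (simp add: free_mon_def)
qed (use assms in \<open>simp add: free_mon_def\<close>)

lemma conv_one_right: "(\<And>w. f w \<in> carrier R) \<Longrightarrow> conv R f (free_mon R []) w = f w"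
proof (induction w arbitrary: f)
  case (Cons x w)
  then have "f [] \<otimes> free_mon R [] (x # w) = \<zero>" by (simp add: free_mon_def)
  with Cons show ?case by simp
qed (simp add: free_mon_def)

lemma free_mon_carrier [simp]: "u \<in> lists X \<Longrightarrow> free_mon R u \<in> carrier F"
  by (auto simp: free_algebra_simps free_mon_def)

lemma conv_free_mon: "conv R (free_mon R u) (free_mon R v) w = free_mon R (u @ v) w"
proof (induction u arbitrary: w)
  case Nil
  then show ?case by (simp add: conv_one_left)
next
  case (Cons x u)
  show ?case
  proof (cases w)
    case w: (Cons y w')
    have "(\<lambda>z. free_mon R (x # u) (y # z)) = (if x = y then free_mon R u else (\<lambda>z. \<zero>))"
      by (auto simp: free_mon_def)
    moreover have "free_mon R (x # u) [] = \<zero>" "free_mon R ((x # u) @ v) (y # w') =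
        (if x = y then free_mon R (u @ v) w' else \<zero>)"
      by (simp_all add: free_mon_def)
    ultimately show ?thesis
      using w by (simp add: conv_zero_left Cons.IH)
  qed (simp add: free_mon_def)
qed

text \<open>A nonzero value at w requires a cut of w with nonzero values on both parts; this keeps
  supports finite.\<close>

lemma supp_conv:
  assumes "\<And>w. f w \<in> carrier R" "\<And>w. g w \<in> carrier R"
  shows "{w. conv R f g w \<noteq> \<zero>} \<subseteq> (\<lambda>(u, v). u @ v) ` ({w. f w \<noteq> \<zero>} \<times> {w. g w \<noteq> \<zero>})"
proof
  fix w assume w: "w \<in> {w. conv R f g w \<noteq> \<zero>}"
  have "\<exists>i\<le>length w. f (take i w) \<otimes> g (drop i w) \<noteq> \<zero>"
  proof (rule ccontr)
    assume "\<not> ?thesis"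
    then have "conv R f g w = (\<Oplus>i\<in>{..length w}. \<zero>)"
      unfolding conv_def by (intro finsum_cong') auto
    with w show False by simp
  qed
  then obtain i where "f (take i w) \<otimes> g (drop i w) \<noteq> \<zero>" by blast
  then have "f (take i w) \<noteq> \<zero>" "g (drop i w) \<noteq> \<zero>"
    using assms by auto
  then show "w \<in> (\<lambda>(u, v). u @ v) ` ({w. f w \<noteq> \<zero>} \<times> {w. g w \<noteq> \<zero>})"
    by (intro image_eqI[of _ _ "(take i w, drop i w)"]) auto
qed

lemma F_carrierD:
  assumes "f \<in> carrier F"
  shows "f w \<in> carrier R" "finite {w. f w \<noteq> \<zero>}" "{w. f w \<noteq> \<zero>} \<subseteq> lists X"
  using assms unfolding free_algebra_simps by blast+

lemma F_carrierI:
  assumes "\<And>w. f w \<in> carrier R" "{w. f w \<noteq> \<zero>} \<subseteq> W" "finite W" "W \<subseteq> lists X"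
  shows "f \<in> carrier F"
  using assms finite_subset[OF assms(2,3)] order_trans[OF assms(2,4)] unfolding free_algebra_simps
  by blast

lemma conv_carrier:
  assumes "f \<in> carrier F" "g \<in> carrier F"
  shows "conv R f g \<in> carrier F"
proof (rule F_carrierI)
  show "{w. conv R f g w \<noteq> \<zero>} \<subseteq> (\<lambda>(u, v). u @ v) ` ({w. f w \<noteq> \<zero>} \<times> {w. g w \<noteq> \<zero>})"
    by (intro supp_conv F_carrierD assms)
  show "finite ((\<lambda>(u, v). u @ v) ` ({w. f w \<noteq> \<zero>} \<times> {w. g w \<noteq> \<zero>}))"
    by (intro finite_imageI finite_cartesian_product F_carrierD assms)
  show "(\<lambda>(u, v). u @ v) ` ({w. f w \<noteq> \<zero>} \<times> {w. g w \<noteq> \<zero>}) \<subseteq> lists X"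
    using F_carrierD(3)[OF assms(1)] F_carrierD(3)[OF assms(2)] by fastforce
qed (simp add: F_carrierD(1) assms)

lemma add_carrier:
  assumes "f \<in> carrier F" "g \<in> carrier F"
  shows "(\<lambda>w. f w \<oplus> g w) \<in> carrier F"
proof (rule F_carrierI)
  show "{w. f w \<oplus> g w \<noteq> \<zero>} \<subseteq> {w. f w \<noteq> \<zero>} \<union> {w. g w \<noteq> \<zero>}" by auto
  show "finite ({w. f w \<noteq> \<zero>} \<union> {w. g w \<noteq> \<zero>})" by (intro finite_UnI F_carrierD assms)
  show "{w. f w \<noteq> \<zero>} \<union> {w. g w \<noteq> \<zero>} \<subseteq> lists X" by (intro Un_least F_carrierD assms)
qed (simp add: F_carrierD(1) assms)

lemma smult_carrier:
  assumes "c \<in> carrier R" "f \<in> carrier F"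
  shows "(\<lambda>w. c \<otimes> f w) \<in> carrier F"
proof (rule F_carrierI)
  show "{w. c \<otimes> f w \<noteq> \<zero>} \<subseteq> {w. f w \<noteq> \<zero>}" using assms(1) by auto
qed (use assms F_carrierD(1)[OF assms(2)] F_carrierD(2,3)[OF assms(2)] in simp_all)

lemmas F_closed = F_carrierD(1)

lemma free_algebra_assoc_algebra: "assoc_algebra R F"
proof (intro assoc_algebraI moduleI abelian_groupI monoidI)
  fix f assume f: "f \<in> carrier F"
  have "(\<lambda>w. (\<ominus> \<one>) \<otimes> f w) \<oplus>\<^bsub>F\<^esub> f = \<zero>\<^bsub>F\<^esub>"
    using F_closed[OF f] by (simp add: free_algebra_simps(2-) l_minus l_neg)
  then show "\<exists>g\<in>carrier F. g \<oplus>\<^bsub>F\<^esub> f = \<zero>\<^bsub>F\<^esub>"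
    using smult_carrier[OF _ f, of "\<ominus> \<one>"] by auto
next
  fix c d f assume "c \<in> carrier R" "d \<in> carrier R" "f \<in> carrier F"
  then show "(c \<oplus> d) \<odot>\<^bsub>F\<^esub> f = c \<odot>\<^bsub>F\<^esub> f \<oplus>\<^bsub>F\<^esub> d \<odot>\<^bsub>F\<^esub> f"
    by (simp add: free_algebra_simps(2-) F_closed l_distr)
next
  show "\<zero>\<^bsub>F\<^esub> \<in> carrier F" by (simp add: free_algebra_simps)
next
  show "\<one>\<^bsub>F\<^esub> \<in> carrier F" by (simp add: free_algebra_simps(3))
next
  fix f g assume "f \<in> carrier F" "g \<in> carrier F"
  then show "f \<oplus>\<^bsub>F\<^esub> g = g \<oplus>\<^bsub>F\<^esub> f"
    by (simp add: free_algebra_simps(2-) F_closed a_comm)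
qed (simp_all add: free_algebra_simps(2-) F_closed fun_eq_iff conv_carrier add_carrier smult_carrier
    conv_one_left conv_one_right conv_assoc conv_add_left conv_add_right conv_smult_left
    conv_smult_right r_distr m_assoc is_cring a_assoc)

text \<open>Induction on a finite set that contains the support; one word with its coefficient is
  split off at a time.\<close>

lemma free_algebra_induct [consumes 1, case_names mon zero add smult]:
  assumes f: "f \<in> carrier F"
    and mon: "\<And>w. w \<in> lists X \<Longrightarrow> Q (free_mon R w)" and zero: "Q \<zero>\<^bsub>F\<^esub>"
    and add: "\<And>f g. f \<in> carrier F \<Longrightarrow> g \<in> carrier F \<Longrightarrow> Q f \<Longrightarrow> Q g \<Longrightarrow> Q (f \<oplus>\<^bsub>F\<^esub> g)"
    and smult: "\<And>c f. c \<in> carrier R \<Longrightarrow> f \<in> carrier F \<Longrightarrow> Q f \<Longrightarrow> Q (c \<odot>\<^bsub>F\<^esub> f)"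
  shows "Q f"
proof -
  have "Q f" if "finite W" "W \<subseteq> lists X" "f \<in> carrier F" "{w. f w \<noteq> \<zero>} \<subseteq> W" for W f
    using that
  proof (induction W arbitrary: f rule: finite_induct)
    case empty
    then have "f = \<zero>\<^bsub>F\<^esub>" by (auto simp: free_algebra_simps)
    with zero show ?case by simp
  next
    case (insert u W)
    let ?f = "\<lambda>w. if w = u then \<zero> else f w"
    note f = F_carrierD[OF insert.prems(2)]
    have u: "u \<in> lists X" "W \<subseteq> lists X" using insert.prems(1) by simp_all
    have supp: "{w. ?f w \<noteq> \<zero>} = {w. f w \<noteq> \<zero>} - {u}" by auto
    have f': "?f \<in> carrier F"
      by (rule F_carrierI[of _ "{w. f w \<noteq> \<zero>}"]) (use f in auto)
    have "Q ?f"
    proof (rule insert.IH)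
      show "{w. ?f w \<noteq> \<zero>} \<subseteq> W" unfolding supp using insert.prems(3) by blast
    qed (rule u f')+
    moreover have "Q (f u \<odot>\<^bsub>F\<^esub> free_mon R u)"
      using u(1) by (intro smult mon f(1)) simp_all
    moreover have "f = ?f \<oplus>\<^bsub>F\<^esub> (f u \<odot>\<^bsub>F\<^esub> free_mon R u)"
      using f(1) by (auto simp: free_algebra_simps free_mon_def fun_eq_iff)
    moreover have "f u \<odot>\<^bsub>F\<^esub> free_mon R u \<in> carrier F"
      using u(1) f(1) by (simp add: free_algebra_simps(6) smult_carrier)
    ultimately show ?case
      using add[OF f', of "f u \<odot>\<^bsub>F\<^esub> free_mon R u"] by simp
  qed
  from this[OF F_carrierD(2,3)[OF f] f order_refl] show ?thesis .
qed

text \<open>The value on words is forced and is extended as a finite sum over the support. Sums with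
  different supports are compared over a common finite set (\<open>\<phi>_W\<close>), and
  multiplicativity is reduced to words one factor at a time.\<close>

lemma free_algebra_universal:
  assumes B: "assoc_algebra R B" and g: "g \<in> X \<rightarrow> carrier B"
  obtains \<phi> where "alg_hom R F B \<phi>" "\<And>w. w \<in> lists X \<Longrightarrow> \<phi> (free_mon R w) = prod_of B (map g w)"
proof -
  interpret B: assoc_algebra R B by fact
  interpret F: assoc_algebra R F by (rule free_algebra_assoc_algebra)
  let ?p = "\<lambda>w. prod_of B (map g w)"
  have pc: "?p w \<in> carrier B" if "w \<in> lists X" for w
    using that g by (intro B.M.prod_of_closed) auto
  define \<phi> where "\<phi> f = (\<Oplus>\<^bsub>B\<^esub>w\<in>{w. f w \<noteq> \<zero>}. f w \<odot>\<^bsub>B\<^esub> ?p w)" for f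
  have \<phi>_W: "\<phi> f = (\<Oplus>\<^bsub>B\<^esub>w\<in>W. f w \<odot>\<^bsub>B\<^esub> ?p w)"
    if "finite W" "W \<subseteq> lists X" "f \<in> carrier F" "{w. f w \<noteq> \<zero>} \<subseteq> W" for W f
    unfolding \<phi>_def
  proof (rule B.M.add.finprod_mono_neutral_cong_left[OF that(1,4)])
    show "f i \<odot>\<^bsub>B\<^esub> ?p i = \<zero>\<^bsub>B\<^esub>" if "i \<in> W - {w. f w \<noteq> \<zero>}" for i
      using that pc[of i] subsetD[OF \<open>W \<subseteq> lists X\<close>, of i] by simp
    show "(\<lambda>w. f w \<odot>\<^bsub>B\<^esub> ?p w) \<in> W \<rightarrow> carrier B"
      by (intro Pi_I B.smult_closed F_closed[OF that(3)] pc subsetD[OF that(2)])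
  qed simp
  have lin: "lin_map R F B \<phi>"
  proof (rule lin_mapI)
    show "\<phi> f \<in> carrier B" if f: "f \<in> carrier F" for f
      unfolding \<phi>_def
      by (intro B.M.finsum_closed Pi_I B.smult_closed F_closed[OF f] pc subsetD[OF F_carrierD(3)[OF f]])
    show "\<phi> (f \<oplus>\<^bsub>F\<^esub> h) = \<phi> f \<oplus>\<^bsub>B\<^esub> \<phi> h" if fh: "f \<in> carrier F" "h \<in> carrier F" for f h
    proof -
      let ?W = "{w. f w \<noteq> \<zero>} \<union> {w. h w \<noteq> \<zero>}"
      have W: "finite ?W" "?W \<subseteq> lists X"
        using F_carrierD(2,3)[OF fh(1)] F_carrierD(2,3)[OF fh(2)] by simp_all
      have pW: "?p w \<in> carrier B" if "w \<in> ?W" for w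
        using pc W(2) that by blast
      have sub: "{w. (f \<oplus>\<^bsub>F\<^esub> h) w \<noteq> \<zero>} \<subseteq> ?W" by (auto simp: free_algebra_simps)
      have "\<phi> (f \<oplus>\<^bsub>F\<^esub> h) = (\<Oplus>\<^bsub>B\<^esub>w\<in>?W. f w \<odot>\<^bsub>B\<^esub> ?p w \<oplus>\<^bsub>B\<^esub> h w \<odot>\<^bsub>B\<^esub> ?p w)"
        unfolding \<phi>_W[OF W F.M.a_closed[OF fh] sub]
        using pW F_closed[OF fh(1)] F_closed[OF fh(2)]
        by (intro B.M.finsum_cong') (simp_all add: free_algebra_simps(5) B.smult_l_distr)
      also have "\<dots> = \<phi> f \<oplus>\<^bsub>B\<^esub> \<phi> h"
        unfolding \<phi>_W[OF W fh(1) Un_upper1] \<phi>_W[OF W fh(2) Un_upper2]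
        using pW F_closed[OF fh(1)] F_closed[OF fh(2)]
        by (intro B.M.finsum_addf) simp_all
      finally show ?thesis .
    qed
    show "\<phi> (c \<odot>\<^bsub>F\<^esub> f) = c \<odot>\<^bsub>B\<^esub> \<phi> f" if cf: "c \<in> carrier R" "f \<in> carrier F" for c f
    proof -
      let ?W = "{w. f w \<noteq> \<zero>}"
      note W = F_carrierD(2,3)[OF cf(2)]
      have pW: "?p w \<in> carrier B" if "w \<in> ?W" for w
        using pc W(2) that by blast
      have sub: "{w. (c \<odot>\<^bsub>F\<^esub> f) w \<noteq> \<zero>} \<subseteq> ?W" using cf by (auto simp: free_algebra_simps)
      have "\<phi> (c \<odot>\<^bsub>F\<^esub> f) = (\<Oplus>\<^bsub>B\<^esub>w\<in>?W. c \<odot>\<^bsub>B\<^esub> (f w \<odot>\<^bsub>B\<^esub> ?p w))"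
        unfolding \<phi>_W[OF W F.smult_closed[OF cf] sub]
        using pW F_closed[OF cf(2)] cf(1)
        by (intro B.M.finsum_cong') (simp_all add: free_algebra_simps(6) B.smult_assoc1)
      also have "\<dots> = c \<odot>\<^bsub>B\<^esub> \<phi> f"
        unfolding \<phi>_def using W pW cf(1) F_closed[OF cf(2)]
        by (intro B.finsum_smult_ldistr[symmetric]) simp_all
      finally show ?thesis .
    qed
  qed
  have \<phi>_mon: "\<phi> (free_mon R w) = ?p w" if w: "w \<in> lists X" for w
  proof -
    have "\<phi> (free_mon R w) = (\<Oplus>\<^bsub>B\<^esub>v\<in>{w}. free_mon R w v \<odot>\<^bsub>B\<^esub> ?p v)"
      by (rule \<phi>_W) (use w free_mon_carrier[OF w] in \<open>auto simp: free_mon_def\<close>)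
    then show ?thesis
      using pc[OF w] by (simp add: free_mon_def)
  qed
  note l = lin_map_closed[OF lin] lin_map_add[OF lin] lin_map_smult[OF lin]
  note zero = additive_map_zero[OF lin_map_additive[OF lin] F.M.abelian_group_axioms B.M.abelian_group_axioms]
  have mult_mon: "\<phi> (free_mon R u \<otimes>\<^bsub>F\<^esub> h) = \<phi> (free_mon R u) \<otimes>\<^bsub>B\<^esub> \<phi> h"
    if u: "u \<in> lists X" and h: "h \<in> carrier F" for u h
    using h u
  proof (induction rule: free_algebra_induct)
    case (mon v)
    have "free_mon R u \<otimes>\<^bsub>F\<^esub> free_mon R v = free_mon R (u @ v)"
      by (simp add: free_algebra_simps(2) conv_free_mon fun_eq_iff)
    moreover have "?p (u @ v) = ?p u \<otimes>\<^bsub>B\<^esub> ?p v"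
      unfolding map_append using mon g by (intro B.M.prod_of_append) auto
    ultimately show ?case
      using mon \<phi>_mon[of "u @ v"] \<phi>_mon[of u] \<phi>_mon[of v] by simp
  qed (simp_all add: zero l F.M.r_distr B.M.r_distr F.smult_mult_right B.smult_mult_right)
  have "alg_hom R F B \<phi>"
  proof (intro alg_homI lin)
    show "\<phi> (f \<otimes>\<^bsub>F\<^esub> h) = \<phi> f \<otimes>\<^bsub>B\<^esub> \<phi> h" if f: "f \<in> carrier F" and h: "h \<in> carrier F" for f h
      using f h
    proof (induction rule: free_algebra_induct)
      case (mon u)
      then show ?case by (rule mult_mon)
    qed (simp_all add: zero l F.M.l_distr B.M.l_distr F.smult_mult_left B.smult_mult_left)
    show "\<phi> \<one>\<^bsub>F\<^esub> = \<one>\<^bsub>B\<^esub>"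
      using \<phi>_mon[of "[]"] by (simp add: free_algebra_simps)
  qed
  with \<phi>_mon that show thesis by blast
qed

end

section \<open>The algebra \<open>H\<^sub>p\<^sub>a\<^sub>r\<close>\<close>

context bij_hopf_algebra
begin

text \<open>Partial representations of the Hopf algebra; \<open>Hpar R H\<close> is the universal
  target for them, see \<open>partial_rep_cl\<close> and \<open>Hpar_universal\<close>.\<close>

definition partial_rep :: "('k, 'b, 'z) module_scheme \<Rightarrow> ('h \<Rightarrow> 'b) \<Rightarrow> bool" where
  "partial_rep C \<pi> \<longleftrightarrow> lin C \<pi> \<and> \<pi> \<one>\<^sub>H = \<one>\<^bsub>C\<^esub> \<and> (\<forall>h\<in>carrier H. \<forall>l\<in>carrier H.
     SW C (\<lambda>x y. \<pi> h \<otimes>\<^bsub>C\<^esub> \<pi> x \<otimes>\<^bsub>C\<^esub> \<pi> (S y)) l = SW C (\<lambda>x y. \<pi> (h \<cdot> x) \<otimes>\<^bsub>C\<^esub> \<pi> (S y)) l \<and>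
     SW C (\<lambda>x y. \<pi> x \<otimes>\<^bsub>C\<^esub> \<pi> (S y) \<otimes>\<^bsub>C\<^esub> \<pi> l) h = SW C (\<lambda>x y. \<pi> x \<otimes>\<^bsub>C\<^esub> \<pi> (S y \<cdot> l)) h \<and>
     SW C (\<lambda>x y. \<pi> h \<otimes>\<^bsub>C\<^esub> \<pi> (S x) \<otimes>\<^bsub>C\<^esub> \<pi> y) l = SW C (\<lambda>x y. \<pi> (h \<cdot> S x) \<otimes>\<^bsub>C\<^esub> \<pi> y) l \<and>
     SW C (\<lambda>x y. \<pi> (S x) \<otimes>\<^bsub>C\<^esub> \<pi> y \<otimes>\<^bsub>C\<^esub> \<pi> l) h = SW C (\<lambda>x y. \<pi> (S x) \<otimes>\<^bsub>C\<^esub> \<pi> (y \<cdot> l)) h)"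

sublocale Fr: free_alg R "carrier H"
  by (intro free_alg.intro HA.is_cring)

abbreviation "TH \<equiv> tensor_algebra R H"
abbreviation "P \<equiv> Hpar R H"
abbreviation "cl \<equiv> cls R H"
abbreviation "gen_T \<equiv> tensor_gen R H"
abbreviation "proj_T f \<equiv> lin_ideal R H +>\<^bsub>Fr.F\<^esub> f"
abbreviation "proj_P X \<equiv> par_ideal R H +>\<^bsub>TH\<^esub> X"

lemma algF: "assoc_algebra R Fr.F"
  by (rule Fr.free_algebra_assoc_algebra)

lemma free_gen_carrier [simp]: "h \<in> carrier H \<Longrightarrow> free_gen R h \<in> carrier Fr.F"
  by (simp add: free_gen_eq)

lemma lin_rels_carrier: "lin_rels R H \<subseteq> carrier Fr.F"
proof -
  interpret F: assoc_algebra R Fr.F by (rule algF)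
  show ?thesis
    unfolding lin_rels_def Let_def
    by (intro Un_least subsetI; elim CollectE exE conjE; simp)
qed

lemma ideal_T: "algebra_ideal R Fr.F (lin_ideal R H)"
proof -
  interpret F: assoc_algebra R Fr.F by (rule algF)
  show ?thesis
    unfolding lin_ideal_def
    by (rule algebra_ideal.intro[OF algF F.M.genideal_ideal[OF lin_rels_carrier]])
qed

lemma algT: "assoc_algebra R TH"
  and proj_T: "alg_hom R Fr.F TH (\<lambda>f. proj_T f)"
  and carrier_T: "carrier TH = (\<lambda>f. proj_T f) ` carrier Fr.F"
  unfolding tensor_algebra_def
  using algebra_ideal.quot_assoc_algebra[OF ideal_T] algebra_ideal.quot_proj[OF ideal_T]
    algebra_ideal.quot_carrier[OF ideal_T] by simp_all

lemma gen_T_lin: "lin TH gen_T"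
proof -
  interpret F: assoc_algebra R Fr.F by (rule algF)
  have rel: "proj_T a = proj_T b"
    if "a \<in> carrier Fr.F" "b \<in> carrier Fr.F" "a \<ominus>\<^bsub>Fr.F\<^esub> b \<in> lin_rels R H" for a b
    using that F.M.genideal_self[OF lin_rels_carrier] algebra_ideal.coset_eq_iff[OF ideal_T that(1,2)]
    by (auto simp: lin_ideal_def)
  note l = alg_hom_lin[OF proj_T]
  show ?thesis
  proof (rule lin_mapI)
    show "gen_T h \<in> carrier TH" if "h \<in> carrier H" for h
      using that by (simp add: tensor_gen_def lin_map_closed[OF l])
    show "gen_T (x \<oplus>\<^bsub>H\<^esub> y) = gen_T x \<oplus>\<^bsub>TH\<^esub> gen_T y" if "x \<in> carrier H" "y \<in> carrier H" for x y
    proof -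
      have "proj_T (free_gen R (x \<oplus>\<^bsub>H\<^esub> y)) = proj_T (free_gen R x \<oplus>\<^bsub>Fr.F\<^esub> free_gen R y)"
        using that by (intro rel) (auto simp: lin_rels_def Let_def)
      with that show ?thesis by (simp add: tensor_gen_def lin_map_add[OF l])
    qed
    show "gen_T (c \<odot>\<^bsub>H\<^esub> x) = c \<odot>\<^bsub>TH\<^esub> gen_T x" if "c \<in> carrier R" "x \<in> carrier H" for c x
    proof -
      have "proj_T (free_gen R (c \<odot>\<^bsub>H\<^esub> x)) = proj_T (c \<odot>\<^bsub>Fr.F\<^esub> free_gen R x)"
        using that by (intro rel) (auto simp: lin_rels_def Let_def)
      with that show ?thesis by (simp add: tensor_gen_def lin_map_smult[OF l])
    qed
  qed
qed

lemma gen_T_closed [simp]: "h \<in> carrier H \<Longrightarrow> gen_T h \<in> carrier TH"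
  by (rule lin_map_closed[OF gen_T_lin])

text \<open>The relations as pairs of sides instead of differences: that a homomorphism kills a
  relation then reads as agreement on the two sides.\<close>

definition par_pairs where
  "par_pairs = {(gen_T \<one>\<^sub>H, \<one>\<^bsub>TH\<^esub>)} \<union> (\<Union>h\<in>carrier H. \<Union>l\<in>carrier H.
     {(SW TH (\<lambda>x y. gen_T h \<otimes>\<^bsub>TH\<^esub> gen_T x \<otimes>\<^bsub>TH\<^esub> gen_T (S y)) l,
       SW TH (\<lambda>x y. gen_T (h \<cdot> x) \<otimes>\<^bsub>TH\<^esub> gen_T (S y)) l),
      (SW TH (\<lambda>x y. gen_T x \<otimes>\<^bsub>TH\<^esub> gen_T (S y) \<otimes>\<^bsub>TH\<^esub> gen_T l) h,
       SW TH (\<lambda>x y. gen_T x \<otimes>\<^bsub>TH\<^esub> gen_T (S y \<cdot> l)) h),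
      (SW TH (\<lambda>x y. gen_T h \<otimes>\<^bsub>TH\<^esub> gen_T (S x) \<otimes>\<^bsub>TH\<^esub> gen_T y) l,
       SW TH (\<lambda>x y. gen_T (h \<cdot> S x) \<otimes>\<^bsub>TH\<^esub> gen_T y) l),
      (SW TH (\<lambda>x y. gen_T (S x) \<otimes>\<^bsub>TH\<^esub> gen_T y \<otimes>\<^bsub>TH\<^esub> gen_T l) h,
       SW TH (\<lambda>x y. gen_T (S x) \<otimes>\<^bsub>TH\<^esub> gen_T (y \<cdot> l)) h)})"

lemma par_rels_eq: "par_rels R H = (\<lambda>(a, b). a \<ominus>\<^bsub>TH\<^esub> b) ` par_pairs"
  unfolding par_rels_def par_pairs_def Let_def image_Un image_UN by simp

lemma par_pairs_carrier: "(a, b) \<in> par_pairs \<Longrightarrow> a \<in> carrier TH \<and> b \<in> carrier TH"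
proof -
  interpret T: assoc_algebra R TH by (rule algT)
  assume "(a, b) \<in> par_pairs"
  then show ?thesis
    unfolding par_pairs_def by (auto intro!: SW_closed T.M.abelian_group_axioms)
qed

lemma par_rels_carrier: "par_rels R H \<subseteq> carrier TH"
proof -
  interpret T: assoc_algebra R TH by (rule algT)
  show ?thesis
    unfolding par_rels_eq using par_pairs_carrier by auto
qed

lemma ideal_P: "algebra_ideal R TH (par_ideal R H)"
proof -
  interpret T: assoc_algebra R TH by (rule algT)
  show ?thesis
    unfolding par_ideal_def
    by (rule algebra_ideal.intro[OF algT T.M.genideal_ideal[OF par_rels_carrier]])
qed

lemma algP [simp]: "assoc_algebra R P"
  and proj_P: "alg_hom R TH P (\<lambda>X. proj_P X)"
  and carrier_P: "carrier P = (\<lambda>X. proj_P X) ` carrier TH"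
  unfolding Hpar_def
  using algebra_ideal.quot_assoc_algebra[OF ideal_P] algebra_ideal.quot_proj[OF ideal_P]
    algebra_ideal.quot_carrier[OF ideal_P] by simp_all

sublocale PA: assoc_algebra R "Hpar R H" by (rule algP)

lemma modP [simp]: "module R P" by (rule PA.module_axioms)
lemma abP [simp]: "abelian_group P" by (rule PA.abelian_group_axioms)

lemma cl_eq: "cl h = proj_P (gen_T h)"
  by (simp add: cls_def)

lemma cl_lin: "lin P cl"
  unfolding cl_eq by (rule lin_map_comp[OF alg_hom_lin[OF proj_P] gen_T_lin])

lemma cl_closed [simp]: "h \<in> carrier H \<Longrightarrow> cl h \<in> carrier P"
  by (rule lin_map_closed[OF cl_lin])

lemmas lin_map_cl [lin_intros] = lin_map_comp[OF cl_lin]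

text \<open>Used in both directions: for the projection onto \<open>P\<close> it shows that
  \<open>cl\<close> is a partial representation, and for a given partial representation it shows
  that the induced map respects the relations.\<close>

lemma par_pairs_image:
  assumes C: "assoc_algebra R C" and \<phi>: "alg_hom R TH C \<phi>"
    and \<pi>: "\<And>h. h \<in> carrier H \<Longrightarrow> \<phi> (gen_T h) = \<pi> h" "\<And>h. h \<in> carrier H \<Longrightarrow> \<pi> h \<in> carrier C"
  shows "(\<forall>(a, b) \<in> par_pairs. \<phi> a = \<phi> b) \<longleftrightarrow> \<pi> \<one>\<^sub>H = \<one>\<^bsub>C\<^esub> \<and> (\<forall>h\<in>carrier H. \<forall>l\<in>carrier H.
     SW C (\<lambda>x y. \<pi> h \<otimes>\<^bsub>C\<^esub> \<pi> x \<otimes>\<^bsub>C\<^esub> \<pi> (S y)) l = SW C (\<lambda>x y. \<pi> (h \<cdot> x) \<otimes>\<^bsub>C\<^esub> \<pi> (S y)) l \<and>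
     SW C (\<lambda>x y. \<pi> x \<otimes>\<^bsub>C\<^esub> \<pi> (S y) \<otimes>\<^bsub>C\<^esub> \<pi> l) h = SW C (\<lambda>x y. \<pi> x \<otimes>\<^bsub>C\<^esub> \<pi> (S y \<cdot> l)) h \<and>
     SW C (\<lambda>x y. \<pi> h \<otimes>\<^bsub>C\<^esub> \<pi> (S x) \<otimes>\<^bsub>C\<^esub> \<pi> y) l = SW C (\<lambda>x y. \<pi> (h \<cdot> S x) \<otimes>\<^bsub>C\<^esub> \<pi> y) l \<and>
     SW C (\<lambda>x y. \<pi> (S x) \<otimes>\<^bsub>C\<^esub> \<pi> y \<otimes>\<^bsub>C\<^esub> \<pi> l) h = SW C (\<lambda>x y. \<pi> (S x) \<otimes>\<^bsub>C\<^esub> \<pi> (y \<cdot> l)) h)"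
proof -
  interpret T: assoc_algebra R TH by (rule algT)
  note modT = T.module_axioms and modB = assoc_algebra_module[OF C]
  have s: "\<phi> (SW TH (\<lambda>x y. gen_T (f x y) \<otimes>\<^bsub>TH\<^esub> gen_T (g x y) \<otimes>\<^bsub>TH\<^esub> gen_T (k x y)) w) =
      SW C (\<lambda>x y. \<pi> (f x y) \<otimes>\<^bsub>C\<^esub> \<pi> (g x y) \<otimes>\<^bsub>C\<^esub> \<pi> (k x y)) w"
      "\<phi> (SW TH (\<lambda>x y. gen_T (f x y) \<otimes>\<^bsub>TH\<^esub> gen_T (g x y)) w) =
      SW C (\<lambda>x y. \<pi> (f x y) \<otimes>\<^bsub>C\<^esub> \<pi> (g x y)) w"
    if "w \<in> carrier H" "\<And>x y. x \<in> carrier H \<Longrightarrow> y \<in> carrier H \<Longrightarrow> f x y \<in> carrier H"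
      "\<And>x y. x \<in> carrier H \<Longrightarrow> y \<in> carrier H \<Longrightarrow> g x y \<in> carrier H"
      "\<And>x y. x \<in> carrier H \<Longrightarrow> y \<in> carrier H \<Longrightarrow> k x y \<in> carrier H" for f g k w
    using that
    by (simp_all add: SW_lin_map[OF alg_hom_lin[OF \<phi>] modT modB] alg_hom_mult[OF \<phi>] \<pi>)
  have *: "(\<forall>(a, b) \<in> par_pairs. \<phi> a = \<phi> b) \<longleftrightarrow> \<phi> (gen_T \<one>\<^sub>H) = \<phi> \<one>\<^bsub>TH\<^esub> \<and>
      (\<forall>h\<in>carrier H. \<forall>l\<in>carrier H.
     \<phi> (SW TH (\<lambda>x y. gen_T h \<otimes>\<^bsub>TH\<^esub> gen_T x \<otimes>\<^bsub>TH\<^esub> gen_T (S y)) l) =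
       \<phi> (SW TH (\<lambda>x y. gen_T (h \<cdot> x) \<otimes>\<^bsub>TH\<^esub> gen_T (S y)) l) \<and>
     \<phi> (SW TH (\<lambda>x y. gen_T x \<otimes>\<^bsub>TH\<^esub> gen_T (S y) \<otimes>\<^bsub>TH\<^esub> gen_T l) h) =
       \<phi> (SW TH (\<lambda>x y. gen_T x \<otimes>\<^bsub>TH\<^esub> gen_T (S y \<cdot> l)) h) \<and>
     \<phi> (SW TH (\<lambda>x y. gen_T h \<otimes>\<^bsub>TH\<^esub> gen_T (S x) \<otimes>\<^bsub>TH\<^esub> gen_T y) l) =
       \<phi> (SW TH (\<lambda>x y. gen_T (h \<cdot> S x) \<otimes>\<^bsub>TH\<^esub> gen_T y) l) \<and>
     \<phi> (SW TH (\<lambda>x y. gen_T (S x) \<otimes>\<^bsub>TH\<^esub> gen_T y \<otimes>\<^bsub>TH\<^esub> gen_T l) h) =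
       \<phi> (SW TH (\<lambda>x y. gen_T (S x) \<otimes>\<^bsub>TH\<^esub> gen_T (y \<cdot> l)) h))"
    unfolding par_pairs_def ball_Un ball_UN by simp
  show ?thesis
    unfolding * by (simp add: s \<pi> alg_hom_one[OF \<phi>])
qed

lemma par_pairs_proj: "(a, b) \<in> par_pairs \<Longrightarrow> proj_P a = proj_P b"
proof -
  interpret T: assoc_algebra R TH by (rule algT)
  assume ab: "(a, b) \<in> par_pairs"
  then have "a \<ominus>\<^bsub>TH\<^esub> b \<in> par_rels R H" by (auto simp: par_rels_eq)
  then have "a \<ominus>\<^bsub>TH\<^esub> b \<in> par_ideal R H"
    using T.M.genideal_self[OF par_rels_carrier] by (auto simp: par_ideal_def)
  then show ?thesis
    using algebra_ideal.coset_eq_iff[OF ideal_P] par_pairs_carrier[OF ab] by simp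
qed

lemma partial_rep_cl: "partial_rep P cl"
  unfolding partial_rep_def
  using cl_lin par_pairs_proj par_pairs_image[OF algP proj_P cl_eq[symmetric] cl_closed]
  by auto

text \<open>Three extensions in a row: from generators to the free algebra, past the linearity
  relations to the tensor algebra, and past the partial relations to \<open>P\<close>.\<close>

lemma Hpar_universal:
  assumes C: "assoc_algebra R C" and \<pi>: "partial_rep C \<pi>"
  obtains \<phi> where "alg_hom R P C \<phi>" "\<And>h. h \<in> carrier H \<Longrightarrow> \<phi> (cl h) = \<pi> h"
proof -
  interpret C: assoc_algebra R C by fact
  interpret T: assoc_algebra R TH by (rule algT)
  have lin: "lin C \<pi>" using \<pi> by (simp add: partial_rep_def)
  note \<pi>c = lin_map_closed[OF lin]
  obtain \<phi>0 where \<phi>0: "alg_hom R Fr.F C \<phi>0"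
    and \<phi>0_mon: "\<And>w. w \<in> lists (carrier H) \<Longrightarrow> \<phi>0 (free_mon R w) = prod_of C (map \<pi> w)"
    using Fr.free_algebra_universal[OF C, of \<pi>] \<pi>c by blast
  have gen0: "\<phi>0 (free_gen R h) = \<pi> h" if "h \<in> carrier H" for h
    using that \<phi>0_mon[of "[h]"] \<pi>c by (simp add: free_gen_eq)
  have "\<phi>0 r = \<zero>\<^bsub>C\<^esub>" if "r \<in> lin_rels R H" for r
  proof -
    interpret F: assoc_algebra R Fr.F by (rule algF)
    note l = alg_hom_lin[OF \<phi>0]
    have diff: "\<phi>0 (a \<ominus>\<^bsub>Fr.F\<^esub> b) = \<zero>\<^bsub>C\<^esub>"
      if "a \<in> carrier Fr.F" "b \<in> carrier Fr.F" "\<phi>0 a = \<phi>0 b" for a b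
    proof -
      have "\<phi>0 (a \<ominus>\<^bsub>Fr.F\<^esub> b) \<oplus>\<^bsub>C\<^esub> \<phi>0 b = \<phi>0 a"
        using that lin_map_add[OF l, of "a \<ominus>\<^bsub>Fr.F\<^esub> b" b]
        by (simp add: F.M.minus_eq F.M.a_assoc F.M.l_neg)
      then show ?thesis
        using that lin_map_closed[OF l] by simp
    qed
    show ?thesis
      using that unfolding lin_rels_def Let_def
      by (elim UnE CollectE exE conjE; simp)
        (intro diff; simp add: gen0 lin_map_add[OF l] lin_map_smult[OF l] lin_map_add[OF lin]
          lin_map_smult[OF lin])+
  qed
  from assoc_algebra.quot_universal[OF algF lin_rels_carrier lin_ideal_def C \<phi>0 this]
  obtain \<phi>1 where \<phi>1: "alg_hom R TH C \<phi>1"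
    and \<phi>1_proj: "\<And>x. x \<in> carrier Fr.F \<Longrightarrow> \<phi>1 (proj_T x) = \<phi>0 x"
    unfolding tensor_algebra_def by metis
  have gen1: "\<phi>1 (gen_T h) = \<pi> h" if "h \<in> carrier H" for h
    using that by (simp add: tensor_gen_def \<phi>1_proj gen0)
  have eq: "\<phi>1 a = \<phi>1 b" if "(a, b) \<in> par_pairs" for a b
    using par_pairs_image[OF C \<phi>1 gen1 \<pi>c] \<pi> that unfolding partial_rep_def by auto
  have "\<phi>1 r = \<zero>\<^bsub>C\<^esub>" if r: "r \<in> par_rels R H" for r
  proof -
    obtain a b where ab: "(a, b) \<in> par_pairs" and r: "r = a \<ominus>\<^bsub>TH\<^esub> b"
      using r by (auto simp: par_rels_eq)
    note c = par_pairs_carrier[OF ab]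
    note l = alg_hom_lin[OF \<phi>1]
    have "\<phi>1 r \<oplus>\<^bsub>C\<^esub> \<phi>1 b = \<phi>1 a"
      using c lin_map_add[OF l, of "a \<ominus>\<^bsub>TH\<^esub> b" b] unfolding r
      by (simp add: T.M.minus_eq T.M.a_assoc T.M.l_neg)
    then show ?thesis
      using eq[OF ab] c lin_map_closed[OF l] unfolding r by simp
  qed
  from assoc_algebra.quot_universal[OF algT par_rels_carrier par_ideal_def C \<phi>1 this]
  obtain \<phi> where "alg_hom R P C \<phi>" "\<And>X. X \<in> carrier TH \<Longrightarrow> \<phi> (proj_P X) = \<phi>1 X"
    unfolding Hpar_def by metis
  then show thesis
    using that by (simp add: cl_eq gen1)
qed

abbreviation "word hs \<equiv> prod_of P (map cl hs)"

lemma word_closed [simp]: "hs \<in> lists (carrier H) \<Longrightarrow> word hs \<in> carrier P"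
  by (intro PA.M.prod_of_closed) auto

lemma word_append:
  "hs \<in> lists (carrier H) \<Longrightarrow> ks \<in> lists (carrier H) \<Longrightarrow> word (hs @ ks) = word hs \<otimes>\<^bsub>P\<^esub> word ks"
  unfolding map_append by (intro PA.M.prod_of_append) auto

lemma Hpar_induct [consumes 1, case_names word add smult]:
  assumes x: "x \<in> carrier P"
    and word: "\<And>hs. hs \<in> lists (carrier H) \<Longrightarrow> Q (word hs)"
    and add: "\<And>x y. x \<in> carrier P \<Longrightarrow> y \<in> carrier P \<Longrightarrow> Q x \<Longrightarrow> Q y \<Longrightarrow> Q (x \<oplus>\<^bsub>P\<^esub> y)"
    and smult: "\<And>c x. c \<in> carrier R \<Longrightarrow> x \<in> carrier P \<Longrightarrow> Q x \<Longrightarrow> Q (c \<odot>\<^bsub>P\<^esub> x)"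
  shows "Q x"
proof -
  interpret F: assoc_algebra R Fr.F by (rule algF)
  have p: "lin_map R Fr.F P (\<lambda>f. proj_P (proj_T f))"
    by (rule lin_map_comp[OF alg_hom_lin[OF proj_P] alg_hom_lin[OF proj_T]])
  have w: "proj_P (proj_T (free_mon R hs)) = word hs" if "hs \<in> lists (carrier H)" for hs
    using that
  proof (induction hs)
    case Nil
    then show ?case
      using alg_hom_one[OF proj_T] alg_hom_one[OF proj_P] by (simp add: free_algebra_simps)
  next
    case (Cons h hs)
    then have c: "free_mon R [h] \<in> carrier Fr.F" "free_mon R hs \<in> carrier Fr.F"
      by (auto intro: Fr.free_mon_carrier)
    have "free_mon R (h # hs) = free_mon R [h] \<otimes>\<^bsub>Fr.F\<^esub> free_mon R hs"
      by (simp add: free_algebra_simps(2) Fr.conv_free_mon fun_eq_iff)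
    with Cons c show ?case
      by (simp add: alg_hom_mult[OF proj_T] alg_hom_mult[OF proj_P] lin_map_closed[OF alg_hom_lin[OF proj_T]]
          cl_eq tensor_gen_def free_gen_eq)
  qed
  have "Q (proj_P (proj_T f))" if "f \<in> carrier Fr.F" for f
    using that
  proof (induction rule: Fr.free_algebra_induct)
    case (mon hs)
    then show ?case by (simp only: w word)
  next
    case zero
    have "Q (\<zero>\<^bsub>R\<^esub> \<odot>\<^bsub>P\<^esub> word [])"
      by (intro smult word) simp_all
    then show ?case
      using additive_map_zero[OF lin_map_additive[OF p] F.M.abelian_group_axioms abP] by simp
  next
    case (add f g)
    then show ?case by (simp add: lin_map_add[OF p] lin_map_closed[OF p] assms(3))
  next
    case (smult c f)
    then show ?case by (simp add: lin_map_smult[OF p] lin_map_closed[OF p] assms(4))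
  qed
  then show ?thesis
    using x by (auto simp: carrier_P carrier_T)
qed

lemma lin_map_Hpar_eqI:
  assumes "lin_map R P G f" "lin_map R P G g" "x \<in> carrier P"
    and "\<And>hs. hs \<in> lists (carrier H) \<Longrightarrow> f (word hs) = g (word hs)"
  shows "f x = g x"
  using assms(3)
  by (induction rule: Hpar_induct)
    (simp_all add: assms(4) lin_map_add[OF assms(1)] lin_map_add[OF assms(2)]
      lin_map_smult[OF assms(1)] lin_map_smult[OF assms(2)])

section \<open>Identities in \<open>H\<^sub>p\<^sub>a\<^sub>r\<close>\<close>

abbreviation mult_P (infixl "\<star>" 70) where "x \<star> y \<equiv> x \<otimes>\<^bsub>P\<^esub> y"
abbreviation "e \<equiv> eps R H"
abbreviation "e' \<equiv> eps' R H"

lemma SW_congI: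
  "h \<in> carrier H \<Longrightarrow> (\<And>x y. x \<in> carrier H \<Longrightarrow> y \<in> carrier H \<Longrightarrow> f x y = g x y) \<Longrightarrow>
    SW G f h = SW G g h"
  by (rule SW_cong[OF refl])

text \<open>Passes from (h1 h2)(h3 h4) to h1 ((h2 h3) h4): the two middle components, which come
  from different factors, become a pair that can be combined.\<close>

lemma SW_regroup:
  assumes "module R G" "h \<in> carrier H"
    and "\<And>b c d. b \<in> carrier H \<Longrightarrow> c \<in> carrier H \<Longrightarrow> d \<in> carrier H \<Longrightarrow> lin G (\<lambda>a. F a b c d)"
    and "\<And>a c d. a \<in> carrier H \<Longrightarrow> c \<in> carrier H \<Longrightarrow> d \<in> carrier H \<Longrightarrow> lin G (\<lambda>b. F a b c d)"
    and "\<And>a b d. a \<in> carrier H \<Longrightarrow> b \<in> carrier H \<Longrightarrow> d \<in> carrier H \<Longrightarrow> lin G (\<lambda>c. F a b c d)"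
    and "\<And>a b c. a \<in> carrier H \<Longrightarrow> b \<in> carrier H \<Longrightarrow> c \<in> carrier H \<Longrightarrow> lin G (\<lambda>d. F a b c d)"
  shows "SW G (\<lambda>x y. SW G (\<lambda>a b. SW G (\<lambda>c d. F a b c d) y) x) h =
    SW G (\<lambda>a v. SW G (\<lambda>w d. SW G (\<lambda>b c. F a b c d) w) v) h"
proof -
  have "SW G (\<lambda>x y. SW G (\<lambda>a b. SW G (\<lambda>c d. F a b c d) y) x) h =
      SW G (\<lambda>a v. SW G (\<lambda>b y. SW G (\<lambda>c d. F a b c d) y) v) h"
    by (rule SW_coassoc; (intro lin_intros assms)?; simp add: assms)
  also have "\<dots> = SW G (\<lambda>a v. SW G (\<lambda>w d. SW G (\<lambda>b c. F a b c d) w) v) h"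
    by (rule SW_congI[OF assms(2)], rule SW_coassoc[symmetric]; (intro lin_intros assms)?; simp add: assms)
  finally show ?thesis .
qed

lemma eps_eq: "e h = SW P (\<lambda>x y. cl x \<star> cl (S y)) h"
  and eps'_eq: "e' h = SW P (\<lambda>x y. cl (S x) \<star> cl y) h"
  by (simp_all add: eps_def eps'_def)

lemma eps_lin: "lin P e"
  unfolding eps_eq by (intro lin_intros; simp)

lemma eps'_lin: "lin P e'"
  unfolding eps'_eq by (intro lin_intros; simp)

lemmas lin_map_eps [lin_intros] = lin_map_comp[OF eps_lin] lin_map_comp[OF eps'_lin]

lemma eps_closed [simp]: "h \<in> carrier H \<Longrightarrow> e h \<in> carrier P" "h \<in> carrier H \<Longrightarrow> e' h \<in> carrier P"
  by (auto intro: lin_map_closed[OF eps_lin] lin_map_closed[OF eps'_lin])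

lemma cl_one [simp]: "cl \<one>\<^sub>H = \<one>\<^bsub>P\<^esub>"
  using partial_rep_cl by (simp add: partial_rep_def)

lemma partial_rep_relations:
  assumes "h \<in> carrier H" "l \<in> carrier H"
  shows cl_mult_eps: "cl h \<star> e l = SW P (\<lambda>x y. cl (h \<cdot> x) \<star> cl (S y)) l"
    and eps_mult_cl: "e h \<star> cl l = SW P (\<lambda>x y. cl x \<star> cl (S y \<cdot> l)) h"
    and cl_mult_eps': "cl h \<star> e' l = SW P (\<lambda>x y. cl (h \<cdot> S x) \<star> cl y) l"
    and eps'_mult_cl: "e' h \<star> cl l = SW P (\<lambda>x y. cl (S x) \<star> cl (y \<cdot> l)) h"
proof -
  have 1: "SW P (\<lambda>x y. cl h \<star> cl x \<star> cl (S y)) l = SW P (\<lambda>x y. cl (h \<cdot> x) \<star> cl (S y)) l"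
     "SW P (\<lambda>x y. cl x \<star> cl (S y) \<star> cl l) h = SW P (\<lambda>x y. cl x \<star> cl (S y \<cdot> l)) h"
     "SW P (\<lambda>x y. cl h \<star> cl (S x) \<star> cl y) l = SW P (\<lambda>x y. cl (h \<cdot> S x) \<star> cl y) l"
     "SW P (\<lambda>x y. cl (S x) \<star> cl y \<star> cl l) h = SW P (\<lambda>x y. cl (S x) \<star> cl (y \<cdot> l)) h"
    using partial_rep_cl assms by (auto simp: partial_rep_def)
  show "cl h \<star> e l = SW P (\<lambda>x y. cl (h \<cdot> x) \<star> cl (S y)) l"
    unfolding 1(1)[symmetric] eps_eq using assms by (simp add: SW_mult_left PA.M.m_assoc)
  show "e h \<star> cl l = SW P (\<lambda>x y. cl x \<star> cl (S y \<cdot> l)) h"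
    unfolding 1(2)[symmetric] eps_eq using assms by (simp add: SW_mult_right)
  show "cl h \<star> e' l = SW P (\<lambda>x y. cl (h \<cdot> S x) \<star> cl y) l"
    unfolding 1(3)[symmetric] eps'_eq using assms by (simp add: SW_mult_left PA.M.m_assoc)
  show "e' h \<star> cl l = SW P (\<lambda>x y. cl (S x) \<star> cl (y \<cdot> l)) h"
    unfolding 1(4)[symmetric] eps'_eq using assms by (simp add: SW_mult_right)
qed

text \<open>By the relations the right-hand side is [h1 k1][S(h2 k2) h3], in which S(h2) h3 cancels.
  It is the rule for moving \<open>e\<close> to the left through a generator.\<close>

lemma cl_eps:
  assumes [simp]: "h \<in> carrier H" "k \<in> carrier H"
  shows "cl h \<star> e k = SW P (\<lambda>x y. e (x \<cdot> k) \<star> cl y) h"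
proof -
  have "SW P (\<lambda>x y. e (x \<cdot> k) \<star> cl y) h = SW P (\<lambda>x y. SW P (\<lambda>u v. cl u \<star> cl (S v \<cdot> y)) (x \<cdot> k)) h"
    by (simp add: eps_mult_cl)
  also have "\<dots> = SW P (\<lambda>x y. SW P (\<lambda>a b. SW P (\<lambda>c d. cl (a \<cdot> c) \<star> cl (S (b \<cdot> d) \<cdot> y)) k) x) h"
    by (rule SW_congI, simp, rule SW_mult; (intro lin_intros)?; simp)
  also have "\<dots> = SW P (\<lambda>a w. SW P (\<lambda>b y. SW P (\<lambda>c d. cl (a \<cdot> c) \<star> cl (S (b \<cdot> d) \<cdot> y)) k) w) h"
    by (rule SW_coassoc; (intro lin_intros)?; simp)
  also have "\<dots> = SW P (\<lambda>a w. SW P (\<lambda>b y. SW P (\<lambda>c d. cl (a \<cdot> c) \<star> cl (S d \<cdot> (S b \<cdot> y))) k) w) h"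
    by (simp add: antipode_mult HA.m_assoc)
  also have "\<dots> = SW P (\<lambda>c d. cl (h \<cdot> c) \<star> cl (S d \<cdot> \<one>\<^sub>H)) k"
    by (rule cancel_right[OF cancels_antipode_left, where
          g="\<lambda>a m. SW P (\<lambda>c d. cl (a \<cdot> c) \<star> cl (S d \<cdot> m)) k"]; (intro lin_intros)?; simp)
  also have "\<dots> = cl h \<star> e k"
    by (simp add: cl_mult_eps)
  finally show ?thesis by simp
qed

text \<open>Mirror image of \<open>cl_eps\<close>, with h1 S(h2) cancelling; \<open>e'\<close> moves
  to the right through a generator.\<close>

lemma eps'_cl:
  assumes [simp]: "h \<in> carrier H" "k \<in> carrier H"
  shows "e' k \<star> cl h = SW P (\<lambda>x y. cl x \<star> e' (k \<cdot> y)) h"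
proof -
  have "SW P (\<lambda>x y. cl x \<star> e' (k \<cdot> y)) h = SW P (\<lambda>x y. SW P (\<lambda>u v. cl (x \<cdot> S u) \<star> cl v) (k \<cdot> y)) h"
    by (simp add: cl_mult_eps')
  also have "\<dots> = SW P (\<lambda>x y. SW P (\<lambda>a b. SW P (\<lambda>c d. cl (x \<cdot> S (a \<cdot> c)) \<star> cl (b \<cdot> d)) y) k) h"
    by (rule SW_congI, simp, rule SW_mult; (intro lin_intros)?; simp)
  also have "\<dots> = SW P (\<lambda>x y. SW P (\<lambda>c d. SW P (\<lambda>a b. cl (x \<cdot> S (a \<cdot> c)) \<star> cl (b \<cdot> d)) k) y) h"
    by (rule SW_congI, simp, rule SW_swap; simp)
  also have "\<dots> = SW P (\<lambda>x y. SW P (\<lambda>c d. SW P (\<lambda>a b. cl (x \<cdot> S c \<cdot> S a) \<star> cl (b \<cdot> d)) k) y) h"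
    by (simp add: antipode_mult HA.m_assoc)
  also have "\<dots> = SW P (\<lambda>a b. cl (\<one>\<^sub>H \<cdot> S a) \<star> cl (b \<cdot> h)) k"
    by (rule cancel_left[OF cancels_antipode_right, where
          g="\<lambda>m d. SW P (\<lambda>a b. cl (m \<cdot> S a) \<star> cl (b \<cdot> d)) k"]; (intro lin_intros)?; simp)
  also have "\<dots> = e' k \<star> cl h"
    by (simp add: eps'_mult_cl)
  finally show ?thesis by simp
qed

text \<open>The relation turns the sum into [h1][S(h2) h3 m], and the antipode cancels. With
  \<open>SW_eps'_inv_cl\<close> it is one half of the exchange rule
  \<open>diag_shift2\<close>.\<close>

lemma SW_eps_cl:
  assumes [simp]: "h \<in> carrier H" "m \<in> carrier H"
  shows "SW P (\<lambda>x y. e x \<star> cl (y \<cdot> m)) h = cl h \<star> cl m"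
proof -
  have "SW P (\<lambda>x y. e x \<star> cl (y \<cdot> m)) h = SW P (\<lambda>x y. SW P (\<lambda>a b. cl a \<star> cl (S b \<cdot> (y \<cdot> m))) x) h"
    by (simp add: eps_mult_cl)
  also have "\<dots> = SW P (\<lambda>a w. SW P (\<lambda>b y. cl a \<star> cl (S b \<cdot> (y \<cdot> m))) w) h"
    by (rule SW_coassoc; (intro lin_intros)?; simp)
  also have "\<dots> = SW P (\<lambda>a w. SW P (\<lambda>b y. cl a \<star> cl ((S b \<cdot> y) \<cdot> m)) w) h"
    by (simp add: HA.m_assoc)
  also have "\<dots> = cl h \<star> cl (\<one>\<^sub>H \<cdot> m)"
    by (rule cancel_right[OF cancels_antipode_left, where g="\<lambda>a n. cl a \<star> cl (n \<cdot> m)"];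
        (intro lin_intros)?; simp)
  finally show ?thesis by simp
qed

lemma SW_eps_cl1: "h \<in> carrier H \<Longrightarrow> SW P (\<lambda>x y. e x \<star> cl y) h = cl h"
  using SW_eps_cl[of h "\<one>\<^sub>H"] by simp

lemma SW_cl_eps':
  assumes [simp]: "h \<in> carrier H" "m \<in> carrier H"
  shows "SW P (\<lambda>x y. cl (m \<cdot> x) \<star> e' y) h = cl m \<star> cl h"
proof -
  have "SW P (\<lambda>x y. cl (m \<cdot> x) \<star> e' y) h = SW P (\<lambda>x w. SW P (\<lambda>a b. cl (m \<cdot> (x \<cdot> S a)) \<star> cl b) w) h"
    by (simp add: cl_mult_eps' HA.m_assoc)
  also have "\<dots> = cl (m \<cdot> \<one>\<^sub>H) \<star> cl h"
    by (rule cancel_left[OF cancels_antipode_right, where g="\<lambda>a n. cl (m \<cdot> a) \<star> cl n"];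
        (intro lin_intros)?; simp)
  finally show ?thesis by simp
qed

lemma SW_cl_eps'1: "h \<in> carrier H \<Longrightarrow> SW P (\<lambda>x y. cl x \<star> e' y) h = cl h"
  using SW_cl_eps'[of h "\<one>\<^sub>H"] by simp

text \<open>Moving \<open>e'\<close> to the right by \<open>eps'_cl\<close> produces S^-1(h3) h2 in
  its index; this cancels and leaves \<open>SW_cl_eps'\<close>. As e'(S^-1(h)) is the target of
  \<open>e h\<close>, here [h][m] is written with a factor that can cross the tensor sign over
  \<open>A\<close>.\<close>

lemma SW_eps'_inv_cl:
  assumes [simp]: "h \<in> carrier H" "m \<in> carrier H"
  shows "SW P (\<lambda>x y. e' (S\<^sub>i y) \<star> cl (x \<cdot> m)) h = cl h \<star> cl m"
proof -
  have "SW P (\<lambda>x y. e' (S\<^sub>i y) \<star> cl (x \<cdot> m)) h =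
      SW P (\<lambda>x y. SW P (\<lambda>a b. cl a \<star> e' (S\<^sub>i y \<cdot> b)) (x \<cdot> m)) h"
    by (simp add: eps'_cl)
  also have "\<dots> = SW P (\<lambda>x y. SW P (\<lambda>a b. SW P (\<lambda>c d. cl (a \<cdot> c) \<star> e' (S\<^sub>i y \<cdot> (b \<cdot> d))) m) x) h"
    by (rule SW_congI, simp, rule SW_mult; (intro lin_intros)?; simp)
  also have "\<dots> = SW P (\<lambda>a w. SW P (\<lambda>b y. SW P (\<lambda>c d. cl (a \<cdot> c) \<star> e' (S\<^sub>i y \<cdot> (b \<cdot> d))) m) w) h"
    by (rule SW_coassoc; (intro lin_intros)?; simp)
  also have "\<dots> = SW P (\<lambda>a w. SW P (\<lambda>b y. SW P (\<lambda>c d. cl (a \<cdot> c) \<star> e' ((S\<^sub>i y \<cdot> b) \<cdot> d)) m) w) h"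
    by (simp add: HA.m_assoc)
  also have "\<dots> = SW P (\<lambda>c d. cl (h \<cdot> c) \<star> e' (\<one>\<^sub>H \<cdot> d)) m"
    by (rule cancel_right[OF cancels_inv_antipode_left, where
          g="\<lambda>a n. SW P (\<lambda>c d. cl (a \<cdot> c) \<star> e' (n \<cdot> d)) m"]; (intro lin_intros)?; simp)
  also have "\<dots> = cl h \<star> cl m"
    by (simp add: SW_cl_eps')
  finally show ?thesis .
qed

lemma SW_eps'_inv_cl1: "h \<in> carrier H \<Longrightarrow> SW P (\<lambda>x y. e' (S\<^sub>i y) \<star> cl x) h = cl h"
  using SW_eps'_inv_cl[of h "\<one>\<^sub>H"] by simp

lemma SW_eps'_cl_antipode:
  assumes [simp]: "h \<in> carrier H"
  shows "SW P (\<lambda>x y. e' x \<star> cl (S y)) h = cl (S h)"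
proof -
  have "SW P (\<lambda>x y. e' x \<star> cl (S y)) h = SW P (\<lambda>x y. SW P (\<lambda>a b. cl (S a) \<star> cl (b \<cdot> S y)) x) h"
    by (simp add: eps'_mult_cl)
  also have "\<dots> = SW P (\<lambda>a w. SW P (\<lambda>b y. cl (S a) \<star> cl (b \<cdot> S y)) w) h"
    by (rule SW_coassoc; (intro lin_intros)?; simp)
  also have "\<dots> = cl (S h) \<star> cl \<one>\<^sub>H"
    by (rule cancel_right[OF cancels_antipode_right, where g="\<lambda>a n. cl (S a) \<star> cl n"];
        (intro lin_intros)?; simp)
  finally show ?thesis by simp
qed

lemma SW_cl_eps_inv:
  assumes [simp]: "h \<in> carrier H"
  shows "SW P (\<lambda>x y. cl y \<star> e (S\<^sub>i x)) h = cl h"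
proof -
  have "SW P (\<lambda>x y. cl y \<star> e (S\<^sub>i x)) h = SW P (\<lambda>x y. SW P (\<lambda>a b. cl (y \<cdot> a) \<star> cl (S b)) (S\<^sub>i x)) h"
    by (simp add: cl_mult_eps)
  also have "\<dots> = SW P (\<lambda>x y. SW P (\<lambda>a b. cl (y \<cdot> S\<^sub>i b) \<star> cl (S (S\<^sub>i a))) x) h"
    by (rule SW_congI, simp, rule SW_inv_antipode; (intro lin_intros)?; simp)
  also have "\<dots> = SW P (\<lambda>a w. SW P (\<lambda>b y. cl (y \<cdot> S\<^sub>i b) \<star> cl (S (S\<^sub>i a))) w) h"
    by (rule SW_coassoc; (intro lin_intros)?; simp)
  also have "\<dots> = SW P (\<lambda>a w. SW P (\<lambda>b y. cl (y \<cdot> S\<^sub>i b) \<star> cl a) w) h"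
    by simp
  also have "\<dots> = cl \<one>\<^sub>H \<star> cl h"
    by (rule cancel_right[OF cancels_inv_antipode_right, where g="\<lambda>a n. cl n \<star> cl a"];
        (intro lin_intros)?; simp)
  finally show ?thesis by simp
qed

lemma eps_antipode: "h \<in> carrier H \<Longrightarrow> e (S h) = SW P (\<lambda>x y. cl (S y) \<star> cl (S (S x))) h"
  unfolding eps_eq by (rule SW_antipode; (intro lin_intros)?; simp)

lemma eps'_antipode: "h \<in> carrier H \<Longrightarrow> e' (S h) = SW P (\<lambda>x y. cl (S (S y)) \<star> cl (S x)) h"
  unfolding eps'_eq by (rule SW_antipode; (intro lin_intros)?; simp)

lemma eps_inv_antipode: "h \<in> carrier H \<Longrightarrow> e (S\<^sub>i h) = SW P (\<lambda>x y. cl (S\<^sub>i y) \<star> cl x) h"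
proof -
  assume h [simp]: "h \<in> carrier H"
  have "e (S\<^sub>i h) = SW P (\<lambda>x y. cl (S\<^sub>i y) \<star> cl (S (S\<^sub>i x))) h"
    unfolding eps_eq by (rule SW_inv_antipode; (intro lin_intros)?; simp)
  then show ?thesis by simp
qed

lemma eps'_inv_antipode: "h \<in> carrier H \<Longrightarrow> e' (S\<^sub>i h) = SW P (\<lambda>x y. cl y \<star> cl (S\<^sub>i x)) h"
proof -
  assume h [simp]: "h \<in> carrier H"
  have "e' (S\<^sub>i h) = SW P (\<lambda>x y. cl (S (S\<^sub>i y)) \<star> cl (S\<^sub>i x)) h"
    unfolding eps'_eq by (rule SW_inv_antipode; (intro lin_intros)?; simp)
  then show ?thesis by simp
qed

text \<open>\<open>e' k\<close> is moved through [h1] and then through the antipode factor of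
  \<open>e h\<close>; its index becomes k h2 S(h3), up to numbering, and cancels back to k.\<close>

lemma eps_eps'_commute:
  assumes [simp]: "h \<in> carrier H" "k \<in> carrier H"
  shows "e h \<star> e' k = e' k \<star> e h"
proof -
  have "e' k \<star> e h = SW P (\<lambda>x y. e' k \<star> cl x \<star> cl (S y)) h"
    by (simp add: eps_eq SW_mult_left PA.M.m_assoc)
  also have "\<dots> = SW P (\<lambda>x y. SW P (\<lambda>a b. cl a \<star> (e' (k \<cdot> b) \<star> cl (S y))) x) h"
    by (simp add: eps'_cl SW_mult_right PA.M.m_assoc del: HA.m_assoc)
  also have "\<dots> = SW P (\<lambda>x y. SW P (\<lambda>a b. SW P (\<lambda>c d. cl a \<star> (cl c \<star> e' (k \<cdot> b \<cdot> d))) (S y)) x) h"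
    by (simp add: eps'_cl SW_mult_left)
  also have "\<dots> = SW P (\<lambda>x y. SW P (\<lambda>a b. SW P (\<lambda>c d. cl a \<star> (cl (S d) \<star> e' (k \<cdot> b \<cdot> S c))) y) x) h"
    by (rule SW_congI, simp, rule SW_congI, simp, rule SW_antipode; (intro lin_intros)?; simp)
  also have "\<dots> = SW P (\<lambda>a v. SW P (\<lambda>b y. SW P (\<lambda>c d. cl a \<star> (cl (S d) \<star> e' (k \<cdot> b \<cdot> S c))) y) v) h"
    by (rule SW_coassoc; (intro lin_intros)?; simp)
  also have "\<dots> = SW P (\<lambda>a v. SW P (\<lambda>b y. SW P (\<lambda>c d. cl a \<star> (cl (S d) \<star> e' (k \<cdot> (b \<cdot> S c)))) y) v) h"
    by (simp add: HA.m_assoc)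
  also have "\<dots> = SW P (\<lambda>a v. cl a \<star> (cl (S v) \<star> e' (k \<cdot> \<one>\<^sub>H))) h"
    by (rule SW_congI, simp, rule cancel_left[OF cancels_antipode_right, where
          g="\<lambda>m d. cl _ \<star> (cl (S d) \<star> e' (k \<cdot> m))"]; (intro lin_intros)?; simp)
  also have "\<dots> = e h \<star> e' k"
    by (simp add: eps_eq SW_mult_right PA.M.m_assoc)
  finally show ?thesis by simp
qed

text \<open>The analogue of the adjoint action. It is only a partial one: by \<open>act_one\<close>
  the unit goes to \<open>e h\<close>, not to a scalar.\<close>

definition act :: "'h \<Rightarrow> ('k, 'h) hpar \<Rightarrow> ('k, 'h) hpar" where
  "act h b = SW P (\<lambda>x y. cl x \<star> b \<star> cl (S y)) h"

lemma act_closed [simp]: "h \<in> carrier H \<Longrightarrow> b \<in> carrier P \<Longrightarrow> act h b \<in> carrier P"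
  by (simp add: act_def)

lemma act_one: "h \<in> carrier H \<Longrightarrow> act h \<one>\<^bsub>P\<^esub> = e h"
  by (simp add: act_def eps_eq)

lemma lin_map_act [lin_intros]: "b \<in> carrier P \<Longrightarrow> lin_map R M H g \<Longrightarrow> lin_map R M P (\<lambda>x. act (g x) b)"
  unfolding act_def by (intro lin_intros; simp)

text \<open>Moving [S(h2)] to the right past the last factor by \<open>cl_eps\<close> changes the
  index of that factor to S(h3) h4 k, in which the antipode cancels. It is the step that brings one
  more factor under the action.\<close>

lemma act_eps:
  assumes [simp]: "h \<in> carrier H" "k \<in> carrier H" "b \<in> carrier P"
  shows "SW P (\<lambda>x y. act x b \<star> e (y \<cdot> k)) h = act h (b \<star> e k)"
proof -
  have "SW P (\<lambda>x y. act x b \<star> e (y \<cdot> k)) h =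
      SW P (\<lambda>x y. SW P (\<lambda>u v. cl u \<star> b \<star> (cl (S v) \<star> e (y \<cdot> k))) x) h"
    by (simp add: act_def SW_mult_right PA.M.m_assoc)
  also have "\<dots> = SW P (\<lambda>x y. SW P (\<lambda>u v. SW P (\<lambda>c d. cl u \<star> b \<star> (e (c \<cdot> (y \<cdot> k)) \<star> cl d)) (S v)) x) h"
    by (simp add: cl_eps SW_mult_left)
  also have "\<dots> = SW P (\<lambda>x y. SW P (\<lambda>u v. SW P (\<lambda>c d. cl u \<star> b \<star> (e (S d \<cdot> (y \<cdot> k)) \<star> cl (S c))) v) x) h"
    by (rule SW_congI, simp, rule SW_congI, simp, rule SW_antipode; (intro lin_intros)?; simp)
  also have "\<dots> = SW P (\<lambda>u w. SW P (\<lambda>v y. SW P (\<lambda>c d. cl u \<star> b \<star> (e (S d \<cdot> (y \<cdot> k)) \<star> cl (S c))) v) w) h"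
    by (rule SW_coassoc; (intro lin_intros)?; simp)
  also have "\<dots> = SW P (\<lambda>u w. SW P (\<lambda>c v. SW P (\<lambda>d y. cl u \<star> b \<star> (e (S d \<cdot> (y \<cdot> k)) \<star> cl (S c))) v) w) h"
    by (rule SW_congI, simp, rule SW_coassoc; (intro lin_intros)?; simp)
  also have "\<dots> = SW P (\<lambda>u w. SW P (\<lambda>c v. SW P (\<lambda>d y. cl u \<star> b \<star> (e (S d \<cdot> y \<cdot> k) \<star> cl (S c))) v) w) h"
    by (simp add: HA.m_assoc)
  also have "\<dots> = SW P (\<lambda>u w. cl u \<star> b \<star> (e (\<one>\<^sub>H \<cdot> k) \<star> cl (S w))) h"
    by (rule SW_congI, simp, rule cancel_right[OF cancels_antipode_left, where
          g="\<lambda>c m. cl _ \<star> b \<star> (e (m \<cdot> k) \<star> cl (S c))"]; (intro lin_intros)?; simp)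
  also have "\<dots> = act h (b \<star> e k)"
    by (simp add: act_def PA.M.m_assoc)
  finally show ?thesis .
qed

section \<open>The base algebras and the counits on words\<close>

lemma par_base_simps [simp]:
  "ring.add (par_base R H) = ring.add P" "monoid.mult (par_base R H) = monoid.mult P"
  "one (par_base R H) = one P" "ring.zero (par_base R H) = ring.zero P"
  "smult (par_base R H) = smult P"
  "ring.add (par_base' R H) = ring.add P" "monoid.mult (par_base' R H) = monoid.mult P"
  "one (par_base' R H) = one P" "ring.zero (par_base' R H) = ring.zero P"
  "smult (par_base' R H) = smult P"
  by (simp_all add: par_base_def par_base'_def gen_subalgebra_def)

abbreviation "A \<equiv> carrier (par_base R H)"
abbreviation "A' \<equiv> carrier (par_base' R H)"

lemma algA [simp]: "assoc_algebra R (par_base R H)" "assoc_algebra R (par_base' R H)"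
  unfolding par_base_def par_base'_def
  by (intro gen_subalgebra_assoc_algebra algP; auto)+

lemma is_subalgebra_A: "is_subalgebra R P A" "is_subalgebra R P A'"
  unfolding par_base_def par_base'_def
  by (intro is_subalgebra_gen algP; auto)+

lemma A_carrier [simp]: "a \<in> A \<Longrightarrow> a \<in> carrier P" "a \<in> A' \<Longrightarrow> a \<in> carrier P"
  using is_subalgebra_A by (auto simp: is_subalgebra_def)

lemma A_closed [simp]:
  "\<one>\<^bsub>P\<^esub> \<in> A" "a \<in> A \<Longrightarrow> b \<in> A \<Longrightarrow> a \<oplus>\<^bsub>P\<^esub> b \<in> A" "a \<in> A \<Longrightarrow> b \<in> A \<Longrightarrow> a \<star> b \<in> A"
  "c \<in> carrier R \<Longrightarrow> a \<in> A \<Longrightarrow> c \<odot>\<^bsub>P\<^esub> a \<in> A"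
  "\<one>\<^bsub>P\<^esub> \<in> A'" "a \<in> A' \<Longrightarrow> b \<in> A' \<Longrightarrow> a \<oplus>\<^bsub>P\<^esub> b \<in> A'" "a \<in> A' \<Longrightarrow> b \<in> A' \<Longrightarrow> a \<star> b \<in> A'"
  "c \<in> carrier R \<Longrightarrow> a \<in> A' \<Longrightarrow> c \<odot>\<^bsub>P\<^esub> a \<in> A'"
  using is_subalgebra_A by (auto simp: is_subalgebra_def)

lemma eps_A [simp]: "h \<in> carrier H \<Longrightarrow> e h \<in> A" "h \<in> carrier H \<Longrightarrow> e' h \<in> A'"
  unfolding par_base_def par_base'_def by (auto intro: gen_subalgebra_incl)

lemma A_induct [consumes 1, case_names gen one add mult smult]:
  assumes "a \<in> A" "\<And>h. h \<in> carrier H \<Longrightarrow> Q (e h)" "Q \<one>\<^bsub>P\<^esub>"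
    "\<And>a b. a \<in> A \<Longrightarrow> b \<in> A \<Longrightarrow> Q a \<Longrightarrow> Q b \<Longrightarrow> Q (a \<oplus>\<^bsub>P\<^esub> b)"
    "\<And>a b. a \<in> A \<Longrightarrow> b \<in> A \<Longrightarrow> Q a \<Longrightarrow> Q b \<Longrightarrow> Q (a \<star> b)"
    "\<And>c a. c \<in> carrier R \<Longrightarrow> a \<in> A \<Longrightarrow> Q a \<Longrightarrow> Q (c \<odot>\<^bsub>P\<^esub> a)"
  shows "Q a"
  by (rule gen_subalgebra_induct[OF algP, where X = "e ` carrier H"])
    (use assms in \<open>auto simp flip: par_base_def\<close>)

lemma A'_induct [consumes 1, case_names gen one add mult smult]:
  assumes "a \<in> A'" "\<And>h. h \<in> carrier H \<Longrightarrow> Q (e' h)" "Q \<one>\<^bsub>P\<^esub>"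
    "\<And>a b. a \<in> A' \<Longrightarrow> b \<in> A' \<Longrightarrow> Q a \<Longrightarrow> Q b \<Longrightarrow> Q (a \<oplus>\<^bsub>P\<^esub> b)"
    "\<And>a b. a \<in> A' \<Longrightarrow> b \<in> A' \<Longrightarrow> Q a \<Longrightarrow> Q b \<Longrightarrow> Q (a \<star> b)"
    "\<And>c a. c \<in> carrier R \<Longrightarrow> a \<in> A' \<Longrightarrow> Q a \<Longrightarrow> Q (c \<odot>\<^bsub>P\<^esub> a)"
  shows "Q a"
  by (rule gen_subalgebra_induct[OF algP, where X = "e' ` carrier H"])
    (use assms in \<open>auto simp flip: par_base'_def\<close>)

text \<open>Commuting with a given element passes to sums and products, so generators suffice, where
  it is \<open>eps_eps'_commute\<close>. The commutation of source and target images comes from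
  here.\<close>

lemma A_commute:
  assumes "a \<in> A" "b \<in> A'"
  shows "a \<star> b = b \<star> a"
proof -
  have 1: "e h \<star> b = b \<star> e h" if [simp]: "h \<in> carrier H" for h
    using assms(2)
  proof (induction rule: A'_induct)
    case (mult a b)
    then show ?case by (metis A_carrier(2) PA.M.m_assoc eps_closed(1) that)
  qed (simp_all add: eps_eps'_commute PA.M.r_distr PA.M.l_distr PA.smult_mult_left PA.smult_mult_right)
  show ?thesis
    using assms(1)
  proof (induction rule: A_induct)
    case (mult a a')
    then show ?case
      using assms(2) by (metis A_carrier PA.M.m_assoc)
  qed (use assms(2) in \<open>simp_all add: 1 PA.M.r_distr PA.M.l_distr PA.smult_mult_left PA.smult_mult_right\<close>)
qed

lemma sum_of_A:
  "set xs \<subseteq> A \<Longrightarrow> sum_of P xs \<in> A" "set xs \<subseteq> A' \<Longrightarrow> sum_of P xs \<in> A'"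
proof -
  \<comment> \<open>The empty sum: zero is obtained as 0 times the unit.\<close>
  have "\<zero>\<^bsub>P\<^esub> \<in> A" "\<zero>\<^bsub>P\<^esub> \<in> A'"
    using A_closed(4)[of "\<zero>\<^bsub>R\<^esub>" "\<one>\<^bsub>P\<^esub>"] A_closed(8)[of "\<zero>\<^bsub>R\<^esub>" "\<one>\<^bsub>P\<^esub>"] by simp_all
  then show "set xs \<subseteq> A \<Longrightarrow> sum_of P xs \<in> A" "set xs \<subseteq> A' \<Longrightarrow> sum_of P xs \<in> A'"
    by (induction xs) simp_all
qed

lemma prod_of_A:
  "set xs \<subseteq> A \<Longrightarrow> prod_of P xs \<in> A" "set xs \<subseteq> A' \<Longrightarrow> prod_of P xs \<in> A'"
  by (induction xs) simp_all

lemma prod_eps_closed [simp]: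
  "set qs \<subseteq> carrier H \<Longrightarrow> prod_of P (map e qs) \<in> carrier P"
  "set qs \<subseteq> carrier H \<Longrightarrow> prod_of P (map e' qs) \<in> carrier P"
  by (auto intro!: PA.M.prod_of_closed eps_closed)

subsection \<open>The left counit\<close>

text \<open>\<open>comult_prod \<phi> h [q\<^sub>1, \<dots>, q\<^sub>n]\<close> is the sum of the products \<open>\<phi> h\<^sub>1 q\<^sub>1 \<cdots> \<phi> h\<^sub>n q\<^sub>n\<close>.\<close>

fun comult_prod :: "('h \<Rightarrow> 'h \<Rightarrow> ('k, 'h) hpar) \<Rightarrow> 'h \<Rightarrow> 'h list \<Rightarrow> ('k, 'h) hpar" where
  "comult_prod \<phi> h [] = \<one>\<^bsub>P\<^esub>"
| "comult_prod \<phi> h [q] = \<phi> h q"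
| "comult_prod \<phi> h (q # q' # qs) = SW P (\<lambda>x y. \<phi> x q \<star> comult_prod \<phi> y (q' # qs)) h"

abbreviation "eps_sum \<equiv> comult_prod (\<lambda>x q. e (x \<cdot> q))"

lemma comult_prod_closed [simp]:
  "(\<And>x q. x \<in> carrier H \<Longrightarrow> q \<in> carrier H \<Longrightarrow> \<phi> x q \<in> carrier P) \<Longrightarrow>
    h \<in> carrier H \<Longrightarrow> set qs \<subseteq> carrier H \<Longrightarrow> comult_prod \<phi> h qs \<in> carrier P"
  by (induction \<phi> h qs rule: comult_prod.induct) simp_all

text \<open>The empty list is excluded because there the value is the unit whatever h is.\<close>

lemma lin_map_eps_sum [lin_intros]:
  assumes "qs \<noteq> []" "set qs \<subseteq> carrier H" "lin_map R M H g"
  shows "lin_map R M P (\<lambda>x. eps_sum (g x) qs)"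
proof -
  have "lin P (\<lambda>x. eps_sum x qs)"
    using assms(1,2)
    by (induction qs rule: induct_list012) (simp; intro lin_intros; simp)+
  then show ?thesis by (rule lin_map_comp) (rule assms(3))
qed

text \<open>The factors are brought under the action one at a time by \<open>act_eps\<close>; the
  parameter \<open>b\<close> collects those already there, so the induction ranges over all
  \<open>b\<close>.\<close>

lemma act_eps_sum:
  assumes "qs \<noteq> []" "set qs \<subseteq> carrier H" "h \<in> carrier H" "b \<in> carrier P"
  shows "SW P (\<lambda>x y. act x b \<star> eps_sum y qs) h = act h (b \<star> prod_of P (map e qs))"
  using assms
proof (induction qs arbitrary: b h rule: induct_list012)
  case (2 q)
  then show ?case by (simp add: act_eps)
next
  case (3 q q' qs)
  then have [simp]: "q \<in> carrier H" "q' \<in> carrier H" "set qs \<subseteq> carrier H" "h \<in> carrier H"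
    "b \<in> carrier P" by simp_all
  have "SW P (\<lambda>x y. act x b \<star> eps_sum y (q # q' # qs)) h =
      SW P (\<lambda>x w. SW P (\<lambda>y z. act x b \<star> e (y \<cdot> q) \<star> eps_sum z (q' # qs)) w) h"
    by (simp add: SW_mult_left PA.M.m_assoc)
  also have "\<dots> = SW P (\<lambda>w z. SW P (\<lambda>x y. act x b \<star> e (y \<cdot> q) \<star> eps_sum z (q' # qs)) w) h"
    by (rule SW_coassoc[symmetric]; (intro lin_intros)?; simp)
  also have "\<dots> = SW P (\<lambda>w z. act w (b \<star> e q) \<star> eps_sum z (q' # qs)) h"
    by (simp add: SW_mult_right[symmetric] act_eps)
  also have "\<dots> = act h (b \<star> e q \<star> prod_of P (map e (q' # qs)))"
    by (rule "3.IH"(2)) simp_all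
  finally show ?case
    by (simp add: PA.M.m_assoc)
qed simp

text \<open>The leading 1 contributes the factor e(h1), which is the action on the unit; from there
  \<open>act_eps_sum\<close> takes over with b = 1.\<close>

lemma eps_sum_one:
  assumes "set qs \<subseteq> carrier H" "h \<in> carrier H"
  shows "eps_sum h (\<one>\<^sub>H # qs) = act h (prod_of P (map e qs))"
proof (cases qs)
  case Nil
  with assms show ?thesis by (simp add: act_one)
next
  case (Cons q qs')
  have "prod_of P (map e qs) \<in> carrier P"
    using assms by (intro PA.M.prod_of_closed) auto
  with Cons assms act_eps_sum[of qs h "\<one>\<^bsub>P\<^esub>"] show ?thesis
    by (simp add: act_one)
qed

lemma iter_sweedler_carrier:
  "h \<in> carrier H \<Longrightarrow> u \<in> set (iter_sweedler R H n h) \<Longrightarrow> u \<in> lists (carrier H) \<and> length u = Suc n"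
proof (induction n arbitrary: h u)
  case (Suc n)
  then obtain x y v where "(x, y) \<in> set (sweedler R H h)" "v \<in> set (iter_sweedler R H n y)" "u = x # v"
    by auto
  with Suc sweedler_carrier[of h] show ?case by fastforce
qed simp

lemma sum_iter_sweedler_Suc:
  assumes "h \<in> carrier H" "\<And>u. u \<in> lists (carrier H) \<Longrightarrow> length u = n + 2 \<Longrightarrow> f u \<in> carrier P"
  shows "sum_of P (map f (iter_sweedler R H (Suc n) h)) =
    SW P (\<lambda>x y. sum_of P (map (\<lambda>u. f (x # u)) (iter_sweedler R H n y))) h"
proof -
  note c = subsetD[OF sweedler_carrier[OF assms(1)]]
  have "sum_of P (map f (iter_sweedler R H (Suc n) h)) =
      sum_of P (concat (map (\<lambda>(x, y). map (\<lambda>u. f (x # u)) (iter_sweedler R H n y)) (sweedler R H h)))"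
    unfolding iter_sweedler.simps map_concat map_map comp_def case_prod_beta by simp
  also have "\<dots> = sum_of P (map (sum_of P)
      (map (\<lambda>(x, y). map (\<lambda>u. f (x # u)) (iter_sweedler R H n y)) (sweedler R H h)))"
  proof (rule PA.M.sum_of_concat)
    fix xs assume "xs \<in> set (map (\<lambda>(x, y). map (\<lambda>u. f (x # u)) (iter_sweedler R H n y)) (sweedler R H h))"
    then obtain x y where xy: "(x, y) \<in> set (sweedler R H h)"
      and xs: "xs = map (\<lambda>u. f (x # u)) (iter_sweedler R H n y)" by auto
    have x: "x \<in> carrier H" and y: "y \<in> carrier H" using c[OF xy] by auto
    have "f (x # u) \<in> carrier P" if "u \<in> set (iter_sweedler R H n y)" for u
      using iter_sweedler_carrier[OF y that] x by (intro assms(2)) simp_all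
    then show "set xs \<subseteq> carrier P"
      unfolding xs by auto
  qed
  also have "\<dots> = SW P (\<lambda>x y. sum_of P (map (\<lambda>u. f (x # u)) (iter_sweedler R H n y))) h"
    unfolding sweedler_sum_def map_map comp_def case_prod_beta ..
  finally show ?thesis .
qed

lemma map_map2: "map g (map2 f u ks) = map2 (\<lambda>x q. g (f x q)) u ks"
  by (induction u ks rule: list_induct2') simp_all

lemma set_map2_closed:
  assumes "\<And>x q. x \<in> carrier H \<Longrightarrow> q \<in> carrier H \<Longrightarrow> \<phi> x q \<in> C"
  shows "u \<in> lists (carrier H) \<Longrightarrow> set ks \<subseteq> carrier H \<Longrightarrow> set (map2 \<phi> u ks) \<subseteq> C"
  by (induction u ks rule: list_induct2') (simp_all add: assms)

text \<open>Links the sums over explicit tuples in the counit formulas with the recursive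
  \<open>comult_prod\<close>. The tuples and \<open>ks\<close> both have length n + 1, so that
  \<open>map2\<close> truncates nothing.\<close>

lemma sum_iter_sweedler:
  assumes \<phi>: "\<And>x q. x \<in> carrier H \<Longrightarrow> q \<in> carrier H \<Longrightarrow> \<phi> x q \<in> carrier P"
    and "h \<in> carrier H" "set ks \<subseteq> carrier H" "length ks = Suc n"
  shows "sum_of P (map (\<lambda>u. prod_of P (map2 \<phi> u ks)) (iter_sweedler R H n h)) = comult_prod \<phi> h ks"
  using assms(2-)
proof (induction n arbitrary: h ks)
  case 0
  then obtain q where "ks = [q]" by (cases ks) auto
  with 0 \<phi> show ?case by simp
next
  case (Suc n)
  then obtain q q' qs where ks: "ks = q # q' # qs" "length qs = n"
    by (auto simp: length_Suc_conv)
  have pc: "prod_of P (map2 \<phi> u ks) \<in> carrier P"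
    if "u \<in> lists (carrier H)" "set ks \<subseteq> carrier H" for u ks
    by (intro PA.M.prod_of_closed set_map2_closed[OF \<phi>] that)
  have "sum_of P (map (\<lambda>u. prod_of P (map2 \<phi> u ks)) (iter_sweedler R H (Suc n) h))
    = SW P (\<lambda>x y. sum_of P (map (\<lambda>u. prod_of P (map2 \<phi> (x # u) ks)) (iter_sweedler R H n y))) h"
    using Suc.prems by (intro sum_iter_sweedler_Suc pc) simp_all
  also have "\<dots> = SW P (\<lambda>x y. \<phi> x q \<star> comult_prod \<phi> y (q' # qs)) h"
  proof (rule SW_congI)
    fix x y assume xy: "x \<in> carrier H" "y \<in> carrier H"
    have c: "prod_of P (map2 \<phi> u (q' # qs)) \<in> carrier P" if "u \<in> set (iter_sweedler R H n y)" for u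
      using iter_sweedler_carrier[OF xy(2) that] Suc.prems ks by (intro pc) simp_all
    have "sum_of P (map (\<lambda>u. prod_of P (map2 \<phi> (x # u) ks)) (iter_sweedler R H n y))
      = sum_of P (map ((\<star>) (\<phi> x q)) (map (\<lambda>u. prod_of P (map2 \<phi> u (q' # qs))) (iter_sweedler R H n y)))"
      by (simp add: comp_def ks)
    also have "\<dots> = \<phi> x q \<star> sum_of P (map (\<lambda>u. prod_of P (map2 \<phi> u (q' # qs))) (iter_sweedler R H n y))"
    proof (rule additive_map_sum_of[symmetric, OF _ abP abP])
      show "additive_map P P ((\<star>) (\<phi> x q))"
        using xy Suc.prems \<phi> ks by (intro lin_map_additive[where R = R] lin_intros; simp)
      show "set (map (\<lambda>u. prod_of P (map2 \<phi> u (q' # qs))) (iter_sweedler R H n y)) \<subseteq> carrier P"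
        unfolding set_map using c by blast
    qed
    also have "\<dots> = \<phi> x q \<star> comult_prod \<phi> y (q' # qs)"
      using Suc xy ks by simp
    finally show "sum_of P (map (\<lambda>u. prod_of P (map2 \<phi> (x # u) ks)) (iter_sweedler R H n y)) =
        \<phi> x q \<star> comult_prod \<phi> y (q' # qs)" .
  qed (use Suc.prems in simp)
  finally show ?case by (simp add: ks)
qed

definition left_args :: "nat \<Rightarrow> 'h list list \<Rightarrow> 'h list" where
  "left_args n us = map (\<lambda>j. prod_of H (map (\<lambda>i. us ! i ! (j - i)) [0..<Suc j])) [0..<n]"

definition left_lists :: "'h list \<Rightarrow> 'h list list list" where
  "left_lists hs = product_lists (map (\<lambda>i. iter_sweedler R H (length hs - 1 - i) (hs ! i)) [0..<length hs])"

lemma left_counit_word: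
  "par_left_counit_word R H hs =
    sum_of P (map (\<lambda>us. prod_of P (map e (left_args (length hs) us))) (left_lists hs))"
  by (simp add: par_left_counit_word_def left_args_def left_lists_def Let_def comp_def)

lemma left_lists_Cons:
  "left_lists (h # hs) =
    concat (map (\<lambda>u. map ((#) u) (left_lists hs)) (iter_sweedler R H (length hs) h))"
  unfolding left_lists_def by (simp add: upt_conv_Cons map_Suc_upt[symmetric] comp_def del: upt_Suc)

text \<open>A new first letter shifts the old arguments by one place and multiplies the j-th
  argument on the left by its j-th component. The 0-th argument consists of the new letter alone,
  whence the 1.\<close>

lemma left_args_Cons:
  "length u = Suc n \<Longrightarrow> left_args (Suc n) (u # us) = map2 (\<cdot>) u (\<one>\<^sub>H # left_args n us)"
proof (rule nth_equalityI)
  fix j assume u: "length u = Suc n" and j: "j < length (left_args (Suc n) (u # us))"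
  show "left_args (Suc n) (u # us) ! j = map2 (\<cdot>) u (\<one>\<^sub>H # left_args n us) ! j"
  proof (cases j)
    case 0
    have "[0..<Suc 0] = [0]" by simp
    with 0 u j show ?thesis by (simp add: left_args_def del: upt_Suc)
  next
    case (Suc k)
    have "[0..<Suc (Suc k)] = 0 # map Suc [0..<Suc k]"
      by (simp add: upt_conv_Cons map_Suc_upt del: upt_Suc)
    with u j Suc show ?thesis
      by (simp add: left_args_def comp_def del: upt_Suc)
  qed
qed (simp add: left_args_def)

lemma left_lists_carrier:
  assumes "hs \<in> lists (carrier H)" "us \<in> set (left_lists hs)"
  shows "set (left_args (length hs) us) \<subseteq> carrier H"
proof -
  have "us ! i ! (j - i) \<in> carrier H" if "i \<le> j" "j < length hs" for i j
  proof -
    have "us ! i \<in> set (iter_sweedler R H (length hs - 1 - i) (hs ! i))"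
      using assms(2) that unfolding left_lists_def product_lists_set
      by (auto simp: list_all2_conv_all_nth)
    moreover have "hs ! i \<in> carrier H"
      using assms(1) that by auto
    ultimately have "us ! i \<in> lists (carrier H) \<and> length (us ! i) = Suc (length hs - 1 - i)"
      by (intro iter_sweedler_carrier)
    with that show ?thesis by auto
  qed
  then show ?thesis
    unfolding left_args_def by (auto intro!: HA.M.prod_of_closed simp del: upt_Suc)
qed

lemma left_counit_word_A: "hs \<in> lists (carrier H) \<Longrightarrow> par_left_counit_word R H hs \<in> A"
  unfolding left_counit_word
proof (rule sum_of_A)
  assume hs: "hs \<in> lists (carrier H)"
  have "prod_of P (map e (left_args (length hs) us)) \<in> A" if "us \<in> set (left_lists hs)" for us
    by (rule prod_of_A) (use left_lists_carrier[OF hs that] in auto)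
  then show "set (map (\<lambda>us. prod_of P (map e (left_args (length hs) us))) (left_lists hs)) \<subseteq> A"
    by auto
qed

lemma left_counit_word_Nil: "par_left_counit_word R H [] = \<one>\<^bsub>P\<^esub>"
  by (simp add: par_left_counit_word_def)

text \<open>The two sums are swapped so that the tuples of the first letter are summed innermost;
  for fixed tuples of the other letters this inner sum is \<open>eps_sum_one\<close>.\<close>

lemma left_counit_word_Cons:
  assumes h: "h \<in> carrier H" and hs: "hs \<in> lists (carrier H)"
  shows "par_left_counit_word R H (h # hs) = act h (par_left_counit_word R H hs)"
proof -
  let ?n = "length hs" and ?us = "left_lists hs" and ?it = "iter_sweedler R H (length hs) h"
  let ?f = "\<lambda>u us. prod_of P (map2 (\<lambda>x q. e (x \<cdot> q)) u (\<one>\<^sub>H # left_args ?n us))"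
  have args: "set (\<one>\<^sub>H # left_args ?n us) \<subseteq> carrier H" if "us \<in> set ?us" for us
    using left_lists_carrier[OF hs that] by simp
  have f: "?f u us \<in> carrier P" if u: "u \<in> set ?it" and us: "us \<in> set ?us" for u us
    using args[OF us] iter_sweedler_carrier[OF h u]
    by (intro PA.M.prod_of_closed set_map2_closed) simp_all
  have "par_left_counit_word R H (h # hs) =
      sum_of P (concat (map (\<lambda>u. map (\<lambda>us. prod_of P (map e (left_args (Suc ?n) (u # us)))) ?us) ?it))"
    unfolding left_counit_word left_lists_Cons by (simp add: map_concat comp_def)
  also have "map (\<lambda>u. map (\<lambda>us. prod_of P (map e (left_args (Suc ?n) (u # us)))) ?us) ?it =
      map (\<lambda>u. map (?f u) ?us) ?it"
    using iter_sweedler_carrier[OF h]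
    by (intro map_cong refl) (simp only: left_args_Cons map_map2)
  also have "sum_of P (concat (map (\<lambda>u. map (?f u) ?us) ?it)) =
      sum_of P (map (sum_of P) (map (\<lambda>u. map (?f u) ?us) ?it))"
    by (rule PA.M.sum_of_concat) (use f in auto)
  also have "\<dots> = sum_of P (map (\<lambda>u. sum_of P (map (?f u) ?us)) ?it)"
    by (simp add: comp_def)
  also have "\<dots> = sum_of P (map (\<lambda>us. sum_of P (map (\<lambda>u. ?f u us) ?it)) ?us)"
    by (rule PA.M.sum_of_swap) (rule f)
  also have "map (\<lambda>us. sum_of P (map (\<lambda>u. ?f u us) ?it)) ?us =
      map (\<lambda>us. act h (prod_of P (map e (left_args ?n us)))) ?us"
  proof (intro map_cong refl)
    fix us assume us: "us \<in> set ?us"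
    have "sum_of P (map (\<lambda>u. ?f u us) ?it) = eps_sum h (\<one>\<^sub>H # left_args ?n us)"
      using h args[OF us] by (intro sum_iter_sweedler) (simp_all add: left_args_def)
    also have "\<dots> = act h (prod_of P (map e (left_args ?n us)))"
      using args[OF us] h by (intro eps_sum_one) simp_all
    finally show "sum_of P (map (\<lambda>u. ?f u us) ?it) = act h (prod_of P (map e (left_args ?n us)))" .
  qed
  also have "\<dots> = map (act h) (map (\<lambda>us. prod_of P (map e (left_args ?n us))) ?us)"
    by (simp add: comp_def)
  also have "sum_of P \<dots> = act h (par_left_counit_word R H hs)"
    unfolding left_counit_word
  proof (rule additive_map_sum_of[symmetric])
    show "additive_map P P (act h)"
      unfolding act_def using h by (intro lin_map_additive[where R = R] lin_intros; simp)
    show "set (map (\<lambda>us. prod_of P (map e (left_args ?n us))) ?us) \<subseteq> carrier P"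
    proof -
      have "prod_of P (map e (left_args ?n us)) \<in> A" if "us \<in> set ?us" for us
        by (rule prod_of_A) (use args[OF that] in auto)
      then show ?thesis by auto
    qed
  qed simp_all
  finally show ?thesis .
qed

subsection \<open>The right counit\<close>

abbreviation "eps'_sum \<equiv> comult_prod (\<lambda>x q. e' (q \<cdot> x))"

definition act' :: "'h \<Rightarrow> ('k, 'h) hpar \<Rightarrow> ('k, 'h) hpar" where
  "act' h b = SW P (\<lambda>x y. cl (S x) \<star> b \<star> cl y) h"

lemma act'_one: "h \<in> carrier H \<Longrightarrow> act' h \<one>\<^bsub>P\<^esub> = e' h"
  by (simp add: act'_def eps'_eq)

text \<open>Mirror image of \<open>act_eps\<close>: \<open>e'\<close> moves to the right through
  [S(h2)], its index becomes q h1 S(h2) and cancels, and the new factor lands on the left of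
  \<open>b\<close>.\<close>

lemma eps'_act':
  assumes [simp]: "h \<in> carrier H" "q \<in> carrier H" "b \<in> carrier P"
  shows "SW P (\<lambda>x y. e' (q \<cdot> x) \<star> act' y b) h = act' h (e' q \<star> b)"
proof -
  have "SW P (\<lambda>x y. e' (q \<cdot> x) \<star> act' y b) h =
      SW P (\<lambda>x y. SW P (\<lambda>u v. e' (q \<cdot> x) \<star> cl (S u) \<star> (b \<star> cl v)) y) h"
    by (simp add: act'_def SW_mult_left PA.M.m_assoc)
  also have "\<dots> = SW P (\<lambda>x y. SW P (\<lambda>u v. SW P (\<lambda>c d. cl c \<star> e' (q \<cdot> x \<cdot> d) \<star> (b \<star> cl v)) (S u)) y) h"
    by (simp add: eps'_cl SW_mult_right)
  also have "\<dots> = SW P (\<lambda>x y. SW P (\<lambda>u v. SW P (\<lambda>c d. cl (S d) \<star> e' (q \<cdot> x \<cdot> S c) \<star> (b \<star> cl v)) u) y) h"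
    by (rule SW_congI, simp, rule SW_congI, simp, rule SW_antipode; (intro lin_intros)?; simp)
  also have "\<dots> = SW P (\<lambda>x y. SW P (\<lambda>c w. SW P (\<lambda>d v. cl (S d) \<star> e' (q \<cdot> x \<cdot> S c) \<star> (b \<star> cl v)) w) y) h"
    by (rule SW_congI, simp, rule SW_coassoc; (intro lin_intros)?; simp)
  also have "\<dots> = SW P (\<lambda>x y. SW P (\<lambda>c w. SW P (\<lambda>d v. cl (S d) \<star> e' (q \<cdot> (x \<cdot> S c)) \<star> (b \<star> cl v)) w) y) h"
    by (simp add: HA.m_assoc)
  also have "\<dots> = SW P (\<lambda>d v. cl (S d) \<star> e' (q \<cdot> \<one>\<^sub>H) \<star> (b \<star> cl v)) h"
    by (rule cancel_left[OF cancels_antipode_right, where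
          g="\<lambda>m w. SW P (\<lambda>d v. cl (S d) \<star> e' (q \<cdot> m) \<star> (b \<star> cl v)) w"]; (intro lin_intros)?; simp)
  also have "\<dots> = act' h (e' q \<star> b)"
    by (simp add: act'_def PA.M.m_assoc)
  finally show ?thesis .
qed

lemma eps'_sum_one:
  assumes "set qs \<subseteq> carrier H" "h \<in> carrier H"
  shows "eps'_sum h (qs @ [\<one>\<^sub>H]) = act' h (prod_of P (map e' qs))"
  using assms
proof (induction qs arbitrary: h)
  case Nil
  then show ?case by (simp add: act'_one)
next
  case (Cons q qs)
  then obtain q' qs' where qs': "qs @ [\<one>\<^sub>H] = q' # qs'" by (cases qs) auto
  have "eps'_sum h ((q # qs) @ [\<one>\<^sub>H]) = SW P (\<lambda>x y. e' (q \<cdot> x) \<star> eps'_sum y (qs @ [\<one>\<^sub>H])) h"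
    unfolding append_Cons qs' by simp
  also have "\<dots> = act' h (prod_of P (map e' (q # qs)))"
    using Cons by (simp add: eps'_act')
  finally show ?case .
qed

definition right_args :: "nat \<Rightarrow> 'h list list \<Rightarrow> 'h list" where
  "right_args n us = map (\<lambda>j. prod_of H (map (\<lambda>i. us ! i ! j) [j..<n])) [0..<n]"

definition right_lists :: "'h list \<Rightarrow> 'h list list list" where
  "right_lists hs = product_lists (map (\<lambda>i. iter_sweedler R H i (hs ! i)) [0..<length hs])"

lemma right_counit_word:
  "par_right_counit_word R H hs =
    sum_of P (map (\<lambda>us. prod_of P (map e' (right_args (length hs) us))) (right_lists hs))"
  by (simp add: par_right_counit_word_def right_args_def right_lists_def Let_def comp_def)

lemma product_lists_snoc:
  "product_lists (xss @ [ys]) = concat (map (\<lambda>xs. map (\<lambda>y. xs @ [y]) ys) (product_lists xss))"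
proof (induction xss)
  case (Cons zs xss)
  then show ?case
    by (induction zs) (simp_all add: map_concat comp_def)
qed (simp add: comp_def)

lemma right_lists_snoc:
  "right_lists (hs @ [h]) =
    concat (map (\<lambda>us. map (\<lambda>u. us @ [u]) (iter_sweedler R H (length hs) h)) (right_lists hs))"
proof -
  have "map (\<lambda>i. iter_sweedler R H i ((hs @ [h]) ! i)) [0..<length (hs @ [h])] =
      map (\<lambda>i. iter_sweedler R H i (hs ! i)) [0..<length hs] @ [iter_sweedler R H (length hs) h]"
    by (auto simp: nth_append)
  then show ?thesis
    unfolding right_lists_def by (simp only: product_lists_snoc)
qed

lemma right_lists_nth:
  assumes "hs \<in> lists (carrier H)" "us \<in> set (right_lists hs)"
  shows "length us = length hs" "j \<le> i \<Longrightarrow> i < length hs \<Longrightarrow> us ! i ! j \<in> carrier H"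
proof -
  have us: "list_all2 (\<lambda>x ys. x \<in> set ys) us (map (\<lambda>i. iter_sweedler R H i (hs ! i)) [0..<length hs])"
    using assms(2) unfolding right_lists_def product_lists_set by simp
  then show "length us = length hs" by (auto dest: list_all2_lengthD)
  assume ij: "j \<le> i" "i < length hs"
  have "us ! i \<in> set (iter_sweedler R H i (hs ! i))"
    using us ij by (auto simp: list_all2_conv_all_nth)
  moreover have "hs ! i \<in> carrier H"
    using assms(1) ij by auto
  ultimately have "us ! i \<in> lists (carrier H) \<and> length (us ! i) = Suc i"
    by (intro iter_sweedler_carrier)
  with ij show "us ! i ! j \<in> carrier H" by auto
qed

lemma right_lists_carrier:
  assumes "hs \<in> lists (carrier H)" "us \<in> set (right_lists hs)"
  shows "set (right_args (length hs) us) \<subseteq> carrier H"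
  unfolding right_args_def using right_lists_nth[OF assms]
  by (auto intro!: HA.M.prod_of_closed)

text \<open>Here words grow at the end: a new last letter multiplies every argument on the right.
  For j equal to the old length the range \<open>[j..<n]\<close> is empty, which gives the appended
  1.\<close>

lemma right_args_snoc:
  assumes hs: "hs \<in> lists (carrier H)" and us: "us \<in> set (right_lists hs)"
    and u: "u \<in> lists (carrier H)" "length u = Suc (length hs)"
  shows "right_args (Suc (length hs)) (us @ [u]) = map2 (\<lambda>x q. q \<cdot> x) u (right_args (length hs) us @ [\<one>\<^sub>H])"
proof (rule nth_equalityI)
  let ?n = "length hs"
  note l = right_lists_nth[OF hs us]
  fix j assume "j < length (right_args (Suc ?n) (us @ [u]))"
  then have j: "j \<le> ?n" by (simp add: right_args_def)
  have uj: "u ! j \<in> carrier H" using u j by auto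
  have "[j..<Suc ?n] = [j..<?n] @ [?n]" using j by simp
  then have "map (\<lambda>i. (us @ [u]) ! i ! j) [j..<Suc ?n] = map (\<lambda>i. us ! i ! j) [j..<?n] @ [u ! j]"
    using l(1) by (simp add: nth_append del: upt_Suc)
  moreover have "set (map (\<lambda>i. us ! i ! j) [j..<?n]) \<subseteq> carrier H"
    using l(2) by auto
  ultimately have eq: "prod_of H (map (\<lambda>i. (us @ [u]) ! i ! j) [j..<Suc ?n]) =
      prod_of H (map (\<lambda>i. us ! i ! j) [j..<?n]) \<cdot> u ! j"
    using uj HA.M.prod_of_append[of "map (\<lambda>i. us ! i ! j) [j..<?n]" "[u ! j]"] by (simp del: upt_Suc)
  have "right_args (Suc ?n) (us @ [u]) ! j = prod_of H (map (\<lambda>i. (us @ [u]) ! i ! j) [j..<Suc ?n])"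
    using j by (simp add: right_args_def nth_append del: upt_Suc)
  moreover have "(right_args ?n us @ [\<one>\<^sub>H]) ! j = prod_of H (map (\<lambda>i. us ! i ! j) [j..<?n])"
    using j by (auto simp: right_args_def nth_append)
  ultimately show "right_args (Suc ?n) (us @ [u]) ! j =
      map2 (\<lambda>x q. q \<cdot> x) u (right_args ?n us @ [\<one>\<^sub>H]) ! j"
    using eq j u(2) by (simp add: right_args_def del: upt_Suc)
qed (use u in \<open>simp add: right_args_def\<close>)

lemma right_counit_word_Nil: "par_right_counit_word R H [] = \<one>\<^bsub>P\<^esub>"
  by (simp add: par_right_counit_word_def)

lemma right_counit_word_snoc:
  assumes h: "h \<in> carrier H" and hs: "hs \<in> lists (carrier H)"
  shows "par_right_counit_word R H (hs @ [h]) = act' h (par_right_counit_word R H hs)"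
proof -
  let ?n = "length hs" and ?us = "right_lists hs" and ?it = "iter_sweedler R H (length hs) h"
  let ?f = "\<lambda>us u. prod_of P (map2 (\<lambda>x q. e' (q \<cdot> x)) u (right_args ?n us @ [\<one>\<^sub>H]))"
  have args: "set (right_args ?n us @ [\<one>\<^sub>H]) \<subseteq> carrier H" if "us \<in> set ?us" for us
    using right_lists_carrier[OF hs that] by simp
  have f: "?f us u \<in> carrier P" if u: "u \<in> set ?it" and us: "us \<in> set ?us" for u us
    using args[OF us] iter_sweedler_carrier[OF h u]
    by (intro PA.M.prod_of_closed set_map2_closed) simp_all
  have "par_right_counit_word R H (hs @ [h]) =
      sum_of P (concat (map (\<lambda>us. map (\<lambda>u. prod_of P (map e' (right_args (Suc ?n) (us @ [u])))) ?it) ?us))"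
    unfolding right_counit_word right_lists_snoc by (simp add: map_concat comp_def)
  also have "map (\<lambda>us. map (\<lambda>u. prod_of P (map e' (right_args (Suc ?n) (us @ [u])))) ?it) ?us =
      map (\<lambda>us. map (?f us) ?it) ?us"
  proof (intro map_cong refl)
    fix us u assume "us \<in> set ?us" "u \<in> set ?it"
    then have "right_args (Suc ?n) (us @ [u]) = map2 (\<lambda>x q. q \<cdot> x) u (right_args ?n us @ [\<one>\<^sub>H])"
      using iter_sweedler_carrier[OF h] by (intro right_args_snoc hs) blast+
    then show "prod_of P (map e' (right_args (Suc ?n) (us @ [u]))) = ?f us u"
      by (simp only: map_map2)
  qed
  also have "sum_of P (concat (map (\<lambda>us. map (?f us) ?it) ?us)) =
      sum_of P (map (sum_of P) (map (\<lambda>us. map (?f us) ?it) ?us))"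
    by (rule PA.M.sum_of_concat) (use f in auto)
  also have "\<dots> = sum_of P (map (\<lambda>us. sum_of P (map (?f us) ?it)) ?us)"
    by (simp add: comp_def)
  also have "map (\<lambda>us. sum_of P (map (?f us) ?it)) ?us =
      map (\<lambda>us. act' h (prod_of P (map e' (right_args ?n us)))) ?us"
  proof (intro map_cong refl)
    fix us assume us: "us \<in> set ?us"
    have "sum_of P (map (?f us) ?it) = eps'_sum h (right_args ?n us @ [\<one>\<^sub>H])"
      using h args[OF us] by (intro sum_iter_sweedler) (simp_all add: right_args_def)
    also have "\<dots> = act' h (prod_of P (map e' (right_args ?n us)))"
      using args[OF us] h by (intro eps'_sum_one) simp_all
    finally show "sum_of P (map (?f us) ?it) = act' h (prod_of P (map e' (right_args ?n us)))" .
  qed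
  also have "\<dots> = map (act' h) (map (\<lambda>us. prod_of P (map e' (right_args ?n us))) ?us)"
    by (simp add: comp_def)
  also have "sum_of P \<dots> = act' h (par_right_counit_word R H hs)"
    unfolding right_counit_word
  proof (rule additive_map_sum_of[symmetric])
    show "additive_map P P (act' h)"
      unfolding act'_def using h by (intro lin_map_additive[where R = R] lin_intros; simp)
    show "set (map (\<lambda>us. prod_of P (map e' (right_args ?n us))) ?us) \<subseteq> carrier P"
    proof -
      have "prod_of P (map e' (right_args ?n us)) \<in> A'" if "us \<in> set ?us" for us
        by (rule prod_of_A) (use args[OF that] in auto)
      then show ?thesis by auto
    qed
  qed simp_all
  finally show ?thesis .
qed

section \<open>Comultiplication of words\<close>

text \<open>Membership in \<open>lists\<close> stays atomic from here on, so that rules with such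
  premises apply directly.\<close>

declare in_lists_conv_set [simp del]

text \<open>The sum of \<open>f [h\<^sub>1\<^sub>1, \<dots>, h\<^sub>n\<^sub>1] [h\<^sub>1\<^sub>2, \<dots>, h\<^sub>n\<^sub>2]\<close> for a word \<open>[h\<^sub>1, \<dots>, h\<^sub>n]\<close>.\<close>

definition WL :: "('g, 'z) ring_scheme \<Rightarrow> ('h list \<Rightarrow> 'h list \<Rightarrow> 'g) \<Rightarrow> 'h list \<Rightarrow> 'g" where
  "WL G f hs = sum_of G (map (\<lambda>ps. f (map fst ps) (map snd ps)) (product_lists (map (sweedler R H) hs)))"

lemma comult_word_eq:
  "par_comult_word R H M C hs = WL (tensor M C M) (\<lambda>us vs. pure M C M (word us) (word vs)) hs"
  by (simp add: par_comult_word_def WL_def comp_def)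

lemma sweedler_lists_carrier:
  assumes "hs \<in> lists (carrier H)" "ps \<in> set (product_lists (map (sweedler R H) hs))"
  shows "map fst ps \<in> lists (carrier H)" "map snd ps \<in> lists (carrier H)"
proof -
  have "list_all2 (\<lambda>p h. p \<in> set (sweedler R H h)) ps hs"
    using assms(2) unfolding product_lists_set by (simp add: list_all2_map2)
  then have "map fst ps \<in> lists (carrier H) \<and> map snd ps \<in> lists (carrier H)"
    using assms(1)
  proof (induction rule: list_all2_induct)
    case (Cons p ps h hs)
    then show ?case using sweedler_carrier[of h] by (cases p) auto
  qed simp
  then show "map fst ps \<in> lists (carrier H)" "map snd ps \<in> lists (carrier H)" by blast+
qed

lemma WL_cong:
  "hs \<in> lists (carrier H) \<Longrightarrow>
    (\<And>us vs. us \<in> lists (carrier H) \<Longrightarrow> vs \<in> lists (carrier H) \<Longrightarrow> f us vs = g us vs) \<Longrightarrow>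
    WL G f hs = WL G g hs"
  unfolding WL_def using sweedler_lists_carrier[of hs] by (intro arg_cong[where f = "sum_of G"] map_cong) auto

lemma WL_closed [simp]:
  assumes "abelian_group G" "hs \<in> lists (carrier H)"
    "\<And>us vs. us \<in> lists (carrier H) \<Longrightarrow> vs \<in> lists (carrier H) \<Longrightarrow> f us vs \<in> carrier G"
  shows "WL G f hs \<in> carrier G"
  unfolding WL_def using sweedler_lists_carrier[OF assms(2)] assms(3)
  by (intro abelian_group.sum_of_closed[OF assms(1)]) auto

lemma WL_Nil: "abelian_group G \<Longrightarrow> f [] [] \<in> carrier G \<Longrightarrow> WL G f [] = f [] []"
proof -
  assume "abelian_group G" "f [] [] \<in> carrier G"
  then interpret G: abelian_group G by simp
  show ?thesis using \<open>f [] [] \<in> carrier G\<close> by (simp add: WL_def)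
qed

lemma WL_Cons:
  assumes G: "abelian_group G" and h: "h \<in> carrier H" and hs: "hs \<in> lists (carrier H)"
    and f: "\<And>us vs. us \<in> lists (carrier H) \<Longrightarrow> vs \<in> lists (carrier H) \<Longrightarrow> f us vs \<in> carrier G"
  shows "WL G f (h # hs) = SW G (\<lambda>x y. WL G (\<lambda>us vs. f (x # us) (y # vs)) hs) h"
proof -
  let ?g = "\<lambda>ps. f (map fst ps) (map snd ps)"
  let ?p = "product_lists (map (sweedler R H) hs)"
  have "WL G f (h # hs) = sum_of G (concat (map (\<lambda>z. map (\<lambda>ps. ?g (z # ps)) ?p) (sweedler R H h)))"
    by (simp add: WL_def map_concat comp_def)
  also have "\<dots> = sum_of G (map (sum_of G) (map (\<lambda>z. map (\<lambda>ps. ?g (z # ps)) ?p) (sweedler R H h)))"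
  proof (rule abelian_group.sum_of_concat[OF G])
    fix xs assume "xs \<in> set (map (\<lambda>z. map (\<lambda>ps. ?g (z # ps)) ?p) (sweedler R H h))"
    then obtain z where z: "z \<in> set (sweedler R H h)" and xs: "xs = map (\<lambda>ps. ?g (z # ps)) ?p" by auto
    have "fst z \<in> carrier H" "snd z \<in> carrier H" using sweedler_carrier[OF h] z by auto
    then have "?g (z # ps) \<in> carrier G" if "ps \<in> set ?p" for ps
      using sweedler_lists_carrier[OF hs that] by (intro f) simp_all
    then show "set xs \<subseteq> carrier G" unfolding xs by auto
  qed
  also have "\<dots> = SW G (\<lambda>x y. WL G (\<lambda>us vs. f (x # us) (y # vs)) hs) h"
    unfolding sweedler_sum_def WL_def map_map comp_def case_prod_beta by simp
  finally show ?thesis .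
qed

lemma WL_additive_map:
  assumes "additive_map G G' \<phi>" "abelian_group G" "abelian_group G'" "hs \<in> lists (carrier H)"
    "\<And>us vs. us \<in> lists (carrier H) \<Longrightarrow> vs \<in> lists (carrier H) \<Longrightarrow> f us vs \<in> carrier G"
  shows "\<phi> (WL G f hs) = WL G' (\<lambda>us vs. \<phi> (f us vs)) hs"
proof -
  have "\<phi> (WL G f hs) = sum_of G' (map \<phi> (map (\<lambda>ps. f (map fst ps) (map snd ps))
      (product_lists (map (sweedler R H) hs))))"
    unfolding WL_def using sweedler_lists_carrier[OF assms(4)] assms(5)
    by (intro additive_map_sum_of[OF assms(1-3)]) auto
  then show ?thesis by (simp add: WL_def comp_def)
qed

lemma WL_lin_map:
  assumes "lin_map R G G' \<phi>" "module R G" "module R G'" "hs \<in> lists (carrier H)"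
    "\<And>us vs. us \<in> lists (carrier H) \<Longrightarrow> vs \<in> lists (carrier H) \<Longrightarrow> f us vs \<in> carrier G"
  shows "\<phi> (WL G f hs) = WL G' (\<lambda>us vs. \<phi> (f us vs)) hs"
  using assms by (intro WL_additive_map lin_map_additive) (auto intro: module.axioms(2))

lemma WL_SW_swap:
  assumes "abelian_group G" "hs \<in> lists (carrier H)" "h \<in> carrier H"
    "\<And>us vs x y. us \<in> lists (carrier H) \<Longrightarrow> vs \<in> lists (carrier H) \<Longrightarrow> x \<in> carrier H \<Longrightarrow> y \<in> carrier H \<Longrightarrow>
      f us vs x y \<in> carrier G"
  shows "WL G (\<lambda>us vs. SW G (f us vs) h) hs = SW G (\<lambda>x y. WL G (\<lambda>us vs. f us vs x y) hs) h"
  unfolding sweedler_sum_def WL_def case_prod_beta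
  using sweedler_carrier[OF assms(3)] sweedler_lists_carrier[OF assms(2)]
  by (intro abelian_group.sum_of_swap[OF assms(1)] assms(4)) auto

text \<open>Linearity concerns a parameter of the summand; a word itself is a list and not an
  element of a module.\<close>

lemma lin_map_WL [lin_intros]:
  assumes G: "module R G" and hs: "hs \<in> lists (carrier H)"
    and f: "\<And>us vs. us \<in> lists (carrier H) \<Longrightarrow> vs \<in> lists (carrier H) \<Longrightarrow> lin_map R M G (\<lambda>x. f x us vs)"
  shows "lin_map R M G (\<lambda>x. WL G (f x) hs)"
proof -
  interpret G: module R G by fact
  let ?p = "product_lists (map (sweedler R H) hs)"
  have lin: "lin_map R M G (\<lambda>x. sum_of G (map (\<lambda>ps. g x ps) ps'))"
    if "\<And>ps. ps \<in> set ps' \<Longrightarrow> lin_map R M G (\<lambda>x. g x ps)" for g :: "_ \<Rightarrow> ('h \<times> 'h) list \<Rightarrow> _" and ps'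
    using that
  proof (induction ps')
    case Nil
    then show ?case by (simp add: lin_map_def)
  next
    case (Cons a ps')
    then have 1: "lin_map R M G (\<lambda>x. g x a)" "lin_map R M G (\<lambda>x. sum_of G (map (\<lambda>ps. g x ps) ps'))"
      by simp_all
    show ?case
      by (rule lin_mapI) (simp_all add: lin_map_closed[OF 1(1)] lin_map_closed[OF 1(2)]
          lin_map_add[OF 1(1)] lin_map_add[OF 1(2)] lin_map_smult[OF 1(1)] lin_map_smult[OF 1(2)]
          G.M.a_ac G.smult_r_distr)
  qed
  show ?thesis
    unfolding WL_def using sweedler_lists_carrier[OF hs] by (intro lin f) auto
qed

lemma WL_snoc:
  assumes G: "abelian_group G" and h: "h \<in> carrier H" and hs: "hs \<in> lists (carrier H)"
    and f: "\<And>us vs. us \<in> lists (carrier H) \<Longrightarrow> vs \<in> lists (carrier H) \<Longrightarrow> f us vs \<in> carrier G"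
  shows "WL G f (hs @ [h]) = WL G (\<lambda>us vs. SW G (\<lambda>x y. f (us @ [x]) (vs @ [y])) h) hs"
  using hs f
proof (induction hs arbitrary: f rule: list.induct)
  case Nil
  then show ?case using G h by (simp add: WL_Cons WL_Nil)
next
  case (Cons k ks)
  have "WL G f ((k # ks) @ [h]) = SW G (\<lambda>x y. WL G (\<lambda>us vs. f (x # us) (y # vs)) (ks @ [h])) k"
    using Cons.prems h by (simp add: WL_Cons[OF G])
  also have "\<dots> = SW G (\<lambda>x y. WL G (\<lambda>us vs. SW G (\<lambda>u v. f (x # us @ [u]) (y # vs @ [v])) h) ks) k"
    using Cons.prems by (intro SW_congI) (simp_all add: Cons.IH)
  also have "\<dots> = WL G (\<lambda>us vs. SW G (\<lambda>x y. f (us @ [x]) (vs @ [y])) h) (k # ks)"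
    using Cons.prems h G by (subst WL_Cons[OF G]) simp_all
  finally show ?case .
qed

text \<open>Coassociativity letter by letter. The first letter is absorbed into \<open>f\<close> as
  left multiplication by its components in the three slots, so the induction ranges over all
  trilinear \<open>f\<close>.\<close>

lemma WL_coassoc:
  assumes G: "module R G" and hs: "hs \<in> lists (carrier H)"
    and f: "\<And>y z. y \<in> carrier P \<Longrightarrow> z \<in> carrier P \<Longrightarrow> lin_map R P G (\<lambda>x. f x y z)"
      "\<And>x z. x \<in> carrier P \<Longrightarrow> z \<in> carrier P \<Longrightarrow> lin_map R P G (\<lambda>y. f x y z)"
      "\<And>x y. x \<in> carrier P \<Longrightarrow> y \<in> carrier P \<Longrightarrow> lin_map R P G (\<lambda>z. f x y z)"
  shows "WL G (\<lambda>ws zs. WL G (\<lambda>xs ys. f (word xs) (word ys) (word zs)) ws) hs =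
    WL G (\<lambda>xs ws. WL G (\<lambda>ys zs. f (word xs) (word ys) (word zs)) ws) hs"
  using hs f
proof (induction hs arbitrary: f rule: list.induct)
  case Nil
  interpret G: module R G by fact
  have "f \<one>\<^bsub>P\<^esub> \<one>\<^bsub>P\<^esub> \<one>\<^bsub>P\<^esub> \<in> carrier G" 
    using lin_map_closed[OF Nil.prems(2)[OF PA.M.one_closed PA.M.one_closed] PA.M.one_closed] .
  then show ?case using G.M.abelian_group_axioms by (simp add: WL_Nil)
next
  case (Cons h hs)
  interpret G: module R G by fact
  note aG = G.M.abelian_group_axioms
  have h: "h \<in> carrier H" and hs: "hs \<in> lists (carrier H)" using Cons.prems by auto
  note f1 = lin_map_comp[OF Cons.prems(2)] and f2 = lin_map_comp[OF Cons.prems(3)]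
    and f3 = lin_map_comp[OF Cons.prems(4)]
  have fc [simp]: "f x y z \<in> carrier G" if "x \<in> carrier P" "y \<in> carrier P" "z \<in> carrier P" for x y z
    using lin_map_closed[OF Cons.prems(2)[OF that(2,3)] that(1)] .
  note [simp] = h hs aG
  let ?f = "\<lambda>x y z X Y Z. f (cl x \<star> X) (cl y \<star> Y) (cl z \<star> Z)"
  have IH: "WL G (\<lambda>ws zs. WL G (\<lambda>xs ys. ?f x y z (word xs) (word ys) (word zs)) ws) hs =
      WL G (\<lambda>xs ws. WL G (\<lambda>ys zs. ?f x y z (word xs) (word ys) (word zs)) ws) hs"
    if [simp]: "x \<in> carrier H" "y \<in> carrier H" "z \<in> carrier H" for x y z
    by (rule Cons.IH; (intro f1 f2 f3 lin_intros)?; simp)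
  have "WL G (\<lambda>ws zs. WL G (\<lambda>xs ys. f (word xs) (word ys) (word zs)) ws) (h # hs) =
      SW G (\<lambda>w z. WL G (\<lambda>ws zs. SW G (\<lambda>x y. WL G (\<lambda>xs ys. ?f x y z (word xs) (word ys) (word zs)) ws) w) hs) h"
    by (simp add: WL_Cons)
      (rule SW_congI, simp, rule WL_cong, simp, simp add: WL_Cons)
  also have "\<dots> = SW G (\<lambda>w z. SW G (\<lambda>x y. WL G (\<lambda>ws zs. WL G (\<lambda>xs ys. ?f x y z (word xs) (word ys) (word zs)) ws) hs) w) h"
    by (rule SW_congI, simp, rule WL_SW_swap) simp_all
  also have "\<dots> = SW G (\<lambda>w z. SW G (\<lambda>x y. WL G (\<lambda>xs ws. WL G (\<lambda>ys zs. ?f x y z (word xs) (word ys) (word zs)) ws) hs) w) h"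
    by (simp add: IH)
  also have "\<dots> = SW G (\<lambda>x w. SW G (\<lambda>y z. WL G (\<lambda>xs ws. WL G (\<lambda>ys zs. ?f x y z (word xs) (word ys) (word zs)) ws) hs) w) h"
    by (rule SW_coassoc; (intro f1 f2 f3 lin_intros G)?; simp)
  also have "\<dots> = SW G (\<lambda>x w. WL G (\<lambda>xs ws. SW G (\<lambda>y z. WL G (\<lambda>ys zs. ?f x y z (word xs) (word ys) (word zs)) ws) w) hs) h"
    by (rule SW_congI, simp, rule WL_SW_swap[symmetric]) simp_all
  also have "\<dots> = WL G (\<lambda>xs ws. WL G (\<lambda>ys zs. f (word xs) (word ys) (word zs)) ws) (h # hs)"
    by (simp add: WL_Cons)
      (rule SW_congI, simp, rule WL_cong, simp, simp add: WL_Cons)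
  finally show ?case .
qed

text \<open>The antipode reverses the word and exchanges the two slots. One side loses its last
  letter by \<open>WL_snoc\<close>, the other its first letter by \<open>WL_Cons\<close>, and the
  letter split off is absorbed into \<open>f\<close>.\<close>

lemma WL_inv_antipode:
  assumes G: "module R G" and hs: "hs \<in> lists (carrier H)" and f: "bilin R P P G f"
  shows "WL G (\<lambda>us vs. f (word us) (word vs)) (map S\<^sub>i (rev hs)) =
    WL G (\<lambda>us vs. f (word (map S\<^sub>i (rev vs))) (word (map S\<^sub>i (rev us)))) hs"
  using hs f
proof (induction hs arbitrary: f rule: list.induct)
  case Nil
  interpret G: module R G by fact
  have "f \<one>\<^bsub>P\<^esub> \<one>\<^bsub>P\<^esub> \<in> carrier G" using bilin_closed[OF Nil.prems(2)] by simp
  then show ?case using G.M.abelian_group_axioms by (simp add: WL_Nil)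
next
  case (Cons h hs)
  interpret G: module R G by fact
  note aG = G.M.abelian_group_axioms
  have h [simp]: "h \<in> carrier H" and hs: "hs \<in> lists (carrier H)" using Cons.prems by auto
  have hs' [simp]: "map S\<^sub>i (rev ks) \<in> lists (carrier H)" if "ks \<in> lists (carrier H)" for ks
    using that by (auto simp: in_lists_conv_set)
  note [simp] = hs aG bilin_closed[OF Cons.prems(2)]
  note f1 = bilin_left[OF Cons.prems(2)] and f2 = bilin_right[OF Cons.prems(2)]
  let ?f = "\<lambda>x y X Y. f (X \<star> cl (S\<^sub>i y)) (Y \<star> cl (S\<^sub>i x))"
  have IH: "WL G (\<lambda>us vs. ?f x y (word us) (word vs)) (map S\<^sub>i (rev hs)) =
      WL G (\<lambda>us vs. ?f x y (word (map S\<^sub>i (rev vs))) (word (map S\<^sub>i (rev us)))) hs"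
    if [simp]: "x \<in> carrier H" "y \<in> carrier H" for x y
    by (rule Cons.IH[OF hs bilinI]; (intro f1 f2 lin_intros)?; simp)
  have snoc: "word (us @ [x]) = word us \<star> cl x" if "us \<in> lists (carrier H)" "x \<in> carrier H" for us x
    using that word_append[of us "[x]"] by simp
  have "WL G (\<lambda>us vs. f (word us) (word vs)) (map S\<^sub>i (rev (h # hs))) =
      WL G (\<lambda>us vs. SW G (\<lambda>x y. f (word us \<star> cl x) (word vs \<star> cl y)) (S\<^sub>i h)) (map S\<^sub>i (rev hs))"
    using WL_snoc[OF aG, of "S\<^sub>i h" "map S\<^sub>i (rev hs)" "\<lambda>us vs. f (word us) (word vs)"]
    by (simp del: map_append add: map_append[of S\<^sub>i])
      (rule WL_cong, simp, rule SW_congI, simp, simp only: snoc)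
  also have "\<dots> = WL G (\<lambda>us vs. SW G (\<lambda>x y. ?f x y (word us) (word vs)) h) (map S\<^sub>i (rev hs))"
    by (rule WL_cong, simp, rule SW_inv_antipode; (intro f1 f2 lin_intros G)?; simp)
  also have "\<dots> = SW G (\<lambda>x y. WL G (\<lambda>us vs. ?f x y (word us) (word vs)) (map S\<^sub>i (rev hs))) h"
    by (rule WL_SW_swap) simp_all
  also have "\<dots> = SW G (\<lambda>x y. WL G (\<lambda>us vs. ?f x y (word (map S\<^sub>i (rev vs))) (word (map S\<^sub>i (rev us)))) hs) h"
    by (simp add: IH)
  also have "\<dots> = SW G (\<lambda>x y. WL G (\<lambda>us vs. f (word (map S\<^sub>i (rev (y # vs)))) (word (map S\<^sub>i (rev (x # us))))) hs) h"
  proof (rule SW_congI[OF h], rule WL_cong[OF hs])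
    fix x y us vs
    assume *: "x \<in> carrier H" "y \<in> carrier H" "us \<in> lists (carrier H)" "vs \<in> lists (carrier H)"
    have "word (map S\<^sub>i (rev (z # ks))) = word (map S\<^sub>i (rev ks)) \<star> cl (S\<^sub>i z)"
      if "z \<in> carrier H" "ks \<in> lists (carrier H)" for z ks
      using snoc[OF hs'[OF that(2)] inv_antipode_closed[OF that(1)]] by simp
    then show "?f x y (word (map S\<^sub>i (rev vs))) (word (map S\<^sub>i (rev us))) =
        f (word (map S\<^sub>i (rev (y # vs)))) (word (map S\<^sub>i (rev (x # us))))"
      using * by presburger
  qed
  also have "\<dots> = WL G (\<lambda>us vs. f (word (map S\<^sub>i (rev vs))) (word (map S\<^sub>i (rev us)))) (h # hs)"
    by (rule WL_Cons[OF aG h hs, symmetric]) (intro bilin_closed[OF Cons.prems(2)] word_closed hs')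
  finally show ?case .
qed

section \<open>Antipodes of \<open>H\<^sub>p\<^sub>a\<^sub>r\<close>\<close>

lemma SW_op [simp]: "SW (op_algebra G) f h = SW G f h"
  by (simp add: sweedler_sum_def sum_of_def)

text \<open>Passing to the opposite algebra exchanges the first relation with the fourth and the
  second with the third. The assumptions on \<sigma> are what the antipode and its inverse have in
  common.\<close>

lemma partial_rep_op:
  assumes \<sigma>: "lin H \<sigma>" "\<sigma> \<one>\<^sub>H = \<one>\<^sub>H"
    and mult: "\<And>h k. h \<in> carrier H \<Longrightarrow> k \<in> carrier H \<Longrightarrow> \<sigma> (h \<cdot> k) = \<sigma> k \<cdot> \<sigma> h"
    and S: "\<And>h. h \<in> carrier H \<Longrightarrow> \<sigma> (S h) = S (\<sigma> h)"
    and SW: "\<And>f h. h \<in> carrier H \<Longrightarrow> bilin R H H P f \<Longrightarrow> SW P f (\<sigma> h) = SW P (\<lambda>x y. f (\<sigma> y) (\<sigma> x)) h"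
  shows "partial_rep (op_algebra P) (\<lambda>h. cl (\<sigma> h))"
proof -
  have [simp]: "\<sigma> h \<in> carrier H" if "h \<in> carrier H" for h
    by (rule lin_map_closed[OF \<sigma>(1) that])
  note [simp] = S mult \<sigma>(2)
  note sw = SW[OF _ bilinI]
  have 1: "e (\<sigma> h) = SW P (\<lambda>x y. cl (\<sigma> y) \<star> cl (S (\<sigma> x))) h"
    "e' (\<sigma> h) = SW P (\<lambda>x y. cl (S (\<sigma> y)) \<star> cl (\<sigma> x)) h" if "h \<in> carrier H" for h
    unfolding eps_eq eps'_eq using that by (subst sw; (intro lin_intros)?; simp)+
  have lin: "lin (op_algebra P) (\<lambda>h. cl (\<sigma> h))"
    using lin_map_comp[OF cl_lin \<sigma>(1)] by (auto simp: lin_map_def)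
  have r1: "SW P (\<lambda>x y. cl (S (\<sigma> y)) \<star> (cl (\<sigma> x) \<star> cl (\<sigma> h))) l = SW P (\<lambda>x y. cl (S (\<sigma> y)) \<star> cl (\<sigma> x \<cdot> \<sigma> h)) l"
    if [simp]: "h \<in> carrier H" "l \<in> carrier H" for h l
  proof -
    have "e' (\<sigma> l) \<star> cl (\<sigma> h) = SW P (\<lambda>x y. cl (S (\<sigma> y)) \<star> cl (\<sigma> x \<cdot> \<sigma> h)) l"
      by (simp add: eps'_mult_cl, rule sw; (intro lin_intros)?; simp)
    then show ?thesis by (simp add: 1 SW_mult_right PA.M.m_assoc)
  qed
  have r2: "SW P (\<lambda>x y. cl (\<sigma> l) \<star> (cl (S (\<sigma> y)) \<star> cl (\<sigma> x))) h = SW P (\<lambda>x y. cl (\<sigma> l \<cdot> S (\<sigma> y)) \<star> cl (\<sigma> x)) h"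
    if [simp]: "h \<in> carrier H" "l \<in> carrier H" for h l
  proof -
    have "cl (\<sigma> l) \<star> e' (\<sigma> h) = SW P (\<lambda>x y. cl (\<sigma> l \<cdot> S (\<sigma> y)) \<star> cl (\<sigma> x)) h"
      by (simp add: cl_mult_eps', rule sw; (intro lin_intros)?; simp)
    then show ?thesis by (simp add: 1 SW_mult_left)
  qed
  have r3: "SW P (\<lambda>x y. cl (\<sigma> y) \<star> (cl (S (\<sigma> x)) \<star> cl (\<sigma> h))) l = SW P (\<lambda>x y. cl (\<sigma> y) \<star> cl (S (\<sigma> x) \<cdot> \<sigma> h)) l"
    if [simp]: "h \<in> carrier H" "l \<in> carrier H" for h l
  proof -
    have "e (\<sigma> l) \<star> cl (\<sigma> h) = SW P (\<lambda>x y. cl (\<sigma> y) \<star> cl (S (\<sigma> x) \<cdot> \<sigma> h)) l"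
      by (simp add: eps_mult_cl, rule sw; (intro lin_intros)?; simp)
    then show ?thesis by (simp add: 1 SW_mult_right PA.M.m_assoc)
  qed
  have r4: "SW P (\<lambda>x y. cl (\<sigma> l) \<star> (cl (\<sigma> y) \<star> cl (S (\<sigma> x)))) h = SW P (\<lambda>x y. cl (\<sigma> l \<cdot> \<sigma> y) \<star> cl (S (\<sigma> x))) h"
    if [simp]: "h \<in> carrier H" "l \<in> carrier H" for h l
  proof -
    have "cl (\<sigma> l) \<star> e (\<sigma> h) = SW P (\<lambda>x y. cl (\<sigma> l \<cdot> \<sigma> y) \<star> cl (S (\<sigma> x))) h"
      by (simp add: cl_mult_eps, rule sw; (intro lin_intros)?; simp)
    then show ?thesis by (simp add: 1 SW_mult_left)
  qed
  show ?thesis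
    unfolding partial_rep_def by (simp add: lin r1 r2 r3 r4)
qed

lemma par_antipode_exists:
  obtains \<theta> where "alg_antihom R P P \<theta>" "\<And>h. h \<in> carrier H \<Longrightarrow> \<theta> (cl h) = cl (S h)"
proof -
  have "partial_rep (op_algebra P) (\<lambda>h. cl (S h))"
    by (rule partial_rep_op[OF antipode_lin antipode_one])
      (simp_all add: antipode_mult SW_antipode bilin_def)
  from Hpar_universal[OF assoc_algebra_op[OF algP] this] that show thesis
    unfolding alg_antihom_def by metis
qed

lemma par_inv_antipode_exists:
  obtains \<theta> where "alg_antihom R P P \<theta>" "\<And>h. h \<in> carrier H \<Longrightarrow> \<theta> (cl h) = cl (S\<^sub>i h)"
proof -
  have "partial_rep (op_algebra P) (\<lambda>h. cl (S\<^sub>i h))"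
    by (rule partial_rep_op[OF inv_antipode_lin inv_antipode_one])
      (simp_all add: inv_antipode_mult SW_inv_antipode bilin_def)
  from Hpar_universal[OF assoc_algebra_op[OF algP] this] that show thesis
    unfolding alg_antihom_def by metis
qed

lemma Hpar_gen_induct [consumes 1, case_names gen one add mult smult]:
  assumes "x \<in> carrier P" "\<And>h. h \<in> carrier H \<Longrightarrow> Q (cl h)" "Q \<one>\<^bsub>P\<^esub>"
    and "\<And>x y. x \<in> carrier P \<Longrightarrow> y \<in> carrier P \<Longrightarrow> Q x \<Longrightarrow> Q y \<Longrightarrow> Q (x \<oplus>\<^bsub>P\<^esub> y)"
    and mult: "\<And>x y. x \<in> carrier P \<Longrightarrow> y \<in> carrier P \<Longrightarrow> Q x \<Longrightarrow> Q y \<Longrightarrow> Q (x \<star> y)"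
    and "\<And>c x. c \<in> carrier R \<Longrightarrow> x \<in> carrier P \<Longrightarrow> Q x \<Longrightarrow> Q (c \<odot>\<^bsub>P\<^esub> x)"
  shows "Q x"
  using assms(1)
proof (induction rule: Hpar_induct)
  case (word hs)
  then show ?case
    by (induction hs rule: list.induct) (simp_all add: assms(3) mult assms(2))
qed (use assms in auto)

lemma alg_antihom_word:
  assumes "alg_antihom R P P \<theta>" "\<And>h. h \<in> carrier H \<Longrightarrow> \<theta> (cl h) = cl (\<sigma> h)"
    "\<And>h. h \<in> carrier H \<Longrightarrow> \<sigma> h \<in> carrier H" "hs \<in> lists (carrier H)"
  shows "\<theta> (word hs) = word (map \<sigma> (rev hs))"
  using assms(4)
proof (induction hs rule: list.induct)
  case Nil
  then show ?case using alg_hom_one[OF assms(1)[unfolded alg_antihom_def]] by simp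
next
  case (Cons h hs)
  then have c: "map \<sigma> (rev hs) \<in> lists (carrier H)" "[\<sigma> h] \<in> lists (carrier H)"
    using assms(3) by (auto simp: in_lists_conv_set)
  from Cons have "\<theta> (word (h # hs)) = word (map \<sigma> (rev hs)) \<star> cl (\<sigma> h)"
    using alg_hom_mult[OF assms(1)[unfolded alg_antihom_def]] assms(2) by simp
  also have "\<dots> = word (map \<sigma> (rev hs) @ [\<sigma> h])"
    using word_append[OF c] Cons assms(3) by simp
  finally show ?case by simp
qed

end

text \<open>The antipodes are parameters because the development serves both the maps constructed
  for existence and arbitrary maps that satisfy \<open>par_structure_maps\<close>.\<close>

locale par_antipodes = bij_hopf_algebra R H for R :: "'k ring" and H :: "('k, 'h) hopf" +
  fixes \<theta> \<theta>' :: "('k, 'h) hpar \<Rightarrow> ('k, 'h) hpar"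
  assumes anti: "alg_antihom R (Hpar R H) (Hpar R H) \<theta>" "alg_antihom R (Hpar R H) (Hpar R H) \<theta>'"
    and \<theta>_cl [simp]: "h \<in> carrier H \<Longrightarrow> \<theta> (cls R H h) = cls R H (antipode H h)"
      "h \<in> carrier H \<Longrightarrow> \<theta>' (cls R H h) = cls R H (antipode_inv H h)"
begin

lemma \<theta>_lin: "lin_map R P P \<theta>" "lin_map R P P \<theta>'"
  using anti by (auto simp: alg_antihom_def alg_hom_def lin_map_def)

lemmas lin_map_\<theta> [lin_intros] = lin_map_comp[OF \<theta>_lin(1)] lin_map_comp[OF \<theta>_lin(2)]

lemma \<theta>_simps [simp]:
  "x \<in> carrier P \<Longrightarrow> \<theta> x \<in> carrier P" "x \<in> carrier P \<Longrightarrow> \<theta>' x \<in> carrier P"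
  "x \<in> carrier P \<Longrightarrow> y \<in> carrier P \<Longrightarrow> \<theta> (x \<star> y) = \<theta> y \<star> \<theta> x"
  "x \<in> carrier P \<Longrightarrow> y \<in> carrier P \<Longrightarrow> \<theta>' (x \<star> y) = \<theta>' y \<star> \<theta>' x"
  "x \<in> carrier P \<Longrightarrow> y \<in> carrier P \<Longrightarrow> \<theta> (x \<oplus>\<^bsub>P\<^esub> y) = \<theta> x \<oplus>\<^bsub>P\<^esub> \<theta> y"
  "x \<in> carrier P \<Longrightarrow> y \<in> carrier P \<Longrightarrow> \<theta>' (x \<oplus>\<^bsub>P\<^esub> y) = \<theta>' x \<oplus>\<^bsub>P\<^esub> \<theta>' y"
  "c \<in> carrier R \<Longrightarrow> x \<in> carrier P \<Longrightarrow> \<theta> (c \<odot>\<^bsub>P\<^esub> x) = c \<odot>\<^bsub>P\<^esub> \<theta> x"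
  "c \<in> carrier R \<Longrightarrow> x \<in> carrier P \<Longrightarrow> \<theta>' (c \<odot>\<^bsub>P\<^esub> x) = c \<odot>\<^bsub>P\<^esub> \<theta>' x"
  "\<theta> \<one>\<^bsub>P\<^esub> = \<one>\<^bsub>P\<^esub>" "\<theta>' \<one>\<^bsub>P\<^esub> = \<one>\<^bsub>P\<^esub>"
  using anti by (auto simp: alg_antihom_def alg_hom_def lin_map_def ring_hom_def)

lemma \<theta>_inverse [simp]: "x \<in> carrier P \<Longrightarrow> \<theta> (\<theta>' x) = x" "x \<in> carrier P \<Longrightarrow> \<theta>' (\<theta> x) = x"
  by (induction rule: Hpar_gen_induct) simp_all

lemma \<theta>_word: "hs \<in> lists (carrier H) \<Longrightarrow> \<theta> (word hs) = word (map S (rev hs))"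
  "hs \<in> lists (carrier H) \<Longrightarrow> \<theta>' (word hs) = word (map S\<^sub>i (rev hs))"
  using alg_antihom_word[OF anti(1), of S] alg_antihom_word[OF anti(2), of S\<^sub>i] by simp_all

text \<open>An anti-homomorphism reverses the two factors, and \<open>eps_antipode\<close> with its
  variants recognises the result. Hence both antipodes exchange \<open>A\<close> and
  \<open>A'\<close>.\<close>

lemma \<theta>_eps [simp]:
  assumes "h \<in> carrier H"
  shows "\<theta> (e h) = e' (S h)" "\<theta> (e' h) = e (S h)" "\<theta>' (e h) = e' (S\<^sub>i h)" "\<theta>' (e' h) = e (S\<^sub>i h)"
  using assms
  by (simp_all add: eps_antipode eps'_antipode eps_inv_antipode eps'_inv_antipode,
      simp_all add: eps_eq eps'_eq SW_lin_map[OF \<theta>_lin(1)] SW_lin_map[OF \<theta>_lin(2)])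

lemma \<theta>_A [simp]: "a \<in> A \<Longrightarrow> \<theta> a \<in> A'" "a \<in> A \<Longrightarrow> \<theta>' a \<in> A'"
  by (induction rule: A_induct) simp_all

lemma \<theta>_A' [simp]: "a \<in> A' \<Longrightarrow> \<theta> a \<in> A" "a \<in> A' \<Longrightarrow> \<theta>' a \<in> A"
  by (induction rule: A'_induct) simp_all

section \<open>The bimodule structures on H_par\<close>

abbreviation "As \<equiv> par_base R H"
abbreviation "As' \<equiv> par_base' R H"
abbreviation "L \<equiv> left_bimod P (\<lambda>a. a) \<theta>'"
abbreviation "Q \<equiv> right_bimod P (\<lambda>a. a) \<theta>'"
abbreviation "LQ \<equiv> as_bimod P (lact L) (ract Q)"
abbreviation "QL \<equiv> as_bimod P (lact Q) (ract L)"

lemma bimod_simps [simp]: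
  "carrier (as_bimod M la ra) = carrier M" "ring.add (as_bimod M la ra) = ring.add M"
  "ring.zero (as_bimod M la ra) = ring.zero M" "one (as_bimod M la ra) = one M"
  "monoid.mult (as_bimod M la ra) = monoid.mult M" "smult (as_bimod M la ra) = smult M"
  "lact (as_bimod M la ra) = la" "ract (as_bimod M la ra) = ra"
  by (simp_all add: as_bimod_def)

lemma LQ_simps [simp]:
  "carrier L = carrier P" "ring.add L = ring.add P" "ring.zero L = ring.zero P" "one L = one P"
  "monoid.mult L = monoid.mult P" "smult L = smult P"
  "carrier Q = carrier P" "ring.add Q = ring.add P" "ring.zero Q = ring.zero P" "one Q = one P"
  "monoid.mult Q = monoid.mult P" "smult Q = smult P"
  "lact L a x = a \<star> x" "ract L x b = \<theta>' b \<star> x" "lact Q b x = x \<star> \<theta>' b" "ract Q x b = x \<star> b"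
  by (simp_all add: left_bimod_def right_bimod_def)

lemma module_as_bimod: "module R (as_bimod P la ra)"
proof (intro moduleI abelian_groupI)
  fix x assume "x \<in> carrier (as_bimod P la ra)"
  then show "\<exists>y\<in>carrier (as_bimod P la ra). y \<oplus>\<^bsub>as_bimod P la ra\<^esub> x = \<zero>\<^bsub>as_bimod P la ra\<^esub>"
    using PA.M.l_neg by auto
qed (simp_all add: HA.is_cring PA.smult_l_distr PA.smult_r_distr PA.smult_assoc1 PA.M.a_ac)

lemma module_LQ: "module R L" "module R Q"
  unfolding left_bimod_def right_bimod_def by (rule module_as_bimod)+

lemma A_left_commute: "a \<in> A \<Longrightarrow> b \<in> A' \<Longrightarrow> x \<in> carrier P \<Longrightarrow> b \<star> (a \<star> x) = a \<star> (b \<star> x)"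
  using A_commute[of a b] by (simp flip: PA.M.m_assoc)

lemmas bimodule_simps = module_LQ module_as_bimod PA.M.l_distr PA.M.r_distr PA.M.m_assoc
  PA.smult_mult_left PA.smult_mult_right A_commute A_left_commute

lemma bimodule_L: "bimodule R As As L"
  by (rule bimodule.intro; simp add: bimodule_simps)

lemma bimodule_Q: "bimodule R As' As' Q"
  by (rule bimodule.intro; simp add: bimodule_simps)

lemma bimodule_LQ: "bimodule R As As' LQ"
  by (rule bimodule.intro; simp add: bimodule_simps)

lemma bimodule_QL: "bimodule R As' As QL"
  by (rule bimodule.intro; simp add: bimodule_simps)

end

section \<open>Balanced maps and the left comultiplication\<close>

context bij_hopf_algebra
begin

text \<open>In the uses below a and c act on the first tensor slot, b and d on the second. As the
  coproduct of S(y) is reversed, the second slot receives b and S(c) from neighbouring parts of h, a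
  pair to which a relation applies. In \<open>SW_regroup_antipode_left\<close> such a pair arises in
  the first slot.\<close>

lemma SW_regroup_antipode_right:
  assumes G: "module R G" and h: "h \<in> carrier H"
    and F: "\<And>b c d. b \<in> carrier H \<Longrightarrow> c \<in> carrier H \<Longrightarrow> d \<in> carrier H \<Longrightarrow> lin G (\<lambda>a. F a b c d)"
      "\<And>a c d. a \<in> carrier H \<Longrightarrow> c \<in> carrier H \<Longrightarrow> d \<in> carrier H \<Longrightarrow> lin G (\<lambda>b. F a b c d)"
      "\<And>a b d. a \<in> carrier H \<Longrightarrow> b \<in> carrier H \<Longrightarrow> d \<in> carrier H \<Longrightarrow> lin G (\<lambda>c. F a b c d)"
      "\<And>a b c. a \<in> carrier H \<Longrightarrow> b \<in> carrier H \<Longrightarrow> c \<in> carrier H \<Longrightarrow> lin G (\<lambda>d. F a b c d)"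
  shows "SW G (\<lambda>x y. SW G (\<lambda>c d. SW G (\<lambda>a b. F a b c d) x) (S y)) h =
    SW G (\<lambda>a v. SW G (\<lambda>w d. SW G (\<lambda>b c. F a b (S d) (S c)) w) v) h"
proof -
  interpret G: module R G by fact
  note [simp] = h G G.M.abelian_group_axioms lin_map_closed[OF F(1)]
  note f = lin_map_comp[OF F(3)] lin_map_comp[OF F(4)]
  have "SW G (\<lambda>x y. SW G (\<lambda>c d. SW G (\<lambda>a b. F a b c d) x) (S y)) h =
      SW G (\<lambda>x y. SW G (\<lambda>c d. SW G (\<lambda>a b. F a b (S d) (S c)) x) y) h"
    by (rule SW_congI, simp, rule SW_antipode; (intro lin_intros F)?; simp)
  also have "\<dots> = SW G (\<lambda>x y. SW G (\<lambda>a b. SW G (\<lambda>c d. F a b (S d) (S c)) y) x) h"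
    by (rule SW_congI, simp, rule SW_swap; simp)
  also have "\<dots> = SW G (\<lambda>a v. SW G (\<lambda>w d. SW G (\<lambda>b c. F a b (S d) (S c)) w) v) h"
    by (rule SW_regroup; (intro F(1,2) f lin_intros)?; simp)
  finally show ?thesis .
qed

lemma SW_regroup_antipode_left:
  assumes G: "module R G" and h: "h \<in> carrier H"
    and F: "\<And>b c d. b \<in> carrier H \<Longrightarrow> c \<in> carrier H \<Longrightarrow> d \<in> carrier H \<Longrightarrow> lin G (\<lambda>a. F a b c d)"
      "\<And>a c d. a \<in> carrier H \<Longrightarrow> c \<in> carrier H \<Longrightarrow> d \<in> carrier H \<Longrightarrow> lin G (\<lambda>b. F a b c d)"
      "\<And>a b d. a \<in> carrier H \<Longrightarrow> b \<in> carrier H \<Longrightarrow> d \<in> carrier H \<Longrightarrow> lin G (\<lambda>c. F a b c d)"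
      "\<And>a b c. a \<in> carrier H \<Longrightarrow> b \<in> carrier H \<Longrightarrow> c \<in> carrier H \<Longrightarrow> lin G (\<lambda>d. F a b c d)"
  shows "SW G (\<lambda>x y. SW G (\<lambda>c d. SW G (\<lambda>a b. F a b c d) (S x)) y) h =
    SW G (\<lambda>a v. SW G (\<lambda>w d. SW G (\<lambda>b c. F (S b) (S a) c d) w) v) h"
proof -
  interpret G: module R G by fact
  note [simp] = h G G.M.abelian_group_axioms lin_map_closed[OF F(1)]
  note f = lin_map_comp[OF F(1)] lin_map_comp[OF F(2)]
  have "SW G (\<lambda>x y. SW G (\<lambda>c d. SW G (\<lambda>a b. F a b c d) (S x)) y) h =
      SW G (\<lambda>x y. SW G (\<lambda>c d. SW G (\<lambda>a b. F (S b) (S a) c d) x) y) h"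
    by (rule SW_congI, simp, rule SW_congI, simp, rule SW_antipode; (intro lin_intros F)?; simp)
  also have "\<dots> = SW G (\<lambda>x y. SW G (\<lambda>a b. SW G (\<lambda>c d. F (S b) (S a) c d) y) x) h"
    by (rule SW_congI, simp, rule SW_swap; simp)
  also have "\<dots> = SW G (\<lambda>a v. SW G (\<lambda>w d. SW G (\<lambda>b c. F (S b) (S a) c d) w) v) h"
    by (rule SW_regroup; (intro F(3,4) f lin_intros)?; simp)
  finally show ?thesis .
qed

text \<open>The four relations in the shape in which they are met below: bracketed to the right,
  followed by a further factor, and seen through a linear map.\<close>

lemma SW_relations:
  assumes G: "module R G" and \<kappa>: "lin_map R P G \<kappa>"
    and [simp]: "v \<in> carrier H" "w \<in> carrier H" "Y \<in> carrier P"
  shows "SW G (\<lambda>b c. \<kappa> (cl v \<star> (cl b \<star> (cl (S c) \<star> Y)))) w = SW G (\<lambda>b c. \<kappa> (cl (v \<cdot> b) \<star> (cl (S c) \<star> Y))) w"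
    and "SW G (\<lambda>b c. \<kappa> (cl b \<star> (cl (S c) \<star> (cl v \<star> Y)))) w = SW G (\<lambda>b c. \<kappa> (cl b \<star> (cl (S c \<cdot> v) \<star> Y))) w"
    and "SW G (\<lambda>b c. \<kappa> (cl v \<star> (cl (S b) \<star> (cl c \<star> Y)))) w = SW G (\<lambda>b c. \<kappa> (cl (v \<cdot> S b) \<star> (cl c \<star> Y))) w"
    and "SW G (\<lambda>b c. \<kappa> (cl (S b) \<star> (cl c \<star> (cl v \<star> Y)))) w = SW G (\<lambda>b c. \<kappa> (cl (S b) \<star> (cl (c \<cdot> v) \<star> Y))) w"
proof -
  have push: "SW G (\<lambda>b c. \<kappa> (f b c \<star> Y)) w = \<kappa> (SW P f w \<star> Y)"
    if "\<And>b c. b \<in> carrier H \<Longrightarrow> c \<in> carrier H \<Longrightarrow> f b c \<in> carrier P" for f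
    using that by (simp add: SW_mult_right SW_lin_map[OF \<kappa> modP G])
  note r = partial_rep_relations
  show "SW G (\<lambda>b c. \<kappa> (cl v \<star> (cl b \<star> (cl (S c) \<star> Y)))) w = SW G (\<lambda>b c. \<kappa> (cl (v \<cdot> b) \<star> (cl (S c) \<star> Y))) w"
    using push[of "\<lambda>b c. cl v \<star> (cl b \<star> cl (S c))"] push[of "\<lambda>b c. cl (v \<cdot> b) \<star> cl (S c)"]
    by (simp add: PA.M.m_assoc r(1)[symmetric]) (simp add: eps_eq SW_mult_left SW_mult_right PA.M.m_assoc)
  show "SW G (\<lambda>b c. \<kappa> (cl b \<star> (cl (S c) \<star> (cl v \<star> Y)))) w = SW G (\<lambda>b c. \<kappa> (cl b \<star> (cl (S c \<cdot> v) \<star> Y))) w"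
    using push[of "\<lambda>b c. cl b \<star> (cl (S c) \<star> cl v)"] push[of "\<lambda>b c. cl b \<star> cl (S c \<cdot> v)"]
    by (simp add: PA.M.m_assoc r(2)[symmetric]) (simp add: eps_eq SW_mult_right PA.M.m_assoc)
  show "SW G (\<lambda>b c. \<kappa> (cl v \<star> (cl (S b) \<star> (cl c \<star> Y)))) w = SW G (\<lambda>b c. \<kappa> (cl (v \<cdot> S b) \<star> (cl c \<star> Y))) w"
    using push[of "\<lambda>b c. cl v \<star> (cl (S b) \<star> cl c)"] push[of "\<lambda>b c. cl (v \<cdot> S b) \<star> cl c"]
    by (simp add: PA.M.m_assoc r(3)[symmetric]) (simp add: eps'_eq SW_mult_left SW_mult_right PA.M.m_assoc)
  show "SW G (\<lambda>b c. \<kappa> (cl (S b) \<star> (cl c \<star> (cl v \<star> Y)))) w = SW G (\<lambda>b c. \<kappa> (cl (S b) \<star> (cl (c \<cdot> v) \<star> Y))) w"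
    using push[of "\<lambda>b c. cl (S b) \<star> (cl c \<star> cl v)"] push[of "\<lambda>b c. cl (S b) \<star> cl (c \<cdot> v)"]
    by (simp add: PA.M.m_assoc r(4)[symmetric]) (simp add: eps'_eq SW_mult_right PA.M.m_assoc)
qed

text \<open>Balancing over the generators of \<open>A\<close> is enough. The target map sends \<open>\<epsilon> h\<close> to
  \<open>\<epsilon>' (S\<^sub>i h)\<close>.\<close>

definition Lbal :: "('k, 'g, 'z) module_scheme \<Rightarrow> (('k, 'h) hpar \<Rightarrow> ('k, 'h) hpar \<Rightarrow> 'g) \<Rightarrow> bool" where
  "Lbal G \<beta> \<longleftrightarrow> bilin R P P G \<beta> \<and>
     (\<forall>h\<in>carrier H. \<forall>x\<in>carrier P. \<forall>y\<in>carrier P. \<beta> (e' (S\<^sub>i h) \<star> x) y = \<beta> x (e h \<star> y))"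

text \<open>\<open>\<beta>\<close> is a parameter rather than the pure tensor map itself, so that
  operators can be composed: \<open>diag G \<beta> h\<close> may again serve as
  \<open>\<beta>\<close>, by \<open>Lbal_diag\<close>.\<close>

definition diag :: "('k, 'g, 'z) module_scheme \<Rightarrow> (('k, 'h) hpar \<Rightarrow> ('k, 'h) hpar \<Rightarrow> 'g)
    \<Rightarrow> 'h \<Rightarrow> ('k, 'h) hpar \<Rightarrow> ('k, 'h) hpar \<Rightarrow> 'g" where
  "diag G \<beta> h x y = SW G (\<lambda>u v. \<beta> (cl u \<star> x) (cl v \<star> y)) h"

lemma Lbal_bilin: "Lbal G \<beta> \<Longrightarrow> bilin R P P G \<beta>"
  and Lbal_eps: "Lbal G \<beta> \<Longrightarrow> h \<in> carrier H \<Longrightarrow> x \<in> carrier P \<Longrightarrow> y \<in> carrier P \<Longrightarrow>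
    \<beta> (e' (S\<^sub>i h) \<star> x) y = \<beta> x (e h \<star> y)"
  by (auto simp: Lbal_def)

section \<open>The diagonal operators satisfy the relations of H_par\<close>

context
  fixes G :: "('k, 'g, 'z) module_scheme" and \<beta>
  assumes G: "module R G" and L: "Lbal G \<beta>"
begin

interpretation G: module R G by (rule G)

lemmas Lbal_lin [lin_intros] = bilin_left[OF Lbal_bilin[OF L]] bilin_right[OF Lbal_bilin[OF L]]
lemmas Lbal_simps [simp] = bilin_closed[OF Lbal_bilin[OF L]] G G.M.abelian_group_axioms

lemma push_left: "h \<in> carrier H \<Longrightarrow> (\<And>u v. u \<in> carrier H \<Longrightarrow> v \<in> carrier H \<Longrightarrow> f u v \<in> carrier P) \<Longrightarrow>
    y \<in> carrier P \<Longrightarrow> \<beta> (SW P f h) y = SW G (\<lambda>u v. \<beta> (f u v) y) h"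
  and push_right: "h \<in> carrier H \<Longrightarrow> (\<And>u v. u \<in> carrier H \<Longrightarrow> v \<in> carrier H \<Longrightarrow> f u v \<in> carrier P) \<Longrightarrow>
    x \<in> carrier P \<Longrightarrow> \<beta> x (SW P f h) = SW G (\<lambda>u v. \<beta> x (f u v)) h"
  by (intro SW_lin_map[where \<phi>="\<lambda>z. \<beta> z y"] SW_lin_map[where \<phi>="\<lambda>z. \<beta> x z"] lin_intros; simp)+

text \<open>[h1][l] is the sum of e'(S^-1(h2)) [h1 l]. The factor \<open>e'\<close> is a target, so
  it crosses to the other slot as \<open>e\<close>, where it turns [h2 m] into [h2][m] by
  \<open>SW_eps_cl\<close>.\<close>

lemma diag_shift2:
  assumes [simp]: "h \<in> carrier H" "l \<in> carrier H" "m \<in> carrier H" "x \<in> carrier P" "y \<in> carrier P"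
  shows "SW G (\<lambda>u v. \<beta> (cl u \<star> (cl l \<star> x)) (cl (v \<cdot> m) \<star> y)) h =
    SW G (\<lambda>u v. \<beta> (cl (u \<cdot> l) \<star> x) (cl v \<star> (cl m \<star> y))) h"
proof -
  have "SW G (\<lambda>u v. \<beta> (cl u \<star> (cl l \<star> x)) (cl (v \<cdot> m) \<star> y)) h =
      SW G (\<lambda>u v. SW G (\<lambda>a b. \<beta> (cl (a \<cdot> l) \<star> x) (e b \<star> (cl (v \<cdot> m) \<star> y))) u) h"
  proof (rule SW_congI)
    fix u v assume [simp]: "u \<in> carrier H" "v \<in> carrier H"
    have "cl u \<star> (cl l \<star> x) = SW P (\<lambda>a b. e' (S\<^sub>i b) \<star> cl (a \<cdot> l)) u \<star> x"
      by (simp add: SW_eps'_inv_cl PA.M.m_assoc)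
    then show "\<beta> (cl u \<star> (cl l \<star> x)) (cl (v \<cdot> m) \<star> y) =
        SW G (\<lambda>a b. \<beta> (cl (a \<cdot> l) \<star> x) (e b \<star> (cl (v \<cdot> m) \<star> y))) u"
      by (simp add: SW_mult_right push_left PA.M.m_assoc Lbal_eps[OF L])
  qed simp
  also have "\<dots> = SW G (\<lambda>a w. SW G (\<lambda>b v. \<beta> (cl (a \<cdot> l) \<star> x) (e b \<star> (cl (v \<cdot> m) \<star> y))) w) h"
    by (rule SW_coassoc; (intro lin_intros)?; simp)
  also have "\<dots> = SW G (\<lambda>a w. \<beta> (cl (a \<cdot> l) \<star> x) (cl w \<star> (cl m \<star> y))) h"
  proof (rule SW_congI)
    fix a w assume [simp]: "a \<in> carrier H" "w \<in> carrier H"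
    have "cl w \<star> (cl m \<star> y) = SW P (\<lambda>b v. e b \<star> cl (v \<cdot> m)) w \<star> y"
      by (simp add: SW_eps_cl PA.M.m_assoc)
    then show "SW G (\<lambda>b v. \<beta> (cl (a \<cdot> l) \<star> x) (e b \<star> (cl (v \<cdot> m) \<star> y))) w =
        \<beta> (cl (a \<cdot> l) \<star> x) (cl w \<star> (cl m \<star> y))"
      by (simp add: SW_mult_right push_right PA.M.m_assoc)
  qed simp
  finally show ?thesis .
qed

lemma diag_shift_left:
  assumes [simp]: "h \<in> carrier H" "l \<in> carrier H" "x \<in> carrier P" "y \<in> carrier P"
  shows "diag G \<beta> h (cl l \<star> x) y = SW G (\<lambda>u v. \<beta> (cl (u \<cdot> l) \<star> x) (cl v \<star> y)) h"
  using diag_shift2[of h l "\<one>\<^sub>H" x y] by (simp add: diag_def)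

lemma diag_shift_right:
  assumes [simp]: "h \<in> carrier H" "l \<in> carrier H" "m \<in> carrier H" "x \<in> carrier P" "y \<in> carrier P"
  shows "diag G \<beta> h (cl l \<star> x) (cl m \<star> y) = SW G (\<lambda>u v. \<beta> (cl u \<star> (cl l \<star> x)) (cl (v \<cdot> m) \<star> y)) h"
  by (simp add: diag_shift2 diag_shift_left)

lemma diag_closed [simp]:
  "h \<in> carrier H \<Longrightarrow> x \<in> carrier P \<Longrightarrow> y \<in> carrier P \<Longrightarrow> diag G \<beta> h x y \<in> carrier G"
  by (simp add: diag_def)

lemma lin_map_diag [lin_intros]:
  "x \<in> carrier P \<Longrightarrow> y \<in> carrier P \<Longrightarrow> lin_map R M H g \<Longrightarrow> lin_map R M G (\<lambda>z. diag G \<beta> (g z) x y)"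
  "h \<in> carrier H \<Longrightarrow> y \<in> carrier P \<Longrightarrow> lin_map R M P g' \<Longrightarrow> lin_map R M G (\<lambda>z. diag G \<beta> h (g' z) y)"
  "h \<in> carrier H \<Longrightarrow> x \<in> carrier P \<Longrightarrow> lin_map R M P g' \<Longrightarrow> lin_map R M G (\<lambda>z. diag G \<beta> h x (g' z))"
  unfolding diag_def by (intro lin_intros; simp)+

text \<open>\<open>e k\<close> moves to the left through the generator in the second slot, crosses
  to the first slot, and moves to the right through the generator there. Its index has then acquired
  S^-1(h3) h2, which cancels.\<close>

lemma Lbal_diag:
  assumes [simp]: "h \<in> carrier H"
  shows "Lbal G (diag G \<beta> h)"
  unfolding Lbal_def
proof (intro conjI ballI)
  show "bilin R P P G (diag G \<beta> h)"
    by (intro bilinI lin_intros; simp)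
  fix k x y assume [simp]: "k \<in> carrier H" "x \<in> carrier P" "y \<in> carrier P"
  have "diag G \<beta> h x (e k \<star> y) =
      SW G (\<lambda>u v. SW G (\<lambda>a b. \<beta> (e' (S\<^sub>i k \<cdot> S\<^sub>i a) \<star> (cl u \<star> x)) (cl b \<star> y)) v) h"
    unfolding diag_def
  proof (rule SW_congI)
    fix u v assume [simp]: "u \<in> carrier H" "v \<in> carrier H"
    have "cl v \<star> (e k \<star> y) = SW P (\<lambda>a b. e (a \<cdot> k) \<star> cl b) v \<star> y"
      by (simp add: cl_eps[symmetric] PA.M.m_assoc)
    then show "\<beta> (cl u \<star> x) (cl v \<star> (e k \<star> y)) =
        SW G (\<lambda>a b. \<beta> (e' (S\<^sub>i k \<cdot> S\<^sub>i a) \<star> (cl u \<star> x)) (cl b \<star> y)) v"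
      by (simp add: SW_mult_right push_right PA.M.m_assoc Lbal_eps[OF L, symmetric] inv_antipode_mult)
  qed simp
  also have "\<dots> = SW G (\<lambda>u v. SW G (\<lambda>a b. SW G (\<lambda>c d. \<beta> (cl c \<star> (e' (S\<^sub>i k \<cdot> (S\<^sub>i a \<cdot> d)) \<star> x)) (cl b \<star> y)) u) v) h"
  proof (rule SW_congI, simp, rule SW_congI, simp)
    fix u v a b assume [simp]: "u \<in> carrier H" "v \<in> carrier H" "a \<in> carrier H" "b \<in> carrier H"
    have "e' (S\<^sub>i k \<cdot> S\<^sub>i a) \<star> (cl u \<star> x) = SW P (\<lambda>c d. cl c \<star> e' (S\<^sub>i k \<cdot> S\<^sub>i a \<cdot> d)) u \<star> x"
      by (simp add: eps'_cl[symmetric] PA.M.m_assoc)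
    then show "\<beta> (e' (S\<^sub>i k \<cdot> S\<^sub>i a) \<star> (cl u \<star> x)) (cl b \<star> y) =
        SW G (\<lambda>c d. \<beta> (cl c \<star> (e' (S\<^sub>i k \<cdot> (S\<^sub>i a \<cdot> d)) \<star> x)) (cl b \<star> y)) u"
      by (simp add: SW_mult_right push_left PA.M.m_assoc HA.m_assoc)
  qed
  also have "\<dots> = SW G (\<lambda>u v. SW G (\<lambda>c d. SW G (\<lambda>a b. \<beta> (cl c \<star> (e' (S\<^sub>i k \<cdot> (S\<^sub>i a \<cdot> d)) \<star> x)) (cl b \<star> y)) v) u) h"
    by (rule SW_congI, simp, rule SW_swap; simp)
  also have "\<dots> = SW G (\<lambda>c w. SW G (\<lambda>d v. SW G (\<lambda>a b. \<beta> (cl c \<star> (e' (S\<^sub>i k \<cdot> (S\<^sub>i a \<cdot> d)) \<star> x)) (cl b \<star> y)) v) w) h"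
    by (rule SW_coassoc; (intro lin_intros)?; simp)
  also have "\<dots> = SW G (\<lambda>c w. \<beta> (cl c \<star> (e' (S\<^sub>i k \<cdot> \<one>\<^sub>H) \<star> x)) (cl w \<star> y)) h"
    by (rule SW_congI, simp, rule cancel_left[OF cancels_inv_antipode_left, where
          g="\<lambda>m b. \<beta> (cl _ \<star> (e' (S\<^sub>i k \<cdot> m) \<star> x)) (cl b \<star> y)"]; (intro lin_intros)?; simp)
  also have "\<dots> = diag G \<beta> h (e' (S\<^sub>i k) \<star> x) y"
    by (simp add: diag_def)
  finally show "diag G \<beta> h (e' (S\<^sub>i k) \<star> x) y = diag G \<beta> h x (e k \<star> y)" by simp
qed

lemma diag_mult:
  assumes [simp]: "h \<in> carrier H" "k \<in> carrier H" "x \<in> carrier P" "y \<in> carrier P"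
  shows "diag G \<beta> (h \<cdot> k) x y = SW G (\<lambda>a b. SW G (\<lambda>u v. \<beta> (cl (u \<cdot> a) \<star> x) (cl (v \<cdot> b) \<star> y)) h) k"
proof -
  have "diag G \<beta> (h \<cdot> k) x y = SW G (\<lambda>u v. SW G (\<lambda>a b. \<beta> (cl (u \<cdot> a) \<star> x) (cl (v \<cdot> b) \<star> y)) k) h"
    unfolding diag_def by (rule SW_mult; (intro lin_intros)?; simp)
  also have "\<dots> = SW G (\<lambda>a b. SW G (\<lambda>u v. \<beta> (cl (u \<cdot> a) \<star> x) (cl (v \<cdot> b) \<star> y)) h) k"
    by (rule SW_swap; simp)
  finally show ?thesis .
qed

text \<open>\<open>diag_shift_left\<close> contracts the product in the first slot, so that the
  relation [h][b][S(c)] = [h b][S(c)] has to be applied in the second slot only.\<close>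

lemma diag_relation1:
  assumes [simp]: "h \<in> carrier H" "l \<in> carrier H" "X \<in> carrier P" "Y \<in> carrier P"
  shows "SW G (\<lambda>x y. SW G (\<lambda>c d. SW G (\<lambda>a b. diag G \<beta> h (cl a \<star> (cl c \<star> X)) (cl b \<star> (cl d \<star> Y))) x) (S y)) l =
    SW G (\<lambda>x y. SW G (\<lambda>c d. diag G \<beta> (h \<cdot> x) (cl c \<star> X) (cl d \<star> Y)) (S y)) l"
proof -
  let ?F = "\<lambda>a b c d. diag G \<beta> h (cl a \<star> (cl c \<star> X)) (cl b \<star> (cl d \<star> Y))"
  let ?F' = "\<lambda>a b c d. SW G (\<lambda>u v. \<beta> (cl (u \<cdot> a) \<star> (cl c \<star> X)) (cl (v \<cdot> b) \<star> (cl d \<star> Y))) h"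
  have inner: "SW G (\<lambda>b c. ?F a b (S d) (S c)) w = SW G (\<lambda>b c. ?F' a b (S d) (S c)) w"
    if [simp]: "a \<in> carrier H" "d \<in> carrier H" "w \<in> carrier H" for a d w
  proof -
    have "SW G (\<lambda>b c. ?F a b (S d) (S c)) w =
        SW G (\<lambda>b c. SW G (\<lambda>u v. \<beta> (cl (u \<cdot> a) \<star> (cl (S d) \<star> X)) (cl v \<star> (cl b \<star> (cl (S c) \<star> Y)))) h) w"
      by (simp add: diag_shift_left)
    also have "\<dots> = SW G (\<lambda>u v. SW G (\<lambda>b c. \<beta> (cl (u \<cdot> a) \<star> (cl (S d) \<star> X)) (cl v \<star> (cl b \<star> (cl (S c) \<star> Y)))) w) h"
      by (rule SW_swap; simp)
    also have "\<dots> = SW G (\<lambda>u v. SW G (\<lambda>b c. \<beta> (cl (u \<cdot> a) \<star> (cl (S d) \<star> X)) (cl (v \<cdot> b) \<star> (cl (S c) \<star> Y))) w) h"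
      by (rule SW_congI, simp, rule SW_relations(1)[where \<kappa>="\<lambda>z. \<beta> (cl (_ \<cdot> a) \<star> (cl (S d) \<star> X)) z"]; (intro lin_intros)?; simp)
    also have "\<dots> = SW G (\<lambda>b c. ?F' a b (S d) (S c)) w"
      by (rule SW_swap; simp)
    finally show ?thesis .
  qed
  have "SW G (\<lambda>x y. SW G (\<lambda>c d. SW G (\<lambda>a b. ?F a b c d) x) (S y)) l =
      SW G (\<lambda>a v. SW G (\<lambda>w d. SW G (\<lambda>b c. ?F a b (S d) (S c)) w) v) l"
    by (rule SW_regroup_antipode_right; (intro lin_intros)?; simp)
  also have "\<dots> = SW G (\<lambda>a v. SW G (\<lambda>w d. SW G (\<lambda>b c. ?F' a b (S d) (S c)) w) v) l"
    by (rule SW_congI, simp, rule SW_congI, simp, rule inner)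
  also have "\<dots> = SW G (\<lambda>x y. SW G (\<lambda>c d. SW G (\<lambda>a b. ?F' a b c d) x) (S y)) l"
    by (rule SW_regroup_antipode_right[symmetric]; (intro lin_intros)?; simp)
  finally show ?thesis
    by (simp add: diag_mult)
qed

text \<open>The slots have changed roles compared with \<open>diag_relation1\<close>:
  \<open>diag_shift_right\<close> settles the second slot and the relation is applied in the
  first.\<close>

lemma diag_relation3:
  assumes [simp]: "h \<in> carrier H" "l \<in> carrier H" "X \<in> carrier P" "Y \<in> carrier P"
  shows "SW G (\<lambda>x y. SW G (\<lambda>c d. SW G (\<lambda>a b. diag G \<beta> h (cl a \<star> (cl c \<star> X)) (cl b \<star> (cl d \<star> Y))) (S x)) y) l =
    SW G (\<lambda>x y. SW G (\<lambda>c d. diag G \<beta> (h \<cdot> S x) (cl c \<star> X) (cl d \<star> Y)) y) l"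
proof -
  let ?F = "\<lambda>a b c d. diag G \<beta> h (cl a \<star> (cl c \<star> X)) (cl b \<star> (cl d \<star> Y))"
  let ?F' = "\<lambda>a b c d. SW G (\<lambda>u v. \<beta> (cl (u \<cdot> a) \<star> (cl c \<star> X)) (cl (v \<cdot> b) \<star> (cl d \<star> Y))) h"
  have inner: "SW G (\<lambda>b c. ?F (S b) (S a) c d) w = SW G (\<lambda>b c. ?F' (S b) (S a) c d) w"
    if [simp]: "a \<in> carrier H" "d \<in> carrier H" "w \<in> carrier H" for a d w
  proof -
    have "SW G (\<lambda>b c. ?F (S b) (S a) c d) w =
        SW G (\<lambda>b c. SW G (\<lambda>u v. \<beta> (cl u \<star> (cl (S b) \<star> (cl c \<star> X))) (cl (v \<cdot> S a) \<star> (cl d \<star> Y))) h) w"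
      by (simp add: diag_shift_right)
    also have "\<dots> = SW G (\<lambda>u v. SW G (\<lambda>b c. \<beta> (cl u \<star> (cl (S b) \<star> (cl c \<star> X))) (cl (v \<cdot> S a) \<star> (cl d \<star> Y))) w) h"
      by (rule SW_swap; simp)
    also have "\<dots> = SW G (\<lambda>u v. SW G (\<lambda>b c. \<beta> (cl (u \<cdot> S b) \<star> (cl c \<star> X)) (cl (v \<cdot> S a) \<star> (cl d \<star> Y))) w) h"
      by (rule SW_congI, simp, rule SW_relations(3)[where \<kappa>="\<lambda>z. \<beta> z (cl (_ \<cdot> S a) \<star> (cl d \<star> Y))"];
          (intro lin_intros)?; simp)
    also have "\<dots> = SW G (\<lambda>b c. ?F' (S b) (S a) c d) w"
      by (rule SW_swap; simp)
    finally show ?thesis .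
  qed
  have "SW G (\<lambda>x y. SW G (\<lambda>c d. SW G (\<lambda>a b. ?F a b c d) (S x)) y) l =
      SW G (\<lambda>a v. SW G (\<lambda>w d. SW G (\<lambda>b c. ?F (S b) (S a) c d) w) v) l"
    by (rule SW_regroup_antipode_left; (intro lin_intros)?; simp)
  also have "\<dots> = SW G (\<lambda>a v. SW G (\<lambda>w d. SW G (\<lambda>b c. ?F' (S b) (S a) c d) w) v) l"
    by (rule SW_congI, simp, rule SW_congI, simp, rule inner)
  also have "\<dots> = SW G (\<lambda>x y. SW G (\<lambda>c d. SW G (\<lambda>a b. ?F' a b c d) (S x)) y) l"
    by (rule SW_regroup_antipode_left[symmetric]; (intro lin_intros)?; simp)
  finally show ?thesis
    by (simp add: diag_mult)
qed

text \<open>The pair in the second slot adds up to \<open>e w\<close>; this crosses to the first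
  slot as the target e'(S^-1(w)) and is absorbed there by \<open>SW_eps'_inv_cl1\<close>. So the
  operator of \<open>e k\<close> affects the first slot alone.\<close>

lemma diag_eps:
  assumes [simp]: "k \<in> carrier H" "X \<in> carrier P" "Y \<in> carrier P"
  shows "SW G (\<lambda>x y. SW G (\<lambda>c d. diag G \<beta> x (cl c \<star> X) (cl d \<star> Y)) (S y)) k = \<beta> (e k \<star> X) Y"
proof -
  let ?F = "\<lambda>a b c d. \<beta> (cl a \<star> (cl c \<star> X)) (cl b \<star> (cl d \<star> Y))"
  have "SW G (\<lambda>x y. SW G (\<lambda>c d. diag G \<beta> x (cl c \<star> X) (cl d \<star> Y)) (S y)) k =
      SW G (\<lambda>a v. SW G (\<lambda>w d. SW G (\<lambda>b c. ?F a b (S d) (S c)) w) v) k"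
    unfolding diag_def by (rule SW_regroup_antipode_right; (intro lin_intros)?; simp)
  also have "\<dots> = SW G (\<lambda>a v. SW G (\<lambda>w d. \<beta> (e' (S\<^sub>i w) \<star> cl a \<star> (cl (S d) \<star> X)) Y) v) k"
  proof (rule SW_congI, simp, rule SW_congI, simp)
    fix a v w d assume [simp]: "a \<in> carrier H" "v \<in> carrier H" "w \<in> carrier H" "d \<in> carrier H"
    have "e w \<star> Y = SW P (\<lambda>b c. cl b \<star> (cl (S c) \<star> Y)) w"
      by (simp add: eps_eq SW_mult_right PA.M.m_assoc)
    then show "SW G (\<lambda>b c. ?F a b (S d) (S c)) w = \<beta> (e' (S\<^sub>i w) \<star> cl a \<star> (cl (S d) \<star> X)) Y"
      by (simp add: push_right Lbal_eps[OF L] PA.M.m_assoc)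
  qed
  also have "\<dots> = SW G (\<lambda>z d. SW G (\<lambda>a w. \<beta> (e' (S\<^sub>i w) \<star> cl a \<star> (cl (S d) \<star> X)) Y) z) k"
    by (rule SW_coassoc[symmetric]; (intro lin_intros)?; simp)
  also have "\<dots> = SW G (\<lambda>z d. \<beta> (cl z \<star> (cl (S d) \<star> X)) Y) k"
  proof (rule SW_congI, simp)
    fix z d assume [simp]: "z \<in> carrier H" "d \<in> carrier H"
    have "cl z \<star> (cl (S d) \<star> X) = SW P (\<lambda>a w. e' (S\<^sub>i w) \<star> cl a) z \<star> (cl (S d) \<star> X)"
      by (simp add: SW_eps'_inv_cl1)
    then show "SW G (\<lambda>a w. \<beta> (e' (S\<^sub>i w) \<star> cl a \<star> (cl (S d) \<star> X)) Y) z = \<beta> (cl z \<star> (cl (S d) \<star> X)) Y"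
      by (simp add: SW_mult_right push_left)
  qed
  also have "\<dots> = \<beta> (e k \<star> X) Y"
    by (simp add: eps_eq SW_mult_right PA.M.m_assoc push_left)
  finally show ?thesis .
qed

text \<open>Here the pair is in the first slot and adds up to \<open>e' w\<close>, which crosses to
  the second slot and is absorbed there.\<close>

lemma diag_eps':
  assumes [simp]: "k \<in> carrier H" "X \<in> carrier P" "Y \<in> carrier P"
  shows "SW G (\<lambda>x y. SW G (\<lambda>c d. diag G \<beta> (S x) (cl c \<star> X) (cl d \<star> Y)) y) k = \<beta> X (e' k \<star> Y)"
proof -
  let ?F = "\<lambda>a b c d. \<beta> (cl a \<star> (cl c \<star> X)) (cl b \<star> (cl d \<star> Y))"
  have "SW G (\<lambda>x y. SW G (\<lambda>c d. diag G \<beta> (S x) (cl c \<star> X) (cl d \<star> Y)) y) k =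
      SW G (\<lambda>a v. SW G (\<lambda>w d. SW G (\<lambda>b c. ?F (S b) (S a) c d) w) v) k"
    unfolding diag_def by (rule SW_regroup_antipode_left; (intro lin_intros)?; simp)
  also have "\<dots> = SW G (\<lambda>a v. SW G (\<lambda>w d. \<beta> X (e (S w) \<star> cl (S a) \<star> (cl d \<star> Y))) v) k"
  proof (rule SW_congI, simp, rule SW_congI, simp)
    fix a v w d assume [simp]: "a \<in> carrier H" "v \<in> carrier H" "w \<in> carrier H" "d \<in> carrier H"
    \<comment> \<open>Writing w as S^-1(S(w)) exhibits \<open>e' w\<close> as the target of e(S(w)),
      so that it can cross by \<open>Lbal_eps\<close>.\<close>
    have "e' (S\<^sub>i (S w)) \<star> X = SW P (\<lambda>b c. cl (S b) \<star> (cl c \<star> X)) w"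
      by (simp add: eps'_eq SW_mult_right PA.M.m_assoc)
    then have "SW G (\<lambda>b c. ?F (S b) (S a) c d) w = \<beta> (e' (S\<^sub>i (S w)) \<star> X) (cl (S a) \<star> (cl d \<star> Y))"
      by (simp add: push_left)
    then show "SW G (\<lambda>b c. ?F (S b) (S a) c d) w = \<beta> X (e (S w) \<star> cl (S a) \<star> (cl d \<star> Y))"
      by (simp only: Lbal_eps[OF L] PA.M.m_assoc) (simp add: Lbal_eps[OF L] PA.M.m_assoc
          del: inv_antipode_antipode)
  qed
  also have "\<dots> = SW G (\<lambda>z d. SW G (\<lambda>a w. \<beta> X (e (S w) \<star> cl (S a) \<star> (cl d \<star> Y))) z) k"
    by (rule SW_coassoc[symmetric]; (intro lin_intros)?; simp)
  also have "\<dots> = SW G (\<lambda>z d. \<beta> X (cl (S z) \<star> (cl d \<star> Y))) k"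
  proof (rule SW_congI, simp)
    fix z d assume [simp]: "z \<in> carrier H" "d \<in> carrier H"
    have "SW P (\<lambda>a w. e (S w) \<star> cl (S a)) z = SW P (\<lambda>x y. e x \<star> cl y) (S z)"
      by (rule SW_antipode[symmetric]; (intro lin_intros)?; simp)
    then have "cl (S z) \<star> (cl d \<star> Y) = SW P (\<lambda>a w. e (S w) \<star> cl (S a)) z \<star> (cl d \<star> Y)"
      by (simp add: SW_eps_cl1)
    then show "SW G (\<lambda>a w. \<beta> X (e (S w) \<star> cl (S a) \<star> (cl d \<star> Y))) z = \<beta> X (cl (S z) \<star> (cl d \<star> Y))"
      by (simp add: SW_mult_right push_right)
  qed
  also have "\<dots> = \<beta> X (e' k \<star> Y)"
    by (simp add: eps'_eq SW_mult_right PA.M.m_assoc push_right)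
  finally show ?thesis .
qed

end

text \<open>Outside the context these rules carry premises on \<open>G\<close> and
  \<open>\<beta>\<close>; they are reinstated wherever these are known.\<close>

declare Lbal_lin [lin_intros del] lin_map_diag [lin_intros del] Lbal_simps [simp del]
  diag_closed [simp del]

text \<open>Stands outside the context because the shift rule is used with
  \<open>diag G \<beta> x\<close> in place of \<open>\<beta>\<close>. After the shift the relation
  is applied in the second slot.\<close>

lemma diag_relation2:
  fixes G :: "('k, 'g, 'z) module_scheme"
  assumes G: "module R G" and L: "Lbal G \<beta>"
    and [simp]: "h \<in> carrier H" "l \<in> carrier H" "X \<in> carrier P" "Y \<in> carrier P"
  shows "SW G (\<lambda>x y. SW G (\<lambda>u v. SW G (\<lambda>c d. diag G \<beta> x (cl c \<star> (cl u \<star> X)) (cl d \<star> (cl v \<star> Y))) (S y)) l) h =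
    SW G (\<lambda>x y. SW G (\<lambda>c d. diag G \<beta> x (cl c \<star> X) (cl d \<star> Y)) (S y \<cdot> l)) h"
proof -
  interpret G: module R G by (rule G)
  note [lin_intros] = bilin_left[OF Lbal_bilin[OF L]] bilin_right[OF Lbal_bilin[OF L]]
    lin_map_diag[OF G L]
  note [simp] = bilin_closed[OF Lbal_bilin[OF L]] G G.M.abelian_group_axioms diag_closed[OF G L]
  let ?F = "\<lambda>a b c d. SW G (\<lambda>u v. \<beta> (cl a \<star> (cl (c \<cdot> u) \<star> X)) (cl b \<star> (cl d \<star> (cl v \<star> Y)))) l"
  let ?F' = "\<lambda>a b c d. SW G (\<lambda>u v. \<beta> (cl a \<star> (cl (c \<cdot> u) \<star> X)) (cl b \<star> (cl (d \<cdot> v) \<star> Y))) l"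
  have inner: "SW G (\<lambda>b c. ?F a b (S d) (S c)) w = SW G (\<lambda>b c. ?F' a b (S d) (S c)) w"
    if [simp]: "a \<in> carrier H" "d \<in> carrier H" "w \<in> carrier H" for a d w
  proof -
    have "SW G (\<lambda>b c. ?F a b (S d) (S c)) w = SW G (\<lambda>u v. SW G (\<lambda>b c.
        \<beta> (cl a \<star> (cl (S d \<cdot> u) \<star> X)) (cl b \<star> (cl (S c) \<star> (cl v \<star> Y)))) w) l"
      by (rule SW_swap; simp)
    also have "\<dots> = SW G (\<lambda>u v. SW G (\<lambda>b c. \<beta> (cl a \<star> (cl (S d \<cdot> u) \<star> X)) (cl b \<star> (cl (S c \<cdot> v) \<star> Y))) w) l"
      by (rule SW_congI, simp, rule SW_relations(2)[where \<kappa>="\<lambda>z. \<beta> (cl a \<star> (cl (S d \<cdot> _) \<star> X)) z"]; (intro lin_intros)?; simp)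
    also have "\<dots> = SW G (\<lambda>b c. ?F' a b (S d) (S c)) w"
      by (rule SW_swap; simp)
    finally show ?thesis .
  qed
  have "SW G (\<lambda>x y. SW G (\<lambda>u v. SW G (\<lambda>c d. diag G \<beta> x (cl c \<star> (cl u \<star> X)) (cl d \<star> (cl v \<star> Y))) (S y)) l) h =
      SW G (\<lambda>x y. SW G (\<lambda>u v. SW G (\<lambda>c d. diag G \<beta> x (cl (c \<cdot> u) \<star> X) (cl d \<star> (cl v \<star> Y))) (S y)) l) h"
    using diag_shift_left[OF G Lbal_diag[OF G L]] unfolding diag_def[of G "diag G \<beta> _"] by simp
  also have "\<dots> = SW G (\<lambda>x y. SW G (\<lambda>c d. SW G (\<lambda>u v. diag G \<beta> x (cl (c \<cdot> u) \<star> X) (cl d \<star> (cl v \<star> Y))) l) (S y)) h"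
    by (rule SW_congI, simp, rule SW_swap; simp)
  also have "\<dots> = SW G (\<lambda>x y. SW G (\<lambda>c d. SW G (\<lambda>a b. ?F a b c d) x) (S y)) h"
    unfolding diag_def by (rule SW_congI, simp, rule SW_congI, simp, rule SW_swap; simp)
  also have "\<dots> = SW G (\<lambda>a v. SW G (\<lambda>w d. SW G (\<lambda>b c. ?F a b (S d) (S c)) w) v) h"
    by (rule SW_regroup_antipode_right; (intro lin_intros)?; simp)
  also have "\<dots> = SW G (\<lambda>a v. SW G (\<lambda>w d. SW G (\<lambda>b c. ?F' a b (S d) (S c)) w) v) h"
    by (rule SW_congI, simp, rule SW_congI, simp, rule inner)
  also have "\<dots> = SW G (\<lambda>x y. SW G (\<lambda>c d. SW G (\<lambda>a b. ?F' a b c d) x) (S y)) h"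
    by (rule SW_regroup_antipode_right[symmetric]; (intro lin_intros)?; simp)
  also have "\<dots> = SW G (\<lambda>x y. SW G (\<lambda>c d. SW G (\<lambda>u v. diag G \<beta> x (cl (c \<cdot> u) \<star> X) (cl (d \<cdot> v) \<star> Y)) l) (S y)) h"
    unfolding diag_def by (rule SW_congI, simp, rule SW_congI, simp, rule SW_swap; simp)
  also have "\<dots> = SW G (\<lambda>x y. SW G (\<lambda>c d. diag G \<beta> x (cl c \<star> X) (cl d \<star> Y)) (S y \<cdot> l)) h"
    by (rule SW_congI, simp, rule SW_mult[symmetric]; (intro lin_intros)?; simp)
  finally show ?thesis .
qed

text \<open>As for \<open>diag_relation2\<close>, but with \<open>diag_shift_right\<close>, which
  leaves the first slot for the relation.\<close>

lemma diag_relation4: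
  fixes G :: "('k, 'g, 'z) module_scheme"
  assumes G: "module R G" and L: "Lbal G \<beta>"
    and [simp]: "h \<in> carrier H" "l \<in> carrier H" "X \<in> carrier P" "Y \<in> carrier P"
  shows "SW G (\<lambda>x y. SW G (\<lambda>u v. SW G (\<lambda>c d. diag G \<beta> (S x) (cl c \<star> (cl u \<star> X)) (cl d \<star> (cl v \<star> Y))) y) l) h =
    SW G (\<lambda>x y. SW G (\<lambda>c d. diag G \<beta> (S x) (cl c \<star> X) (cl d \<star> Y)) (y \<cdot> l)) h"
proof -
  interpret G: module R G by (rule G)
  note [lin_intros] = bilin_left[OF Lbal_bilin[OF L]] bilin_right[OF Lbal_bilin[OF L]]
    lin_map_diag[OF G L]
  note [simp] = bilin_closed[OF Lbal_bilin[OF L]] G G.M.abelian_group_axioms diag_closed[OF G L]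
  let ?F = "\<lambda>a b c d. SW G (\<lambda>u v. \<beta> (cl a \<star> (cl c \<star> (cl u \<star> X))) (cl b \<star> (cl (d \<cdot> v) \<star> Y))) l"
  let ?F' = "\<lambda>a b c d. SW G (\<lambda>u v. \<beta> (cl a \<star> (cl (c \<cdot> u) \<star> X)) (cl b \<star> (cl (d \<cdot> v) \<star> Y))) l"
  have inner: "SW G (\<lambda>b c. ?F (S b) (S a) c d) w = SW G (\<lambda>b c. ?F' (S b) (S a) c d) w"
    if [simp]: "a \<in> carrier H" "d \<in> carrier H" "w \<in> carrier H" for a d w
  proof -
    have "SW G (\<lambda>b c. ?F (S b) (S a) c d) w = SW G (\<lambda>u v. SW G (\<lambda>b c.
        \<beta> (cl (S b) \<star> (cl c \<star> (cl u \<star> X))) (cl (S a) \<star> (cl (d \<cdot> v) \<star> Y))) w) l"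
      by (rule SW_swap; simp)
    also have "\<dots> = SW G (\<lambda>u v. SW G (\<lambda>b c. \<beta> (cl (S b) \<star> (cl (c \<cdot> u) \<star> X)) (cl (S a) \<star> (cl (d \<cdot> v) \<star> Y))) w) l"
      by (rule SW_congI, simp, rule SW_relations(4)[where \<kappa>="\<lambda>z. \<beta> z (cl (S a) \<star> (cl (d \<cdot> _) \<star> Y))"];
          (intro lin_intros)?; simp)
    also have "\<dots> = SW G (\<lambda>b c. ?F' (S b) (S a) c d) w"
      by (rule SW_swap; simp)
    finally show ?thesis .
  qed
  have "SW G (\<lambda>x y. SW G (\<lambda>u v. SW G (\<lambda>c d. diag G \<beta> (S x) (cl c \<star> (cl u \<star> X)) (cl d \<star> (cl v \<star> Y))) y) l) h =
      SW G (\<lambda>x y. SW G (\<lambda>u v. SW G (\<lambda>c d. diag G \<beta> (S x) (cl c \<star> (cl u \<star> X)) (cl (d \<cdot> v) \<star> Y)) y) l) h"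
    using diag_shift_right[OF G Lbal_diag[OF G L]] unfolding diag_def[of G "diag G \<beta> _"] by simp
  also have "\<dots> = SW G (\<lambda>x y. SW G (\<lambda>c d. SW G (\<lambda>u v. diag G \<beta> (S x) (cl c \<star> (cl u \<star> X)) (cl (d \<cdot> v) \<star> Y)) l) y) h"
    by (rule SW_congI, simp, rule SW_swap; simp)
  also have "\<dots> = SW G (\<lambda>x y. SW G (\<lambda>c d. SW G (\<lambda>a b. ?F a b c d) (S x)) y) h"
    unfolding diag_def by (rule SW_congI, simp, rule SW_congI, simp, rule SW_swap; simp)
  also have "\<dots> = SW G (\<lambda>a v. SW G (\<lambda>w d. SW G (\<lambda>b c. ?F (S b) (S a) c d) w) v) h"
    by (rule SW_regroup_antipode_left; (intro lin_intros)?; simp)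
  also have "\<dots> = SW G (\<lambda>a v. SW G (\<lambda>w d. SW G (\<lambda>b c. ?F' (S b) (S a) c d) w) v) h"
    by (rule SW_congI, simp, rule SW_congI, simp, rule inner)
  also have "\<dots> = SW G (\<lambda>x y. SW G (\<lambda>c d. SW G (\<lambda>a b. ?F' a b c d) (S x)) y) h"
    by (rule SW_regroup_antipode_left[symmetric]; (intro lin_intros)?; simp)
  also have "\<dots> = SW G (\<lambda>x y. SW G (\<lambda>c d. SW G (\<lambda>u v. diag G \<beta> (S x) (cl (c \<cdot> u) \<star> X) (cl (d \<cdot> v) \<star> Y)) l) y) h"
    unfolding diag_def by (rule SW_congI, simp, rule SW_congI, simp, rule SW_swap; simp)
  also have "\<dots> = SW G (\<lambda>x y. SW G (\<lambda>c d. diag G \<beta> (S x) (cl c \<star> X) (cl d \<star> Y)) (y \<cdot> l)) h"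
    by (rule SW_congI, simp, rule SW_mult[symmetric]; (intro lin_intros)?; simp)
  finally show ?thesis .
qed

end

context bij_hopf_algebra
begin

section \<open>Modules over H_par\<close>

lemma SW_end_algebra:
  assumes G: "module R G" and h: "h \<in> carrier H" and X: "X \<in> carrier G"
    and F: "\<And>x y. x \<in> carrier H \<Longrightarrow> y \<in> carrier H \<Longrightarrow> F x y \<in> carrier (end_algebra R G)"
  shows "SW (end_algebra R G) F h X = SW G (\<lambda>x y. F x y X) h"
proof -
  interpret G: module R G by fact
  interpret E: assoc_algebra R "end_algebra R G" by (rule end_algebra[OF G])
  have "additive_map (end_algebra R G) G (\<lambda>F. F X)"
    using X by (intro additive_mapI) (auto simp: end_algebra_simps lin_map_closed)
  from SW_additive_map[OF this E.M.abelian_group_axioms G.M.abelian_group_axioms h F]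
  show ?thesis .
qed

text \<open>\<open>Hpar_universal\<close> with the endomorphism algebra as target; the assumptions
  r1 to r4 are the relations of a partial representation evaluated at a vector.\<close>

lemma Hpar_module:
  assumes G: "module R G"
    and lin1: "\<And>h. h \<in> carrier H \<Longrightarrow> lin_map R G G (\<rho> h)"
    and lin2: "\<And>X. X \<in> carrier G \<Longrightarrow> lin G (\<lambda>h. \<rho> h X)"
    and one: "\<And>X. X \<in> carrier G \<Longrightarrow> \<rho> \<one>\<^sub>H X = X"
    and r1: "\<And>h l X. h \<in> carrier H \<Longrightarrow> l \<in> carrier H \<Longrightarrow> X \<in> carrier G \<Longrightarrow>
      SW G (\<lambda>x y. \<rho> h (\<rho> x (\<rho> (S y) X))) l = SW G (\<lambda>x y. \<rho> (h \<cdot> x) (\<rho> (S y) X)) l"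
    and r2: "\<And>h l X. h \<in> carrier H \<Longrightarrow> l \<in> carrier H \<Longrightarrow> X \<in> carrier G \<Longrightarrow>
      SW G (\<lambda>x y. \<rho> x (\<rho> (S y) (\<rho> l X))) h = SW G (\<lambda>x y. \<rho> x (\<rho> (S y \<cdot> l) X)) h"
    and r3: "\<And>h l X. h \<in> carrier H \<Longrightarrow> l \<in> carrier H \<Longrightarrow> X \<in> carrier G \<Longrightarrow>
      SW G (\<lambda>x y. \<rho> h (\<rho> (S x) (\<rho> y X))) l = SW G (\<lambda>x y. \<rho> (h \<cdot> S x) (\<rho> y X)) l"
    and r4: "\<And>h l X. h \<in> carrier H \<Longrightarrow> l \<in> carrier H \<Longrightarrow> X \<in> carrier G \<Longrightarrow>
      SW G (\<lambda>x y. \<rho> (S x) (\<rho> y (\<rho> l X))) h = SW G (\<lambda>x y. \<rho> (S x) (\<rho> (y \<cdot> l) X)) h"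
  obtains \<Phi> where "\<And>x. x \<in> carrier P \<Longrightarrow> lin_map R G G (\<Phi> x)"
    "\<And>X. X \<in> carrier G \<Longrightarrow> lin_map R P G (\<lambda>x. \<Phi> x X)"
    "\<And>X. X \<in> carrier G \<Longrightarrow> \<Phi> \<one>\<^bsub>P\<^esub> X = X"
    "\<And>x y X. x \<in> carrier P \<Longrightarrow> y \<in> carrier P \<Longrightarrow> X \<in> carrier G \<Longrightarrow> \<Phi> (x \<star> y) X = \<Phi> x (\<Phi> y X)"
    "\<And>h X. h \<in> carrier H \<Longrightarrow> X \<in> carrier G \<Longrightarrow> \<Phi> (cl h) X = \<rho> h X"
proof -
  interpret G: module R G by fact
  let ?E = "end_algebra R G"
  interpret E: assoc_algebra R ?E by (rule end_algebra[OF G])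
  define \<pi> where "\<pi> h = restrict (\<rho> h) (carrier G)" for h
  note c = lin_map_closed[OF lin1]
  have \<pi>E: "\<pi> h \<in> carrier ?E" if "h \<in> carrier H" for h
    using lin1[OF that] by (auto simp: \<pi>_def end_algebra_simps lin_map_def Pi_iff)
  have \<pi>_app: "\<pi> h X = \<rho> h X" if "X \<in> carrier G" for h X
    using that by (simp add: \<pi>_def)
  have ext: "F = F'" if "F \<in> carrier ?E" "F' \<in> carrier ?E" "\<And>X. X \<in> carrier G \<Longrightarrow> F X = F' X" for F F'
    using that by (auto simp: end_algebra_simps intro: extensionalityI)
  have mult_app: "(F \<otimes>\<^bsub>?E\<^esub> F') X = F (F' X)" if "X \<in> carrier G" for F F' X
    using that by (simp add: end_algebra_simps)
  have \<pi>lin: "lin ?E \<pi>"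
  proof (rule lin_mapI)
    show "\<pi> h \<in> carrier ?E" if "h \<in> carrier H" for h by (rule \<pi>E[OF that])
    show "\<pi> (x \<oplus>\<^bsub>H\<^esub> y) = \<pi> x \<oplus>\<^bsub>?E\<^esub> \<pi> y" if "x \<in> carrier H" "y \<in> carrier H" for x y
    proof (rule ext)
      show "\<pi> x \<oplus>\<^bsub>?E\<^esub> \<pi> y \<in> carrier ?E" using that \<pi>E by simp
    qed (use that \<pi>E lin_map_add[OF lin2] in \<open>auto simp: \<pi>_app end_algebra_simps(5)\<close>)
    show "\<pi> (k \<odot>\<^bsub>H\<^esub> x) = k \<odot>\<^bsub>?E\<^esub> \<pi> x" if "k \<in> carrier R" "x \<in> carrier H" for k x
    proof (rule ext)
      show "k \<odot>\<^bsub>?E\<^esub> \<pi> x \<in> carrier ?E" using that \<pi>E by simp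
    qed (use that \<pi>E lin_map_smult[OF lin2] in \<open>auto simp: \<pi>_app end_algebra_simps(6)\<close>)
  qed
  have "partial_rep ?E \<pi>"
    unfolding partial_rep_def
  proof (intro conjI ballI \<pi>lin)
    show "\<pi> \<one>\<^sub>H = \<one>\<^bsub>?E\<^esub>"
    proof (rule ext)
      show "\<one>\<^bsub>?E\<^esub> \<in> carrier ?E" by simp
    qed (use \<pi>E one in \<open>auto simp: \<pi>_app end_algebra_simps(3)\<close>)
  next
    fix h l assume [simp]: "h \<in> carrier H" "l \<in> carrier H"
    note [simp] = \<pi>E E.M.abelian_group_axioms SW_end_algebra[OF G] mult_app \<pi>_app c
    show "SW ?E (\<lambda>x y. \<pi> h \<otimes>\<^bsub>?E\<^esub> \<pi> x \<otimes>\<^bsub>?E\<^esub> \<pi> (S y)) l = SW ?E (\<lambda>x y. \<pi> (h \<cdot> x) \<otimes>\<^bsub>?E\<^esub> \<pi> (S y)) l"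
      by (rule ext) (simp_all add: r1)
    show "SW ?E (\<lambda>x y. \<pi> x \<otimes>\<^bsub>?E\<^esub> \<pi> (S y) \<otimes>\<^bsub>?E\<^esub> \<pi> l) h = SW ?E (\<lambda>x y. \<pi> x \<otimes>\<^bsub>?E\<^esub> \<pi> (S y \<cdot> l)) h"
      by (rule ext) (simp_all add: r2)
    show "SW ?E (\<lambda>x y. \<pi> h \<otimes>\<^bsub>?E\<^esub> \<pi> (S x) \<otimes>\<^bsub>?E\<^esub> \<pi> y) l = SW ?E (\<lambda>x y. \<pi> (h \<cdot> S x) \<otimes>\<^bsub>?E\<^esub> \<pi> y) l"
      by (rule ext) (simp_all add: r3)
    show "SW ?E (\<lambda>x y. \<pi> (S x) \<otimes>\<^bsub>?E\<^esub> \<pi> y \<otimes>\<^bsub>?E\<^esub> \<pi> l) h = SW ?E (\<lambda>x y. \<pi> (S x) \<otimes>\<^bsub>?E\<^esub> \<pi> (y \<cdot> l)) h"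
      by (rule ext) (simp_all add: r4)
  qed
  then obtain \<Phi> where \<Phi>: "alg_hom R P ?E \<Phi>" "\<And>h. h \<in> carrier H \<Longrightarrow> \<Phi> (cl h) = \<pi> h"
    using Hpar_universal[OF end_algebra[OF G]] by blast
  note l = alg_hom_lin[OF \<Phi>(1)]
  show thesis
  proof
    show "lin_map R G G (\<Phi> x)" if "x \<in> carrier P" for x
      using lin_map_closed[OF l that] by (simp add: end_algebra_simps)
    show "lin_map R P G (\<lambda>x. \<Phi> x X)" if X: "X \<in> carrier G" for X
      using X lin_map_closed[OF l] lin_map_closed[of R G G]
      by (intro lin_mapI) (simp_all add: lin_map_add[OF l] lin_map_smult[OF l] end_algebra_simps)
    show "\<Phi> \<one>\<^bsub>P\<^esub> X = X" if "X \<in> carrier G" for X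
      using that alg_hom_one[OF \<Phi>(1)] by (simp add: end_algebra_simps)
    show "\<Phi> (x \<star> y) X = \<Phi> x (\<Phi> y X)" if "x \<in> carrier P" "y \<in> carrier P" "X \<in> carrier G" for x y X
      using that alg_hom_mult[OF \<Phi>(1)] by (simp add: mult_app)
    show "\<Phi> (cl h) X = \<rho> h X" if "h \<in> carrier H" "X \<in> carrier G" for h X
      using that by (simp add: \<Phi>(2) \<pi>_app)
  qed
qed

end

context par_antipodes
begin

section \<open>The diagonal action on the tensor square over A\<close>

sublocale LL: tensor_pair R "par_base R H" "par_base R H" "par_base R H"
  "left_bimod (Hpar R H) (\<lambda>a. a) \<theta>'" "left_bimod (Hpar R H) (\<lambda>a. a) \<theta>'"
  by (intro tensor_pair.intro bimodule_L)

sublocale QQ: tensor_pair R "par_base' R H" "par_base' R H" "par_base' R H"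
  "right_bimod (Hpar R H) (\<lambda>a. a) \<theta>'" "right_bimod (Hpar R H) (\<lambda>a. a) \<theta>'"
  by (intro tensor_pair.intro bimodule_Q)

lemma modLL [simp]: "module R LL.T" "abelian_group LL.T" "module R QQ.T" "abelian_group QQ.T"
  by (rule LL.module_T LL.abelian_group_T QQ.module_T QQ.abelian_group_T)+

lemma pureL_simps [simp]:
  "x \<in> carrier P \<Longrightarrow> y \<in> carrier P \<Longrightarrow> LL.p x y \<in> carrier LL.T"
  "x \<in> carrier P \<Longrightarrow> y \<in> carrier P \<Longrightarrow> QQ.p x y \<in> carrier QQ.T"
  using LL.pure_closed QQ.pure_closed by simp_all

lemma pureL_ract: "x \<in> carrier P \<Longrightarrow> y \<in> carrier P \<Longrightarrow> a \<in> A \<Longrightarrow> LL.p (\<theta>' a \<star> x) y = LL.p x (a \<star> y)"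
  using LL.pure_ract[of x a y] by simp

lemma pureQ_ract: "x \<in> carrier P \<Longrightarrow> y \<in> carrier P \<Longrightarrow> b \<in> A' \<Longrightarrow> QQ.p (x \<star> b) y = QQ.p x (y \<star> \<theta>' b)"
  using QQ.pure_ract[of x b y] by simp

lemma bilin_pureL: "bilin R P P LL.T LL.p"
  by (intro bilinI lin_mapI)
    (use LL.pure_add_left LL.pure_add_right LL.smult_pure LL.pure_smult in \<open>simp_all\<close>)

lemma bilin_pureQ: "bilin R P P QQ.T QQ.p"
  by (intro bilinI lin_mapI)
    (use QQ.pure_add_left QQ.pure_add_right QQ.smult_pure QQ.pure_smult in \<open>simp_all\<close>)

lemmas lin_pure [lin_intros] = bilin_left[OF bilin_pureL] bilin_right[OF bilin_pureL]
  bilin_left[OF bilin_pureQ] bilin_right[OF bilin_pureQ]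

lemma Lbal_pure: "Lbal LL.T LL.p"
  unfolding Lbal_def using bilin_pureL by (simp add: pureL_ract[symmetric])

text \<open>The elements of \<open>A\<close> over which \<open>\<beta>\<close> is balanced form a
  subalgebra: for a product, the reversal of factors by \<open>\<theta>'\<close> lets them cross one
  after the other in the right order.\<close>

lemma Lbal_balanced:
  assumes G: "module R G" and L: "Lbal G \<beta>"
  shows "balanced L As L G \<beta>"
proof (rule balancedI)
  interpret G: module R G by fact
  note b = Lbal_bilin[OF L]
  note l = bilin_left[OF b] bilin_right[OF b]
  show "additive_map L G (\<lambda>x. \<beta> x y)" if "y \<in> carrier L" for y
    using l(1)[OF _ lin_map_id, of y] that by (auto simp: additive_map_def lin_map_def)
  show "additive_map L G (\<beta> x)" if "x \<in> carrier L" for x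
    using l(2)[OF _ lin_map_id, of x] that by (auto simp: additive_map_def lin_map_def)
  have c [simp]: "x \<in> carrier P \<Longrightarrow> y \<in> carrier P \<Longrightarrow> \<beta> x y \<in> carrier G" for x y
    by (rule bilin_closed[OF b])
  have add: "\<beta> (x \<oplus>\<^bsub>P\<^esub> x') y = \<beta> x y \<oplus>\<^bsub>G\<^esub> \<beta> x' y" "\<beta> y (x \<oplus>\<^bsub>P\<^esub> x') = \<beta> y x \<oplus>\<^bsub>G\<^esub> \<beta> y x'"
    "r \<in> carrier R \<Longrightarrow> \<beta> (r \<odot>\<^bsub>P\<^esub> x) y = r \<odot>\<^bsub>G\<^esub> \<beta> x y" "r \<in> carrier R \<Longrightarrow> \<beta> y (r \<odot>\<^bsub>P\<^esub> x) = r \<odot>\<^bsub>G\<^esub> \<beta> y x"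
    if "x \<in> carrier P" "x' \<in> carrier P" "y \<in> carrier P" for x x' y r
    using b that by (auto simp: bilin_def lin_map_def)
  have "\<forall>x\<in>carrier P. \<forall>y\<in>carrier P. \<beta> (\<theta>' a \<star> x) y = \<beta> x (a \<star> y)" if "a \<in> A" for a
    using that
    by (induction rule: A_induct)
      (simp_all add: Lbal_eps[OF L] add PA.M.l_distr PA.smult_mult_left PA.M.m_assoc)
  then show "\<beta> (ract L x a) y = \<beta> x (lact L a y)"
    if "x \<in> carrier L" "a \<in> carrier As" "y \<in> carrier L" for x a y
    using that by simp
qed

definition op :: "'h \<Rightarrow> (('k, 'h) hpar \<times> ('k, 'h) hpar \<Rightarrow>\<^sub>0 int) set \<Rightarrow> (('k, 'h) hpar \<times> ('k, 'h) hpar \<Rightarrow>\<^sub>0 int) set" where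
  "op h = tensor_lift L As L LL.T (diag LL.T LL.p h)"

lemmas diagL_closed [simp] = diag_closed[OF modLL(1) Lbal_pure]
lemmas lin_map_diagL [lin_intros] = lin_map_diag[OF modLL(1) Lbal_pure]

lemma op_balanced: "h \<in> carrier H \<Longrightarrow> balanced L As L LL.T (diag LL.T LL.p h)"
  by (intro Lbal_balanced Lbal_diag modLL Lbal_pure)

lemma op_pure [simp]: "h \<in> carrier H \<Longrightarrow> x \<in> carrier P \<Longrightarrow> y \<in> carrier P \<Longrightarrow>
    op h (LL.p x y) = diag LL.T LL.p h x y"
  unfolding op_def by (rule LL.tensor_lift_pure[OF modLL(2) op_balanced]) simp_all

lemma op_lin: "h \<in> carrier H \<Longrightarrow> lin_map R LL.T LL.T (op h)"
  unfolding op_def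
proof (rule LL.tensor_lift_lin[OF modLL(1) op_balanced])
  fix c x y assume "h \<in> carrier H" "c \<in> carrier R" "x \<in> carrier L" "y \<in> carrier L"
  then show "diag LL.T LL.p h (c \<odot>\<^bsub>L\<^esub> x) y = c \<odot>\<^bsub>LL.T\<^esub> diag LL.T LL.p h x y"
    using lin_map_smult[OF lin_map_diagL(2)[OF _ _ lin_map_id]] by simp
qed

lemma op_closed [simp]: "h \<in> carrier H \<Longrightarrow> X \<in> carrier LL.T \<Longrightarrow> op h X \<in> carrier LL.T"
  by (rule lin_map_closed[OF op_lin])

lemma op_SW: "h \<in> carrier H \<Longrightarrow> k \<in> carrier H \<Longrightarrow>
    (\<And>x y. x \<in> carrier H \<Longrightarrow> y \<in> carrier H \<Longrightarrow> f x y \<in> carrier LL.T) \<Longrightarrow>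
    op h (SW LL.T f k) = SW LL.T (\<lambda>x y. op h (f x y)) k"
  by (rule SW_lin_map[OF op_lin modLL(1) modLL(1)])

lemma op_diag: "h \<in> carrier H \<Longrightarrow> k \<in> carrier H \<Longrightarrow> x \<in> carrier P \<Longrightarrow> y \<in> carrier P \<Longrightarrow>
    op h (diag LL.T LL.p k x y) = SW LL.T (\<lambda>a b. diag LL.T LL.p h (cl a \<star> x) (cl b \<star> y)) k"
  unfolding diag_def[of _ _ k] by (simp add: op_SW)

lemma lin_map_add_fun:
  assumes "module R G" "lin_map R M G f" "lin_map R M G g"
  shows "lin_map R M G (\<lambda>x. f x \<oplus>\<^bsub>G\<^esub> g x)"
proof -
  interpret module R G by fact
  show ?thesis
    using assms(2,3) by (intro lin_mapI)
      (simp_all add: lin_map_closed[OF assms(2)] lin_map_closed[OF assms(3)] lin_map_add[OF assms(2)]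
        lin_map_add[OF assms(3)] lin_map_smult[OF assms(2)] lin_map_smult[OF assms(3)] M.a_ac smult_r_distr)
qed

lemma lin_map_cong:
  assumes "module R M" "lin_map R M G f" "\<And>x. x \<in> carrier M \<Longrightarrow> f x = g x"
  shows "lin_map R M G g"
proof -
  interpret module R M by fact
  show ?thesis using assms(2,3) by (auto simp: lin_map_def Pi_iff)
qed

text \<open>In \<open>op h X\<close> the variable h sits inside the lifted map; linearity in it is
  visible on pure tensors and spreads by induction on \<open>X\<close>.\<close>

lemma op_lin_arg:
  assumes "X \<in> carrier LL.T"
  shows "lin LL.T (\<lambda>h. op h X)"
  using assms
proof (induction rule: LL.tensor_induct)
  case (pure x y)
  then have "lin LL.T (\<lambda>h. diag LL.T LL.p h x y)" by (intro lin_intros; simp)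
  then show ?case by (rule lin_map_cong[OF modH]) (use pure in simp)
next
  case (add X Y)
  show ?case
    by (rule lin_map_cong[OF modH lin_map_add_fun[OF modLL(1) add(3,4)]])
      (use add(1,2) in \<open>simp add: lin_map_add[OF op_lin]\<close>)
qed

lemma op_relations:
  assumes [simp]: "h \<in> carrier H" "l \<in> carrier H" and X: "X \<in> carrier LL.T"
  shows "SW LL.T (\<lambda>x y. op h (op x (op (S y) X))) l = SW LL.T (\<lambda>x y. op (h \<cdot> x) (op (S y) X)) l"
    and "SW LL.T (\<lambda>x y. op x (op (S y) (op l X))) h = SW LL.T (\<lambda>x y. op x (op (S y \<cdot> l) X)) h"
    and "SW LL.T (\<lambda>x y. op h (op (S x) (op y X))) l = SW LL.T (\<lambda>x y. op (h \<cdot> S x) (op y X)) l"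
    and "SW LL.T (\<lambda>x y. op (S x) (op y (op l X))) h = SW LL.T (\<lambda>x y. op (S x) (op (y \<cdot> l) X)) h"
  using X
proof (induction rule: LL.tensor_induct)
  case (pure x y)
  then have [simp]: "x \<in> carrier P" "y \<in> carrier P" by simp_all
  note r = diag_relation1 diag_relation2 diag_relation3 diag_relation4
  { case 1 then show ?case by (simp add: op_diag op_SW r(1)[OF modLL(1) Lbal_pure]) }
  { case 2 then show ?case by (simp add: op_diag op_SW r(2)[OF modLL(1) Lbal_pure]) }
  { case 3 then show ?case by (simp add: op_diag op_SW r(3)[OF modLL(1) Lbal_pure]) }
  { case 4 then show ?case by (simp add: op_diag op_SW r(4)[OF modLL(1) Lbal_pure]) }
qed (simp_all add: lin_map_add[OF op_lin] SW_add)

lemma op_one: "X \<in> carrier LL.T \<Longrightarrow> op \<one>\<^sub>H X = X"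
proof (induction rule: LL.tensor_induct)
  case (pure x y)
  then have [simp]: "x \<in> carrier P" "y \<in> carrier P" by simp_all
  have "SW LL.T (\<lambda>u v. LL.p (cl u \<star> x) (cl v \<star> y)) \<one>\<^sub>H = LL.p (cl \<one>\<^sub>H \<star> x) (cl \<one>\<^sub>H \<star> y)"
    by (rule SW_one; (intro lin_intros)?; simp)
  then show ?case by (simp add: diag_def)
qed (simp add: lin_map_add[OF op_lin])

text \<open>\<open>\<Phi> x\<close> is the diagonal action of \<open>x\<close> on \<open>H\<^sub>p\<^sub>a\<^sub>r \<otimes>\<^sub>A H\<^sub>p\<^sub>a\<^sub>r\<close>, so that \<open>\<Delta>\<^sub>l x = \<Phi> x (1 \<otimes> 1)\<close>.\<close>

definition \<Phi> where
  "\<Phi> = (SOME \<Phi>. (\<forall>x\<in>carrier P. lin_map R LL.T LL.T (\<Phi> x)) \<and>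
     (\<forall>X\<in>carrier LL.T. lin_map R P LL.T (\<lambda>x. \<Phi> x X) \<and> \<Phi> \<one>\<^bsub>P\<^esub> X = X \<and>
       (\<forall>x\<in>carrier P. \<forall>y\<in>carrier P. \<Phi> (x \<star> y) X = \<Phi> x (\<Phi> y X)) \<and>
       (\<forall>h\<in>carrier H. \<Phi> (cl h) X = op h X)))"

lemma \<Phi>:
  shows \<Phi>_lin: "x \<in> carrier P \<Longrightarrow> lin_map R LL.T LL.T (\<Phi> x)"
    and \<Phi>_lin_arg: "X \<in> carrier LL.T \<Longrightarrow> lin_map R P LL.T (\<lambda>x. \<Phi> x X)"
    and \<Phi>_one: "X \<in> carrier LL.T \<Longrightarrow> \<Phi> \<one>\<^bsub>P\<^esub> X = X"
    and \<Phi>_mult: "x \<in> carrier P \<Longrightarrow> y \<in> carrier P \<Longrightarrow> X \<in> carrier LL.T \<Longrightarrow> \<Phi> (x \<star> y) X = \<Phi> x (\<Phi> y X)"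
    and \<Phi>_cl: "h \<in> carrier H \<Longrightarrow> X \<in> carrier LL.T \<Longrightarrow> \<Phi> (cl h) X = op h X"
proof -
  obtain F where F: "\<And>x. x \<in> carrier P \<Longrightarrow> lin_map R LL.T LL.T (F x)"
    "\<And>X. X \<in> carrier LL.T \<Longrightarrow> lin_map R P LL.T (\<lambda>x. F x X)"
    "\<And>X. X \<in> carrier LL.T \<Longrightarrow> F \<one>\<^bsub>P\<^esub> X = X"
    "\<And>x y X. x \<in> carrier P \<Longrightarrow> y \<in> carrier P \<Longrightarrow> X \<in> carrier LL.T \<Longrightarrow> F (x \<star> y) X = F x (F y X)"
    "\<And>h X. h \<in> carrier H \<Longrightarrow> X \<in> carrier LL.T \<Longrightarrow> F (cl h) X = op h X"
    by (rule Hpar_module[OF modLL(1) op_lin op_lin_arg op_one op_relations]; (assumption | rule that))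
  have "\<exists>\<Phi>. (\<forall>x\<in>carrier P. lin_map R LL.T LL.T (\<Phi> x)) \<and>
     (\<forall>X\<in>carrier LL.T. lin_map R P LL.T (\<lambda>x. \<Phi> x X) \<and> \<Phi> \<one>\<^bsub>P\<^esub> X = X \<and>
       (\<forall>x\<in>carrier P. \<forall>y\<in>carrier P. \<Phi> (x \<star> y) X = \<Phi> x (\<Phi> y X)) \<and>
       (\<forall>h\<in>carrier H. \<Phi> (cl h) X = op h X))"
    by (intro exI[of _ F] conjI ballI F)
  from someI_ex[OF this, folded \<Phi>_def]
  show "x \<in> carrier P \<Longrightarrow> lin_map R LL.T LL.T (\<Phi> x)"
    "X \<in> carrier LL.T \<Longrightarrow> lin_map R P LL.T (\<lambda>x. \<Phi> x X)"
    "X \<in> carrier LL.T \<Longrightarrow> \<Phi> \<one>\<^bsub>P\<^esub> X = X"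
    "x \<in> carrier P \<Longrightarrow> y \<in> carrier P \<Longrightarrow> X \<in> carrier LL.T \<Longrightarrow> \<Phi> (x \<star> y) X = \<Phi> x (\<Phi> y X)"
    "h \<in> carrier H \<Longrightarrow> X \<in> carrier LL.T \<Longrightarrow> \<Phi> (cl h) X = op h X"
    by blast+
qed

lemma \<Phi>_simps [simp]:
  assumes "X \<in> carrier LL.T" "x \<in> carrier P"
  shows "\<Phi> x X \<in> carrier LL.T"
    "y \<in> carrier P \<Longrightarrow> \<Phi> (x \<oplus>\<^bsub>P\<^esub> y) X = \<Phi> x X \<oplus>\<^bsub>LL.T\<^esub> \<Phi> y X"
    "c \<in> carrier R \<Longrightarrow> \<Phi> (c \<odot>\<^bsub>P\<^esub> x) X = c \<odot>\<^bsub>LL.T\<^esub> \<Phi> x X"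
    "Y \<in> carrier LL.T \<Longrightarrow> \<Phi> x (X \<oplus>\<^bsub>LL.T\<^esub> Y) = \<Phi> x X \<oplus>\<^bsub>LL.T\<^esub> \<Phi> x Y"
    "c \<in> carrier R \<Longrightarrow> \<Phi> x (c \<odot>\<^bsub>LL.T\<^esub> X) = c \<odot>\<^bsub>LL.T\<^esub> \<Phi> x X"
  using assms lin_map_closed[OF \<Phi>_lin] lin_map_add[OF \<Phi>_lin_arg] lin_map_smult[OF \<Phi>_lin_arg]
    lin_map_add[OF \<Phi>_lin] lin_map_smult[OF \<Phi>_lin] by simp_all

lemma \<Phi>_word:
  assumes "hs \<in> lists (carrier H)" and [simp]: "x \<in> carrier P" "y \<in> carrier P"
  shows "\<Phi> (word hs) (LL.p x y) = WL LL.T (\<lambda>us vs. LL.p (word us \<star> x) (word vs \<star> y)) hs"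
  using assms(1)
proof (induction hs rule: list.induct)
  case Nil
  then show ?case by (simp add: WL_Nil \<Phi>_one)
next
  case (Cons h hs)
  then have [simp]: "h \<in> carrier H" "hs \<in> lists (carrier H)" by simp_all
  have "\<Phi> (word (h # hs)) (LL.p x y) = op h (WL LL.T (\<lambda>us vs. LL.p (word us \<star> x) (word vs \<star> y)) hs)"
    using Cons by (simp add: \<Phi>_mult \<Phi>_cl)
  also have "\<dots> = WL LL.T (\<lambda>us vs. op h (LL.p (word us \<star> x) (word vs \<star> y))) hs"
    by (rule WL_lin_map[OF op_lin]) simp_all
  also have "\<dots> = WL LL.T (\<lambda>us vs. SW LL.T (\<lambda>u v. LL.p (cl u \<star> (word us \<star> x)) (cl v \<star> (word vs \<star> y))) h) hs"
    by (rule WL_cong) (simp_all add: diag_def)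
  also have "\<dots> = SW LL.T (\<lambda>u v. WL LL.T (\<lambda>us vs. LL.p (cl u \<star> (word us \<star> x)) (cl v \<star> (word vs \<star> y))) hs) h"
    by (rule WL_SW_swap) simp_all
  also have "\<dots> = SW LL.T (\<lambda>u v. WL LL.T (\<lambda>us vs. LL.p (word (u # us) \<star> x) (word (v # vs) \<star> y)) hs) h"
    by (rule SW_congI, simp, rule WL_cong) (simp_all add: PA.M.m_assoc)
  also have "\<dots> = WL LL.T (\<lambda>us vs. LL.p (word us \<star> x) (word vs \<star> y)) (h # hs)"
    by (rule WL_Cons[symmetric]) simp_all
  finally show ?case .
qed

lemma \<Phi>_SW: "h \<in> carrier H \<Longrightarrow> X \<in> carrier LL.T \<Longrightarrow>
    (\<And>x y. x \<in> carrier H \<Longrightarrow> y \<in> carrier H \<Longrightarrow> f x y \<in> carrier P) \<Longrightarrow>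
    \<Phi> (SW P f h) X = SW LL.T (\<lambda>x y. \<Phi> (f x y) X) h"
  by (rule SW_lin_map[OF \<Phi>_lin_arg modP modLL(1)])

text \<open>The diagonal action of the base algebras is the bimodule structure: \<open>e k\<close>
  acts on the left, and \<open>e' k\<close>, being the target of e(S(k)), acts on the right.
  Extended to all of \<open>A\<close> in \<open>\<Phi>_A\<close>, this makes the left
  comultiplication a bimodule map.\<close>

lemma \<Phi>_eps:
  assumes [simp]: "k \<in> carrier H" and X: "X \<in> carrier LL.T"
  shows "\<Phi> (e k) X = lact LL.T (e k) X" "\<Phi> (e' k) X = ract LL.T X (e (S k))"
proof -
  have "\<Phi> (e k) X = SW LL.T (\<lambda>x y. op x (op (S y) X)) k"
    using X by (simp add: eps_eq \<Phi>_SW \<Phi>_mult \<Phi>_cl)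
  also have "\<dots> = lact LL.T (e k) X"
    using X
  proof (induction rule: LL.tensor_induct)
    case (pure x y)
    then show ?case
      by (simp add: op_diag diag_eps[OF modLL(1) Lbal_pure] LL.lact_pure)
  qed (simp_all add: lin_map_add[OF op_lin] SW_add LL.lact_add_T)
  finally show "\<Phi> (e k) X = lact LL.T (e k) X" .
  have "\<Phi> (e' k) X = SW LL.T (\<lambda>x y. op (S x) (op y X)) k"
    using X by (simp add: eps'_eq \<Phi>_SW \<Phi>_mult \<Phi>_cl)
  also have "\<dots> = ract LL.T X (e (S k))"
    using X
  proof (induction rule: LL.tensor_induct)
    case (pure x y)
    then show ?case
      by (simp add: op_diag diag_eps'[OF modLL(1) Lbal_pure] LL.ract_pure)
  qed (simp_all add: lin_map_add[OF op_lin] SW_add LL.ract_add_T)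
  finally show "\<Phi> (e' k) X = ract LL.T X (e (S k))" .
qed

interpretation TB: bimodule R As As LL.T
  by (rule LL.bimodule_T)

lemma smult_eq_lact: "c \<in> carrier R \<Longrightarrow> a \<in> A \<Longrightarrow> X \<in> carrier LL.T \<Longrightarrow>
    lact LL.T (c \<odot>\<^bsub>P\<^esub> a) X = c \<odot>\<^bsub>LL.T\<^esub> lact LL.T a X"
  using TB.lact_mult[of "c \<odot>\<^bsub>P\<^esub> \<one>\<^bsub>P\<^esub>" a X] TB.lact_smult_one[of c "lact LL.T a X"]
  by (simp add: PA.smult_mult_left TB.lact_closed)

lemma smult_eq_ract: "c \<in> carrier R \<Longrightarrow> a \<in> A \<Longrightarrow> X \<in> carrier LL.T \<Longrightarrow>
    ract LL.T X (c \<odot>\<^bsub>P\<^esub> a) = c \<odot>\<^bsub>LL.T\<^esub> ract LL.T X a"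
  using TB.ract_mult[of a "c \<odot>\<^bsub>P\<^esub> \<one>\<^bsub>P\<^esub>" X] TB.ract_smult_one[of c "ract LL.T X a"]
  by (simp add: PA.smult_mult_right TB.ract_closed)

lemma \<Phi>_A:
  assumes "a \<in> A"
  shows "X \<in> carrier LL.T \<Longrightarrow> \<Phi> a X = lact LL.T a X"
    and "X \<in> carrier LL.T \<Longrightarrow> \<Phi> (\<theta>' a) X = ract LL.T X a"
proof -
  \<comment> \<open>\<open>bimodule\<close> expresses unitality through scalars, so the unit is read
    as 1 times the unit.\<close>
  have one: "lact LL.T \<one>\<^bsub>P\<^esub> X = X" "ract LL.T X \<one>\<^bsub>P\<^esub> = X" if X: "X \<in> carrier LL.T" for X
    using X TB.lact_smult_one[of "\<one>\<^bsub>R\<^esub>" X] TB.ract_smult_one[of "\<one>\<^bsub>R\<^esub>" X] LL.AA.smult_one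
    by (simp_all add: module.smult_one[OF modLL(1)])
  show "X \<in> carrier LL.T \<Longrightarrow> \<Phi> a X = lact LL.T a X"
    using assms
    by (induction arbitrary: X rule: A_induct)
      (simp_all add: \<Phi>_eps \<Phi>_one one TB.lact_add_left[simplified] \<Phi>_mult TB.lact_mult[simplified]
        smult_eq_lact TB.lact_closed)
  show "X \<in> carrier LL.T \<Longrightarrow> \<Phi> (\<theta>' a) X = ract LL.T X a"
    using assms
    by (induction arbitrary: X rule: A_induct)
      (simp_all add: \<Phi>_eps \<Phi>_one one TB.ract_add_right[simplified] \<Phi>_mult TB.ract_mult[simplified]
        smult_eq_ract TB.ract_closed)
qed

text \<open>Right multiplication in both slots. It makes sense over \<open>A\<close> because both
  actions of \<open>A\<close> on \<open>L\<close> are left multiplications.\<close>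

definition rmul where
  "rmul c d = tensor_lift L As L LL.T (\<lambda>x y. LL.p (x \<star> c) (y \<star> d))"

lemma Lbal_rmul: "c \<in> carrier P \<Longrightarrow> d \<in> carrier P \<Longrightarrow> Lbal LL.T (\<lambda>x y. LL.p (x \<star> c) (y \<star> d))"
  unfolding Lbal_def
  by (intro conjI bilinI ballI lin_intros; simp add: Lbal_eps[OF Lbal_pure] PA.M.m_assoc)

lemma rmul_simps [simp]:
  assumes "c \<in> carrier P" "d \<in> carrier P"
  shows "x \<in> carrier P \<Longrightarrow> y \<in> carrier P \<Longrightarrow> rmul c d (LL.p x y) = LL.p (x \<star> c) (y \<star> d)"
    "X \<in> carrier LL.T \<Longrightarrow> rmul c d X \<in> carrier LL.T"
    "X \<in> carrier LL.T \<Longrightarrow> Y \<in> carrier LL.T \<Longrightarrow> rmul c d (X \<oplus>\<^bsub>LL.T\<^esub> Y) = rmul c d X \<oplus>\<^bsub>LL.T\<^esub> rmul c d Y"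
  unfolding rmul_def using Lbal_balanced[OF modLL(1) Lbal_rmul[OF assms]]
  by (simp_all add: LL.tensor_lift_pure LL.tensor_lift_closed LL.tensor_lift_add)

lemma rmul_lin: "c \<in> carrier P \<Longrightarrow> d \<in> carrier P \<Longrightarrow> lin_map R LL.T LL.T (rmul c d)"
  unfolding rmul_def
  by (rule LL.tensor_lift_lin[OF modLL(1) Lbal_balanced[OF modLL(1) Lbal_rmul]])
    (simp_all add: PA.smult_mult_left LL.smult_pure)

lemma \<Phi>_rmul:
  assumes z: "z \<in> carrier P" and [simp]: "c \<in> carrier P" "d \<in> carrier P" and X: "X \<in> carrier LL.T"
  shows "rmul c d (\<Phi> z X) = \<Phi> z (rmul c d X)"
  using z X
proof (induction arbitrary: X rule: Hpar_gen_induct)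
  case (gen h)
  note [simp] = \<open>h \<in> carrier H\<close>
  from gen(2) show ?case
  proof (induction rule: LL.tensor_induct)
    case (pure x y)
    then show ?case
      by (simp add: \<Phi>_cl diag_def SW_lin_map[OF rmul_lin] PA.M.m_assoc)
  qed simp
qed (simp_all add: \<Phi>_one \<Phi>_mult lin_map_smult[OF rmul_lin])

end

context tensor_pair
begin

lemma tensor_lift_cong:
  assumes "X \<in> carrier T" "\<And>x y. x \<in> carrier M \<Longrightarrow> y \<in> carrier N \<Longrightarrow> f x y = g x y"
  shows "tensor_lift M B N G f X = tensor_lift M B N G g X"
  unfolding tensor_lift_def using tensor_rep(1)[OF assms(1)] assms(2)
  by (intro arg_cong[where f = "sum_of G"] map_cong) auto

lemma tensor_lift_additive_map:
  assumes "additive_map G G' \<phi>" "abelian_group G" "abelian_group G'" "X \<in> carrier T"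
    "\<And>x y. x \<in> carrier M \<Longrightarrow> y \<in> carrier N \<Longrightarrow> f x y \<in> carrier G"
  shows "\<phi> (tensor_lift M B N G f X) = tensor_lift M B N G' (\<lambda>x y. \<phi> (f x y)) X"
proof -
  have "\<phi> (tensor_lift M B N G f X) = sum_of G' (map \<phi> (map (\<lambda>(x, y). f x y) (tensor_rep M B N X)))"
    unfolding tensor_lift_def using tensor_rep(1)[OF assms(4)] assms(5)
    by (intro additive_map_sum_of[OF assms(1-3)]) auto
  then show ?thesis unfolding tensor_lift_def map_map comp_def case_prod_beta .
qed

lemma tensor_lift_pure_self: "X \<in> carrier T \<Longrightarrow> tensor_lift M B N T p X = X"
  using tensor_rep(2)[of X] by (simp add: tensor_lift_def)

end

context bij_hopf_algebra
begin

section \<open>Properties of the left counit\<close>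

text \<open>Of the four generators around \<open>b\<close>, the two on its right add up to an
  element e'(S(w)) of \<open>A'\<close>. It commutes with \<open>b\<close> and is absorbed by the
  generator on the left. This gives the compatibility of the left counit with the source
  map.\<close>

lemma act_act_eps:
  assumes [simp]: "k \<in> carrier H" and b: "b \<in> A"
  shows "SW P (\<lambda>x y. act x (act (S y) b)) k = e k \<star> b"
proof -
  have [simp]: "b \<in> carrier P" using b by simp
  let ?F = "\<lambda>p q c d. cl p \<star> (cl c \<star> (b \<star> (cl (S d) \<star> cl (S q))))"
  have act: "act x (act z b) = SW P (\<lambda>c d. SW P (\<lambda>p q. ?F p q c d) x) z"
    if [simp]: "x \<in> carrier H" "z \<in> carrier H" for x z
  proof -
    have "act x (act z b) = SW P (\<lambda>p q. SW P (\<lambda>c d. ?F p q c d) z) x"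
      by (simp add: act_def SW_mult_left SW_mult_right PA.M.m_assoc)
    also have "\<dots> = SW P (\<lambda>c d. SW P (\<lambda>p q. ?F p q c d) x) z"
      by (rule SW_swap; simp)
    finally show ?thesis .
  qed
  have "SW P (\<lambda>x y. act x (act (S y) b)) k = SW P (\<lambda>x y. SW P (\<lambda>c d. SW P (\<lambda>p q. ?F p q c d) x) (S y)) k"
    by (simp add: act)
  also have "\<dots> = SW P (\<lambda>a v. SW P (\<lambda>w d. SW P (\<lambda>q c. ?F a q (S d) (S c)) w) v) k"
    by (rule SW_regroup_antipode_right; (intro lin_intros)?; simp)
  also have "\<dots> = SW P (\<lambda>a v. SW P (\<lambda>w d. cl a \<star> (cl (S d) \<star> (b \<star> e' (S w)))) v) k"
    by (simp add: SW_mult_left eps'_antipode)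
  also have "\<dots> = SW P (\<lambda>a v. SW P (\<lambda>w d. cl a \<star> (cl (S d) \<star> (e' (S w) \<star> b))) v) k"
    by (simp add: A_commute[OF b eps_A(2)])
  also have "\<dots> = SW P (\<lambda>a v. cl a \<star> (SW P (\<lambda>w d. cl (S d) \<star> e' (S w)) v \<star> b)) k"
    by (simp add: SW_mult_left SW_mult_right PA.M.m_assoc)
  also have "\<dots> = SW P (\<lambda>a v. cl a \<star> (cl (S v) \<star> b)) k"
  proof (rule SW_congI)
    fix a v assume [simp]: "a \<in> carrier H" "v \<in> carrier H"
    have "SW P (\<lambda>w d. cl (S d) \<star> e' (S w)) v = SW P (\<lambda>x y. cl x \<star> e' y) (S v)"
      by (rule SW_antipode[symmetric]; (intro lin_intros)?; simp)
    then show "cl a \<star> (SW P (\<lambda>w d. cl (S d) \<star> e' (S w)) v \<star> b) = cl a \<star> (cl (S v) \<star> b)"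
      by (simp add: SW_cl_eps'1)
  qed simp
  also have "\<dots> = e k \<star> b"
    by (simp add: eps_eq SW_mult_right PA.M.m_assoc)
  finally show ?thesis .
qed

text \<open>Here the two generators on the left of \<open>b\<close> add up to \<open>e' w\<close>,
  which passes to the right of \<open>b\<close> and is absorbed there. It serves the target
  map.\<close>

lemma act_act_eps':
  assumes [simp]: "k \<in> carrier H" and b: "b \<in> A"
  shows "SW P (\<lambda>x y. act (S x) (act y b)) k = b \<star> e (S k)"
proof -
  have [simp]: "b \<in> carrier P" using b by simp
  let ?F = "\<lambda>p q c d. cl p \<star> (cl c \<star> (b \<star> (cl (S d) \<star> cl (S q))))"
  have act: "act x (act z b) = SW P (\<lambda>c d. SW P (\<lambda>p q. ?F p q c d) x) z"
    if [simp]: "x \<in> carrier H" "z \<in> carrier H" for x z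
  proof -
    have "act x (act z b) = SW P (\<lambda>p q. SW P (\<lambda>c d. ?F p q c d) z) x"
      by (simp add: act_def SW_mult_left SW_mult_right PA.M.m_assoc)
    also have "\<dots> = SW P (\<lambda>c d. SW P (\<lambda>p q. ?F p q c d) x) z"
      by (rule SW_swap; simp)
    finally show ?thesis .
  qed
  have "SW P (\<lambda>x y. act (S x) (act y b)) k = SW P (\<lambda>x y. SW P (\<lambda>c d. SW P (\<lambda>p q. ?F p q c d) (S x)) y) k"
    by (simp add: act)
  also have "\<dots> = SW P (\<lambda>a v. SW P (\<lambda>w d. SW P (\<lambda>q c. ?F (S q) (S a) c d) w) v) k"
    by (rule SW_regroup_antipode_left; (intro lin_intros)?; simp)
  also have "\<dots> = SW P (\<lambda>a v. SW P (\<lambda>w d. b \<star> (e' w \<star> cl (S d) \<star> cl (S (S a)))) v) k"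
  proof (rule SW_congI, simp, rule SW_congI, simp)
    fix a v w d assume [simp]: "a \<in> carrier H" "v \<in> carrier H" "w \<in> carrier H" "d \<in> carrier H"
    have "SW P (\<lambda>q c. ?F (S q) (S a) c d) w = e' w \<star> b \<star> (cl (S d) \<star> cl (S (S a)))"
      by (simp add: eps'_eq SW_mult_right PA.M.m_assoc)
    also have "e' w \<star> b = b \<star> e' w"
      using A_commute[OF b eps_A(2)] by simp
    finally show "SW P (\<lambda>q c. ?F (S q) (S a) c d) w = b \<star> (e' w \<star> cl (S d) \<star> cl (S (S a)))"
      by (simp add: PA.M.m_assoc)
  qed
  also have "\<dots> = SW P (\<lambda>a v. b \<star> (SW P (\<lambda>w d. e' w \<star> cl (S d)) v \<star> cl (S (S a)))) k"
    by (simp add: SW_mult_left SW_mult_right)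
  also have "\<dots> = b \<star> e (S k)"
    by (simp add: SW_eps'_cl_antipode eps_antipode SW_mult_left)
  finally show ?thesis .
qed

text \<open>Behind \<open>b\<close> stands [S(h2)][h3], an element of \<open>A'\<close>; it commutes
  with \<open>b\<close> and is absorbed by [h1]. It is the induction step of the first counit
  law.\<close>

lemma SW_act_cl:
  assumes [simp]: "h \<in> carrier H" and b: "b \<in> A"
  shows "SW P (\<lambda>x y. act x b \<star> cl y) h = cl h \<star> b"
proof -
  have [simp]: "b \<in> carrier P" using b by simp
  have "SW P (\<lambda>x y. act x b \<star> cl y) h = SW P (\<lambda>x y. SW P (\<lambda>u v. cl u \<star> (b \<star> (cl (S v) \<star> cl y))) x) h"
    by (simp add: act_def SW_mult_right PA.M.m_assoc)
  also have "\<dots> = SW P (\<lambda>u w. SW P (\<lambda>v y. cl u \<star> (b \<star> (cl (S v) \<star> cl y))) w) h"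
    by (rule SW_coassoc; (intro lin_intros)?; simp)
  also have "\<dots> = SW P (\<lambda>u w. cl u \<star> (b \<star> e' w)) h"
    by (simp add: eps'_eq SW_mult_left)
  also have "\<dots> = SW P (\<lambda>u w. cl u \<star> e' w) h \<star> b"
    using A_commute[OF b eps_A(2)] by (simp add: SW_mult_right PA.M.m_assoc)
  finally show ?thesis by (simp add: SW_cl_eps'1)
qed

end

context par_antipodes
begin

text \<open>The counterpart of \<open>SW_act_cl\<close> under \<open>\<theta>'\<close>: the element
  that commutes and is absorbed is e(S^-1(w)). It is the induction step of the second counit
  law.\<close>

lemma SW_inv_act_cl:
  assumes [simp]: "h \<in> carrier H" and b: "b \<in> A"
  shows "SW P (\<lambda>x y. \<theta>' (act y b) \<star> cl x) h = cl h \<star> \<theta>' b"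
proof -
  have [simp]: "b \<in> carrier P" using b by simp
  have "SW P (\<lambda>x y. \<theta>' (act y b) \<star> cl x) h =
      SW P (\<lambda>x y. SW P (\<lambda>u v. cl v \<star> (\<theta>' b \<star> (cl (S\<^sub>i u) \<star> cl x))) y) h"
    by (simp add: act_def SW_lin_map[OF \<theta>_lin(2)] SW_mult_right PA.M.m_assoc)
  also have "\<dots> = SW P (\<lambda>w v. SW P (\<lambda>x u. cl v \<star> (\<theta>' b \<star> (cl (S\<^sub>i u) \<star> cl x))) w) h"
    by (rule SW_coassoc[symmetric]; (intro lin_intros)?; simp)
  also have "\<dots> = SW P (\<lambda>w v. cl v \<star> (\<theta>' b \<star> e (S\<^sub>i w))) h"
    by (simp add: eps_inv_antipode SW_mult_left)
  also have "\<dots> = SW P (\<lambda>w v. cl v \<star> e (S\<^sub>i w)) h \<star> \<theta>' b"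
    using A_commute[OF eps_A(1) \<theta>_A(2)[OF b]] by (simp add: SW_mult_right PA.M.m_assoc)
  finally show ?thesis by (simp add: SW_cl_eps_inv)
qed

lemma \<theta>_act:
  assumes [simp]: "h \<in> carrier H" "b \<in> carrier P"
  shows "\<theta> (act (S\<^sub>i h) b) = act' h (\<theta> b)"
proof -
  have "act (S\<^sub>i h) b = SW P (\<lambda>x y. cl (S\<^sub>i y) \<star> b \<star> cl (S (S\<^sub>i x))) h"
    unfolding act_def by (rule SW_inv_antipode; (intro lin_intros)?; simp)
  then show ?thesis
    by (simp add: act'_def SW_lin_map[OF \<theta>_lin(1)] PA.M.m_assoc)
qed

section \<open>The flip between the two tensor squares\<close>

definition flip where
  "flip = tensor_lift L As L QQ.T (\<lambda>x y. QQ.p (\<theta> y) (\<theta> x))"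

lemma Lbal_flip: "Lbal QQ.T (\<lambda>x y. QQ.p (\<theta> y) (\<theta> x))"
  unfolding Lbal_def
proof (intro conjI bilinI ballI)
  fix h x y assume [simp]: "h \<in> carrier H" "x \<in> carrier P" "y \<in> carrier P"
  show "QQ.p (\<theta> y) (\<theta> (e' (S\<^sub>i h) \<star> x)) = QQ.p (\<theta> (e h \<star> y)) (\<theta> x)"
    using pureQ_ract[of "\<theta> y" "\<theta> x" "e' (S h)"] by simp
qed (intro lin_intros; simp)+

lemma flip_pure [simp]: "x \<in> carrier P \<Longrightarrow> y \<in> carrier P \<Longrightarrow> flip (LL.p x y) = QQ.p (\<theta> y) (\<theta> x)"
  unfolding flip_def
  by (rule LL.tensor_lift_pure[OF modLL(4) Lbal_balanced[OF modLL(3) Lbal_flip]]) simp_all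

lemma flip_lin: "lin_map R LL.T QQ.T flip"
  unfolding flip_def
  by (rule LL.tensor_lift_lin[OF modLL(3) Lbal_balanced[OF modLL(3) Lbal_flip]])
    (use QQ.pure_smult in \<open>simp add: QQ.smult_pure\<close>)

lemma flip_simps [simp]:
  "X \<in> carrier LL.T \<Longrightarrow> flip X \<in> carrier QQ.T"
  "X \<in> carrier LL.T \<Longrightarrow> Y \<in> carrier LL.T \<Longrightarrow> flip (X \<oplus>\<^bsub>LL.T\<^esub> Y) = flip X \<oplus>\<^bsub>QQ.T\<^esub> flip Y"
  by (rule lin_map_closed[OF flip_lin] lin_map_add[OF flip_lin]; assumption)+

lemma flip_balanced:
  assumes "balanced Q As' Q G f"
  shows "balanced L As L G (\<lambda>y z. f (\<theta> z) (\<theta> y))"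
proof (rule balancedI)
  have f: "additive_map P G (\<lambda>x. f x y)" "additive_map P G (f y)" if "y \<in> carrier P" for y
    using assms that by (auto simp: balanced_def additive_map_def)
  show "additive_map L G (\<lambda>x. f (\<theta> z) (\<theta> x))" if "z \<in> carrier L" for z
    using f(2)[of "\<theta> z"] that by (auto simp: additive_map_def Pi_iff)
  show "additive_map L G (\<lambda>z. f (\<theta> z) (\<theta> x))" if "x \<in> carrier L" for x
    using f(1)[of "\<theta> x"] that by (auto simp: additive_map_def Pi_iff)
  show "f (\<theta> y) (\<theta> (ract L x a)) = f (\<theta> (lact L a y)) (\<theta> x)"
    if "x \<in> carrier L" "a \<in> carrier As" "y \<in> carrier L" for x a y
  proof -
    have "f (ract Q (\<theta> y) (\<theta> a)) (\<theta> x) = f (\<theta> y) (lact Q (\<theta> a) (\<theta> x))"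
      using assms that by (simp add: balanced_def)
    with that show ?thesis by simp
  qed
qed

text \<open>Pulls identities about the right comultiplication back to lifts over the left tensor
  square, where they are known.\<close>

lemma lift_flip:
  assumes G: "abelian_group G" and f: "balanced Q As' Q G f" and X: "X \<in> carrier LL.T"
  shows "tensor_lift Q As' Q G f (flip X) = tensor_lift L As L G (\<lambda>y z. f (\<theta> z) (\<theta> y)) X"
  using X
  by (induction rule: LL.tensor_induct)
    (simp_all add: QQ.tensor_lift_pure[OF G f] LL.tensor_lift_pure[OF G flip_balanced[OF f]]
      QQ.tensor_lift_add[OF G f] LL.tensor_lift_add[OF G flip_balanced[OF f]])

lemma flip_act:
  assumes a: "a \<in> A" and X: "X \<in> carrier LL.T"
  shows "flip (ract LL.T X a) = lact QQ.T (\<theta> a) (flip X)"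
    and "flip (lact LL.T a X) = ract QQ.T (flip X) (\<theta> a)"
  using X
  by (induction rule: LL.tensor_induct)
    (use a in \<open>simp_all add: LL.ract_pure LL.lact_pure QQ.ract_pure QQ.lact_pure LL.T_add LL.T_closed
      QQ.T_add QQ.T_closed\<close>)

end

text \<open>The equations are required on the carrier only, since the maps of
  \<open>par_structure_maps\<close> are arbitrary outside it.\<close>

locale par_comults = par_antipodes R H \<theta> \<theta>' for R :: "'k ring" and H :: "('k, 'h) hopf" and \<theta> \<theta>' +
  fixes Dl Dr :: "('k, 'h) hpar \<Rightarrow> (('k, 'h) hpar \<times> ('k, 'h) hpar \<Rightarrow>\<^sub>0 int) set"
  assumes Dl: "x \<in> carrier P \<Longrightarrow> Dl x = \<Phi> x (LL.p \<one>\<^bsub>Hpar R H\<^esub> \<one>\<^bsub>Hpar R H\<^esub>)"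
    and Dr: "x \<in> carrier P \<Longrightarrow> Dr x = flip (Dl (\<theta>' x))"
begin

abbreviation "one_LL \<equiv> LL.p \<one>\<^bsub>P\<^esub> \<one>\<^bsub>P\<^esub>"

lemma Dl_closed [simp]: "x \<in> carrier P \<Longrightarrow> Dl x \<in> carrier LL.T"
  by (simp add: Dl)

lemma Dl_lin: "lin_map R P LL.T Dl"
  by (rule lin_map_cong[OF modP \<Phi>_lin_arg[of one_LL]]) (simp_all add: Dl)

lemma Dl_mult: "x \<in> carrier P \<Longrightarrow> y \<in> carrier P \<Longrightarrow> Dl (x \<star> y) = \<Phi> x (Dl y)"
  by (simp add: Dl \<Phi>_mult)

lemma Dl_word: "hs \<in> lists (carrier H) \<Longrightarrow> Dl (word hs) = WL LL.T (\<lambda>us vs. LL.p (word us) (word vs)) hs"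
  by (simp add: Dl \<Phi>_word) (rule WL_cong, simp_all)

lemma Dl_A:
  assumes "a \<in> A" and [simp]: "x \<in> carrier P"
  shows "Dl (a \<star> x) = lact LL.T a (Dl x)" "Dl (\<theta>' a \<star> x) = ract LL.T (Dl x) a"
  using assms by (simp_all add: Dl_mult \<Phi>_A)

text \<open>Acting on 1 \<otimes> 1, an element a of \<open>A\<close> gives a \<otimes> 1 and b of
  \<open>A'\<close> gives 1 \<otimes> b, and these are right multiplications as well;
  \<open>\<Phi>_rmul\<close> carries this along. The mixed coassociativity laws depend on it, as
  their outer actions have this form.\<close>

lemma Dl_right:
  assumes [simp]: "x \<in> carrier P"
  shows "a \<in> A \<Longrightarrow> Dl (x \<star> a) = rmul a \<one>\<^bsub>P\<^esub> (Dl x)" "b \<in> A' \<Longrightarrow> Dl (x \<star> b) = rmul \<one>\<^bsub>P\<^esub> b (Dl x)"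
proof -
  show "Dl (x \<star> a) = rmul a \<one>\<^bsub>P\<^esub> (Dl x)" if [simp]: "a \<in> A"
    by (simp add: Dl_mult) (simp add: Dl \<Phi>_rmul \<Phi>_A LL.lact_pure)
  show "Dl (x \<star> b) = rmul \<one>\<^bsub>P\<^esub> b (Dl x)" if [simp]: "b \<in> A'"
    using \<Phi>_A(2)[of "\<theta> b" one_LL] by (simp add: Dl_mult) (simp add: Dl \<Phi>_rmul LL.ract_pure)
qed

text \<open>At 1 \<otimes> 1 this is the balancing relation of the tensor product over
  \<open>A\<close>.\<close>

lemma rmul_takeuchi: "x \<in> carrier P \<Longrightarrow> a \<in> A \<Longrightarrow> rmul (\<theta>' a) \<one>\<^bsub>P\<^esub> (Dl x) = rmul \<one>\<^bsub>P\<^esub> a (Dl x)"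
  using pureL_ract[of "\<one>\<^bsub>P\<^esub>" "\<one>\<^bsub>P\<^esub>" a] by (simp add: Dl \<Phi>_rmul)

lemma lift_Dl_word:
  assumes G: "abelian_group G" and f: "balanced L As L G f" and hs: "hs \<in> lists (carrier H)"
  shows "tensor_lift L As L G f (Dl (word hs)) = WL G (\<lambda>us vs. f (word us) (word vs)) hs"
proof -
  have "tensor_lift L As L G f (Dl (word hs)) =
      WL G (\<lambda>us vs. tensor_lift L As L G f (LL.p (word us) (word vs))) hs"
    unfolding Dl_word[OF hs]
    by (rule WL_additive_map[OF LL.tensor_lift_additive[OF G f] modLL(2) G hs]) simp
  also have "\<dots> = WL G (\<lambda>us vs. f (word us) (word vs)) hs"
    by (rule WL_cong[OF hs]) (simp add: LL.tensor_lift_pure[OF G f])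
  finally show ?thesis .
qed

text \<open>Both sides are linear, so they are compared on words, where the lift becomes a
  \<open>WL\<close> sum and is open to induction.\<close>

lemma lift_Dl_eqI:
  assumes f: "Lbal P f" and g: "lin_map R P P g" and x: "x \<in> carrier P"
    and w: "\<And>hs. hs \<in> lists (carrier H) \<Longrightarrow> WL P (\<lambda>us vs. f (word us) (word vs)) hs = g (word hs)"
  shows "tensor_lift L As L P f (Dl x) = g x"
proof (rule lin_map_Hpar_eqI[OF _ g x])
  note b = Lbal_balanced[OF modP f]
  have "lin_map R LL.T P (tensor_lift L As L P f)"
  proof (rule LL.tensor_lift_lin[OF modP b])
    fix c x y assume "c \<in> carrier R" "x \<in> carrier L" "y \<in> carrier L"
    then show "f (c \<odot>\<^bsub>L\<^esub> x) y = c \<odot>\<^bsub>P\<^esub> f x y"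
      using lin_map_smult[OF bilin_left[OF Lbal_bilin[OF f] _ lin_map_id]] by simp
  qed
  then show "lin_map R P P (\<lambda>x. tensor_lift L As L P f (Dl x))"
    by (rule lin_map_comp[OF _ Dl_lin])
  show "tensor_lift L As L P f (Dl (word hs)) = g (word hs)" if "hs \<in> lists (carrier H)" for hs
    using that by (simp add: lift_Dl_word[OF abP b] w)
qed

lemma takeuchi_left:
  assumes [simp]: "x \<in> carrier P"
  shows "Dl x \<in> carrier (left_takeuchi P As (\<lambda>a. a) \<theta>')"
proof -
  have "tensor_lift L As L LL.T (\<lambda>x y. LL.p (x \<star> \<theta>' a) y) (Dl x) =
      tensor_lift L As L LL.T (\<lambda>x y. LL.p x (y \<star> a)) (Dl x)" if [simp]: "a \<in> A" for a
  proof -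
    have "tensor_lift L As L LL.T (\<lambda>x y. LL.p (x \<star> \<theta>' a) y) (Dl x) = rmul (\<theta>' a) \<one>\<^bsub>P\<^esub> (Dl x)"
      unfolding rmul_def by (rule LL.tensor_lift_cong) simp_all
    also have "\<dots> = rmul \<one>\<^bsub>P\<^esub> a (Dl x)" by (simp add: rmul_takeuchi)
    also have "\<dots> = tensor_lift L As L LL.T (\<lambda>x y. LL.p x (y \<star> a)) (Dl x)"
      unfolding rmul_def by (rule LL.tensor_lift_cong) simp_all
    finally show ?thesis .
  qed
  then show ?thesis
    by (simp add: left_takeuchi_def Let_def)
qed

text \<open>The componentwise product of \<open>\<Delta>\<^sub>l x\<close> with a tensor \<open>Y\<close> is computed along any expression of \<open>Y\<close>,
  since right multiplications commute with the diagonal action.\<close>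

lemma Dl_takeuchi_mult:
  assumes [simp]: "x \<in> carrier P" "y \<in> carrier P"
  shows "Dl x \<otimes>\<^bsub>LL.T\<^esub> Dl y = Dl (x \<star> y)"
proof -
  let ?X = "tensor_rep L As L (Dl x)" and ?Y = "tensor_rep L As L (Dl y)"
  have X: "set ?X \<subseteq> carrier P \<times> carrier P" and Y: "set ?Y \<subseteq> carrier P \<times> carrier P"
    using LL.tensor_rep(1)[OF Dl_closed] by simp_all
  have "Dl x \<otimes>\<^bsub>LL.T\<^esub> Dl y =
      sum_of LL.T (map (\<lambda>z. sum_of LL.T (map (\<lambda>w. LL.p (fst z \<star> fst w) (snd z \<star> snd w)) ?Y)) ?X)"
    by (simp add: LL.mult_T tensor_lift_def split_def)
  also have "\<dots> = sum_of LL.T (map (\<lambda>w. sum_of LL.T (map (\<lambda>z. LL.p (fst z \<star> fst w) (snd z \<star> snd w)) ?X)) ?Y)"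
    using X Y by (intro abelian_group.sum_of_swap[OF modLL(2)] pureL_simps PA.M.m_closed) auto
  also have "\<dots> = sum_of LL.T (map (\<lambda>w. rmul (fst w) (snd w) (Dl x)) ?Y)"
    by (simp add: rmul_def tensor_lift_def split_def)
  also have "map (\<lambda>w. rmul (fst w) (snd w) (Dl x)) ?Y = map (\<Phi> x) (map (\<lambda>(u, v). LL.p u v) ?Y)"
    using Y by (auto simp: Dl \<Phi>_rmul)
  also have "sum_of LL.T \<dots> = \<Phi> x (sum_of LL.T (map (\<lambda>(u, v). LL.p u v) ?Y))"
    using Y by (intro additive_map_sum_of[symmetric] lin_map_additive[OF \<Phi>_lin]) auto
  also have "\<dots> = \<Phi> x (Dl y)"
    using LL.tensor_rep(2)[of "Dl y"] by simp
  finally show ?thesis by (simp add: Dl_mult)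
qed

end

text \<open>The left counit enters through its recursion and its value at 1; the closed formula is
  recovered in \<open>El_word\<close>.\<close>

locale par_maps = par_comults R H \<theta> \<theta>' Dl Dr
  for R :: "'k ring" and H :: "('k, 'h) hopf" and \<theta> \<theta>' Dl Dr +
  fixes El Er :: "('k, 'h) hpar \<Rightarrow> ('k, 'h) hpar"
  assumes El_lin: "lin_map R P P El" and El_one [simp]: "El \<one>\<^bsub>Hpar R H\<^esub> = \<one>\<^bsub>Hpar R H\<^esub>"
    and El_cl: "h \<in> carrier H \<Longrightarrow> x \<in> carrier P \<Longrightarrow>
      El (cls R H h \<otimes>\<^bsub>Hpar R H\<^esub> x) = act h (El x)"
    and El_A [simp]: "x \<in> carrier P \<Longrightarrow> El x \<in> A"
    and Er: "x \<in> carrier P \<Longrightarrow> Er x = \<theta> (El (\<theta>' x))"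
begin

lemma El_simps [simp]:
  "x \<in> carrier P \<Longrightarrow> El x \<in> carrier P"
  "x \<in> carrier P \<Longrightarrow> y \<in> carrier P \<Longrightarrow> El (x \<oplus>\<^bsub>P\<^esub> y) = El x \<oplus>\<^bsub>P\<^esub> El y"
  "c \<in> carrier R \<Longrightarrow> x \<in> carrier P \<Longrightarrow> El (c \<odot>\<^bsub>P\<^esub> x) = c \<odot>\<^bsub>P\<^esub> El x"
  using El_lin by (auto simp: lin_map_def)

lemmas lin_map_El [lin_intros] = lin_map_comp[OF El_lin]

text \<open>Unfolding a generator and applying the recursion of the counit twice leads to
  \<open>act_act_eps\<close> and \<open>act_act_eps'\<close>.\<close>

lemma El_act:
  assumes "a \<in> A"
  shows El_source: "x \<in> carrier P \<Longrightarrow> El (a \<star> x) = a \<star> El x"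
    and El_target: "x \<in> carrier P \<Longrightarrow> El (\<theta>' a \<star> x) = El x \<star> a"
proof -
  have gen: "El (e h \<star> x) = e h \<star> El x" "El (e' h \<star> x) = El x \<star> e (S h)"
    if [simp]: "h \<in> carrier H" "x \<in> carrier P" for h x
    by (simp_all add: act_act_eps[OF _ El_A, symmetric] act_act_eps'[OF _ El_A, symmetric],
        simp_all add: eps_eq eps'_eq SW_mult_right SW_lin_map[OF El_lin] El_cl PA.M.m_assoc)
  show "x \<in> carrier P \<Longrightarrow> El (a \<star> x) = a \<star> El x"
    using assms
    by (induction arbitrary: x rule: A_induct)
      (simp_all add: gen PA.M.l_distr PA.M.m_assoc PA.smult_mult_left)
  show "x \<in> carrier P \<Longrightarrow> El (\<theta>' a \<star> x) = El x \<star> a"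
    using assms
    by (induction arbitrary: x rule: A_induct)
      (simp_all add: gen PA.M.l_distr PA.M.r_distr PA.M.m_assoc PA.smult_mult_left PA.smult_mult_right)
qed

lemma El_base [simp]: "a \<in> A \<Longrightarrow> El a = a" "a \<in> A \<Longrightarrow> El (\<theta>' a) = a"
  using El_source[of a "\<one>\<^bsub>P\<^esub>"] El_target[of a "\<one>\<^bsub>P\<^esub>"] by simp_all

lemma El_base' [simp]: "b \<in> A' \<Longrightarrow> El b = \<theta> b"
  using El_base(2)[of "\<theta> b"] by simp

text \<open>For a generator both sides are the action on \<open>El y\<close>, since
  \<open>El\<close> fixes \<open>A\<close>. For a product the hypotheses are used at several second
  arguments, so y is arbitrary in the induction.\<close>

lemma El_mult:
  assumes "x \<in> carrier P" "y \<in> carrier P"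
  shows "El (x \<star> y) = El (x \<star> El y)"
  using assms
proof (induction arbitrary: y rule: Hpar_gen_induct)
  case (mult x x')
  note [simp] = mult.hyps mult.prems
  have "El (x \<star> x' \<star> y) = El (x \<star> (x' \<star> y))"
    by (simp add: PA.M.m_assoc)
  also have "\<dots> = El (x \<star> El (x' \<star> y))"
    by (rule mult.IH(1)) simp
  also have "El (x' \<star> y) = El (x' \<star> El y)"
    by (rule mult.IH(2)) simp
  also have "El (x \<star> El (x' \<star> El y)) = El (x \<star> (x' \<star> El y))"
    by (rule mult.IH(1)[symmetric]) simp
  finally show ?case by (simp add: PA.M.m_assoc)
next
  case (add x x')
  then show ?case
    using add.IH(1)[OF add.prems] add.IH(2)[OF add.prems] by (simp only: PA.M.l_distr El_simps PA.M.m_closed)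
next
  case (smult c x)
  then show ?case
    using smult.IH[OF smult.prems] by (simp only: PA.smult_mult_left El_simps PA.M.m_closed)
qed (simp_all add: El_cl)

text \<open>y and the target of \<open>El y\<close> have the same counit, so \<open>El_mult\<close>
  applies to both.\<close>

lemma El_mult_target:
  assumes "x \<in> carrier P" "y \<in> carrier P"
  shows "El (x \<star> \<theta>' (El y)) = El (x \<star> y)"
  using El_mult[of x "\<theta>' (El y)"] El_mult[of x y] assms by simp

text \<open>Induction on words with \<open>SW_act_cl\<close> as the step; the sum over the first
  letter is moved innermost, where it meets a fixed element of \<open>A\<close>.\<close>

lemma left_counit_left:
  assumes x: "x \<in> carrier P"
  shows "tensor_lift L As L P (\<lambda>y z. El y \<star> z) (Dl x) = x"
proof (rule lift_Dl_eqI[OF _ lin_map_id x])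
  show "Lbal P (\<lambda>y z. El y \<star> z)"
    unfolding Lbal_def
  proof (intro conjI bilinI ballI)
    fix h x y assume [simp]: "h \<in> carrier H" "x \<in> carrier P" "y \<in> carrier P"
    show "El (e' (S\<^sub>i h) \<star> x) \<star> y = El x \<star> (e h \<star> y)"
      using El_target[of "e h" x] by (simp add: PA.M.m_assoc)
  qed (intro lin_intros; simp)+
  fix hs assume "hs \<in> lists (carrier H)"
  then show "WL P (\<lambda>us vs. El (word us) \<star> word vs) hs = word hs"
  proof (induction hs rule: list.induct)
    case Nil
    then show ?case by (simp add: WL_Nil)
  next
    case (Cons h hs)
    then have [simp]: "h \<in> carrier H" "hs \<in> lists (carrier H)" by simp_all
    have "WL P (\<lambda>us vs. El (word us) \<star> word vs) (h # hs) =
        SW P (\<lambda>x y. WL P (\<lambda>us vs. El (word (x # us)) \<star> word (y # vs)) hs) h"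
      by (rule WL_Cons) simp_all
    also have "\<dots> = WL P (\<lambda>us vs. SW P (\<lambda>x y. El (word (x # us)) \<star> word (y # vs)) h) hs"
      by (rule WL_SW_swap[symmetric]) simp_all
    also have "\<dots> = WL P (\<lambda>us vs. cl h \<star> (El (word us) \<star> word vs)) hs"
    proof (rule WL_cong)
      fix us vs assume uv: "us \<in> lists (carrier H)" "vs \<in> lists (carrier H)"
      have "SW P (\<lambda>x y. El (word (x # us)) \<star> word (y # vs)) h =
          SW P (\<lambda>x y. act x (El (word us)) \<star> cl y) h \<star> word vs"
        using uv by (simp add: El_cl SW_mult_right PA.M.m_assoc)
      then show "SW P (\<lambda>x y. El (word (x # us)) \<star> word (y # vs)) h = cl h \<star> (El (word us) \<star> word vs)"
        using uv by (simp add: SW_act_cl PA.M.m_assoc)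
    qed simp
    also have "\<dots> = cl h \<star> WL P (\<lambda>us vs. El (word us) \<star> word vs) hs"
      by (rule WL_lin_map[symmetric, where \<phi>="\<lambda>z. cl h \<star> z"]; (intro lin_intros)?; simp)
    finally show ?case using Cons by simp
  qed
qed

text \<open>The same induction with \<open>SW_inv_act_cl\<close> as the step.\<close>

lemma left_counit_right:
  assumes x: "x \<in> carrier P"
  shows "tensor_lift L As L P (\<lambda>y z. \<theta>' (El z) \<star> y) (Dl x) = x"
proof (rule lift_Dl_eqI[OF _ lin_map_id x])
  show "Lbal P (\<lambda>y z. \<theta>' (El z) \<star> y)"
    unfolding Lbal_def
  proof (intro conjI bilinI ballI)
    fix h x y assume [simp]: "h \<in> carrier H" "x \<in> carrier P" "y \<in> carrier P"
    show "\<theta>' (El y) \<star> (e' (S\<^sub>i h) \<star> x) = \<theta>' (El (e h \<star> y)) \<star> x"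
      by (simp add: El_source PA.M.m_assoc)
  qed (intro lin_intros; simp)+
  fix hs assume "hs \<in> lists (carrier H)"
  then show "WL P (\<lambda>us vs. \<theta>' (El (word vs)) \<star> word us) hs = word hs"
  proof (induction hs rule: list.induct)
    case Nil
    then show ?case by (simp add: WL_Nil)
  next
    case (Cons h hs)
    then have [simp]: "h \<in> carrier H" "hs \<in> lists (carrier H)" by simp_all
    have "WL P (\<lambda>us vs. \<theta>' (El (word vs)) \<star> word us) (h # hs) =
        SW P (\<lambda>x y. WL P (\<lambda>us vs. \<theta>' (El (word (y # vs))) \<star> word (x # us)) hs) h"
      by (rule WL_Cons) simp_all
    also have "\<dots> = WL P (\<lambda>us vs. SW P (\<lambda>x y. \<theta>' (El (word (y # vs))) \<star> word (x # us)) h) hs"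
      by (rule WL_SW_swap[symmetric]) simp_all
    also have "\<dots> = WL P (\<lambda>us vs. cl h \<star> (\<theta>' (El (word vs)) \<star> word us)) hs"
    proof (rule WL_cong)
      fix us vs assume uv: "us \<in> lists (carrier H)" "vs \<in> lists (carrier H)"
      have "SW P (\<lambda>x y. \<theta>' (El (word (y # vs))) \<star> word (x # us)) h =
          SW P (\<lambda>x y. \<theta>' (act y (El (word vs))) \<star> cl x) h \<star> word us"
        using uv by (simp add: El_cl SW_mult_right PA.M.m_assoc)
      then show "SW P (\<lambda>x y. \<theta>' (El (word (y # vs))) \<star> word (x # us)) h =
          cl h \<star> (\<theta>' (El (word vs)) \<star> word us)"
        using uv by (simp add: SW_inv_act_cl PA.M.m_assoc)
    qed simp
    also have "\<dots> = cl h \<star> WL P (\<lambda>us vs. \<theta>' (El (word vs)) \<star> word us) hs"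
      by (rule WL_lin_map[symmetric, where \<phi>="\<lambda>z. cl h \<star> z"]; (intro lin_intros)?; simp)
    finally show ?case using Cons by simp
  qed
qed

end

context bij_hopf_algebra
begin

section \<open>Coassociativity\<close>

text \<open>Words span H_par only with coefficients, but a coefficient c can be put in front of the
  word as the letter c1, so additive maps can be compared on words. Tensor products with mixed
  factors are then handled as groups.\<close>

lemma additive_map_Hpar_eqI:
  assumes f: "additive_map P G f" and g: "additive_map P G g" and x: "x \<in> carrier P"
    and eq: "\<And>hs. hs \<in> lists (carrier H) \<Longrightarrow> f (word hs) = g (word hs)"
  shows "f x = g x"
proof -
  \<comment> \<open>The claim is strengthened to all scalar multiples so that it survives the scalar
    case of the induction.\<close>
  have "\<forall>c\<in>carrier R. f (c \<odot>\<^bsub>P\<^esub> x) = g (c \<odot>\<^bsub>P\<^esub> x)"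
    using x
  proof (induction rule: Hpar_induct)
    case (word hs)
    have "c \<odot>\<^bsub>P\<^esub> word hs = word ((c \<odot>\<^bsub>H\<^esub> \<one>\<^sub>H) # hs)" if "c \<in> carrier R" for c
      using that word by (simp add: lin_map_smult[OF cl_lin] cl_one PA.smult_mult_left)
    with word show ?case using eq[of "(_ \<odot>\<^bsub>H\<^esub> \<one>\<^sub>H) # hs"] by simp
  next
    case (add x y)
    then show ?case
      by (simp add: PA.smult_r_distr additive_map_add[OF f] additive_map_add[OF g])
  next
    case (smult c x)
    then show ?case by (simp flip: PA.smult_assoc1)
  qed
  from bspec[OF this, of "\<one>\<^bsub>R\<^esub>"] x show ?thesis by simp
qed

text \<open>What \<open>L\<close>, \<open>Q\<close>, \<open>LQ\<close> and \<open>QL\<close> have in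
  common; they differ in their actions.\<close>

definition like_P :: "('k, 'a, 'b, ('k, 'h) hpar) bimod \<Rightarrow> bool" where
  "like_P M \<longleftrightarrow> carrier M = carrier P \<and> ring.add M = ring.add P \<and> smult M = smult P"

text \<open>All four coassociativity laws at once. \<open>e1\<close> and \<open>e2\<close> are
  applied first, then \<open>d1\<close> and \<open>d2\<close> to one factor. The conditions r and l
  say that the latter respect the action at the remaining tensor sign, which makes the maps on
  tensors well defined. On words the bimodules look alike and \<open>WL_coassoc\<close>
  applies.\<close>

lemma word_coassoc:
  assumes tri: "tensor_triple R B1 B2 B3 B4 M N W"
    and pairs: "tensor_pair R C1 B3 C2 U V" "tensor_pair R C3 B2 C4 U' V'"
    and like: "like_P M" "like_P N" "like_P W" "like_P U" "like_P V" "like_P U'" "like_P V'"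
    and d1: "additive_map P (tensor M B2 N) d1" "\<And>hs. hs \<in> lists (carrier H) \<Longrightarrow>
      d1 (word hs) = WL (tensor M B2 N) (\<lambda>us vs. pure M B2 N (word us) (word vs)) hs"
    and d2: "additive_map P (tensor N B3 W) d2" "\<And>hs. hs \<in> lists (carrier H) \<Longrightarrow>
      d2 (word hs) = WL (tensor N B3 W) (\<lambda>us vs. pure N B3 W (word us) (word vs)) hs"
    and e1: "additive_map P (tensor U B3 V) e1" "\<And>hs. hs \<in> lists (carrier H) \<Longrightarrow>
      e1 (word hs) = WL (tensor U B3 V) (\<lambda>us vs. pure U B3 V (word us) (word vs)) hs"
    and e2: "additive_map P (tensor U' B2 V') e2" "\<And>hs. hs \<in> lists (carrier H) \<Longrightarrow>
      e2 (word hs) = WL (tensor U' B2 V') (\<lambda>us vs. pure U' B2 V' (word us) (word vs)) hs"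
    and r: "\<And>x b. x \<in> carrier P \<Longrightarrow> b \<in> carrier B3 \<Longrightarrow> d1 (ract U x b) = ract (tensor M B2 N) (d1 x) b"
      "\<And>y b. y \<in> carrier P \<Longrightarrow> b \<in> carrier B3 \<Longrightarrow> lact V b y = lact W b y"
    and l: "\<And>y b. y \<in> carrier P \<Longrightarrow> b \<in> carrier B2 \<Longrightarrow> d2 (lact V' b y) = lact (tensor N B3 W) b (d2 y)"
      "\<And>x b. x \<in> carrier P \<Longrightarrow> b \<in> carrier B2 \<Longrightarrow> ract U' x b = ract M x b"
    and x: "x \<in> carrier P"
  shows "tensor_assoc M B2 N B3 W (tensor_map U B3 V (tensor M B2 N) W d1 (\<lambda>y. y) (e1 x)) =
    tensor_map U' B2 V' M (tensor N B3 W) (\<lambda>y. y) d2 (e2 x)"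
proof -
  interpret TT: tensor_triple R B1 B2 B3 B4 M N W by fact
  interpret UV: tensor_pair R C1 B3 C2 U V by fact
  interpret UV': tensor_pair R C3 B2 C4 U' V' by fact
  note [simp] = like[unfolded like_P_def] additive_map_closed[OF d1(1)] additive_map_closed[OF d2(1)]
  note cl = TT.MN.pure_closed[simplified] TT.NP.pure_closed[simplified] UV.pure_closed[simplified]
    UV'.pure_closed[simplified] TT.LP.pure_closed[simplified] TT.RP.pure_closed[simplified]
  note ab = TT.LP.abelian_group_T TT.RP.abelian_group_T
  have b1: "balanced U B3 V (tensor (tensor M B2 N) B3 W)
      (\<lambda>x y. pure (tensor M B2 N) B3 W (d1 x) y)"
    using TT.LP.pure_add_left[simplified] TT.LP.pure_add_right[simplified] TT.LP.pure_ract[simplified] r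
    by (intro balancedI additive_mapI) (simp_all add: cl additive_map_add[OF d1(1)])
  have b2: "balanced U' B2 V' (tensor M B2 (tensor N B3 W))
      (\<lambda>x y. pure M B2 (tensor N B3 W) x (d2 y))"
    using TT.RP.pure_add_left[simplified] TT.RP.pure_add_right[simplified] TT.RP.pure_ract[simplified] l
    by (intro balancedI additive_mapI) (simp_all add: cl additive_map_add[OF d2(1)])
  note m1 = UV.tensor_lift_additive[OF ab(1) b1] and m2 = UV'.tensor_lift_additive[OF ab(2) b2]
  note p1 = UV.tensor_lift_pure[OF ab(1) b1, simplified] and p2 = UV'.tensor_lift_pure[OF ab(2) b2, simplified]
  let ?G = "tensor M B2 (tensor N B3 W)"
  let ?f = "\<lambda>x y z. pure M B2 (tensor N B3 W) x (pure N B3 W y z)"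
  show ?thesis
  proof (rule additive_map_Hpar_eqI[OF _ _ x, of ?G])
    show "additive_map P ?G (\<lambda>x. tensor_assoc M B2 N B3 W
        (tensor_map U B3 V (tensor M B2 N) W d1 (\<lambda>y. y) (e1 x)))"
      unfolding tensor_map_def using e1(1) m1 TT.tensor_assoc_additive
      by (auto simp: additive_map_def Pi_iff)
    show "additive_map P ?G (\<lambda>x. tensor_map U' B2 V' M (tensor N B3 W) (\<lambda>y. y) d2 (e2 x))"
      unfolding tensor_map_def using e2(1) m2 by (auto simp: additive_map_def Pi_iff)
    fix hs assume hs: "hs \<in> lists (carrier H)"
    have inner: "balanced M B2 N ?G (\<lambda>x y. ?f x y (word zs))" if "zs \<in> lists (carrier H)" for zs
      using TT.balanced_assoc_inner that by simp
    have "tensor_map U B3 V (tensor M B2 N) W d1 (\<lambda>y. y) (e1 (word hs)) =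
        WL (tensor (tensor M B2 N) B3 W) (\<lambda>ws zs. pure (tensor M B2 N) B3 W (d1 (word ws)) (word zs)) hs"
      unfolding e1(2)[OF hs] tensor_map_def
      using WL_additive_map[OF m1 UV.abelian_group_T ab(1) hs, of "\<lambda>us vs. UV.p (word us) (word vs)"]
      by (simp add: cl p1 cong: WL_cong[OF hs])
    then have "tensor_assoc M B2 N B3 W (tensor_map U B3 V (tensor M B2 N) W d1 (\<lambda>y. y) (e1 (word hs))) =
        WL ?G (\<lambda>ws zs. tensor_assoc M B2 N B3 W
          (pure (tensor M B2 N) B3 W (d1 (word ws)) (word zs))) hs"
      using WL_additive_map[OF TT.tensor_assoc_additive ab hs,
        of "\<lambda>ws zs. pure (tensor M B2 N) B3 W (d1 (word ws)) (word zs)"]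
      by (simp add: cl)
    also have "\<dots> = WL ?G (\<lambda>ws zs. WL ?G (\<lambda>xs ys. ?f (word xs) (word ys) (word zs)) ws) hs"
    proof (rule WL_cong[OF hs])
      fix ws zs assume ws: "ws \<in> lists (carrier H)" and zs: "zs \<in> lists (carrier H)"
      have "tensor_assoc M B2 N B3 W (pure (tensor M B2 N) B3 W (d1 (word ws)) (word zs)) =
          tensor_lift M B2 N ?G (\<lambda>x y. ?f x y (word zs)) (d1 (word ws))"
        using ws zs by (intro TT.tensor_assoc_pure) simp_all
      also have "\<dots> = WL ?G (\<lambda>xs ys. tensor_lift M B2 N ?G (\<lambda>x y. ?f x y (word zs))
          (TT.MN.p (word xs) (word ys))) ws"
        unfolding d1(2)[OF ws]
        by (rule WL_additive_map[OF TT.MN.tensor_lift_additive[OF ab(2) inner[OF zs]]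
              TT.MN.abelian_group_T ab(2) ws]) (simp add: cl)
      also have "\<dots> = WL ?G (\<lambda>xs ys. ?f (word xs) (word ys) (word zs)) ws"
        by (rule WL_cong[OF ws], rule TT.MN.tensor_lift_pure[OF ab(2) inner[OF zs]]) simp_all
      finally show "tensor_assoc M B2 N B3 W (pure (tensor M B2 N) B3 W (d1 (word ws)) (word zs)) =
          WL ?G (\<lambda>xs ys. ?f (word xs) (word ys) (word zs)) ws" .
    qed
    also have "\<dots> = WL ?G (\<lambda>xs ws. WL ?G (\<lambda>ys zs. ?f (word xs) (word ys) (word zs)) ws) hs"
      using TT.RP.pure_add_left[simplified] TT.RP.pure_add_right[simplified]
        TT.NP.pure_add_left[simplified] TT.NP.pure_add_right[simplified]
        TT.RP.smult_pure[simplified] TT.RP.pure_smult[simplified]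
        TT.NP.smult_pure[simplified] TT.NP.pure_smult[simplified]
      by (intro WL_coassoc[OF TT.RP.module_T hs] lin_mapI) (simp_all add: cl)
    also have "\<dots> = WL ?G (\<lambda>xs ws. pure M B2 (tensor N B3 W) (word xs) (d2 (word ws))) hs"
    proof (rule WL_cong[OF hs])
      fix xs ws assume xs: "xs \<in> lists (carrier H)" and ws: "ws \<in> lists (carrier H)"
      have "additive_map (tensor N B3 W) ?G (TT.RP.p (word xs))"
        using TT.RP.pure_balanced xs by (simp add: balanced_def)
      from WL_additive_map[OF this TT.NP.abelian_group_T ab(2) ws, of "\<lambda>ys zs. TT.NP.p (word ys) (word zs)"]
      show "WL ?G (\<lambda>ys zs. ?f (word xs) (word ys) (word zs)) ws =
          pure M B2 (tensor N B3 W) (word xs) (d2 (word ws))"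
        using xs ws by (simp add: d2(2) cl)
    qed
    also have "\<dots> = tensor_map U' B2 V' M (tensor N B3 W) (\<lambda>y. y) d2 (e2 (word hs))"
      unfolding e2(2)[OF hs] tensor_map_def
      using WL_additive_map[OF m2 UV'.abelian_group_T ab(2) hs, of "\<lambda>us vs. UV'.p (word us) (word vs)"]
      by (simp add: cl p2 cong: WL_cong[OF hs])
    finally show "tensor_assoc M B2 N B3 W (tensor_map U B3 V (tensor M B2 N) W d1 (\<lambda>y. y) (e1 (word hs))) =
      tensor_map U' B2 V' M (tensor N B3 W) (\<lambda>y. y) d2 (e2 (word hs))" .
  qed
qed

end

text \<open>Apart from addition and scalars, a tensor product sees its left factor through the right
  action and its right factor through the left action. Hence \<open>L\<close> with \<open>LQ\<close>
  and \<open>L\<close> with \<open>L\<close> give the same tensors, and the mixed laws can reuse the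
  results for \<open>LL\<close> and \<open>QQ\<close>.\<close>

lemma tensor_cong:
  assumes M: "carrier M = carrier M'" "ring.add M = ring.add M'" "ract M = ract M'" "smult M = smult M'"
    and N: "carrier N = carrier N'" "ring.add N = ring.add N'" "lact N = lact N'"
  shows "pure M B N = pure M' B N'" "tensor_rep M B N = tensor_rep M' B N'"
    "carrier (tensor M B N) = carrier (tensor M' B N')"
    "ring.add (tensor M B N) = ring.add (tensor M' B N')"
    "ring.zero (tensor M B N) = ring.zero (tensor M' B N')"
    "smult (tensor M B N) = smult (tensor M' B N')"
proof -
  have F: "tensor_free M N = tensor_free M' N'"
    by (simp add: tensor_free_def M N)
  have K: "tensor_ker M B N = tensor_ker M' B N'"
    by (simp add: tensor_ker_def tensor_rels_def F M N)
  have G: "tensor_group M B N = tensor_group M' B N'"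
    by (simp add: tensor_group_def F K)
  show p: "pure M B N = pure M' B N'"
    by (intro ext) (simp add: pure_def F K)
  show r: "tensor_rep M B N = tensor_rep M' B N'"
    by (intro ext) (simp add: tensor_rep_def G p M N)
  show "carrier (tensor M B N) = carrier (tensor M' B N')"
    "ring.add (tensor M B N) = ring.add (tensor M' B N')"
    "ring.zero (tensor M B N) = ring.zero (tensor M' B N')"
    "smult (tensor M B N) = smult (tensor M' B N')"
    by (simp_all add: tensor_def tensor_ab_def Let_def tensor_lift_def sum_of_def G p r M fun_eq_iff)
qed

context bij_hopf_algebra
begin

lemma WL_record_cong: "ring.add G = ring.add G' \<Longrightarrow> ring.zero G = ring.zero G' \<Longrightarrow> WL G = WL G'"
  by (intro ext) (simp add: WL_def sum_of_def)

end

context par_antipodes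
begin

definition lmul where
  "lmul c d = tensor_lift Q As' Q QQ.T (\<lambda>x y. QQ.p (c \<star> x) (d \<star> y))"

lemma lmul_balanced:
  assumes [simp]: "c \<in> carrier P" "d \<in> carrier P"
  shows "balanced Q As' Q QQ.T (\<lambda>x y. QQ.p (c \<star> x) (d \<star> y))"
  using QQ.pure_add_left QQ.pure_add_right pureQ_ract
  by (intro balancedI additive_mapI) (simp_all add: PA.M.r_distr flip: PA.M.m_assoc)

lemma lmul_simps [simp]:
  assumes "c \<in> carrier P" "d \<in> carrier P"
  shows "x \<in> carrier P \<Longrightarrow> y \<in> carrier P \<Longrightarrow> lmul c d (QQ.p x y) = QQ.p (c \<star> x) (d \<star> y)"
    "X \<in> carrier QQ.T \<Longrightarrow> Y \<in> carrier QQ.T \<Longrightarrow> lmul c d (X \<oplus>\<^bsub>QQ.T\<^esub> Y) = lmul c d X \<oplus>\<^bsub>QQ.T\<^esub> lmul c d Y"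
  unfolding lmul_def using lmul_balanced[OF assms]
  by (simp_all add: QQ.tensor_lift_pure QQ.tensor_lift_add)

lemma flip_rmul:
  assumes [simp]: "c \<in> carrier P" "d \<in> carrier P" and X: "X \<in> carrier LL.T"
  shows "flip (rmul c d X) = lmul (\<theta> d) (\<theta> c) (flip X)"
  using X by (induction rule: LL.tensor_induct) simp_all

lemma LQ_tensor:
  "pure L As LQ = LL.p" "carrier (tensor L As LQ) = carrier LL.T"
  "ring.add (tensor L As LQ) = ring.add LL.T" "ring.zero (tensor L As LQ) = ring.zero LL.T"
  "tensor_rep L As LQ = tensor_rep L As L"
  "pure LQ As' Q = QQ.p" "carrier (tensor LQ As' Q) = carrier QQ.T"
  "ring.add (tensor LQ As' Q) = ring.add QQ.T" "ring.zero (tensor LQ As' Q) = ring.zero QQ.T"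
  "tensor_rep LQ As' Q = tensor_rep Q As' Q"
  "pure Q As' QL = QQ.p" "carrier (tensor Q As' QL) = carrier QQ.T"
  "ring.add (tensor Q As' QL) = ring.add QQ.T" "ring.zero (tensor Q As' QL) = ring.zero QQ.T"
  "tensor_rep Q As' QL = tensor_rep Q As' Q"
  "pure QL As L = LL.p" "carrier (tensor QL As L) = carrier LL.T"
  "ring.add (tensor QL As L) = ring.add LL.T" "ring.zero (tensor QL As L) = ring.zero LL.T"
  "tensor_rep QL As L = tensor_rep L As L"
  by (intro tensor_cong; simp)+

text \<open>In a mixed tensor product the outer action at the middle factor is a multiplication on
  the side that \<open>Dl_right\<close> and \<open>Dr_left\<close> describe.\<close>

lemma LQ_tensor_act:
  "X \<in> carrier LL.T \<Longrightarrow> b \<in> A' \<Longrightarrow> ract (tensor L As LQ) X b = rmul \<one>\<^bsub>P\<^esub> b X"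
  "X \<in> carrier QQ.T \<Longrightarrow> a \<in> A \<Longrightarrow> lact (tensor LQ As' Q) a X = lmul a \<one>\<^bsub>P\<^esub> X"
  "X \<in> carrier QQ.T \<Longrightarrow> a \<in> A \<Longrightarrow> ract (tensor Q As' QL) X a = lmul \<one>\<^bsub>P\<^esub> (\<theta>' a) X"
  "X \<in> carrier LL.T \<Longrightarrow> b \<in> A' \<Longrightarrow> lact (tensor QL As L) b X = rmul (\<theta>' b) \<one>\<^bsub>P\<^esub> X"
proof -
  interpret T1: tensor_pair R As As As' L LQ by (intro tensor_pair.intro bimodule_L bimodule_LQ)
  interpret T2: tensor_pair R As As' As' LQ Q by (intro tensor_pair.intro bimodule_Q bimodule_LQ)
  interpret T3: tensor_pair R As' As' As Q QL by (intro tensor_pair.intro bimodule_Q bimodule_QL)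
  interpret T4: tensor_pair R As' As As QL L by (intro tensor_pair.intro bimodule_L bimodule_QL)
  have lift: "tensor_lift L As LQ T1.T = tensor_lift L As L LL.T"
    "tensor_lift LQ As' Q T2.T = tensor_lift Q As' Q QQ.T"
    "tensor_lift Q As' QL T3.T = tensor_lift Q As' Q QQ.T"
    "tensor_lift QL As L T4.T = tensor_lift L As L LL.T"
    by (intro ext; simp add: tensor_lift_def sum_of_def LQ_tensor)+
  note c = LL.tensor_lift_cong QQ.tensor_lift_cong
  show "X \<in> carrier LL.T \<Longrightarrow> b \<in> A' \<Longrightarrow> ract T1.T X b = rmul \<one>\<^bsub>P\<^esub> b X"
    unfolding T1.ract_T lift LQ_tensor rmul_def by (rule c) simp_all
  show "X \<in> carrier QQ.T \<Longrightarrow> a \<in> A \<Longrightarrow> lact T2.T a X = lmul a \<one>\<^bsub>P\<^esub> X"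
    unfolding T2.lact_T lift LQ_tensor lmul_def by (rule c) simp_all
  show "X \<in> carrier QQ.T \<Longrightarrow> a \<in> A \<Longrightarrow> ract T3.T X a = lmul \<one>\<^bsub>P\<^esub> (\<theta>' a) X"
    unfolding T3.ract_T lift LQ_tensor lmul_def by (rule c) simp_all
  show "X \<in> carrier LL.T \<Longrightarrow> b \<in> A' \<Longrightarrow> lact T4.T b X = rmul (\<theta>' b) \<one>\<^bsub>P\<^esub> X"
    unfolding T4.lact_T lift LQ_tensor rmul_def by (rule c) simp_all
qed

lemma like_P [simp]: "like_P L" "like_P Q" "like_P LQ" "like_P QL"
  by (simp_all add: like_P_def)

end

context par_comults
begin

section \<open>The right comultiplication and the coassociativity laws\<close>

lemma Dr_lin: "lin_map R P QQ.T Dr"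
  by (rule lin_map_cong[OF modP lin_map_comp[OF flip_lin lin_map_comp[OF Dl_lin \<theta>_lin(2)]]])
    (simp add: Dr)

lemma Dr_closed [simp]: "x \<in> carrier P \<Longrightarrow> Dr x \<in> carrier QQ.T"
  by (simp add: Dr)

lemma Dr_A':
  assumes "x \<in> carrier P" "b \<in> A'"
  shows "Dr (x \<star> b) = ract QQ.T (Dr x) b" "Dr (x \<star> \<theta>' b) = lact QQ.T b (Dr x)"
  using assms by (simp_all add: Dr Dl_A flip_act)

lemma Dr_left:
  assumes "x \<in> carrier P"
  shows "a \<in> A \<Longrightarrow> Dr (a \<star> x) = lmul a \<one>\<^bsub>P\<^esub> (Dr x)" "b \<in> A' \<Longrightarrow> Dr (b \<star> x) = lmul \<one>\<^bsub>P\<^esub> b (Dr x)"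
  using assms by (simp_all add: Dr Dl_right flip_rmul)

text \<open>\<open>\<theta>'\<close> reverses the word and, by \<open>WL_inv_antipode\<close>, the
  slots; the flip reverses both a second time, so the same letterwise formula results.\<close>

lemma Dr_word:
  assumes hs: "hs \<in> lists (carrier H)"
  shows "Dr (word hs) = WL QQ.T (\<lambda>us vs. QQ.p (word us) (word vs)) hs"
proof -
  let ?hs = "map S\<^sub>i (rev hs)"
  have hs': "?hs \<in> lists (carrier H)"
    using hs by (auto simp: in_lists_conv_set)
  have "Dr (word hs) = flip (WL LL.T (\<lambda>us vs. LL.p (word us) (word vs)) ?hs)"
    unfolding Dl_word[OF hs', symmetric] using hs by (simp add: Dr \<theta>_word)
  also have "\<dots> = WL QQ.T (\<lambda>us vs. flip (LL.p (word us) (word vs))) ?hs"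
    by (rule WL_lin_map[OF flip_lin modLL(1,3) hs']) simp
  also have "\<dots> = WL QQ.T (\<lambda>us vs. QQ.p (\<theta> (word vs)) (\<theta> (word us))) ?hs"
    by (rule WL_cong[OF hs']) simp
  also have "\<dots> = WL QQ.T (\<lambda>us vs. QQ.p (\<theta> (word (map S\<^sub>i (rev us)))) (\<theta> (word (map S\<^sub>i (rev vs))))) hs"
    by (rule WL_inv_antipode[OF modLL(3) hs bilinI]; intro lin_intros; simp)
  also have "\<dots> = WL QQ.T (\<lambda>us vs. QQ.p (word us) (word vs)) hs"
    by (rule WL_cong[OF hs]) (simp only: \<theta>_word(2)[symmetric] \<theta>_inverse word_closed)
  finally show ?thesis .
qed

lemma coassoc:
  assumes "x \<in> carrier P"
  shows coassoc_left: "tensor_assoc L As L As L (tensor_map L As L LL.T L Dl (\<lambda>y. y) (Dl x)) =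
      tensor_map L As L L LL.T (\<lambda>y. y) Dl (Dl x)"
    and coassoc_right: "tensor_assoc Q As' Q As' Q (tensor_map Q As' Q QQ.T Q Dr (\<lambda>y. y) (Dr x)) =
      tensor_map Q As' Q Q QQ.T (\<lambda>y. y) Dr (Dr x)"
    and coassoc_left_right: "tensor_assoc L As LQ As' Q
        (tensor_map Q As' Q (tensor L As LQ) Q Dl (\<lambda>y. y) (Dr x)) =
      tensor_map L As L L (tensor LQ As' Q) (\<lambda>y. y) Dr (Dl x)"
    and coassoc_right_left: "tensor_assoc Q As' QL As L
        (tensor_map L As L (tensor Q As' QL) L Dr (\<lambda>y. y) (Dl x)) =
      tensor_map Q As' Q Q (tensor QL As L) (\<lambda>y. y) Dl (Dr x)"
proof -
  note bi = bimodule_L bimodule_Q bimodule_LQ bimodule_QL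
  note tri = tensor_triple.intro tensor_pair.intro bi
  have WL: "WL (tensor L As LQ) = WL LL.T" "WL (tensor LQ As' Q) = WL QQ.T"
    "WL (tensor Q As' QL) = WL QQ.T" "WL (tensor QL As L) = WL LL.T"
    by (intro WL_record_cong LQ_tensor)+
  have add: "additive_map P LL.T Dl" "additive_map P QQ.T Dr"
    using Dl_lin Dr_lin by (simp_all add: lin_map_additive)
  then have add': "additive_map P (tensor L As LQ) Dl" "additive_map P (tensor LQ As' Q) Dr"
    "additive_map P (tensor Q As' QL) Dr" "additive_map P (tensor QL As L) Dl"
    by (simp_all add: additive_map_def LQ_tensor)
  note s = WL LQ_tensor Dl_word Dr_word Dl_A Dr_A' Dl_right Dr_left LQ_tensor_act
  show "tensor_assoc L As L As L (tensor_map L As L LL.T L Dl (\<lambda>y. y) (Dl x)) =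
      tensor_map L As L L LL.T (\<lambda>y. y) Dl (Dl x)"
    by (rule word_coassoc[where ?B1.0 = As and ?B4.0 = As and ?C1.0 = As and ?C2.0 = As and ?C3.0 = As
          and ?C4.0 = As]; (intro tri add add' assms)?; simp add: s)
  show "tensor_assoc Q As' Q As' Q (tensor_map Q As' Q QQ.T Q Dr (\<lambda>y. y) (Dr x)) =
      tensor_map Q As' Q Q QQ.T (\<lambda>y. y) Dr (Dr x)"
    by (rule word_coassoc[where ?B1.0 = As' and ?B4.0 = As' and ?C1.0 = As' and ?C2.0 = As' and ?C3.0 = As'
          and ?C4.0 = As']; (intro tri add add' assms)?; simp add: s)
  show "tensor_assoc L As LQ As' Q (tensor_map Q As' Q (tensor L As LQ) Q Dl (\<lambda>y. y) (Dr x)) =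
      tensor_map L As L L (tensor LQ As' Q) (\<lambda>y. y) Dr (Dl x)"
    by (rule word_coassoc[where ?B1.0 = As and ?B4.0 = As' and ?C1.0 = As' and ?C2.0 = As' and ?C3.0 = As
          and ?C4.0 = As]; (intro tri add add' assms)?; simp add: s)
  show "tensor_assoc Q As' QL As L (tensor_map L As L (tensor Q As' QL) L Dr (\<lambda>y. y) (Dl x)) =
      tensor_map Q As' Q Q (tensor QL As L) (\<lambda>y. y) Dl (Dr x)"
    by (rule word_coassoc[where ?B1.0 = As' and ?B4.0 = As and ?C1.0 = As and ?C2.0 = As and ?C3.0 = As'
          and ?C4.0 = As']; (intro tri add add' assms)?; simp add: s)
qed

lemma takeuchi_right:
  assumes [simp]: "x \<in> carrier P"
  shows "Dr x \<in> carrier (right_takeuchi P As' (\<lambda>a. a) \<theta>')"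
proof -
  have "tensor_lift Q As' Q QQ.T (\<lambda>x y. QQ.p (b \<star> x) y) (Dr x) =
      tensor_lift Q As' Q QQ.T (\<lambda>x y. QQ.p x (\<theta>' b \<star> y)) (Dr x)" if [simp]: "b \<in> A'" for b
  proof -
    have "tensor_lift Q As' Q QQ.T (\<lambda>x y. QQ.p (b \<star> x) y) (Dr x) = lmul b \<one>\<^bsub>P\<^esub> (Dr x)"
      unfolding lmul_def by (rule QQ.tensor_lift_cong) simp_all
    also have "\<dots> = flip (rmul \<one>\<^bsub>P\<^esub> (\<theta>' b) (Dl (\<theta>' x)))"
      by (simp add: Dr flip_rmul)
    also have "\<dots> = flip (rmul (\<theta>' (\<theta>' b)) \<one>\<^bsub>P\<^esub> (Dl (\<theta>' x)))"
      by (simp add: rmul_takeuchi)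
    also have "\<dots> = lmul \<one>\<^bsub>P\<^esub> (\<theta>' b) (Dr x)"
      by (simp add: Dr flip_rmul)
    also have "\<dots> = tensor_lift Q As' Q QQ.T (\<lambda>x y. QQ.p x (\<theta>' b \<star> y)) (Dr x)"
      unfolding lmul_def by (rule QQ.tensor_lift_cong) simp_all
    finally show ?thesis .
  qed
  then show ?thesis
    by (simp add: right_takeuchi_def Let_def)
qed

text \<open>The flip turns left into right multiplications, so each term of the product is the flip
  of \<open>\<Phi> (\<theta>' y)\<close> at a pure tensor. The operator is pulled out of the sum,
  and in what remains \<open>?f\<close> undoes the flip.\<close>

lemma Dr_takeuchi_mult:
  assumes [simp]: "x \<in> carrier P" "y \<in> carrier P"
  shows "Dr x \<otimes>\<^bsub>QQ.T\<^esub> Dr y = Dr (x \<star> y)"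
proof -
  let ?f = "\<lambda>u v. LL.p (\<theta>' v) (\<theta>' u)"
  have bal: "balanced Q As' Q LL.T ?f"
    using LL.pure_add_left LL.pure_add_right pureL_ract
    by (intro balancedI additive_mapI) simp_all
  have "tensor_lift Q As' Q LL.T ?f (Dr x) = tensor_lift L As L LL.T (\<lambda>u v. ?f (\<theta> v) (\<theta> u)) (Dl (\<theta>' x))"
    by (simp add: Dr lift_flip[OF modLL(2) bal])
  also have "\<dots> = tensor_lift L As L LL.T LL.p (Dl (\<theta>' x))"
    by (rule LL.tensor_lift_cong) simp_all
  also have "\<dots> = Dl (\<theta>' x)"
    by (simp add: LL.tensor_lift_pure_self)
  finally have f: "tensor_lift Q As' Q LL.T ?f (Dr x) = Dl (\<theta>' x)" .
  have "Dr x \<otimes>\<^bsub>QQ.T\<^esub> Dr y = tensor_lift Q As' Q QQ.T (\<lambda>u v. lmul u v (Dr y)) (Dr x)"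
    by (simp add: QQ.mult_T lmul_def)
  also have "\<dots> = tensor_lift Q As' Q QQ.T (\<lambda>u v. flip (\<Phi> (\<theta>' y) (?f u v))) (Dr x)"
  proof (rule QQ.tensor_lift_cong)
    fix u v assume [simp]: "u \<in> carrier Q" "v \<in> carrier Q"
    have [simp]: "u \<in> carrier P" "v \<in> carrier P" using \<open>u \<in> carrier Q\<close> \<open>v \<in> carrier Q\<close> by simp_all
    have "lmul u v (Dr y) = flip (rmul (\<theta>' v) (\<theta>' u) (Dl (\<theta>' y)))"
      by (simp add: Dr flip_rmul)
    then show "lmul u v (Dr y) = flip (\<Phi> (\<theta>' y) (?f u v))"
      by (simp add: Dl \<Phi>_rmul)
  qed simp
  also have "\<dots> = flip (\<Phi> (\<theta>' y) (tensor_lift Q As' Q LL.T ?f (Dr x)))"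
    by (rule QQ.tensor_lift_additive_map[symmetric,
        OF lin_map_additive[OF lin_map_comp[OF flip_lin \<Phi>_lin]]]) simp_all
  also have "\<dots> = Dr (x \<star> y)"
    unfolding f by (simp add: Dr Dl_mult)
  finally show ?thesis .
qed

section \<open>The Hopf algebroid\<close>

text \<open>Splitting off the first letter wraps the remaining sum into the action of that letter,
  which is the recursion of \<open>left_counit_word_Cons\<close>.\<close>

lemma antipode_right_word:
  assumes "hs \<in> lists (carrier H)"
  shows "WL P (\<lambda>us vs. word us \<star> \<theta> (word vs)) hs = par_left_counit_word R H hs"
  using assms
proof (induction hs rule: list.induct)
  case Nil
  then show ?case by (simp add: WL_Nil left_counit_word_Nil)
next
  case (Cons h hs)
  then have [simp]: "h \<in> carrier H" "hs \<in> lists (carrier H)" by simp_all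
  have "WL P (\<lambda>us vs. word us \<star> \<theta> (word vs)) (h # hs) =
      SW P (\<lambda>x y. WL P (\<lambda>us vs. word (x # us) \<star> \<theta> (word (y # vs))) hs) h"
    by (rule WL_Cons) simp_all
  also have "\<dots> = SW P (\<lambda>x y. WL P (\<lambda>us vs. cl x \<star> (word us \<star> \<theta> (word vs)) \<star> cl (S y)) hs) h"
    by (rule SW_congI, simp, rule WL_cong) (simp_all add: PA.M.m_assoc)
  also have "\<dots> = SW P (\<lambda>x y. cl x \<star> WL P (\<lambda>us vs. word us \<star> \<theta> (word vs)) hs \<star> cl (S y)) h"
    by (rule SW_congI, simp, rule WL_lin_map[where \<phi> = "\<lambda>z. cl _ \<star> z \<star> cl _", symmetric];
        (intro lin_intros)?; simp)
  also have "\<dots> = par_left_counit_word R H (h # hs)"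
    using Cons by (simp add: act_def left_counit_word_Cons)
  finally show ?case .
qed

text \<open>One side of an antipode axiom, serving at the same time as the construction of the left
  counit: it is linear, and by \<open>antipode_right_lift_word\<close> it has the prescribed values
  on words.\<close>

abbreviation "antipode_right_lift \<equiv> \<lambda>x. tensor_lift Q As' Q P (\<lambda>y z. y \<star> \<theta> z) (Dr x)"

lemma antipode_right_balanced: "balanced Q As' Q P (\<lambda>y z. y \<star> \<theta> z)"
  by (intro balancedI additive_mapI) (simp_all add: PA.M.l_distr PA.M.r_distr PA.M.m_assoc)

lemma antipode_right_lift_lin: "lin_map R P P antipode_right_lift"
  by (intro lin_map_comp[OF _ Dr_lin] QQ.tensor_lift_lin antipode_right_balanced modP)
    (simp add: PA.smult_mult_left)

lemma antipode_right_lift_word: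
  assumes hs: "hs \<in> lists (carrier H)"
  shows "antipode_right_lift (word hs) = par_left_counit_word R H hs"
proof -
  have "antipode_right_lift (word hs) =
      WL P (\<lambda>us vs. tensor_lift Q As' Q P (\<lambda>y z. y \<star> \<theta> z) (QQ.p (word us) (word vs))) hs"
    unfolding Dr_word[OF hs]
    by (rule WL_additive_map[OF QQ.tensor_lift_additive[OF abP antipode_right_balanced] modLL(4) abP hs])
      simp
  also have "\<dots> = WL P (\<lambda>us vs. word us \<star> \<theta> (word vs)) hs"
    by (rule WL_cong[OF hs]) (simp add: QQ.tensor_lift_pure[OF abP antipode_right_balanced])
  finally show ?thesis by (simp add: antipode_right_word[OF hs])
qed

end

context par_maps
begin

section \<open>The right counit and the assembly of the Hopf algebroid\<close>

lemma Er_A [simp]: "x \<in> carrier P \<Longrightarrow> Er x \<in> A'" "x \<in> carrier P \<Longrightarrow> Er x \<in> carrier P"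
  by (simp_all add: Er)

lemma Er_lin: "lin_map R P P Er"
  by (rule lin_map_cong[OF modP lin_map_comp[OF \<theta>_lin(1) lin_map_comp[OF El_lin \<theta>_lin(2)]]])
    (simp add: Er)

lemma Er_cl: "x \<in> carrier P \<Longrightarrow> h \<in> carrier H \<Longrightarrow> Er (x \<star> cl h) = act' h (Er x)"
  by (simp add: Er El_cl \<theta>_act)

lemma El_word: "hs \<in> lists (carrier H) \<Longrightarrow> El (word hs) = par_left_counit_word R H hs"
  by (induction hs rule: list.induct) (simp_all add: El_cl left_counit_word_Nil left_counit_word_Cons)

lemma Er_word: "hs \<in> lists (carrier H) \<Longrightarrow> Er (word hs) = par_right_counit_word R H hs"
proof (induction hs rule: rev_induct)
  case Nil
  then show ?case by (simp add: Er right_counit_word_Nil)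
next
  case (snoc h hs)
  then have [simp]: "h \<in> carrier H" "hs \<in> lists (carrier H)" by simp_all
  have "word (hs @ [h]) = word hs \<star> cl h"
    using word_append[of hs "[h]"] by simp
  with snoc show ?case by (simp add: Er_cl right_counit_word_snoc del: map_append)
qed

lemma Er_A':
  assumes "x \<in> carrier P" "b \<in> A'"
  shows "Er (x \<star> b) = Er x \<star> b" "Er (x \<star> \<theta>' b) = b \<star> Er x"
  using assms by (simp_all add: Er El_source El_target)

lemma Er_mult:
  assumes "x \<in> carrier P" "y \<in> carrier P"
  shows "Er (Er x \<star> y) = Er (x \<star> y)" "Er (\<theta>' (Er x) \<star> y) = Er (x \<star> y)"
  using assms El_mult[of "\<theta>' y" "\<theta>' x"] El_mult_target[of "\<theta>' y" "\<theta>' x"] by (simp_all add: Er)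

text \<open>Transported from \<open>left_counit_right\<close>: the flip exchanges the slots, so the
  two counit laws change places.\<close>

lemma right_counit_left:
  assumes [simp]: "x \<in> carrier P"
  shows "tensor_lift Q As' Q P (\<lambda>y z. z \<star> \<theta>' (Er y)) (Dr x) = x"
proof -
  have bal: "balanced Q As' Q P (\<lambda>y z. z \<star> \<theta>' (Er y))"
    by (intro balancedI additive_mapI)
      (simp_all add: Er_A' lin_map_add[OF Er_lin] PA.M.l_distr PA.M.r_distr PA.M.m_assoc)
  have "tensor_lift Q As' Q P (\<lambda>y z. z \<star> \<theta>' (Er y)) (Dr x) =
      tensor_lift L As L P (\<lambda>y z. \<theta> y \<star> \<theta>' (Er (\<theta> z))) (Dl (\<theta>' x))"
    by (simp add: Dr lift_flip[OF abP bal])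
  also have "\<dots> = tensor_lift L As L P (\<lambda>y z. \<theta> (\<theta>' (El z) \<star> y)) (Dl (\<theta>' x))"
    by (rule LL.tensor_lift_cong) (simp_all add: Er)
  also have "\<dots> = \<theta> (tensor_lift L As L P (\<lambda>y z. \<theta>' (El z) \<star> y) (Dl (\<theta>' x)))"
    by (rule LL.tensor_lift_additive_map[OF lin_map_additive[OF \<theta>_lin(1)], symmetric]) simp_all
  finally show ?thesis by (simp add: left_counit_right)
qed

lemma right_counit_right:
  assumes [simp]: "x \<in> carrier P"
  shows "tensor_lift Q As' Q P (\<lambda>y z. y \<star> Er z) (Dr x) = x"
proof -
  have bal: "balanced Q As' Q P (\<lambda>y z. y \<star> Er z)"
    by (intro balancedI additive_mapI)
      (simp_all add: Er_A' lin_map_add[OF Er_lin] PA.M.l_distr PA.M.r_distr PA.M.m_assoc)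
  have "tensor_lift Q As' Q P (\<lambda>y z. y \<star> Er z) (Dr x) =
      tensor_lift L As L P (\<lambda>y z. \<theta> z \<star> Er (\<theta> y)) (Dl (\<theta>' x))"
    by (simp add: Dr lift_flip[OF abP bal])
  also have "\<dots> = tensor_lift L As L P (\<lambda>y z. \<theta> (El y \<star> z)) (Dl (\<theta>' x))"
    by (rule LL.tensor_lift_cong) (simp_all add: Er)
  also have "\<dots> = \<theta> (tensor_lift L As L P (\<lambda>y z. El y \<star> z) (Dl (\<theta>' x)))"
    by (rule LL.tensor_lift_additive_map[OF lin_map_additive[OF \<theta>_lin(1)], symmetric]) simp_all
  finally show ?thesis by (simp add: left_counit_left)
qed

text \<open>\<open>coring\<close> states the counit laws with the bimodule as target, the lemmas
  above with \<open>P\<close>; a lift reads only the addition and zero that they share.\<close>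

lemma tensor_lift_LQ: "tensor_lift M C N Q = tensor_lift M C N P" "tensor_lift M C N L = tensor_lift M C N P"
  by (intro ext; simp add: tensor_lift_def sum_of_def)+

lemma coring_L: "coring R As L Dl El"
proof (rule coring.intro)
  show "bimod_hom As As L LL.T Dl"
    by (simp add: bimod_hom_def Dl_A lin_map_add[OF Dl_lin])
  show "bimod_hom As As L (reg_bimod As) El"
    by (simp add: bimod_hom_def reg_bimod_def El_source El_target)
qed (simp_all add: bimodule_L coassoc_left tensor_lift_LQ left_counit_left left_counit_right)

lemma coring_Q: "coring R As' Q Dr Er"
proof (rule coring.intro)
  show "bimod_hom As' As' Q QQ.T Dr"
    by (simp add: bimod_hom_def Dr_A' lin_map_add[OF Dr_lin])
  show "bimod_hom As' As' Q (reg_bimod As') Er"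
    by (simp add: bimod_hom_def reg_bimod_def Er_A' lin_map_add[OF Er_lin])
qed (simp_all add: bimodule_Q coassoc_right tensor_lift_LQ right_counit_left right_counit_right)

lemma source_target:
  "alg_hom R As P (\<lambda>a. a)" "alg_antihom R As P \<theta>'" "alg_hom R As' P (\<lambda>a. a)" "alg_antihom R As' P \<theta>'"
  "alg_hom R As (op_algebra As') \<theta>"
  unfolding alg_antihom_def by (intro alg_homI lin_mapI; simp add: op_algebra_simps)+

lemma left_bialgebroid: "left_bialgebroid R P As (\<lambda>a. a) \<theta>' Dl El"
proof (rule left_bialgebroid.intro)
  let ?T = "left_takeuchi P As (\<lambda>a. a) \<theta>'"
  have T: "ring.add ?T = ring.add LL.T" "monoid.mult ?T = monoid.mult LL.T" "one ?T = LL.p \<one>\<^bsub>P\<^esub> \<one>\<^bsub>P\<^esub>"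
    "smult ?T = smult LL.T"
    by (simp_all add: left_takeuchi_def Let_def LL.one_T)
  show "alg_hom R P ?T Dl"
    by (intro alg_homI lin_mapI takeuchi_left)
      (simp_all add: T Dl_takeuchi_mult lin_map_add[OF Dl_lin] lin_map_smult[OF Dl_lin],
       simp add: Dl \<Phi>_one)
  show "El (x \<star> y) = El (x \<star> El y)" "El (x \<star> y) = El (x \<star> \<theta>' (El y))"
    if "x \<in> carrier P" "y \<in> carrier P" for x y
    using El_mult[OF that] El_mult_target[OF that] by simp_all
  show "a \<star> \<theta>' b = \<theta>' b \<star> a" if "a \<in> A" "b \<in> A" for a b
    using A_commute[of a "\<theta>' b"] that by simp
qed (simp_all add: algP source_target coring_L)

lemma right_bialgebroid: "right_bialgebroid R P As' (\<lambda>a. a) \<theta>' Dr Er"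
proof (rule right_bialgebroid.intro)
  let ?T = "right_takeuchi P As' (\<lambda>a. a) \<theta>'"
  have T: "ring.add ?T = ring.add QQ.T" "monoid.mult ?T = monoid.mult QQ.T" "one ?T = QQ.p \<one>\<^bsub>P\<^esub> \<one>\<^bsub>P\<^esub>"
    "smult ?T = smult QQ.T"
    by (simp_all add: right_takeuchi_def Let_def QQ.one_T)
  show "alg_hom R P ?T Dr"
    by (intro alg_homI lin_mapI takeuchi_right)
      (simp_all add: T Dr_takeuchi_mult lin_map_add[OF Dr_lin] lin_map_smult[OF Dr_lin],
       simp add: Dr Dl \<Phi>_one)
  show "b \<star> \<theta>' c = \<theta>' c \<star> b" if "b \<in> A'" "c \<in> A'" for b c
    using A_commute[of "\<theta>' c" b] that by simp
qed (simp_all add: algP source_target coring_Q Er_mult)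

text \<open>Induction from the end of the word: as \<theta> reverses products, the last letter ends
  up outermost on both sides, which is the form of \<open>act'\<close>.\<close>

lemma antipode_left_word:
  assumes "hs \<in> lists (carrier H)"
  shows "WL P (\<lambda>us vs. \<theta> (word us) \<star> word vs) hs = Er (word hs)"
  using assms
proof (induction hs rule: rev_induct)
  case Nil
  then show ?case by (simp add: WL_Nil Er)
next
  case (snoc h hs)
  then have [simp]: "h \<in> carrier H" "hs \<in> lists (carrier H)" by simp_all
  have w: "word (us @ [x]) = word us \<star> cl x" if "us \<in> lists (carrier H)" "x \<in> carrier H" for us x
    using that word_append[of us "[x]"] by simp
  have "WL P (\<lambda>us vs. \<theta> (word us) \<star> word vs) (hs @ [h]) =
      WL P (\<lambda>us vs. SW P (\<lambda>x y. \<theta> (word (us @ [x])) \<star> word (vs @ [y])) h) hs"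
    by (rule WL_snoc) simp_all
  also have "\<dots> = WL P (\<lambda>us vs. act' h (\<theta> (word us) \<star> word vs)) hs"
    by (rule WL_cong) (simp_all add: w act'_def PA.M.m_assoc del: map_append)
  also have "\<dots> = act' h (WL P (\<lambda>us vs. \<theta> (word us) \<star> word vs) hs)"
    unfolding act'_def by (rule WL_lin_map[symmetric]; (intro lin_intros)?; simp)
  also have "\<dots> = Er (word (hs @ [h]))"
    using snoc by (simp add: w Er_cl del: map_append)
  finally show ?case .
qed

lemma antipode_left_lift:
  assumes "x \<in> carrier P"
  shows "tensor_lift L As L P (\<lambda>y z. \<theta> y \<star> z) (Dl x) = Er x"
proof (rule lift_Dl_eqI[OF _ Er_lin assms antipode_left_word])
  show "Lbal P (\<lambda>y z. \<theta> y \<star> z)"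
    unfolding Lbal_def
    by (intro conjI bilinI ballI lin_intros) (simp_all add: PA.M.m_assoc)
qed

lemma hopf_algebroid: "hopf_algebroid R P As As' (\<lambda>a. a) \<theta>' (\<lambda>a. a) \<theta>' Dl Dr El Er \<theta>"
proof (rule hopf_algebroid.intro)
  have "bij_betw \<theta> A A'"
    by (rule bij_betw_byWitness[where f' = \<theta>']) auto
  then show "\<exists>\<phi>. alg_hom R As (op_algebra As') \<phi> \<and> bij_betw \<phi> A A'"
    using source_target(5) by blast
  show "\<theta> (\<theta>' a \<star> x \<star> \<theta>' b) = b \<star> \<theta> x \<star> a" if "a \<in> A" "b \<in> A'" "x \<in> carrier P" for a b x
    using that by (simp add: PA.M.m_assoc)
  show "antipode_right_lift x = El x" if "x \<in> carrier P" for x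
    by (rule lin_map_Hpar_eqI[OF antipode_right_lift_lin El_lin that])
      (simp add: antipode_right_lift_word El_word)
qed (simp_all add: left_bialgebroid right_bialgebroid anti Er coassoc_left_right coassoc_right_left
    antipode_left_lift)

end

context bij_hopf_algebra
begin

text \<open>The order of the constructions matters: the left counit is defined by an antipode axiom
  and so presupposes the right comultiplication, and with it the flip.\<close>

lemma par_structure_maps_exist: "\<exists>S S' Dl Dr El Er. par_structure_maps R H S S' Dl Dr El Er"
proof -
  obtain \<theta> where \<theta>: "alg_antihom R P P \<theta>" "\<And>h. h \<in> carrier H \<Longrightarrow> \<theta> (cl h) = cl (S h)"
    using par_antipode_exists by blast
  obtain \<theta>' where \<theta>': "alg_antihom R P P \<theta>'" "\<And>h. h \<in> carrier H \<Longrightarrow> \<theta>' (cl h) = cl (S\<^sub>i h)"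
    using par_inv_antipode_exists by blast
  interpret par_antipodes R H \<theta> \<theta>'
    by unfold_locales (use \<theta> \<theta>' in auto)
  define Dl where "Dl = (\<lambda>x. \<Phi> x (LL.p \<one>\<^bsub>P\<^esub> \<one>\<^bsub>P\<^esub>))"
  define Dr where "Dr = (\<lambda>x. flip (Dl (\<theta>' x)))"
  interpret par_comults R H \<theta> \<theta>' Dl Dr
    by unfold_locales (simp_all add: Dl_def Dr_def)
  define El where "El = antipode_right_lift"
  have lin: "lin_map R P P El"
    unfolding El_def by (rule antipode_right_lift_lin)
  have word: "El (word hs) = par_left_counit_word R H hs" if "hs \<in> lists (carrier H)" for hs
    unfolding El_def by (rule antipode_right_lift_word[OF that])
  define Er where "Er = (\<lambda>x. \<theta> (El (\<theta>' x)))"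
  interpret par_maps R H \<theta> \<theta>' Dl Dr El Er
  proof unfold_locales
    show "El \<one>\<^bsub>P\<^esub> = \<one>\<^bsub>P\<^esub>"
      using word[of "[]"] by (simp add: left_counit_word_Nil)
    show "El (cl h \<star> x) = act h (El x)" if h: "h \<in> carrier H" and x: "x \<in> carrier P" for h x
    proof (rule lin_map_Hpar_eqI[OF _ _ x])
      show "El (cl h \<star> word hs) = act h (El (word hs))" if "hs \<in> lists (carrier H)" for hs
        using word[of "h # hs"] word[OF that] h that by (simp add: left_counit_word_Cons)
      show "lin_map R P P (\<lambda>x. El (cl h \<star> x))"
        by (intro lin_map_comp[OF lin] lin_intros) (simp_all add: h)
      show "lin_map R P P (\<lambda>x. act h (El x))"
        unfolding act_def by (intro lin_intros lin_map_comp[OF lin]; simp add: h)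
    qed
    show "El x \<in> A" if "x \<in> carrier P" for x
      using that
      by (induction rule: Hpar_induct)
        (simp_all add: word left_counit_word_A lin_map_add[OF lin] lin_map_smult[OF lin])
  qed (simp_all add: lin Er_def)
  have "par_structure_maps R H \<theta> \<theta>' Dl Dr El Er"
    by (rule par_structure_maps.intro)
      (use lin_map_closed[OF lin] lin_map_closed[OF Er_lin] lin_map_add[OF lin] lin_map_add[OF Er_lin]
          lin_map_smult[OF lin] lin_map_smult[OF Er_lin] in
        \<open>simp_all add: anti \<theta>_word Dl_lin Dr_lin comult_word_eq Dl_word Dr_word El_word Er_word lin_mapI\<close>)
  then show ?thesis by blast
qed

text \<open>Linear maps on H_par are determined on words, so the given right-hand maps agree with
  the flipped ones. The auxiliary instance \<open>M\<close> of the locale, with the flipped maps in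
  place of \<open>Dr\<close> and \<open>Er\<close>, supplies the word formulas for the
  comparison.\<close>

lemma par_maps_if_par_structure_maps:
  assumes "par_structure_maps R H \<theta> \<theta>' Dl Dr El Er"
  shows "par_maps R H \<theta> \<theta>' Dl Dr El Er"
proof -
  interpret str: par_structure_maps R H \<theta> \<theta>' Dl Dr El Er P "par_base R H" "par_base' R H"
    "left_bimod P (\<lambda>a. a) \<theta>'" "right_bimod P (\<lambda>a. a) \<theta>'" "\<lambda>hs. word hs"
    by (fact assms) simp_all
  interpret par_antipodes R H \<theta> \<theta>'
  proof unfold_locales
    show "\<theta> (cl h) = cl (S h)" "\<theta>' (cl h) = cl (S\<^sub>i h)" if "h \<in> carrier H" for h
      using str.S_word[of "[h]"] str.S'_word[of "[h]"] that by simp_all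
  qed (rule str.S_anti str.S'_anti)+
  have Dl: "Dl x = \<Phi> x (LL.p \<one>\<^bsub>P\<^esub> \<one>\<^bsub>P\<^esub>)" if "x \<in> carrier P" for x
  proof (rule lin_map_Hpar_eqI[OF str.Dl_lin _ that])
    show "lin_map R P LL.T (\<lambda>x. \<Phi> x (LL.p \<one>\<^bsub>P\<^esub> \<one>\<^bsub>P\<^esub>))"
      by (rule \<Phi>_lin_arg) simp
    show "Dl (word hs) = \<Phi> (word hs) (LL.p \<one>\<^bsub>P\<^esub> \<one>\<^bsub>P\<^esub>)" if "hs \<in> lists (carrier H)" for hs
      unfolding str.Dl_word[OF that] comult_word_eq \<Phi>_word[OF that PA.M.one_closed PA.M.one_closed]
      by (rule WL_cong[OF that]) simp
  qed
  have El_P: "lin_map R P P El"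
    using str.El_lin by (auto simp: lin_map_def Pi_iff)
  interpret M: par_maps R H \<theta> \<theta>' Dl "\<lambda>x. flip (Dl (\<theta>' x))" El "\<lambda>x. \<theta> (El (\<theta>' x))"
  proof unfold_locales
    show "El \<one>\<^bsub>P\<^esub> = \<one>\<^bsub>P\<^esub>"
      using str.El_word[of "[]"] by (simp add: left_counit_word_Nil)
    show "El (cl h \<star> x) = act h (El x)" if h: "h \<in> carrier H" and x: "x \<in> carrier P" for h x
    proof (rule lin_map_Hpar_eqI[OF _ _ x])
      show "El (cl h \<star> word hs) = act h (El (word hs))" if "hs \<in> lists (carrier H)" for hs
        using str.El_word[of "h # hs"] str.El_word[OF that] h that by (simp add: left_counit_word_Cons)
      show "lin_map R P P (\<lambda>x. El (cl h \<star> x))"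
        by (intro lin_map_comp[OF El_P] lin_intros) (simp_all add: h)
      show "lin_map R P P (\<lambda>x. act h (El x))"
        unfolding act_def by (intro lin_intros lin_map_comp[OF El_P]; simp add: h)
    qed
    show "El x \<in> A" if "x \<in> carrier P" for x
      using lin_map_closed[OF str.El_lin that] .
  qed (simp_all add: El_P Dl)
  show ?thesis
  proof unfold_locales
    show "Dr x = flip (Dl (\<theta>' x))" if "x \<in> carrier P" for x
      by (rule lin_map_Hpar_eqI[OF str.Dr_lin M.Dr_lin that])
        (simp add: str.Dr_word comult_word_eq M.Dr_word)
    have "lin_map R P P Er"
      using str.Er_lin by (auto simp: lin_map_def Pi_iff)
    then show "Er x = \<theta> (El (\<theta>' x))" if "x \<in> carrier P" for x
      by (rule lin_map_Hpar_eqI[OF _ M.Er_lin that]) (simp add: str.Er_word M.Er_word)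
  qed (simp_all add: Dl M.El_lin M.El_cl)
qed

end

theorem theorem4p10:
  fixes R :: "'k ring" and H :: "('k, 'h) hopf"
  assumes "hopf_algebra R H"
    and "bij_betw (antipode H) (carrier H) (carrier H)"
  shows "(\<exists>S S' Dl Dr El Er. par_structure_maps R H S S' Dl Dr El Er) \<and>
    (\<forall>S S' Dl Dr El Er. par_structure_maps R H S S' Dl Dr El Er \<longrightarrow>
       hopf_algebroid R (Hpar R H) (par_base R H) (par_base' R H)
         (\<lambda>a. a) S' (\<lambda>a. a) S' Dl Dr El Er S)"
proof -
  interpret bij_hopf_algebra R H
    using assms by (simp add: bij_hopf_algebra_def bij_hopf_algebra_axioms_def)
  show ?thesis
    using par_structure_maps_exist par_maps.hopf_algebroid[OF par_maps_if_par_structure_maps] by blast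
qed

end
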